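(* In each of the types $E_6^{(1)}$, $E_7^{(1)}$ and $E_8^{(1)}$ there is an isomorphism of affine crystals $\mathcal{Z}(\Lambda_0)\xrightarrow{\sim}B(\mathcal F(\Lambda_0))$ which sends the ground state wall to the ground state sequence $\mathbf s_{\Lambda_0}$. Here $\mathcal Z(\Lambda_0)$ is the set of Young walls $(z^{n_r}y_r)_{r\ge0}$ with $H_{\mathrm{aff}}(z^{n_{r+1}}y_{r+1}\otimes z^{n_r}y_r)>0$ for all $r\geq 0$, with the affine crystal structure given by the signature rule, and $B(\mathcal F(\Lambda_0))$ is the Fock space crystal.
   Context: **Notation.** $\hat{\mathfrak g}$ is the untwisted affine Kac–Moody algebra of type $E_6^{(1)},E_7^{(1)}$ or $E_8^{(1)}$, with index set $I=\{0,\dots,n\}$ ($n=6,7,8$), simple roots $\alpha_i$, simple coroots $h_i$, fundamental weights $\Lambda_i$, null root $\delta$, $P=\bigoplus_i\mathbb Z\Lambda_i\oplus\mathbb Z\delta$, $\overline P=\bigoplus_i\mathbb Z\Lambda_i$ (viewed both as a sublattice and as the quotient $P/\mathbb Z\delta$). Dynkin diagrams (Bourbaki): $E_6^{(1)}$: chain $1-3-4-5-6$ together with $4-2-0$; $E_7^{(1)}$: chain $0-1-3-4-5-6-7$ together with $4-2$; $E_8^{(1)}$: chain $0-8-7-6-5-4-3-1$ together with $4-2$. **Crystals.** An affine (resp. classical) crystal is a set $B$ with maps $\tilde e_i,\tilde f_i:B\to B\sqcup\{0\}$, $\varepsilon_i,\varphi_i:B\to\mathbb Z\cup\{-\infty\}$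 ($i\in I$) and $\mathrm{wt}:B\to P$ (resp. $\overline P$) such that $\varphi_i(b)-\varepsilon_i(b)=\langle h_i,\mathrm{wt}(b)\rangle$; if $\tilde e_ib\in B$ then $\mathrm{wt},\varepsilon_i,\varphi_i$ change by $+\alpha_i,-1,+1$; if $\tilde f_ib\in B$ they change by $-\alpha_i,+1,-1$; $\tilde f_ib=b'$ iff $b=\tilde e_ib'$; and $\varphi_i(b)=-\infty$ implies $\tilde e_ib=\tilde f_ib=0$. An isomorphism is a bijection (extended by $0\mapsto 0$) preserving $\mathrm{wt},\varepsilon_i,\varphi_i$ and commuting with all $\tilde e_i,\tilde f_i$. On $B\otimes B'$ (underlying set $B\times B'$): $\tilde f_i(b\otimes b')=\tilde f_ib\otimes b'$ if $\varphi_i(b)>\varepsilon_i(b')$ and $b\otimes\tilde f_ib'$ otherwise; $\tilde e_i(b\otimes b')=\tilde e_ib\otimes b'$ if $\varphi_i(b)\ge\varepsilon_i(b')$ and $b\otimes\tilde e_ib'$ otherwise; $\mathrm{wt}(b\otimes b')=\mathrm{wt}(b)+\mathrm{wt}(b')$; $\varepsilon_i(b\otimes b')=\max(\varepsilon_i(b),\varepsilon_i(b')-\langle h_i,\mathrm{wt}(b)\rangle)$; $\varphi_i(b\otimes b')=\max(\varphi_i(b'),\varphi_i(b)+\langle h_i,\mathrm{wt}(b')\rangle)$. The affinization of a classical crystal $B$ is $B_{\mathrm{aff}}=\{z^mb:m\in\mathbb Z,b\in B\}$ with $\mathrm{wt}(z^mb)=\mathrm{wt}(b)+m\delta$, $\varepsilon_i,\varphi_i$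 as for $b$, $\tilde e_i(z^mb)=z^{m+\delta_{i0}}\tilde e_ib$, $\tilde f_i(z^mb)=z^{m-\delta_{i0}}\tilde f_ib$. **The level 1 perfect crystals.** $B=B_6$ (resp. $B_7$) is the crystal basis of the level $0$ fundamental representation $W(\varpi_1)$ in type $E_6^{(1)}$ (resp. $W(\varpi_7)$ in type $E_7^{(1)}$): its elements are $b_\mu$, for $\mu\in\overline P$ in the finite Weyl group orbit of $\Lambda_1-\Lambda_0$ (resp. $\Lambda_7-\Lambda_0$), with $\mathrm{wt}(b_\mu)=\mu$ and $\tilde f_ib_\mu=b_{\mu-\alpha_i}$ if $\langle h_i,\mu\rangle=1$, $\tilde f_ib_\mu=0$ otherwise ($i\in I$, $\alpha_i$ taken in $\overline P$). In type $E_8^{(1)}$, $B=B_8$ has elements $x_\alpha$ ($\alpha$ a root of $E_8$), $y_i$ ($i\in I\setminus\{0\}$), $\emptyset$, with arrows ($b\xrightarrow{i}b'$ meaning $\tilde f_ib=b'$): $x_\alpha\xrightarrow{i}x_{\alpha-\alpha_i}$ if $i\neq0$ and $\alpha,\alpha-\alpha_i$ are roots; $x_{\alpha_i}\xrightarrow{i}y_i\xrightarrow{i}x_{-\alpha_i}$ for $i\ne0$; $x_\alpha\xrightarrow{0}x_{\alpha+\theta}$ if $\alpha,\alpha+\theta$ are roots different from $\pm\theta$; $x_{-\theta}\xrightarrow{0}\emptyset\xrightarrow{0}x_\theta$ ($\theta$ the highest root). In all cases $\varepsilon_i,\varphi_i$ are the distances to the start and end of the $i$-string and $\mathrm{wt}(b)=\sum_i(\varphi_i(b)-\varepsilon_i(b))\Lambda_i$.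 **Energy functions.** For $B$ the level 1 perfect crystal $B_6$, $B_7$ or $B_8$ in type $E_6^{(1)}$, $E_7^{(1)}$ or $E_8^{(1)}$ respectively (or a crystal isomorphic to it) $H:B\otimes B\to\mathbb Z$ is the function with $H(\tilde f_i(b\otimes b'))=H(b\otimes b')$ for $i\ne0$, and, when $\tilde f_0(b\otimes b')\ne0$, $H(\tilde f_0(b\otimes b'))=H(b\otimes b')+1$ if $\tilde f_0(b\otimes b')=\tilde f_0b\otimes b'$ and $H(b\otimes b')-1$ if $\tilde f_0(b\otimes b')=b\otimes\tilde f_0b'$; normalised by $H(c\otimes c)=0$ for extremal $c$ (all $c$ in types $E_6^{(1)},E_7^{(1)}$; all $c$ of nonzero weight in type $E_8^{(1)}$). $H_{\mathrm{aff}}(z^ma\otimes z^nb)=H(a\otimes b)+m-n$. **Fock space crystal.** For $b\in B$ put $\varepsilon(b)=\sum_i\varepsilon_i(b)\Lambda_i$, $\varphi(b)=\sum_i\varphi_i(b)\Lambda_i$. Let $(b_r)_{r\ge0}$ be the unique sequence in $B$ with $\varphi(b_0)=\Lambda_0$ and $\varphi(b_{r+1})=\varepsilon(b_r)$ for all $r$. Let $m_0=0$ and let $m_r\in\mathbb Z$ be determined by $H_{\mathrm{aff}}(z^{m_{r+1}}b_{r+1}\otimes z^{m_r}b_r)=1$; put $g_r=z^{m_r}b_r$. The ground state sequence is $\mathbf s_{\Lambda_0}=(g_r)_{r\ge0}$. $B(\mathcal F(\Lambda_0))$, the crystal basis of the level 1 Fock space representation $\mathcal F(\Lambda_0)$ of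 $U_q(\hat{\mathfrak g})$ (Kashiwara–Miwa–Petersen–Yung), is the set of sequences $\mathbf s=(s_r)_{r\ge0}$ in $B_{\mathrm{aff}}$ with $H_{\mathrm{aff}}(s_{r+1}\otimes s_r)>0$ for all $r$ and $s_r=g_r$ for $r\gg0$. If $s_r=g_r$ for all $r\ge k$ and $\mathbf s'=s_{k-1}\otimes\cdots\otimes s_0$, its affine crystal structure is: $\tilde e_i,\tilde f_i$ act by $\cdots\otimes s_{k+1}\otimes\tilde e_i(s_k\otimes\cdots\otimes s_0)$, $\cdots\otimes s_{k+1}\otimes\tilde f_i(s_k\otimes\cdots\otimes s_0)$; $\varepsilon_i(\mathbf s)=\max(\varepsilon_i(\mathbf s')-\varphi_i(b_k),0)$; $\varphi_i(\mathbf s)=\varphi_i(\mathbf s')+\max(\varphi_i(b_k)-\varepsilon_i(\mathbf s'),0)$; $\mathrm{wt}(\mathbf s)=\Lambda_0+\sum_r(\mathrm{wt}(s_r)-\mathrm{wt}(g_r))$. **Young column patterns.** A Young column pattern is an infinite vertical strip of unit cubes indexed by $k\in\mathbb Z$ (height increasing with $k$), each cut by vertical cuts into blocks coloured by $I$. The horizontal cross-section of every cube is a grid with $w$ columns of cells (numbered $1,\dots,w$ from left to right) and two rows (upper, lower), $w=2,3,6$ in types $E_6^{(1)},E_7^{(1)},E_8^{(1)}$. A block is the full-height prism over a union of cells. Write $u/l$ for a cross-section whose upper row has colours $u$ and lower row has colours $l$ (just $u$ if both rows agree); equally coloured cells of one cube form a single block, except that in type $E_8^{(1)}$ a cube $444444$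 consists of two $4$-blocks, one over cell columns $1$–$3$ and one over cell columns $4$–$6$. Rotation by $180^\circ$ sends $u/l$ to $\mathrm{rev}(l)/\mathrm{rev}(u)$, where rev reverses a word. - $E_6^{(1)}$ (period 12): cubes $1,\dots,6$ are $44/04$; $25$; $46/44$; $35$; $44/14$; $32$; cube $k+6$ is the rotation of cube $k$ for all $k$. - $E_7^{(1)}$ (period 8): cubes $1,\dots,8$ are $332/032$; $144$; $355/335$; $446$; $257/255$; $446$; $355/335$; $144$. - $E_8^{(1)}$ (period 20): cubes $1,\dots,10$ are $775522/075552$; $866444$; $755533/775533$; $664441$; $552233/555233$; $444444$; $332555/332255$; $144466$; $335577/335557$; $444668$; cube $k+10$ is the rotation of cube $k$ for all $k$. **Young columns.** A Young column is a nonempty collection of blocks of the pattern of bounded height with no empty space below any block: if a block of cube $k$ belongs to it, so does every block of cube $k-1$ lying below at least one of its cells. Young columns are equivalent if obtained from one another by vertical translation and/or rotation by $180^\circ$ about the vertical axis. In type $E_8^{(1)}$ two further equivalence classes of collections also count as Young columns, those of: (S1) all blocks of cubes $k\le4$, the $5$- and $3$-blocks of cube 5, and the $4$-block over cell columns 4–6 of cube 6; (S2) all blocks of cubes $k\le5$, the $4$-block over cell columns 4–6 of cube 6, and the $2$-block of cube 7. An $i$-block of a Young column is removable if removing it leaves a Young column; an $i$-block not in it is addable if adding it gives a Young column. $\tilde f_i$ adds an addable $i$-block if one exists and gives $0$ otherwise; $\tilde e_i$ removes a removable $i$-block if one exists and gives $0$ otherwise; in type $E_8^{(1)}$ with these rules: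 (a) if there are two addable $i$-blocks, $\tilde f_i$ adds the higher one if $i\ne4$ and the one lying on top of a $5$-block if $i=4$; if there are two removable $i$-blocks, $\tilde e_i$ removes the lower one if $i\neq4$ and the one lying on top of a $3$-block if $i=4$; (b) if a Young column $y$ is obtained by adding (resp. removing) an $i$-block to (from) another Young column by these rules and $y$ itself has an addable (resp. removable) $i$-block, then $\tilde f_j(y)=\tilde e_j(y)=0$ for all $j\neq i$. Put $\varphi_i(y)=\max\{m:\tilde f_i^my\ne0\}$, $\varepsilon_i(y)=\max\{m:\tilde e_i^my\neq0\}$. The set $C$ of equivalence classes becomes a classical crystal with $\mathrm{wt}(y)=\sum_i(\varphi_i(y)-\varepsilon_i(y))\Lambda_i$, isomorphic to $B$ via the isomorphism of classical crystals $\psi:B\to C$; transport $H$ and $H_{\mathrm{aff}}$ to $C$ and $C_{\mathrm{aff}}$. **Young walls.** The Young wall pattern has columns indexed $r=0,1,2,\dots$ from right to left. In type $E_6^{(1)}$, cube $k$ of column $r$ is cube $k+8r$ of the Young column pattern; in type $E_7^{(1)}$, column $r$ is the Young column pattern for $r$ even, and for $r$ odd its cube $k$ is the rotation of cube $k+4$ of the Young column pattern; in type $E_8^{(1)}$ every column is the Young column pattern. Each column pattern is thus a translated/rotated copy of the Young column pattern, so Young columns in column $r$, their classes in $C$ and the operators $\tilde e_i,\tilde f_i$ make sense. The ground state wall consists in every column $r$ of all blocks of cubes $k\le0$ together with: ($E_6^{(1)}$) the three-cell block of cube 1, the block over cell column 2 of cube 2, the one-cell block of cube 3; ($E_7^{(1)}$)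 all blocks of cube 1 except the one-cell block, the block over cell columns 2–3 of cube 2, the block of cube 3 containing cell column 3, the block over cell column 3 of cube 4, the one-cell block of cube 5; ($E_8^{(1)}$) the blocks of colours $7,5,2$ in cube 1; $6,4$ in cube 2; $5,3$ in cube 3; $4,1$ in cube 4; $2,3$ in cube 5; the $4$-block over cell columns 4–6 in cube 6; and the blocks of colours $5,6,7,8,0$ in cubes $7,8,9,10,11$ respectively. (Column $r$ of the ground state wall has class $\psi(b_r)$.) A Young wall is a collection of blocks of the Young wall pattern which differs from the ground state wall in finitely many blocks and each of whose columns is a Young column. The Young columns in column $r$ are identified with the elements $z^my$ of $C_{\mathrm{aff}}$ by the bijection commuting with all $\tilde e_i,\tilde f_i$ which sends column $r$ of the ground state wall to $z^{m_r}\psi(b_r)$; so a Young wall is written $(z^{n_r}y_r)_{r\ge0}$. **Crystal structure on $\mathcal Z(\Lambda_0)$.** Let $\mathrm{sign}_i(y)$ be $\varepsilon_i(y)$ signs $-$ followed by $\varphi_i(y)$ signs $+$. For a Young wall $Y$ with columns of classes $y_r$, cancelling all $+-$ pairs in $\cdots\mathrm{sign}_i(y_2)\,\mathrm{sign}_i(y_1)\,\mathrm{sign}_i(y_0)$ leaves finitely many $-$'s followed by finitely many $+$'s, denoted $\mathrm{sign}_i(Y)$. $\tilde e_i(Y)$ is obtained by applying $\tilde e_i$ to the column containing the rightmost $-$ of $\mathrm{sign}_i(Y)$ ($0$ if there is none); $\tilde f_i(Y)$ by applying $\tilde f_i$ to the column containing the leftmost $+$ ($0$ if there is none); $\varepsilon_i(Y)$,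 $\varphi_i(Y)$ are the numbers of $-$'s and $+$'s in $\mathrm{sign}_i(Y)$; $\mathrm{wt}(Y)=\Lambda_0-\sum_ik_i\alpha_i$ where $k_i$ is the difference in the number of $i$-blocks between $Y$ and the ground state wall. *)

theory Defs
  imports Main "HOL-Library.Extended" "HOL-Library.Function_Algebras"
    "HOL-Library.Product_Plus"
begin

section \<open>Affine root data\<close>

datatype affine_type = E6 | E7 | E8

fun rnk :: "affine_type \<Rightarrow> nat" where
  "rnk E6 = 6"
| "rnk E7 = 7"
| "rnk E8 = 8"

definition Iset :: "affine_type \<Rightarrow> nat set" where
  "Iset T = {0..rnk T}"

fun dynkin_edges :: "affine_type \<Rightarrow> (nat \<times> nat) set" where
  "dynkin_edges E6 = {(1,3), (3,4), (4,5), (5,6), (4,2), (2,0)}"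
| "dynkin_edges E7 = {(0,1), (1,3), (3,4), (4,5), (5,6), (6,7), (4,2)}"
| "dynkin_edges E8 = {(0,8), (8,7), (7,6), (6,5), (5,4), (4,3), (3,1), (4,2)}"

definition cartan :: "affine_type \<Rightarrow> nat \<Rightarrow> nat \<Rightarrow> int" where
  "cartan T i j = (if i = j then 2
     else if (i, j) \<in> dynkin_edges T \<or> (j, i) \<in> dynkin_edges T then -1 else 0)"

text \<open>An element \<open>\<Sum>\<^sub>i c\<^sub>i \<Lambda>\<^sub>i\<close> of the classical weight lattice is the function \<open>c\<close>
  (zero outside \<open>I\<close>), so its pairing with \<open>h\<^sub>i\<close> is its value at \<open>i\<close>; an element
  \<open>\<Sum>\<^sub>i c\<^sub>i \<Lambda>\<^sub>i + m \<delta>\<close> of \<open>P\<close> is the pair \<open>(c, m)\<close>.\<close>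

type_synonym cweight = "nat \<Rightarrow> int"
type_synonym aweight = "cweight \<times> int"

definition fund_comb :: "affine_type \<Rightarrow> (nat \<Rightarrow> int) \<Rightarrow> cweight" where
  "fund_comb T c = (\<lambda>i. if i \<in> Iset T then c i else 0)"

definition cfund :: "nat \<Rightarrow> cweight" where
  "cfund i = (\<lambda>j. if j = i then 1 else 0)"

definition fund :: "nat \<Rightarrow> aweight" where
  "fund i = (cfund i, 0)"

text \<open>The image of \<open>\<alpha>\<^sub>i\<close> in \<open>P / \<int>\<delta>\<close>.\<close>

definition csroot :: "affine_type \<Rightarrow> nat \<Rightarrow> cweight" where
  "csroot T i = fund_comb T (\<lambda>j. cartan T j i)"

text \<open>The \<open>\<delta>\<close>-component of \<open>\<alpha>\<^sub>i\<close> is \<open>\<delta>\<^sub>i\<^sub>0\<close>, because \<open>\<delta> = \<Sum>\<^sub>i a\<^sub>i \<alpha>\<^sub>i\<close> with \<open>a\<^sub>0 = 1\<close>.\<close>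

definition sroot :: "affine_type \<Rightarrow> nat \<Rightarrow> aweight" where
  "sroot T i = (csroot T i, if i = 0 then 1 else 0)"

definition scale_weight :: "int \<Rightarrow> aweight \<Rightarrow> aweight" where
  "scale_weight k w = ((\<lambda>i. k * fst w i), k * snd w)"

record 'w weight_data =
  index :: "nat set"
  lattice :: "'w set"
  pairing :: "nat \<Rightarrow> 'w \<Rightarrow> int"
  simple_root :: "nat \<Rightarrow> 'w"

definition classical_data :: "affine_type \<Rightarrow> cweight weight_data" where
  "classical_data T = \<lparr>index = Iset T, lattice = {w. \<forall>i. i \<notin> Iset T \<longrightarrow> w i = 0},
     pairing = (\<lambda>i w. w i), simple_root = csroot T\<rparr>"

definition affine_data :: "affine_type \<Rightarrow> aweight weight_data" where
  "affine_data T = \<lparr>index = Iset T, lattice = {w. \<forall>i. i \<notin> Iset T \<longrightarrow> fst w i = 0},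
     pairing = (\<lambda>i w. fst w i), simple_root = sroot T\<rparr>"


section \<open>Crystals\<close>

text \<open>\<open>None\<close> plays the role of the extra element \<open>0\<close>, and \<^term>\<open>Minf\<close> that of \<open>-\<infinity>\<close>;
  the value \<^term>\<open>Pinf\<close> of the type \<^typ>\<open>int extended\<close> is excluded in \<open>is_crystal\<close>.\<close>

record ('b, 'w) crystal =
  elts :: "'b set"
  ee :: "nat \<Rightarrow> 'b \<Rightarrow> 'b option"
  ff :: "nat \<Rightarrow> 'b \<Rightarrow> 'b option"
  eps :: "nat \<Rightarrow> 'b \<Rightarrow> int extended"
  phi :: "nat \<Rightarrow> 'b \<Rightarrow> int extended"
  wt :: "'b \<Rightarrow> 'w"

definition is_crystal :: "('w::ab_group_add) weight_data \<Rightarrow> ('b, 'w) crystal \<Rightarrow> bool" where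
  "is_crystal D B \<longleftrightarrow> (\<forall>b \<in> elts B. wt B b \<in> lattice D \<and> (\<forall>i \<in> index D.
     eps B i b \<noteq> Pinf \<and> phi B i b \<noteq> Pinf \<and>
     phi B i b = eps B i b + Fin (pairing D i (wt B b)) \<and>
     (\<forall>b'. ee B i b = Some b' \<longrightarrow> b' \<in> elts B \<and> wt B b' = wt B b + simple_root D i \<and>
        eps B i b' = eps B i b - 1 \<and> phi B i b' = phi B i b + 1) \<and>
     (\<forall>b'. ff B i b = Some b' \<longrightarrow> b' \<in> elts B \<and> wt B b' = wt B b - simple_root D i \<and>
        eps B i b' = eps B i b + 1 \<and> phi B i b' = phi B i b - 1) \<and>
     (\<forall>b' \<in> elts B. ff B i b = Some b' \<longleftrightarrow> ee B i b' = Some b) \<and>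
     (phi B i b = Minf \<longrightarrow> ee B i b = None \<and> ff B i b = None)))"

definition crystal_iso ::
    "'w weight_data \<Rightarrow> ('a, 'w) crystal \<Rightarrow> ('b, 'w) crystal \<Rightarrow> ('a \<Rightarrow> 'b) \<Rightarrow> bool" where
  "crystal_iso D A B \<Phi> \<longleftrightarrow> bij_betw \<Phi> (elts A) (elts B) \<and>
     (\<forall>a \<in> elts A. wt B (\<Phi> a) = wt A a \<and> (\<forall>i \<in> index D.
        eps B i (\<Phi> a) = eps A i a \<and> phi B i (\<Phi> a) = phi A i a \<and>
        ee B i (\<Phi> a) = map_option \<Phi> (ee A i a) \<and>
        ff B i (\<Phi> a) = map_option \<Phi> (ff A i a)))"

definition tensor ::
    "('w::plus) weight_data \<Rightarrow> ('a, 'w) crystal \<Rightarrow> ('b, 'w) crystal \<Rightarrow> ('a \<times> 'b, 'w) crystal" where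
  "tensor D A B = \<lparr>
     elts = elts A \<times> elts B,
     ee = (\<lambda>i (a, b). if phi A i a \<ge> eps B i b then map_option (\<lambda>a'. (a', b)) (ee A i a)
                      else map_option (\<lambda>b'. (a, b')) (ee B i b)),
     ff = (\<lambda>i (a, b). if phi A i a > eps B i b then map_option (\<lambda>a'. (a', b)) (ff A i a)
                      else map_option (\<lambda>b'. (a, b')) (ff B i b)),
     eps = (\<lambda>i (a, b). max (eps A i a) (eps B i b - Fin (pairing D i (wt A a)))),
     phi = (\<lambda>i (a, b). max (phi B i b) (phi A i a + Fin (pairing D i (wt B b)))),
     wt = (\<lambda>(a, b). wt A a + wt B b)\<rparr>"

text \<open>The \<open>n\<close>-fold tensor power on lists of length \<open>n\<close>, where the list \<open>[a, b, \<dots>]\<close> stands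
  for \<open>a \<otimes> b \<otimes> \<dots>\<close>. The empty tensor product is the unit crystal.\<close>

fun tensor_power ::
    "('w::{plus,zero}) weight_data \<Rightarrow> ('a, 'w) crystal \<Rightarrow> nat \<Rightarrow> ('a list, 'w) crystal" where
  "tensor_power D B 0 = \<lparr>elts = {[]}, ee = (\<lambda>i x. None), ff = (\<lambda>i x. None),
     eps = (\<lambda>i x. 0), phi = (\<lambda>i x. 0), wt = (\<lambda>x. 0)\<rparr>"
| "tensor_power D B (Suc n) = (let C = tensor D B (tensor_power D B n) in \<lparr>
     elts = (\<lambda>(b, bs). b # bs) ` elts C,
     ee = (\<lambda>i x. map_option (\<lambda>(b, bs). b # bs) (ee C i (hd x, tl x))),
     ff = (\<lambda>i x. map_option (\<lambda>(b, bs). b # bs) (ff C i (hd x, tl x))),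
     eps = (\<lambda>i x. eps C i (hd x, tl x)),
     phi = (\<lambda>i x. phi C i (hd x, tl x)),
     wt = (\<lambda>x. wt C (hd x, tl x))\<rparr>)"

text \<open>The element \<open>z\<^sup>m b\<close> of the affinization is the pair \<open>(m, b)\<close>.\<close>

definition affinization :: "('b, cweight) crystal \<Rightarrow> (int \<times> 'b, aweight) crystal" where
  "affinization B = \<lparr>
     elts = UNIV \<times> elts B,
     ee = (\<lambda>i (m, b). map_option (\<lambda>b'. (if i = 0 then m + 1 else m, b')) (ee B i b)),
     ff = (\<lambda>i (m, b). map_option (\<lambda>b'. (if i = 0 then m - 1 else m, b')) (ff B i b)),
     eps = (\<lambda>i (m, b). eps B i b),
     phi = (\<lambda>i (m, b). phi B i b),
     wt = (\<lambda>(m, b). (wt B b, m))\<rparr>"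

fun iter_option :: "('b \<Rightarrow> 'b option) \<Rightarrow> nat \<Rightarrow> 'b \<Rightarrow> 'b option" where
  "iter_option g 0 b = Some b"
| "iter_option g (Suc m) b = Option.bind (iter_option g m b) g"

definition string_length :: "('b \<Rightarrow> 'b option) \<Rightarrow> 'b \<Rightarrow> nat" where
  "string_length g b = Max {m. iter_option g m b \<noteq> None}"

definition string_crystal ::
    "affine_type \<Rightarrow> 'b set \<Rightarrow> (nat \<Rightarrow> 'b \<Rightarrow> 'b option) \<Rightarrow> (nat \<Rightarrow> 'b \<Rightarrow> 'b option)
      \<Rightarrow> ('b, cweight) crystal" where
  "string_crystal T X e f = \<lparr>
     elts = X, ee = e, ff = f,
     eps = (\<lambda>i b. Fin (int (string_length (e i) b))),
     phi = (\<lambda>i b. Fin (int (string_length (f i) b))),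
     wt = (\<lambda>b. fund_comb T (\<lambda>i. int (string_length (f i) b) - int (string_length (e i) b)))\<rparr>"

primrec fin_part :: "int extended \<Rightarrow> int" where
  "fin_part (Fin x) = x"
| "fin_part Pinf = 0"
| "fin_part Minf = 0"

definition eps_weight :: "affine_type \<Rightarrow> ('b, 'w) crystal \<Rightarrow> 'b \<Rightarrow> cweight" where
  "eps_weight T B b = fund_comb T (\<lambda>i. fin_part (eps B i b))"

definition phi_weight :: "affine_type \<Rightarrow> ('b, 'w) crystal \<Rightarrow> 'b \<Rightarrow> cweight" where
  "phi_weight T B b = fund_comb T (\<lambda>i. fin_part (phi B i b))"


section \<open>The level 1 perfect crystals\<close>

inductive_set weyl_orbit :: "affine_type \<Rightarrow> cweight \<Rightarrow> cweight set" for T \<mu> where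
  base: "\<mu> \<in> weyl_orbit T \<mu>"
| reflect: "\<nu> \<in> weyl_orbit T \<mu> \<Longrightarrow> i \<in> Iset T - {0} \<Longrightarrow>
    (\<lambda>j. \<nu> j - \<nu> i * csroot T i j) \<in> weyl_orbit T \<mu>"

text \<open>Roots of the finite root system are represented by their (pairwise distinct) images in
  \<open>P / \<int>\<delta>\<close>. There the highest root \<open>\<theta> = \<delta> - \<alpha>\<^sub>0\<close> becomes \<open>- \<alpha>\<^sub>0\<close>.\<close>

definition finite_roots :: "affine_type \<Rightarrow> cweight set" where
  "finite_roots T = (\<Union>i \<in> Iset T - {0}. weyl_orbit T (csroot T i))"

definition highest_root :: "affine_type \<Rightarrow> cweight" where
  "highest_root T = - csroot T 0"

text \<open>\<open>Bel \<mu>\<close> is the element \<open>b\<^sub>\<mu>\<close> in types \<open>E\<^sub>6\<close> and \<open>E\<^sub>7\<close>; \<open>Xel \<alpha>\<close>, \<open>Yel i\<close> and \<open>Empt\<close> are the elements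
  \<open>x\<^sub>\<alpha>\<close>, \<open>y\<^sub>i\<close> and \<open>\<emptyset>\<close> in type \<open>E\<^sub>8\<close>.\<close>

datatype perfect_elt = Bel cweight | Xel cweight | Yel nat | Empt

fun perfect_set :: "affine_type \<Rightarrow> perfect_elt set" where
  "perfect_set E6 = Bel ` weyl_orbit E6 (cfund 1 - cfund 0)"
| "perfect_set E7 = Bel ` weyl_orbit E7 (cfund 7 - cfund 0)"
| "perfect_set E8 = Xel ` finite_roots E8 \<union> Yel ` (Iset E8 - {0}) \<union> {Empt}"

text \<open>\<open>arrow T i b b'\<close> is the arrow \<open>b \<rightarrow> b'\<close> with label \<open>i\<close>.\<close>

inductive arrow :: "affine_type \<Rightarrow> nat \<Rightarrow> perfect_elt \<Rightarrow> perfect_elt \<Rightarrow> bool" where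
  minuscule: "T \<noteq> E8 \<Longrightarrow> i \<in> Iset T \<Longrightarrow> Bel \<mu> \<in> perfect_set T \<Longrightarrow> \<mu> i = 1 \<Longrightarrow>
    arrow T i (Bel \<mu>) (Bel (\<mu> - csroot T i))"
| real_root: "i \<in> Iset E8 - {0} \<Longrightarrow> \<alpha> \<in> finite_roots E8 \<Longrightarrow> \<alpha> - csroot E8 i \<in> finite_roots E8 \<Longrightarrow>
    arrow E8 i (Xel \<alpha>) (Xel (\<alpha> - csroot E8 i))"
| into_Yel: "i \<in> Iset E8 - {0} \<Longrightarrow> arrow E8 i (Xel (csroot E8 i)) (Yel i)"
| from_Yel: "i \<in> Iset E8 - {0} \<Longrightarrow> arrow E8 i (Yel i) (Xel (- csroot E8 i))"
| theta: "\<alpha> \<in> finite_roots E8 \<Longrightarrow> \<alpha> + highest_root E8 \<in> finite_roots E8 \<Longrightarrow>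
    {\<alpha>, \<alpha> + highest_root E8} \<inter> {highest_root E8, - highest_root E8} = {} \<Longrightarrow>
    arrow E8 0 (Xel \<alpha>) (Xel (\<alpha> + highest_root E8))"
| into_Empt: "arrow E8 0 (Xel (- highest_root E8)) Empt"
| from_Empt: "arrow E8 0 Empt (Xel (highest_root E8))"

definition partial_fun :: "('b \<Rightarrow> 'b \<Rightarrow> bool) \<Rightarrow> 'b \<Rightarrow> 'b option" where
  "partial_fun R b = (if \<exists>b'. R b b' then Some (THE b'. R b b') else None)"

definition perfect :: "affine_type \<Rightarrow> (perfect_elt, cweight) crystal" where
  "perfect T = string_crystal T (perfect_set T)
     (\<lambda>i. partial_fun (\<lambda>b b'. arrow T i b' b)) (\<lambda>i. partial_fun (arrow T i))"


section \<open>Energy functions and the Fock space crystal\<close>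

definition extremal :: "affine_type \<Rightarrow> perfect_elt \<Rightarrow> bool" where
  "extremal T c \<longleftrightarrow> c \<in> elts (perfect T) \<and> (T = E8 \<longrightarrow> wt (perfect T) c \<noteq> 0)"

definition is_energy :: "affine_type \<Rightarrow> (perfect_elt \<Rightarrow> perfect_elt \<Rightarrow> int) \<Rightarrow> bool" where
  "is_energy T H \<longleftrightarrow>
     (\<forall>b \<in> elts (perfect T). \<forall>b' \<in> elts (perfect T). \<forall>i \<in> Iset T. \<forall>c c'.
        ff (tensor (classical_data T) (perfect T) (perfect T)) i (b, b') = Some (c, c') \<longrightarrow>
        (i \<noteq> 0 \<longrightarrow> H c c' = H b b') \<and>
        (i = 0 \<and> ff (perfect T) 0 b = Some c \<and> c' = b' \<longrightarrow> H c c' = H b b' + 1) \<and>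
        (i = 0 \<and> c = b \<and> ff (perfect T) 0 b' = Some c' \<longrightarrow> H c c' = H b b' - 1)) \<and>
     (\<forall>c. extremal T c \<longrightarrow> H c c = 0)"

text \<open>The conditions determine the values on pairs of elements of the crystal, and no other
  values are used below.\<close>

definition energy :: "affine_type \<Rightarrow> perfect_elt \<Rightarrow> perfect_elt \<Rightarrow> int" where
  "energy T = (SOME H. is_energy T H)"

definition energy_aff :: "('b \<Rightarrow> 'b \<Rightarrow> int) \<Rightarrow> int \<times> 'b \<Rightarrow> int \<times> 'b \<Rightarrow> int" where
  "energy_aff H x y = H (snd x) (snd y) + fst x - fst y"

definition ground_elt :: "affine_type \<Rightarrow> nat \<Rightarrow> perfect_elt" where
  "ground_elt T = (THE b. (\<forall>r. b r \<in> elts (perfect T)) \<and>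
     phi_weight T (perfect T) (b 0) = cfund 0 \<and>
     (\<forall>r. phi_weight T (perfect T) (b (Suc r)) = eps_weight T (perfect T) (b r)))"

definition ground_exp :: "affine_type \<Rightarrow> nat \<Rightarrow> int" where
  "ground_exp T = (THE m. m 0 = 0 \<and>
     (\<forall>r. energy_aff (energy T) (m (Suc r), ground_elt T (Suc r)) (m r, ground_elt T r) = 1))"

definition ground_seq :: "affine_type \<Rightarrow> nat \<Rightarrow> int \<times> perfect_elt" where
  "ground_seq T r = (ground_exp T r, ground_elt T r)"

definition fock_set :: "affine_type \<Rightarrow> (nat \<Rightarrow> int \<times> perfect_elt) set" where
  "fock_set T = {s. (\<forall>r. s r \<in> elts (affinization (perfect T))) \<and>
     (\<forall>r. energy_aff (energy T) (s (Suc r)) (s r) > 0) \<and>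
     (\<exists>k. \<forall>r\<ge>k. s r = ground_seq T r)}"

definition stab :: "affine_type \<Rightarrow> (nat \<Rightarrow> int \<times> perfect_elt) \<Rightarrow> nat" where
  "stab T s = (LEAST k. \<forall>r\<ge>k. s r = ground_seq T r)"

text \<open>\<open>lower_part s k\<close> is the list of factors of \<open>s\<^bsub>k-1\<^esub> \<otimes> \<dots> \<otimes> s\<^sub>0\<close>, and \<open>replace_lower\<close>
  puts such a list back.\<close>

definition lower_part :: "(nat \<Rightarrow> 'b) \<Rightarrow> nat \<Rightarrow> 'b list" where
  "lower_part s k = rev (map s [0..<k])"

definition replace_lower :: "(nat \<Rightarrow> 'b) \<Rightarrow> 'b list \<Rightarrow> nat \<Rightarrow> 'b" where
  "replace_lower s xs r = (if r < length xs then rev xs ! r else s r)"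

text \<open>For \<open>k = stab T s\<close>, the operator \<open>e\<^sub>i\<close> on \<open>s\<^sub>k \<otimes> \<dots> \<otimes> s\<^sub>0\<close> may act on the factor
  \<open>s\<^sub>k = g\<^sub>k\<close>. This happens only if \<open>\<epsilon>\<^sub>i(s) = 0\<close>, and the resulting sequence violates the
  energy condition at the factors \<open>k + 1\<close> and \<open>k\<close>; it is then read as \<open>0\<close>.\<close>

definition fock_ee :: "affine_type \<Rightarrow> nat \<Rightarrow> (nat \<Rightarrow> int \<times> perfect_elt)
    \<Rightarrow> (nat \<Rightarrow> int \<times> perfect_elt) option" where
  "fock_ee T i s = (let k = stab T s in
     case ee (tensor_power (affine_data T) (affinization (perfect T)) (Suc k)) i (lower_part s (Suc k)) of
       None \<Rightarrow> None
     | Some xs \<Rightarrow> if replace_lower s xs \<in> fock_set T then Some (replace_lower s xs) else None)"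

definition fock_ff :: "affine_type \<Rightarrow> nat \<Rightarrow> (nat \<Rightarrow> int \<times> perfect_elt)
    \<Rightarrow> (nat \<Rightarrow> int \<times> perfect_elt) option" where
  "fock_ff T i s = (let k = stab T s in map_option (replace_lower s)
     (ff (tensor_power (affine_data T) (affinization (perfect T)) (Suc k)) i (lower_part s (Suc k))))"

definition fock_crystal :: "affine_type \<Rightarrow> (nat \<Rightarrow> int \<times> perfect_elt, aweight) crystal" where
  "fock_crystal T = \<lparr>
     elts = fock_set T,
     ee = fock_ee T,
     ff = fock_ff T,
     eps = (\<lambda>i s. let k = stab T s; B' = tensor_power (affine_data T) (affinization (perfect T)) k
        in max (eps B' i (lower_part s k) - phi (perfect T) i (ground_elt T k)) 0),
     phi = (\<lambda>i s. let k = stab T s; B' = tensor_power (affine_data T) (affinization (perfect T)) k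
        in phi B' i (lower_part s k) +
           max (phi (perfect T) i (ground_elt T k) - eps B' i (lower_part s k)) 0),
     wt = (\<lambda>s. fund 0 + (\<Sum>r \<in> {r. s r \<noteq> ground_seq T r}.
        wt (affinization (perfect T)) (s r) - wt (affinization (perfect T)) (ground_seq T r)))\<rparr>"


section \<open>The Young column pattern\<close>

text \<open>A cell is a pair of its column number \<open>1, \<dots>, w\<close> and a flag telling whether it is in the
  upper row; a block is the pair of the index of its cube and its set of cells.\<close>

type_synonym cell = "nat \<times> bool"
type_synonym block = "int \<times> cell set"

fun width :: "affine_type \<Rightarrow> nat" where
  "width E6 = 2"
| "width E7 = 3"
| "width E8 = 6"

definition cells :: "affine_type \<Rightarrow> cell set" where
  "cells T = {1..width T} \<times> UNIV"

text \<open>A cross-section \<open>u/l\<close> is the pair \<open>(u, l)\<close>.\<close>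

type_synonym cross_section = "nat list \<times> nat list"

fun base_cubes :: "affine_type \<Rightarrow> cross_section list" where
  "base_cubes E6 =
     [([4,4], [0,4]), ([2,5], [2,5]), ([4,6], [4,4]), ([3,5], [3,5]), ([4,4], [1,4]), ([3,2], [3,2])]"
| "base_cubes E7 =
     [([3,3,2], [0,3,2]), ([1,4,4], [1,4,4]), ([3,5,5], [3,3,5]), ([4,4,6], [4,4,6]),
      ([2,5,7], [2,5,5]), ([4,4,6], [4,4,6]), ([3,5,5], [3,3,5]), ([1,4,4], [1,4,4])]"
| "base_cubes E8 =
     [([7,7,5,5,2,2], [0,7,5,5,5,2]), ([8,6,6,4,4,4], [8,6,6,4,4,4]),
      ([7,5,5,5,3,3], [7,7,5,5,3,3]), ([6,6,4,4,4,1], [6,6,4,4,4,1]),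
      ([5,5,2,2,3,3], [5,5,5,2,3,3]), ([4,4,4,4,4,4], [4,4,4,4,4,4]),
      ([3,3,2,5,5,5], [3,3,2,2,5,5]), ([1,4,4,4,6,6], [1,4,4,4,6,6]),
      ([3,3,5,5,7,7], [3,3,5,5,5,7]), ([4,4,4,6,6,8], [4,4,4,6,6,8])]"

definition rot_cross :: "cross_section \<Rightarrow> cross_section" where
  "rot_cross c = (rev (snd c), rev (fst c))"

text \<open>In type \<open>E\<^sub>7\<close> the list above is a full period; in types \<open>E\<^sub>6\<close> and \<open>E\<^sub>8\<close> it is half a period,
  and the other half is rotated.\<close>

definition cross :: "affine_type \<Rightarrow> int \<Rightarrow> cross_section" where
  "cross T k = (let h = int (length (base_cubes T)); c = base_cubes T ! nat ((k - 1) mod h) in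
     if T \<noteq> E7 \<and> odd ((k - 1) div h) then rot_cross c else c)"

definition cell_colour :: "affine_type \<Rightarrow> int \<Rightarrow> cell \<Rightarrow> nat" where
  "cell_colour T k x = (if snd x then fst (cross T k) else snd (cross T k)) ! (fst x - 1)"

definition cube_blocks :: "affine_type \<Rightarrow> int \<Rightarrow> block set" where
  "cube_blocks T k =
     (if T = E8 \<and> (\<forall>x \<in> cells T. cell_colour T k x = 4)
      then {(k, {1..3} \<times> UNIV), (k, {4..6} \<times> UNIV)}
      else (\<lambda>i. (k, {x \<in> cells T. cell_colour T k x = i})) ` cell_colour T k ` cells T)"

definition blocks :: "affine_type \<Rightarrow> block set" where
  "blocks T = (\<Union>k. cube_blocks T k)"

definition colour :: "affine_type \<Rightarrow> block \<Rightarrow> nat" where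
  "colour T b = the_elem (cell_colour T (fst b) ` snd b)"

definition rests_on :: "block \<Rightarrow> block \<Rightarrow> bool" where
  "rests_on b c \<longleftrightarrow> fst c = fst b - 1 \<and> snd b \<inter> snd c \<noteq> {}"

definition rot_cell :: "affine_type \<Rightarrow> cell \<Rightarrow> cell" where
  "rot_cell T x = (width T + 1 - fst x, \<not> snd x)"

text \<open>\<open>move T d \<rho>\<close> is the vertical translation by \<open>d\<close> cubes, combined with the rotation by
  \<open>180\<close> degrees about the vertical axis if \<open>\<rho>\<close> holds.\<close>

definition move :: "affine_type \<Rightarrow> int \<Rightarrow> bool \<Rightarrow> block \<Rightarrow> block" where
  "move T d \<rho> b = (fst b + d, if \<rho> then rot_cell T ` snd b else snd b)"

definition column_equiv :: "affine_type \<Rightarrow> block set \<Rightarrow> block set \<Rightarrow> bool" where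
  "column_equiv T Y Y' \<longleftrightarrow> (\<exists>d \<rho>. Y' = move T d \<rho> ` Y \<and>
     (\<forall>b \<in> Y. move T d \<rho> b \<in> blocks T \<and> colour T (move T d \<rho> b) = colour T b))"


section \<open>Young columns\<close>

definition proper_column :: "affine_type \<Rightarrow> block set \<Rightarrow> bool" where
  "proper_column T Y \<longleftrightarrow> Y \<noteq> {} \<and> Y \<subseteq> blocks T \<and> (\<exists>K. \<forall>b \<in> Y. fst b \<le> K) \<and>
     (\<forall>b \<in> Y. \<forall>c \<in> blocks T. rests_on b c \<longrightarrow> c \<in> Y)"

definition special1 :: "block set" where
  "special1 = (\<Union>k \<in> {..4}. cube_blocks E8 k) \<union>
     {b \<in> cube_blocks E8 5. colour E8 b \<in> {5, 3}} \<union> {(6, {4..6} \<times> UNIV)}"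

definition special2 :: "block set" where
  "special2 = (\<Union>k \<in> {..5}. cube_blocks E8 k) \<union>
     {(6, {4..6} \<times> UNIV)} \<union> {b \<in> cube_blocks E8 7. colour E8 b = 2}"

definition columns :: "affine_type \<Rightarrow> block set set" where
  "columns T = {Y. proper_column T Y \<or>
     T = E8 \<and> (column_equiv E8 special1 Y \<or> column_equiv E8 special2 Y)}"

definition addable :: "affine_type \<Rightarrow> nat \<Rightarrow> block set \<Rightarrow> block set" where
  "addable T i Y = {b \<in> blocks T. colour T b = i \<and> b \<notin> Y \<and> insert b Y \<in> columns T}"

definition removable :: "affine_type \<Rightarrow> nat \<Rightarrow> block set \<Rightarrow> block set" where
  "removable T i Y = {b \<in> Y. colour T b = i \<and> Y - {b} \<in> columns T}"

definition on_colour :: "affine_type \<Rightarrow> nat \<Rightarrow> block \<Rightarrow> bool" where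
  "on_colour T j b \<longleftrightarrow> (\<exists>c \<in> blocks T. rests_on b c \<and> colour T c = j)"

text \<open>The tie-breaking condition is void if there is only one addable (removable) block, so it
  is relevant in type \<open>E\<^sub>8\<close> only.\<close>

definition add_block :: "affine_type \<Rightarrow> nat \<Rightarrow> block set \<Rightarrow> block" where
  "add_block T i Y = (THE b. b \<in> addable T i Y \<and>
     (\<forall>b' \<in> addable T i Y - {b}. if i = 4 then on_colour T 5 b else fst b > fst b'))"

definition remove_block :: "affine_type \<Rightarrow> nat \<Rightarrow> block set \<Rightarrow> block" where
  "remove_block T i Y = (THE b. b \<in> removable T i Y \<and>
     (\<forall>b' \<in> removable T i Y - {b}. if i = 4 then on_colour T 3 b else fst b < fst b'))"

definition add_step :: "affine_type \<Rightarrow> nat \<Rightarrow> block set \<Rightarrow> block set option" where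
  "add_step T i Y = (if addable T i Y = {} then None else Some (insert (add_block T i Y) Y))"

definition remove_step :: "affine_type \<Rightarrow> nat \<Rightarrow> block set \<Rightarrow> block set option" where
  "remove_step T i Y = (if removable T i Y = {} then None else Some (Y - {remove_block T i Y}))"

text \<open>The hypothesis of rule (b): \<open>Y\<close> is the middle of an \<open>i\<close>-string of length two.\<close>

definition mid_string :: "affine_type \<Rightarrow> nat \<Rightarrow> block set \<Rightarrow> bool" where
  "mid_string T i Y \<longleftrightarrow>
     (\<exists>Y' \<in> columns T. add_step T i Y' = Some Y) \<and> addable T i Y \<noteq> {} \<or>
     (\<exists>Y' \<in> columns T. remove_step T i Y' = Some Y) \<and> removable T i Y \<noteq> {}"

definition column_ee :: "affine_type \<Rightarrow> nat \<Rightarrow> block set \<Rightarrow> block set option" where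
  "column_ee T j Y = (if T = E8 \<and> (\<exists>i \<in> Iset T - {j}. mid_string T i Y) then None
     else remove_step T j Y)"

definition column_ff :: "affine_type \<Rightarrow> nat \<Rightarrow> block set \<Rightarrow> block set option" where
  "column_ff T j Y = (if T = E8 \<and> (\<exists>i \<in> Iset T - {j}. mid_string T i Y) then None
     else add_step T j Y)"

definition column_class :: "affine_type \<Rightarrow> block set \<Rightarrow> block set set" where
  "column_class T Y = {Y' \<in> columns T. column_equiv T Y Y'}"

definition class_op :: "affine_type \<Rightarrow> (block set \<Rightarrow> block set option)
    \<Rightarrow> block set set \<Rightarrow> block set set option" where
  "class_op T g y = map_option (column_class T) (g (SOME Y. Y \<in> y))"

definition column_crystal :: "affine_type \<Rightarrow> (block set set, cweight) crystal" where
  "column_crystal T = string_crystal T (column_class T ` columns T)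
     (\<lambda>i. class_op T (column_ee T i)) (\<lambda>i. class_op T (column_ff T i))"

text \<open>Each of the maps chosen below (\<open>psi\<close>, and \<open>ident\<close> for Young walls) is determined on its
  domain by the stated conditions, because the crystals in question are connected.\<close>

definition psi :: "affine_type \<Rightarrow> perfect_elt \<Rightarrow> block set set" where
  "psi T = (SOME \<psi>. crystal_iso (classical_data T) (perfect T) (column_crystal T) \<psi>)"

definition column_energy :: "affine_type \<Rightarrow> block set set \<Rightarrow> block set set \<Rightarrow> int" where
  "column_energy T y y' = energy T
     (inv_into (elts (perfect T)) (psi T) y) (inv_into (elts (perfect T)) (psi T) y')"


section \<open>Young walls\<close>

text \<open>Blocks of column \<open>r\<close> of the Young wall pattern are given in the coordinates of the wall;
  \<open>place T r\<close> maps them to the corresponding blocks of the Young column pattern.\<close>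

definition place :: "affine_type \<Rightarrow> nat \<Rightarrow> block \<Rightarrow> block" where
  "place T r = (case T of
       E6 \<Rightarrow> move T (8 * int r) False
     | E7 \<Rightarrow> if even r then move T 0 False else move T 4 True
     | E8 \<Rightarrow> move T 0 False)"

definition wall_cube :: "affine_type \<Rightarrow> nat \<Rightarrow> int \<Rightarrow> block set" where
  "wall_cube T r k = {b. fst b = k \<and> place T r b \<in> blocks T}"

definition wall_colour :: "affine_type \<Rightarrow> nat \<Rightarrow> block \<Rightarrow> nat" where
  "wall_colour T r b = colour T (place T r b)"

definition wall_columns :: "affine_type \<Rightarrow> nat \<Rightarrow> block set set" where
  "wall_columns T r = {Y. place T r ` Y \<in> columns T}"

definition wall_class :: "affine_type \<Rightarrow> nat \<Rightarrow> block set \<Rightarrow> block set set" where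
  "wall_class T r Y = column_class T (place T r ` Y)"

definition wall_ee :: "affine_type \<Rightarrow> nat \<Rightarrow> nat \<Rightarrow> block set \<Rightarrow> block set option" where
  "wall_ee T r i Y = map_option (\<lambda>Z. place T r -` Z) (column_ee T i (place T r ` Y))"

definition wall_ff :: "affine_type \<Rightarrow> nat \<Rightarrow> nat \<Rightarrow> block set \<Rightarrow> block set option" where
  "wall_ff T r i Y = map_option (\<lambda>Z. place T r -` Z) (column_ff T i (place T r ` Y))"

definition ground_top :: "affine_type \<Rightarrow> nat \<Rightarrow> block set" where
  "ground_top T r = (case T of
     E6 \<Rightarrow>
       {b \<in> wall_cube T r 1. card (snd b) = 3} \<union>
       {b \<in> wall_cube T r 2. snd b = {2} \<times> UNIV} \<union>
       {b \<in> wall_cube T r 3. card (snd b) = 1}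
   | E7 \<Rightarrow>
       {b \<in> wall_cube T r 1. card (snd b) \<noteq> 1} \<union>
       {b \<in> wall_cube T r 2. snd b = {2,3} \<times> UNIV} \<union>
       {b \<in> wall_cube T r 3. {3} \<times> UNIV \<subseteq> snd b} \<union>
       {b \<in> wall_cube T r 4. snd b = {3} \<times> UNIV} \<union>
       {b \<in> wall_cube T r 5. card (snd b) = 1}
   | E8 \<Rightarrow>
       {b \<in> wall_cube T r 1. wall_colour T r b \<in> {7,5,2}} \<union>
       {b \<in> wall_cube T r 2. wall_colour T r b \<in> {6,4}} \<union>
       {b \<in> wall_cube T r 3. wall_colour T r b \<in> {5,3}} \<union>
       {b \<in> wall_cube T r 4. wall_colour T r b \<in> {4,1}} \<union>
       {b \<in> wall_cube T r 5. wall_colour T r b \<in> {2,3}} \<union>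
       {b \<in> wall_cube T r 6. snd b = {4..6} \<times> UNIV} \<union>
       {b \<in> wall_cube T r 7. wall_colour T r b = 5} \<union>
       {b \<in> wall_cube T r 8. wall_colour T r b = 6} \<union>
       {b \<in> wall_cube T r 9. wall_colour T r b = 7} \<union>
       {b \<in> wall_cube T r 10. wall_colour T r b = 8} \<union>
       {b \<in> wall_cube T r 11. wall_colour T r b = 0})"

text \<open>A collection of blocks of the Young wall pattern is the function that maps \<open>r\<close> to the set
  of its blocks in column \<open>r\<close>.\<close>

type_synonym wall = "nat \<Rightarrow> block set"

definition ground_wall :: "affine_type \<Rightarrow> wall" where
  "ground_wall T r = (\<Union>k \<in> {..0}. wall_cube T r k) \<union> ground_top T r"

definition young_wall :: "affine_type \<Rightarrow> wall \<Rightarrow> bool" where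
  "young_wall T W \<longleftrightarrow> (\<forall>r. W r \<in> wall_columns T r) \<and>
     finite {(r, b). b \<in> (W r - ground_wall T r) \<union> (ground_wall T r - W r)}"

definition is_ident :: "affine_type \<Rightarrow> nat \<Rightarrow> (block set \<Rightarrow> int \<times> block set set) \<Rightarrow> bool" where
  "is_ident T r \<iota> \<longleftrightarrow>
     bij_betw \<iota> (wall_columns T r) (elts (affinization (column_crystal T))) \<and>
     (\<forall>Y \<in> wall_columns T r. \<forall>i \<in> Iset T.
        ee (affinization (column_crystal T)) i (\<iota> Y) = map_option \<iota> (wall_ee T r i Y) \<and>
        ff (affinization (column_crystal T)) i (\<iota> Y) = map_option \<iota> (wall_ff T r i Y)) \<and>
     \<iota> (ground_wall T r) = (ground_exp T r, psi T (ground_elt T r))"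

definition ident :: "affine_type \<Rightarrow> nat \<Rightarrow> block set \<Rightarrow> int \<times> block set set" where
  "ident T r = (SOME \<iota>. is_ident T r \<iota>)"

definition reduced_wall_set :: "affine_type \<Rightarrow> wall set" where
  "reduced_wall_set T = {W. young_wall T W \<and>
     (\<forall>r. energy_aff (column_energy T) (ident T (Suc r) (W (Suc r))) (ident T r (W r)) > 0)}"


section \<open>The signature rule\<close>

text \<open>Consider the word \<open>\<dots> w\<^sub>2 w\<^sub>1 w\<^sub>0\<close>, infinite to the left, where \<open>w\<^sub>r\<close> consists of \<open>m r\<close>
  minus signs followed by \<open>p r\<close> plus signs. The sign number \<open>j\<close> (from the left, starting with
  \<open>0\<close>) of \<open>w\<^sub>r\<close> has the position \<open>(r, j)\<close>.\<close>

type_synonym position = "nat \<times> nat"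

definition positions :: "(nat \<Rightarrow> nat) \<Rightarrow> (nat \<Rightarrow> nat) \<Rightarrow> position set" where
  "positions m p = {(r, j). j < m r + p r}"

definition is_minus :: "(nat \<Rightarrow> nat) \<Rightarrow> position \<Rightarrow> bool" where
  "is_minus m x \<longleftrightarrow> snd x < m (fst x)"

definition left_of :: "position \<Rightarrow> position \<Rightarrow> bool" where
  "left_of x y \<longleftrightarrow> fst x > fst y \<or> fst x = fst y \<and> snd x < snd y"

text \<open>A plus sign cancels with a minus sign to its right if all signs between them have cancelled
  among themselves.\<close>

inductive cancels :: "(nat \<Rightarrow> nat) \<Rightarrow> (nat \<Rightarrow> nat) \<Rightarrow> position \<Rightarrow> position \<Rightarrow> bool" for m p where
  "x \<in> positions m p \<Longrightarrow> y \<in> positions m p \<Longrightarrow> \<not> is_minus m x \<Longrightarrow> is_minus m y \<Longrightarrow> left_of x y \<Longrightarrow>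
   \<forall>u \<in> positions m p. left_of x u \<and> left_of u y \<longrightarrow>
     (\<exists>v. left_of x v \<and> left_of v y \<and> (cancels m p u v \<or> cancels m p v u)) \<Longrightarrow>
   cancels m p x y"

definition remaining :: "(nat \<Rightarrow> nat) \<Rightarrow> (nat \<Rightarrow> nat) \<Rightarrow> position set" where
  "remaining m p = {x \<in> positions m p. \<not> (\<exists>y. cancels m p x y \<or> cancels m p y x)}"

definition remaining_minus :: "(nat \<Rightarrow> nat) \<Rightarrow> (nat \<Rightarrow> nat) \<Rightarrow> position set" where
  "remaining_minus m p = {x \<in> remaining m p. is_minus m x}"

definition remaining_plus :: "(nat \<Rightarrow> nat) \<Rightarrow> (nat \<Rightarrow> nat) \<Rightarrow> position set" where
  "remaining_plus m p = {x \<in> remaining m p. \<not> is_minus m x}"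

definition wall_minus :: "affine_type \<Rightarrow> nat \<Rightarrow> wall \<Rightarrow> nat \<Rightarrow> nat" where
  "wall_minus T i W r = nat (fin_part (eps (column_crystal T) i (wall_class T r (W r))))"

definition wall_plus :: "affine_type \<Rightarrow> nat \<Rightarrow> wall \<Rightarrow> nat \<Rightarrow> nat" where
  "wall_plus T i W r = nat (fin_part (phi (column_crystal T) i (wall_class T r (W r))))"

definition sign_minus :: "affine_type \<Rightarrow> nat \<Rightarrow> wall \<Rightarrow> position set" where
  "sign_minus T i W = remaining_minus (wall_minus T i W) (wall_plus T i W)"

definition sign_plus :: "affine_type \<Rightarrow> nat \<Rightarrow> wall \<Rightarrow> position set" where
  "sign_plus T i W = remaining_plus (wall_minus T i W) (wall_plus T i W)"

text \<open>Columns are numbered from right to left, so the rightmost minus sign lies in the column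
  with the smallest index, and the leftmost plus sign in the one with the largest index.\<close>

definition wall_crystal_ee :: "affine_type \<Rightarrow> nat \<Rightarrow> wall \<Rightarrow> wall option" where
  "wall_crystal_ee T i W = (if sign_minus T i W = {} then None else
     let r = Min (fst ` sign_minus T i W) in map_option (\<lambda>Z. W(r := Z)) (wall_ee T r i (W r)))"

definition wall_crystal_ff :: "affine_type \<Rightarrow> nat \<Rightarrow> wall \<Rightarrow> wall option" where
  "wall_crystal_ff T i W = (if sign_plus T i W = {} then None else
     let r = Max (fst ` sign_plus T i W) in map_option (\<lambda>Z. W(r := Z)) (wall_ff T r i (W r)))"

definition block_diff :: "affine_type \<Rightarrow> wall \<Rightarrow> nat \<Rightarrow> int" where
  "block_diff T W i =
     int (card {(r, b). b \<in> W r - ground_wall T r \<and> wall_colour T r b = i}) -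
     int (card {(r, b). b \<in> ground_wall T r - W r \<and> wall_colour T r b = i})"

definition wall_crystal :: "affine_type \<Rightarrow> (wall, aweight) crystal" where
  "wall_crystal T = \<lparr>
     elts = reduced_wall_set T,
     ee = wall_crystal_ee T,
     ff = wall_crystal_ff T,
     eps = (\<lambda>i W. Fin (int (card (sign_minus T i W)))),
     phi = (\<lambda>i W. Fin (int (card (sign_plus T i W)))),
     wt = (\<lambda>W. fund 0 - (\<Sum>i \<in> Iset T. scale_weight (block_diff T W i) (sroot T i)))\<rparr>"

end

theory Submission
  imports Defs "HOL-Library.Code_Binary_Nat"
begin

text \<open>The blocks of the Young column pattern can be numbered by the integers in such a way that a
  Young column becomes a set \<open>{..<a} \<union> X\<close> with \<open>X\<close> finite, and translation by one period (by half a
  period with a rotation in types \<open>E\<^sub>6\<close> and \<open>E\<^sub>8\<close>) becomes a shift. Up to shifts there are only 27,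
  56 and 249 Young columns. They are tabulated together with the blocks that can be added or
  removed, and the table is complete because it is closed under adding blocks.
  It turns the operators on Young columns and those of the perfect crystal into the same finite
  graph, so that the columns of the wall pattern in position \<open>r\<close> form a copy of the affinization;
  the copy is unique because the affinization is connected.

  The energy function is \<open>H(b \<otimes> b') = - max {m. z\<^sup>m b \<le> b'}\<close>, where \<open>\<le>\<close> is the order on affine weights
  generated by the reflections in positive real roots that lower the weight; its lifting property
  yields the recursion for \<open>H\<close> along the arrows.

  The isomorphism reads off the columns of a wall. The number of minus signs of the columns
  \<open>0, \<dots>, r - 1\<close> which survive the cancellation is \<open>\<epsilon>\<^sub>i(s\<^bsub>r-1\<^esub> \<otimes> \<dots> \<otimes> s\<^sub>0)\<close>, so the signature rule and the
  tensor product rule select the same factor, and the signs of the columns in the ground state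
  cancel because of \<open>\<phi>(b\<^bsub>r+1\<^esub>) = \<epsilon>(b\<^sub>r)\<close>.\<close>


section \<open>Numbering the blocks\<close>

text \<open>The numbers 12, 18 and 30 of blocks in a period are the Coxeter numbers: a period
  contains each colour as often as its mark in \<delta>, the sum of the marks times the simple
  roots. A shift by one period therefore changes the weight by \<delta>, up to sign. The maps
  \<open>psi\<close> and \<open>ident\<close> and the function \<open>energy\<close> are arbitrary
  objects with the stated properties, so existence has to be shown for each of them before anything
  can be said about it. The energy function is never tabulated. Once it exists only its recursion is
  used, and the one numerical fact about it, that raising a tail factor of the ground state destroys
  the energy condition, comes from following the recursion along an explicit loop in the crystal.
  Two features of type E8 shape the table: the exceptional columns S1 and S2 contain a block that is
  not fully supported, and the elements of weight zero are the middles of strings of length two,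
  where rule (b) intervenes.\<close>

text \<open>The blocks of the cubes \<open>1, \<dots>, ncub T\<close> have the numbers \<open>0, \<dots>, nblk T - 1\<close>, from bottom to top.
  The \<open>n\<close>-th entry of \<open>off_list\<close> lists the numbers \<open>d\<close> such that block \<open>n\<close> rests on block \<open>n - d\<close>.\<close>

fun ncub :: "affine_type \<Rightarrow> int" where
  "ncub E6 = 6" | "ncub E7 = 8" | "ncub E8 = 10"

fun nblk :: "affine_type \<Rightarrow> int" where
  "nblk E6 = 12" | "nblk E7 = 18" | "nblk E8 = 30"

fun col_list :: "affine_type \<Rightarrow> nat list" where
  "col_list E6 = [0,4,2,5,4,6,3,5,1,4,2,3]"
| "col_list E7 = [0,2,3,1,4,3,5,4,6,2,5,7,4,6,3,5,1,4]"
| "col_list E8 = [0,2,5,7,4,6,8,3,5,7,1,4,6,2,3,5,4,4,2,3,5,1,4,6,3,5,7,4,6,8]"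

fun cube_list :: "affine_type \<Rightarrow> int list" where
  "cube_list E6 = [1,1,2,2,3,3,4,4,5,5,6,6]"
| "cube_list E7 = [1,1,1,2,2,3,3,4,4,5,5,5,6,6,7,7,8,8]"
| "cube_list E8 = [1,1,1,1,2,2,2,3,3,3,4,4,4,5,5,5,6,6,7,7,7,8,8,8,9,9,9,10,10,10]"

fun off_list :: "affine_type \<Rightarrow> int list list" where
  "off_list E6 = [[2],[3,2],[2,1],[2],[2,1],[2],[2],[3,2],[2],[3,2],[1],[3,2]]"
| "off_list E7 = [[2],[2],[4,3],[3,1],[3,2],[2,1],[2],[2,1],[2],[2],[3,2],[3],[3,2],[3,2],[2],[3,2],
     [2],[3,2]]"
| "off_list E8 = [[1],[4],[5,4],[5,4],[3,2],[3,2],[6,3],[3],[4,3],[4,3],[3],[4,3],[4,3],[2],[4,3],[4,3],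
     [3,1],[4,3],[2,1],[3],[3],[2],[4,3,2],[3],[3,2],[3,2],[3],[3,2],[3,2],[3]]"

definition zcol :: "affine_type \<Rightarrow> int \<Rightarrow> nat" where
  "zcol T n = col_list T ! nat (n mod nblk T)"

definition zcube :: "affine_type \<Rightarrow> int \<Rightarrow> int" where
  "zcube T n = ncub T * (n div nblk T) + cube_list T ! nat (n mod nblk T)"

definition offs :: "affine_type \<Rightarrow> int \<Rightarrow> int list" where
  "offs T n = off_list T ! nat (n mod nblk T)"

definition flips :: "affine_type \<Rightarrow> int \<Rightarrow> bool" where
  "flips T q \<longleftrightarrow> T \<noteq> E7 \<and> odd q"

definition cell_list :: "affine_type \<Rightarrow> cell list" where
  "cell_list T = concat (map (\<lambda>x. [(x, True), (x, False)]) [1..<Suc (width T)])"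

text \<open>The colour does not single out a block in the cube \<open>444444\<close>, whose two
  blocks have the numbers 16 and 17; they are given by their columns of cells.\<close>

definition base_cells :: "affine_type \<Rightarrow> nat \<Rightarrow> cell list" where
  "base_cells T t =
     (if T = E8 \<and> t = 16 then filter (\<lambda>x. fst x \<le> 3) (cell_list E8)
      else if T = E8 \<and> t = 17 then filter (\<lambda>x. fst x > 3) (cell_list E8)
      else filter (\<lambda>x. cell_colour T (cube_list T ! t) x = col_list T ! t) (cell_list T))"

definition blk :: "affine_type \<Rightarrow> int \<Rightarrow> block" where
  "blk T n = move T (ncub T * (n div nblk T)) (flips T (n div nblk T))
     (cube_list T ! nat (n mod nblk T), set (base_cells T (nat (n mod nblk T))))"

lemma ncub_pos [simp]: "ncub T > 0"
  by (cases T) auto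

lemma nblk_pos [simp]: "nblk T > 0"
  by (cases T) auto

lemma ncub_length: "ncub T = int (length (base_cubes T))"
  by (cases T) auto

lemma set_cell_list: "set (cell_list T) = cells T"
  by (auto simp: cell_list_def cells_def)

lemma rot_cross_invol [simp]: "rot_cross (rot_cross c) = c"
  by (simp add: rot_cross_def)

lemma cross_period:
  "cross T (k + ncub T * q) = (if flips T q then rot_cross (cross T k) else cross T k)"
proof -
  have *: "(k + ncub T * q - 1) mod ncub T = (k - 1) mod ncub T"
    by (metis add.commute add_diff_eq mod_mult_self2 diff_add_eq)
  have **: "(k + ncub T * q - 1) div ncub T = (k - 1) div ncub T + q"
    using div_mult_self2[of "ncub T" "k - 1" q] ncub_pos[of T] by (simp add: algebra_simps)
  show ?thesis
    unfolding cross_def Let_def ncub_length[symmetric] * ** flips_def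
    by auto
qed

lemma base_cubes_width:
  "c \<in> set (base_cubes T) \<Longrightarrow> length (fst c) = width T \<and> length (snd c) = width T"
  by (cases T) auto

lemma cross_width: "length (fst (cross T k)) = width T" "length (snd (cross T k)) = width T"
proof -
  have "base_cubes T ! nat ((k - 1) mod ncub T) \<in> set (base_cubes T)"
    using ncub_pos[of T] by (intro nth_mem) (simp add: ncub_length nat_less_iff)
  from base_cubes_width[OF this]
  show "length (fst (cross T k)) = width T" "length (snd (cross T k)) = width T"
    by (simp_all add: cross_def Let_def ncub_length rot_cross_def)
qed

text \<open>Rotation applied only if a flag is set. Rotation is an involution of the cells, so flags
  compose by exclusive or, which is written \<open>\<rho> \<noteq> \<sigma>\<close>
  throughout.\<close>

definition rotq :: "affine_type \<Rightarrow> bool \<Rightarrow> cell \<Rightarrow> cell" where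
  "rotq T \<rho> x = (if \<rho> then rot_cell T x else x)"

lemma move_rotq: "move T d \<rho> b = (fst b + d, rotq T \<rho> ` snd b)"
  by (auto simp: move_def rotq_def image_def)

lemma rotq_cells [simp]: "x \<in> cells T \<Longrightarrow> rotq T \<rho> x \<in> cells T"
  by (auto simp: cells_def rotq_def rot_cell_def)

lemma rotq_rotq [simp]: "x \<in> cells T \<Longrightarrow> rotq T \<rho> (rotq T \<sigma> x) = rotq T (\<rho> \<noteq> \<sigma>) x"
  by (auto simp: cells_def rotq_def rot_cell_def)

lemma rotq_False [simp]: "rotq T False = id" by (auto simp: rotq_def)

lemma inj_rotq: "inj_on (rotq T \<rho>) (cells T)"
  by (rule inj_on_inverseI[where g = "rotq T \<rho>"]) simp

lemma rotq_image [simp]: "S \<subseteq> cells T \<Longrightarrow> rotq T \<rho> ` rotq T \<sigma> ` S = rotq T (\<rho> \<noteq> \<sigma>) ` S"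
  by (simp only: image_image) (rule image_cong[OF refl], auto)

lemma cell_colour_period:
  assumes "x \<in> cells T"
  shows "cell_colour T (k + ncub T * q) x = cell_colour T k (rotq T (flips T q) x)"
  using assms cross_width[of T k]
  by (auto simp: cell_colour_def cross_period rotq_def rot_cell_def rot_cross_def cells_def rev_nth)

lemma cell_colour_period':
  assumes "x \<in> cells T"
  shows "cell_colour T (k + ncub T * q) (rotq T (flips T q) x) = cell_colour T k x"
  using assms by (simp add: cell_colour_period)

text \<open>Executable form of \<open>cube_blocks\<close>. All cell lists here and in
  \<open>base_cells\<close> are filters of one list, so equality of blocks can be tested as equality
  of lists.\<close>

definition cube_block_list :: "affine_type \<Rightarrow> int \<Rightarrow> (int \<times> cell list) list" where
  "cube_block_list T k =
     (if T = E8 \<and> (\<forall>x \<in> set (cell_list T). cell_colour T k x = 4)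
      then [(k, filter (\<lambda>x. fst x \<le> 3) (cell_list T)), (k, filter (\<lambda>x. fst x > 3) (cell_list T))]
      else map (\<lambda>i. (k, filter (\<lambda>x. cell_colour T k x = i) (cell_list T)))
             (remdups (map (cell_colour T k) (cell_list T))))"

lemma half_cells: "{1..3} \<times> UNIV = set (filter (\<lambda>x. fst x \<le> 3) (cell_list E8))"
  "{4..6} \<times> UNIV = set (filter (\<lambda>x. fst x > 3) (cell_list E8))"
  by (auto simp: set_cell_list cells_def)

lemma cube_blocks_list: "cube_blocks T k = (\<lambda>(k, l). (k, set l)) ` set (cube_block_list T k)"
proof (cases "T = E8 \<and> (\<forall>x \<in> cells T. cell_colour T k x = 4)")
  case True
  have *: "cube_block_list T k = [(k, filter (\<lambda>x. fst x \<le> 3) (cell_list T)),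
      (k, filter (\<lambda>x. fst x > 3) (cell_list T))]"
    unfolding cube_block_list_def set_cell_list by (rule if_P[OF True])
  have **: "cube_blocks T k = {(k, {1..3} \<times> UNIV), (k, {4..6} \<times> UNIV)}"
    unfolding cube_blocks_def by (rule if_P[OF True])
  show ?thesis
    using True unfolding * ** half_cells by simp
next
  case False
  then have *: "cube_block_list T k = map (\<lambda>i. (k, filter (\<lambda>x. cell_colour T k x = i) (cell_list T)))
             (remdups (map (cell_colour T k) (cell_list T)))"
    unfolding cube_block_list_def set_cell_list by (rule if_not_P)
  have **: "cube_blocks T k = (\<lambda>i. (k, {x \<in> cells T. cell_colour T k x = i})) ` cell_colour T k ` cells T"
    unfolding cube_blocks_def by (rule if_not_P[OF False])
  show ?thesis
    unfolding * ** by (simp add: image_image set_cell_list)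
qed

definition base_ok :: "affine_type \<Rightarrow> bool" where
  "base_ok T = list_all (\<lambda>k. set (cube_block_list T k) =
     set (map (\<lambda>t. (k, base_cells T t)) (filter (\<lambda>t. cube_list T ! t = k) [0..<nat (nblk T)])))
     [1..ncub T]"

lemma base_ok: "base_ok T"
proof (cases T)
  case E6 show ?thesis unfolding E6 by code_simp
next
  case E7 show ?thesis unfolding E7 by code_simp
next
  case E8 show ?thesis unfolding E8 by code_simp
qed

lemma cube_blocks_base:
  assumes "1 \<le> k" "k \<le> ncub T"
  shows "cube_blocks T k = (\<lambda>t. (k, set (base_cells T t))) ` {t. t < nat (nblk T) \<and> cube_list T ! t = k}"
proof -
  have "set (cube_block_list T k) =
     set (map (\<lambda>t. (k, base_cells T t)) (filter (\<lambda>t. cube_list T ! t = k) [0..<nat (nblk T)]))"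
    using base_ok[of T] assms by (auto simp: base_ok_def list_all_iff)
  then show ?thesis
    by (simp add: cube_blocks_list image_image)
qed

definition base_block :: "affine_type \<Rightarrow> nat \<Rightarrow> block" where
  "base_block T t = (cube_list T ! t, set (base_cells T t))"

lemma blk_base: "blk T n = move T (ncub T * (n div nblk T)) (flips T (n div nblk T))
     (base_block T (nat (n mod nblk T)))"
  by (simp add: blk_def base_block_def)

lemma cube_list_range:
  assumes "t < nat (nblk T)"
  shows "1 \<le> cube_list T ! t" "cube_list T ! t \<le> ncub T"
proof -
  have "\<forall>k \<in> set (cube_list T). 1 \<le> k \<and> k \<le> ncub T" "length (cube_list T) = nat (nblk T)"
    by (cases T; simp)+
  then show "1 \<le> cube_list T ! t" "cube_list T ! t \<le> ncub T"
    using assms nth_mem[of t "cube_list T"] by auto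
qed

lemma base_block_mem: "t < nat (nblk T) \<Longrightarrow> base_block T t \<in> cube_blocks T (cube_list T ! t)"
  using cube_list_range[of t T] by (auto simp: cube_blocks_base base_block_def)

lemma cube_blocks_cells: "b \<in> cube_blocks T k \<Longrightarrow> fst b = k \<and> snd b \<subseteq> cells T \<and> snd b \<noteq> {}"
proof (cases "T = E8 \<and> (\<forall>x \<in> cells T. cell_colour T k x = 4)")
  case True
  have *: "cube_blocks T k = {(k, {1..3} \<times> UNIV), (k, {4..6} \<times> UNIV)}"
    unfolding cube_blocks_def by (rule if_P[OF True])
  assume "b \<in> cube_blocks T k"
  then show ?thesis using True unfolding * by (auto simp: cells_def)
next
  case False
  have *: "cube_blocks T k = (\<lambda>i. (k, {x \<in> cells T. cell_colour T k x = i})) ` cell_colour T k ` cells T"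
    unfolding cube_blocks_def by (rule if_not_P[OF False])
  assume "b \<in> cube_blocks T k"
  then obtain x where "x \<in> cells T" "b = (k, {y \<in> cells T. cell_colour T k y = cell_colour T k x})"
    unfolding * by blast
  then show ?thesis by (cases x) auto
qed

lemma base_cells_sub: "set (base_cells T t) \<subseteq> cells T"
  by (auto simp: base_cells_def set_cell_list)

lemma move_move:
  assumes "snd b \<subseteq> cells T"
  shows "move T d \<rho> (move T d' \<sigma> b) = move T (d + d') (\<rho> \<noteq> \<sigma>) b"
  using assms by (simp add: move_rotq)

lemma rotq_collect:
  "{x \<in> cells T. P (rotq T \<rho> x)} = rotq T \<rho> ` {x \<in> cells T. P x}"
proof (intro equalityI subsetI)
  fix x assume x: "x \<in> {x \<in> cells T. P (rotq T \<rho> x)}"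
  then have "x = rotq T \<rho> (rotq T \<rho> x)" "rotq T \<rho> x \<in> {x \<in> cells T. P x}" by auto
  then show "x \<in> rotq T \<rho> ` {x \<in> cells T. P x}" by blast
qed auto

lemma rotq_half: "rotq E8 \<rho> ` ({1..3} \<times> UNIV) = (if \<rho> then {4..6} \<times> UNIV else {1..3} \<times> UNIV)"
  "rotq E8 \<rho> ` ({4..6} \<times> UNIV) = (if \<rho> then {1..3} \<times> UNIV else {4..6} \<times> UNIV)"
proof -
  have h: "{1..3::nat} = {1,2,3}" "{4..6::nat} = {4,5,6}" by auto
  show "rotq E8 \<rho> ` ({1..3} \<times> UNIV) = (if \<rho> then {4..6} \<times> UNIV else {1..3} \<times> UNIV)"
    "rotq E8 \<rho> ` ({4..6} \<times> UNIV) = (if \<rho> then {1..3} \<times> UNIV else {4..6} \<times> UNIV)"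
    unfolding h by (auto simp: rotq_def rot_cell_def image_def UNIV_bool)
qed

text \<open>A rotation exchanges the two halves of a cube \<open>444444\<close>, whereas every other
  block is a colour class and goes to the class of the same colour. This is why the exceptional
  cubes form a case of their own.\<close>

lemma cube_blocks_period:
  "cube_blocks T (k + ncub T * q) = move T (ncub T * q) (flips T q) ` cube_blocks T k"
proof -
  let ?r = "rotq T (flips T q)"
  have im: "?r ` cells T = cells T"
  proof (intro equalityI subsetI)
    fix x assume "x \<in> cells T"
    then have "x = ?r (?r x)" "?r x \<in> cells T" by auto
    then show "x \<in> ?r ` cells T" by blast
  qed auto
  have c: "cell_colour T (k + ncub T * q) ` cells T = cell_colour T k ` cells T"
  proof -
    have "cell_colour T (k + ncub T * q) ` cells T = (\<lambda>x. cell_colour T k (?r x)) ` cells T"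
      by (rule image_cong) (auto simp: cell_colour_period)
    also have "\<dots> = cell_colour T k ` ?r ` cells T" by (simp add: image_image)
    finally show ?thesis by (simp add: im)
  qed
  have s: "{x \<in> cells T. cell_colour T (k + ncub T * q) x = i} = ?r ` {x \<in> cells T. cell_colour T k x = i}"
    for i
    using rotq_collect[of T "\<lambda>x. cell_colour T k x = i" "flips T q"]
    by (auto simp: cell_colour_period)
  have "(\<forall>x \<in> cells T. cell_colour T (k + ncub T * q) x = 4) \<longleftrightarrow> (\<forall>x \<in> cells T. cell_colour T k x = 4)"
  proof -
    have "(\<forall>x \<in> A. f x = 4) \<longleftrightarrow> f ` A \<subseteq> {4}" for A and f :: "cell \<Rightarrow> nat" by blast
    then show ?thesis using c by simp
  qed
  note cond = this
  show ?thesis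
  proof (cases "T = E8 \<and> (\<forall>x \<in> cells T. cell_colour T k x = 4)")
    case True
    have "cube_blocks T k = {(k, {1..3} \<times> UNIV), (k, {4..6} \<times> UNIV)}"
      "cube_blocks T (k + ncub T * q) =
        {(k + ncub T * q, {1..3} \<times> UNIV), (k + ncub T * q, {4..6} \<times> UNIV)}"
      unfolding cube_blocks_def cond by (rule if_P[OF True])+
    then show ?thesis using True rotq_half[of "flips T q"] by (auto simp: move_rotq)
  next
    case False
    have "cube_blocks T k =
        (\<lambda>i. (k, {x \<in> cells T. cell_colour T k x = i})) ` cell_colour T k ` cells T"
      "cube_blocks T (k + ncub T * q) =
        (\<lambda>i. (k + ncub T * q, ?r ` {x \<in> cells T. cell_colour T k x = i})) ` cell_colour T k ` cells T"
      unfolding cube_blocks_def cond s c by (rule if_not_P[OF False])+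
    then show ?thesis by (simp add: move_rotq image_image)
  qed
qed

lemma blocks_eq: "blocks T = range (blk T)"
proof (intro equalityI subsetI)
  fix b assume "b \<in> blocks T"
  then obtain k where k: "b \<in> cube_blocks T k" by (auto simp: blocks_def)
  define q where "q = (k - 1) div ncub T"
  define k0 where "k0 = (k - 1) mod ncub T + 1"
  have k0: "1 \<le> k0" "k0 \<le> ncub T"
    using pos_mod_sign[of "ncub T" "k - 1"] pos_mod_bound[of "ncub T" "k - 1"] ncub_pos[of T]
    unfolding k0_def by linarith+
  have kk: "k = k0 + ncub T * q"
    using mult_div_mod_eq[of "ncub T" "k - 1"] unfolding q_def k0_def by linarith
  obtain c where c: "c \<in> cube_blocks T k0" "b = move T (ncub T * q) (flips T q) c"
    using k unfolding kk cube_blocks_period by auto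
  obtain t where t: "t < nat (nblk T)" "cube_list T ! t = k0" "c = base_block T t"
    using c k0 by (auto simp: cube_blocks_base base_block_def)
  have "b = blk T (int t + nblk T * q)"
    using t nblk_pos[of T] c(2) by (simp add: blk_base)
  then show "b \<in> range (blk T)" by blast
next
  fix b assume "b \<in> range (blk T)"
  then obtain n where n: "b = blk T n" by auto
  have "nat (n mod nblk T) < nat (nblk T)" using nblk_pos[of T] by (simp add: nat_less_iff)
  then have "b \<in> cube_blocks T (cube_list T ! nat (n mod nblk T) + ncub T * (n div nblk T))"
    unfolding n blk_base cube_blocks_period by (intro imageI base_block_mem)
  then show "b \<in> blocks T" by (auto simp: blocks_def)
qed

lemma fst_blk [simp]: "fst (blk T n) = zcube T n"
  by (simp add: blk_def move_def zcube_def)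

lemma snd_blk: "snd (blk T n) = rotq T (flips T (n div nblk T)) ` set (base_cells T (nat (n mod nblk T)))"
  by (simp add: blk_def move_rotq)

lemma blk_in_cube: "blk T n \<in> cube_blocks T (zcube T n)"
proof -
  have "nat (n mod nblk T) < nat (nblk T)" using nblk_pos[of T] by (simp add: nat_less_iff)
  then have "blk T n \<in> cube_blocks T (cube_list T ! nat (n mod nblk T) + ncub T * (n div nblk T))"
    unfolding blk_base cube_blocks_period by (intro imageI base_block_mem)
  then show ?thesis by (simp add: zcube_def add.commute)
qed

lemma move_blk: "move T (ncub T * d) (flips T d) (blk T n) = blk T (n + nblk T * d)"
proof -
  have "nblk T \<noteq> 0" using nblk_pos[of T] by linarith
  then have "(n + nblk T * d) div nblk T = n div nblk T + d" "(n + nblk T * d) mod nblk T = n mod nblk T"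
    by simp_all
  moreover have "(flips T d \<noteq> flips T (n div nblk T)) = flips T (n div nblk T + d)"
    by (auto simp: flips_def)
  ultimately show ?thesis
    using base_cells_sub by (simp add: blk_def move_move algebra_simps)
qed

lemma zcol_period [simp]: "zcol T (n + nblk T * d) = zcol T n"
  by (simp add: zcol_def)

lemma offs_period [simp]: "offs T (n + nblk T * d) = offs T n"
  by (simp add: offs_def)

definition base_colour_ok :: "affine_type \<Rightarrow> bool" where
  "base_colour_ok T = list_all (\<lambda>t. base_cells T t \<noteq> [] \<and>
     list_all (\<lambda>x. cell_colour T (cube_list T ! t) x = col_list T ! t) (base_cells T t)) [0..<nat (nblk T)]"

lemma base_colour_ok: "base_colour_ok T"
proof (cases T)
  case E6 show ?thesis unfolding E6 by code_simp
next
  case E7 show ?thesis unfolding E7 by code_simp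
next
  case E8 show ?thesis unfolding E8 by code_simp
qed

lemma colour_blk: "colour T (blk T n) = zcol T n"
proof -
  let ?t = "nat (n mod nblk T)" and ?q = "n div nblk T"
  have t: "?t < nat (nblk T)" using nblk_pos[of T] by (simp add: nat_less_iff)
  have ok: "set (base_cells T ?t) \<noteq> {}"
    "\<And>x. x \<in> set (base_cells T ?t) \<Longrightarrow> cell_colour T (cube_list T ! ?t) x = col_list T ! ?t"
    using base_colour_ok[of T] t by (auto simp: base_colour_ok_def list_all_iff)
  have "cell_colour T (zcube T n) y = zcol T n" if y: "y \<in> snd (blk T n)" for y
  proof -
    obtain x where x: "x \<in> set (base_cells T ?t)" "y = rotq T (flips T ?q) x"
      using y by (auto simp: snd_blk)
    have "x \<in> cells T" using x base_cells_sub by blast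
    then show ?thesis
      using ok(2)[OF x(1)] cell_colour_period'[of x T "cube_list T ! ?t" ?q]
      by (simp add: x(2) zcube_def zcol_def add.commute)
  qed
  moreover have "snd (blk T n) \<noteq> {}" using ok by (simp add: snd_blk)
  ultimately have "cell_colour T (fst (blk T n)) ` snd (blk T n) = {zcol T n}"
    by (simp add: image_constant_conv[symmetric]) force
  then show ?thesis by (simp add: colour_def)
qed

definition meets :: "cell list \<Rightarrow> cell list \<Rightarrow> bool" where
  "meets xs ys = list_ex (\<lambda>x. List.member ys x) xs"

text \<open>A block of the first cube rests on blocks of the last cube of the preceding period. In
  types E6 and E8 these two periods are rotated against each other, hence the \<open>rotq\<close> in
  the second condition, and \<open>nblk T\<close> is added to the difference of the numbers. The
  bound 6 on all differences limits later searches.\<close>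

definition base_rests_ok :: "affine_type \<Rightarrow> bool" where
  "base_rests_ok T = list_all (\<lambda>t. list_all (\<lambda>u. \<not> u < 1 \<and> \<not> 6 < u) (off_list T ! t) \<and> list_all (\<lambda>t'.
     ((cube_list T ! t' = cube_list T ! t - 1 \<and> meets (base_cells T t) (base_cells T t')) =
        List.member (off_list T ! t) (int t - int t')) \<and>
     ((cube_list T ! t = 1 \<and> cube_list T ! t' = ncub T \<and>
         meets (map (rotq T (T \<noteq> E7)) (base_cells T t)) (base_cells T t')) =
        List.member (off_list T ! t) (int t - int t' + nblk T)))
     [0..<nat (nblk T)]) [0..<nat (nblk T)]"

lemma base_rests_ok: "base_rests_ok T"
proof (cases T)
  case E6 show ?thesis unfolding E6 by code_simp
next
  case E7 show ?thesis unfolding E7 by code_simp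
next
  case E8 show ?thesis unfolding E8 by code_simp
qed

lemma meets_iff: "meets xs ys \<longleftrightarrow> (\<exists>x \<in> set xs. x \<in> set ys)"
  by (simp add: meets_def list_ex_iff)

lemma rotq_meets:
  assumes "A \<subseteq> cells T" "B \<subseteq> cells T"
  shows "rotq T f ` A \<inter> rotq T g ` B \<noteq> {} \<longleftrightarrow> (\<exists>x \<in> A. rotq T (f \<noteq> g) x \<in> B)"
proof
  assume "rotq T f ` A \<inter> rotq T g ` B \<noteq> {}"
  then obtain x y where xy: "x \<in> A" "y \<in> B" "rotq T f x = rotq T g y" by blast
  have "rotq T (f \<noteq> g) x = rotq T g (rotq T f x)"
    using rotq_rotq[of x T g f] subsetD[OF assms(1) xy(1)] by (cases f; cases g; simp)
  also have "\<dots> = y" using xy assms by auto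
  finally show "\<exists>x \<in> A. rotq T (f \<noteq> g) x \<in> B" using xy by auto
next
  assume "\<exists>x \<in> A. rotq T (f \<noteq> g) x \<in> B"
  then obtain x where x: "x \<in> A" "rotq T (f \<noteq> g) x \<in> B" by auto
  have "rotq T g (rotq T (f \<noteq> g) x) = rotq T f x"
    using x assms by (cases f; cases g) auto
  then show "rotq T f ` A \<inter> rotq T g ` B \<noteq> {}" using x by (metis IntI empty_iff image_eqI)
qed

lemma zdecomp:
  obtains t q where "n = int t + nblk T * q" "t < nat (nblk T)" "n div nblk T = q" "nat (n mod nblk T) = t"
proof
  show "n = int (nat (n mod nblk T)) + nblk T * (n div nblk T)"
    using nblk_pos[of T] by simp
  show "nat (n mod nblk T) < nat (nblk T)" using nblk_pos[of T] by (simp add: nat_less_iff)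
qed auto

lemma nblk_ge: "nblk T \<ge> 12"
  by (cases T) auto

lemma offs_range: "d \<in> set (offs T n) \<Longrightarrow> 1 \<le> d \<and> d \<le> 6"
proof -
  obtain t q where t: "n = int t + nblk T * q" "t < nat (nblk T)" "nat (n mod nblk T) = t"
    using zdecomp[of n T] by metis
  assume "d \<in> set (offs T n)"
  then have d: "d \<in> set (off_list T ! t)" using t by (simp add: offs_def)
  have "\<forall>u \<in> set (off_list T ! t). \<not> u < 1 \<and> \<not> 6 < u"
    using base_rests_ok[of T] t(2) by (simp add: base_rests_ok_def list_all_iff)
  then show ?thesis using d by force
qed

text \<open>Adjacent cubes lie in the same period or in consecutive ones, and so do numbers that
  differ by at most 6, which is less than a period. The two cases correspond to the two conditions
  in \<open>base_rests_ok\<close>.\<close>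

lemma rests_on_blk: "rests_on (blk T n) (blk T m) \<longleftrightarrow> n - m \<in> set (offs T n)"
proof -
  obtain t q where n: "n = int t + nblk T * q" "t < nat (nblk T)" "n div nblk T = q" "nat (n mod nblk T) = t"
    using zdecomp[of n T] by metis
  obtain t' q' where m: "m = int t' + nblk T * q'" "t' < nat (nblk T)" "m div nblk T = q'"
    "nat (m mod nblk T) = t'"
    using zdecomp[of m T] by metis
  let ?A = "set (base_cells T t)" and ?B = "set (base_cells T t')"
  have sub: "?A \<subseteq> cells T" "?B \<subseteq> cells T" by (rule base_cells_sub)+
  have ok: "(cube_list T ! t' = cube_list T ! t - 1 \<and> (\<exists>x \<in> ?A. x \<in> ?B)) \<longleftrightarrow>
       int t - int t' \<in> set (off_list T ! t)"
    "(cube_list T ! t = 1 \<and> cube_list T ! t' = ncub T \<and> (\<exists>x \<in> ?A. rotq T (T \<noteq> E7) x \<in> ?B)) \<longleftrightarrow>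
       int t - int t' + nblk T \<in> set (off_list T ! t)"
    using base_rests_ok[of T] n(2) m(2)
    by (auto simp: base_rests_ok_def list_all_iff meets_iff)
  have r: "rests_on (blk T n) (blk T m) \<longleftrightarrow>
     ncub T * q' + cube_list T ! t' = ncub T * q + cube_list T ! t - 1 \<and>
     (\<exists>x \<in> ?A. rotq T (flips T q \<noteq> flips T q') x \<in> ?B)"
    using rotq_meets[OF sub, of "flips T q" "flips T q'"] by (simp add: rests_on_def snd_blk n(3,4) m(3,4) zcube_def)
  note c = cube_list_range[OF n(2)] cube_list_range[OF m(2)]
  have cube: "ncub T * q' + cube_list T ! t' = ncub T * q + cube_list T ! t - 1 \<longleftrightarrow>
     (q' = q \<and> cube_list T ! t' = cube_list T ! t - 1) \<or>
     (q' = q - 1 \<and> cube_list T ! t = 1 \<and> cube_list T ! t' = ncub T)" (is "?L \<longleftrightarrow> ?R")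
  proof
    assume L: ?L
    have "ncub T * (q - q') = cube_list T ! t' - cube_list T ! t + 1" using L by (simp add: algebra_simps)
    moreover have "cube_list T ! t' - cube_list T ! t + 1 < ncub T * 2"
      "cube_list T ! t' - cube_list T ! t + 1 > ncub T * (- 1)" using c by linarith+
    ultimately have "ncub T * (q - q') < ncub T * 2" "ncub T * (- 1) < ncub T * (q - q')" by linarith+
    then have "q - q' < 2" "- 1 < q - q'" using ncub_pos[of T] by (simp_all only: mult_less_cancel_left_pos)
    then consider "q' = q" | "q' = q - 1" by linarith
    then show ?R
    proof cases
      case 2
      then have "ncub T * q' = ncub T * q - ncub T" by (simp add: right_diff_distrib)
      then show ?thesis using 2 L c by linarith
    qed (use L in simp)
  qed (auto simp: algebra_simps)
  have rng: "1 \<le> d \<and> d \<le> 6" if "d \<in> set (off_list T ! t)" for d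
    using offs_range[of d T n] that by (simp add: offs_def n(3,4))
  have off: "n - m \<in> set (offs T n) \<longleftrightarrow>
     (q' = q \<and> int t - int t' \<in> set (off_list T ! t)) \<or>
     (q' = q - 1 \<and> int t - int t' + nblk T \<in> set (off_list T ! t))" (is "?L \<longleftrightarrow> ?R")
  proof
    assume L: ?L
    have e: "n - m = int t - int t' + nblk T * (q - q')" by (simp add: n m algebra_simps)
    have "int t < nblk T" "int t' < nblk T" using n(2) m(2) by linarith+
    moreover have "1 \<le> n - m" "n - m \<le> 6" using L rng by (auto simp: offs_def n(3,4))
    ultimately have "nblk T * (q - q') < nblk T * 2" "nblk T * (- 1) < nblk T * (q - q')"
      using nblk_ge[of T] unfolding e by linarith+
    then have "q - q' < 2" "- 1 < q - q'" using nblk_pos[of T] by (simp_all only: mult_less_cancel_left_pos)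
    then consider "q' = q" | "q' = q - 1" by linarith
    then show ?R using L e by cases (auto simp: offs_def n(3,4))
  next
    assume ?R
    then show ?L
    proof
      assume "q' = q \<and> int t - int t' \<in> set (off_list T ! t)"
      then show ?thesis using n m by (simp add: offs_def)
    next
      assume R: "q' = q - 1 \<and> int t - int t' + nblk T \<in> set (off_list T ! t)"
      then have "q' = q - 1" by simp
      then have "n - m = int t - int t' + nblk T" unfolding n(1) m(1) by (simp add: right_diff_distrib)
      then show ?thesis using R by (simp add: offs_def n(3,4))
    qed
  qed
  have "flips T q \<noteq> flips T (q - 1) \<longleftrightarrow> T \<noteq> E7" by (auto simp: flips_def)
  then show ?thesis
    unfolding r cube off ok[symmetric] by (cases "q' = q"; cases "q' = q - 1") (simp_all, blast?)
qed

definition base_distinct_ok :: "affine_type \<Rightarrow> bool" where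
  "base_distinct_ok T = (list_all (\<lambda>t. list_all (\<lambda>t'. t = t' \<or> cube_list T ! t' \<noteq> cube_list T ! t \<or>
     \<not> meets (base_cells T t) (base_cells T t')) [0..<nat (nblk T)]) [0..<nat (nblk T)])"

lemma base_distinct_ok: "base_distinct_ok T"
proof (cases T)
  case E6 show ?thesis unfolding E6 by code_simp
next
  case E7 show ?thesis unfolding E7 by code_simp
next
  case E8 show ?thesis unfolding E8 by code_simp
qed

text \<open>Equal cubes force equal periods; inside one cube distinct blocks have disjoint non-empty
  sets of cells.\<close>

lemma blk_inject [simp]: "blk T n = blk T m \<longleftrightarrow> n = m"
proof
  assume eq: "blk T n = blk T m"
  obtain t q where n: "n = int t + nblk T * q" "t < nat (nblk T)" "n div nblk T = q" "nat (n mod nblk T) = t"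
    using zdecomp[of n T] by metis
  obtain t' q' where m: "m = int t' + nblk T * q'" "t' < nat (nblk T)" "m div nblk T = q'"
    "nat (m mod nblk T) = t'"
    using zdecomp[of m T] by metis
  note c = cube_list_range[OF n(2)] cube_list_range[OF m(2)]
  have "zcube T n = zcube T m" using eq by (metis fst_blk)
  then have z: "ncub T * (q - q') = cube_list T ! t' - cube_list T ! t"
    by (simp add: zcube_def n(3,4) m(3,4) algebra_simps)
  then have "ncub T * (q - q') < ncub T * 1" "ncub T * (- 1) < ncub T * (q - q')" using c by linarith+
  then have "q - q' < 1" "- 1 < q - q'" using ncub_pos[of T] by (simp_all only: mult_less_cancel_left_pos)
  then have q: "q = q'" by linarith
  have ct: "cube_list T ! t' = cube_list T ! t" using z q by simp
  have ne: "set (base_cells T t) \<noteq> {}"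
    using base_colour_ok[of T] n(2) by (auto simp: base_colour_ok_def list_all_iff)
  have "rotq T (flips T q) ` set (base_cells T t) = rotq T (flips T q) ` set (base_cells T t')"
    using arg_cong[OF eq, of snd] q by (simp add: snd_blk n(3,4) m(3,4))
  then have "set (base_cells T t) = set (base_cells T t')"
    using inj_on_image_eq_iff[OF inj_rotq base_cells_sub base_cells_sub] by blast
  then have "meets (base_cells T t) (base_cells T t')" using ne unfolding meets_iff by (metis all_not_in_conv)
  moreover have "a = b \<or> cube_list T ! b \<noteq> cube_list T ! a \<or> \<not> meets (base_cells T a) (base_cells T b)"
    if "a < nat (nblk T)" "b < nat (nblk T)" for a b
    using base_distinct_ok[of T] that by (simp add: base_distinct_ok_def list_all_iff)
  ultimately have "t = t'" using n(2) m(2) ct by blast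
  then show "n = m" using q n m by simp
qed auto

lemma inj_blk: "inj (blk T)" by (simp add: inj_def)

text \<open>The mark of the affine node is 1: every period has a single block of colour 0. These
  blocks serve as reference points of the pattern.\<close>

lemma zcol_0_iff: "zcol T n = 0 \<longleftrightarrow> n mod nblk T = 0"
proof -
  have "\<forall>t < nat (nblk T). col_list T ! t = 0 \<longrightarrow> t = 0"
    by (cases T) (auto simp: less_Suc_eq numeral_eq_Suc)
  moreover have "nat (n mod nblk T) < nat (nblk T)" using nblk_pos[of T] by (simp add: nat_less_iff)
  ultimately have "zcol T n = 0 \<Longrightarrow> nat (n mod nblk T) = 0" unfolding zcol_def by blast
  moreover have "col_list T ! 0 = 0" by (cases T) auto
  ultimately show ?thesis
    using pos_mod_sign[OF nblk_pos[of T], of n] unfolding zcol_def by auto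
qed

lemma base_block_0: "list_all (\<lambda>T. base_cells T 0 = [(1, False)] \<and> cube_list T ! 0 = 1) [E6, E7, E8]"
  by code_simp

lemma blk_0: "blk T (nblk T * q) = (1 + ncub T * q, {if flips T q then (width T, True) else (1, False)})"
proof -
  have "base_cells T 0 = [(1, False)] \<and> cube_list T ! 0 = 1"
    using base_block_0 by (cases T) auto
  then show ?thesis
    using less_imp_neq[OF nblk_pos[of T]]
    by (simp add: blk_def move_rotq rotq_def rot_cell_def)
qed

text \<open>A 0-block is a single corner cell. A move that takes one 0-block to another is
  determined by the two cubes and the two corners, so the only moves compatible with the colours are
  the shifts by periods.\<close>

lemma symmetry_of_pattern:
  assumes "move T d \<rho> (blk T (nblk T * q)) \<in> blocks T"
    and "colour T (move T d \<rho> (blk T (nblk T * q))) = 0"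
  shows "\<exists>p. d = ncub T * p \<and> \<rho> = flips T p"
proof -
  obtain m where m: "move T d \<rho> (blk T (nblk T * q)) = blk T m"
    using assms(1) by (auto simp: blocks_eq)
  have "m mod nblk T = 0" using assms(2) by (simp add: m colour_blk zcol_0_iff)
  then obtain p where p: "m = nblk T * p" by (auto elim: dvdE)
  have "fst (move T d \<rho> (blk T (nblk T * q))) = fst (blk T (nblk T * p))" using m p by simp
  then have d: "d = ncub T * (p - q)"
    unfolding blk_0 by (simp add: move_def algebra_simps)
  have s: "snd (move T d \<rho> (blk T (nblk T * q))) = snd (blk T (nblk T * p))" using m p by simp
  have "\<rho> = flips T (p - q)"
    using s unfolding blk_0
    by (cases T) (auto simp: move_def rot_cell_def flips_def split: if_splits)
  then show ?thesis using d by blast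
qed


section \<open>The table of Young columns\<close>

text \<open>The entry for the column \<open>j\<close> consists of its weight, the pair \<open>(a, xs)\<close> standing for the column
  \<open>{..<a} \<union> set xs\<close>, the triples \<open>(i, n, k)\<close> such that adding the \<open>i\<close>-block \<open>n\<close> gives the column \<open>k\<close>, and
  the triples such that removing the \<open>i\<close>-block \<open>n\<close> gives the column \<open>k\<close>, where \<open>k\<close> is shifted by one
  period if \<open>i = 0\<close>. Of several triples of the same colour the first one is chosen by the
  tie-breaking rule. The tables are search trees since they are evaluated by rewriting.\<close>

type_synonym entry = "int list \<times> (int \<times> int list) \<times> (nat \<times> int \<times> nat) list \<times> (nat \<times> int \<times> nat) list"

definition tab6_0 :: "nat \<Rightarrow> entry" where "tab6_0 j =
  (if j < 8 then (if j < 4 then (if j < 2 then (if j < 1 then ([1,0,-1,-1,1,0,0],(12,[]),[(0,12,4),(4,13,1)],[(2,10,24),(3,11,25)])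
  else ([1,0,0,0,-1,1,0],(12,[13]),[(0,12,5),(5,15,2)],[(4,13,0)]))
  else (if j < 3 then ([1,0,0,0,0,-1,1],(12,[13,15]),[(0,12,6),(6,17,3)],[(5,15,1)])
  else ([1,0,0,0,0,0,-1],(12,[13,15,17]),[(0,12,7)],[(6,17,2)])))
  else (if j < 6 then (if j < 5 then ([-1,0,0,-1,1,0,0],(1,[]),[(4,1,5)],[(0,0,0),(3,-1,26)])
  else ([-1,0,1,0,-1,1,0],(2,[]),[(2,2,8),(5,3,6)],[(0,0,1),(4,1,4)]))
  else (if j < 7 then ([-1,0,1,0,0,-1,1],(2,[3]),[(2,2,9),(6,5,7)],[(0,0,2),(5,3,5)])
  else ([-1,0,1,0,0,0,-1],(2,[3,5]),[(2,2,10)],[(0,0,3),(6,5,6)]))))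
  else (if j < 12 then (if j < 10 then (if j < 9 then ([0,0,-1,0,0,1,0],(3,[]),[(5,3,9)],[(2,2,5)])
  else ([0,0,-1,0,1,-1,1],(4,[]),[(4,4,11),(6,5,10)],[(2,2,6),(5,3,8)]))
  else (if j < 11 then ([0,0,-1,0,1,0,-1],(4,[5]),[(4,4,14)],[(2,2,7),(6,5,9)])
  else ([0,0,0,1,-1,0,1],(5,[]),[(3,6,12),(6,5,14)],[(4,4,9)])))
  else (if j < 14 then (if j < 13 then ([0,1,0,-1,0,0,1],(5,[6]),[(1,8,13),(6,5,16)],[(3,6,11)])
  else ([0,-1,0,0,0,0,1],(5,[6,8]),[(6,5,17)],[(1,8,12)]))
  else (if j < 15 then ([0,0,0,1,-1,1,-1],(6,[]),[(3,6,16),(5,7,15)],[(4,4,10),(6,5,11)])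
  else ([0,0,0,1,0,-1,0],(6,[7]),[(3,6,18)],[(5,7,14)])))))"

definition tab6_1 :: "nat \<Rightarrow> entry" where "tab6_1 j =
  (if j < 21 then (if j < 18 then (if j < 17 then ([0,1,0,-1,0,1,-1],(7,[]),[(1,8,17),(5,7,18)],[(3,6,14),(6,5,12)])
  else ([0,-1,0,0,0,1,-1],(7,[8]),[(5,7,22)],[(1,8,16),(6,5,13)]))
  else (if j < 19 then ([0,1,0,-1,1,-1,0],(8,[]),[(1,8,22),(4,9,19)],[(3,6,15),(5,7,16)])
  else (if j < 20 then ([0,1,1,0,-1,0,0],(8,[9]),[(1,8,23),(2,10,20)],[(4,9,18)])
  else ([1,1,-1,0,0,0,0],(8,[9,10]),[(0,12,21),(1,8,25)],[(2,10,19)]))))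
  else (if j < 24 then (if j < 22 then ([-1,1,0,0,0,0,0],(-4,[-3,-2,0]),[(1,-4,26)],[(0,0,20)])
  else (if j < 23 then ([0,-1,0,0,1,-1,0],(9,[]),[(4,9,23)],[(1,8,18),(5,7,17)])
  else ([0,-1,1,1,-1,0,0],(10,[]),[(2,10,25),(3,11,24)],[(1,8,19),(4,9,22)])))
  else (if j < 25 then ([0,0,1,-1,0,0,0],(10,[11]),[(2,10,0)],[(3,11,23)])
  else (if j < 26 then ([1,-1,-1,1,0,0,0],(11,[]),[(0,12,26),(3,11,0)],[(1,8,20),(2,10,23)])
  else ([-1,-1,0,1,0,0,0],(-1,[0]),[(3,-1,4)],[(0,0,25),(1,-4,21)])))))"

definition tab6 :: "nat \<Rightarrow> entry" where "tab6 j =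
  (if j < 16 then tab6_0 j else tab6_1 j)"

definition tab7_0 :: "nat \<Rightarrow> entry" where "tab7_0 j =
  (if j < 8 then (if j < 4 then (if j < 2 then (if j < 1 then ([1,-1,1,1,-1,0,0,0],(18,[]),[(0,18,8),(2,19,1),(3,20,7)],[(1,16,52),(4,17,54)])
  else ([1,-1,-1,1,0,0,0,0],(18,[19]),[(0,18,11),(3,20,2)],[(1,16,53),(2,19,0)]))
  else (if j < 3 then ([1,0,-1,-1,1,0,0,0],(18,[19,20]),[(0,18,12),(4,22,3)],[(2,19,7),(3,20,1)])
  else ([1,0,0,0,-1,1,0,0],(18,[19,20,22]),[(0,18,13),(5,24,4)],[(4,22,2)])))
  else (if j < 6 then (if j < 5 then ([1,0,0,0,0,-1,1,0],(18,[19,20,22,24]),[(0,18,14),(6,26,5)],[(5,24,3)])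
  else ([1,0,0,0,0,0,-1,1],(18,[19,20,22,24,26]),[(0,18,15),(7,29,6)],[(6,26,4)]))
  else (if j < 7 then ([1,0,0,0,0,0,0,-1],(18,[19,20,22,24,26,29]),[(0,18,16)],[(7,29,5)])
  else ([1,0,1,-1,0,0,0,0],(18,[20]),[(0,18,9),(2,19,2)],[(3,20,0)]))))
  else (if j < 12 then (if j < 10 then (if j < 9 then ([-1,0,1,1,-1,0,0,0],(1,[]),[(2,1,11),(3,2,9)],[(0,0,0),(4,-1,55)])
  else ([-1,1,1,-1,0,0,0,0],(1,[2]),[(1,3,10),(2,1,12)],[(0,0,7),(3,2,8)]))
  else (if j < 11 then ([0,-1,1,0,0,0,0,0],(1,[2,3]),[(2,1,17)],[(1,3,9)])
  else ([-1,0,-1,1,0,0,0,0],(2,[]),[(3,2,12)],[(0,0,1),(2,1,8)])))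
  else (if j < 14 then (if j < 13 then ([-1,1,-1,-1,1,0,0,0],(3,[]),[(1,3,17),(4,4,13)],[(0,0,2),(2,1,9),(3,2,11)])
  else ([-1,1,0,0,-1,1,0,0],(3,[4]),[(1,3,18),(5,6,14)],[(0,0,3),(4,4,12)]))
  else (if j < 15 then ([-1,1,0,0,0,-1,1,0],(3,[4,6]),[(1,3,19),(6,8,15)],[(0,0,4),(5,6,13)])
  else ([-1,1,0,0,0,0,-1,1],(3,[4,6,8]),[(1,3,20),(7,11,16)],[(0,0,5),(6,8,14)])))))"

definition tab7_1 :: "nat \<Rightarrow> entry" where "tab7_1 j =
  (if j < 24 then (if j < 20 then (if j < 18 then (if j < 17 then ([-1,1,0,0,0,0,0,-1],(3,[4,6,8,11]),[(1,3,21)],[(0,0,6),(7,11,15)])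
  else ([0,-1,-1,0,1,0,0,0],(4,[]),[(4,4,18)],[(1,3,12),(2,1,10)]))
  else (if j < 19 then ([0,-1,0,1,-1,1,0,0],(5,[]),[(3,5,22),(5,6,19)],[(1,3,13),(4,4,17)])
  else ([0,-1,0,1,0,-1,1,0],(5,[6]),[(3,5,23),(6,8,20)],[(1,3,14),(5,6,18)])))
  else (if j < 22 then (if j < 21 then ([0,-1,0,1,0,0,-1,1],(5,[6,8]),[(3,5,24),(7,11,21)],[(1,3,15),(6,8,19)])
  else ([0,-1,0,1,0,0,0,-1],(5,[6,8,11]),[(3,5,25)],[(1,3,16),(7,11,20)]))
  else (if j < 23 then ([0,0,0,-1,0,1,0,0],(6,[]),[(5,6,23)],[(3,5,18)])
  else ([0,0,0,-1,1,-1,1,0],(7,[]),[(4,7,26),(6,8,24)],[(3,5,19),(5,6,22)]))))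
  else (if j < 28 then (if j < 26 then (if j < 25 then ([0,0,0,-1,1,0,-1,1],(7,[8]),[(4,7,28),(7,11,25)],[(3,5,20),(6,8,23)])
  else ([0,0,0,-1,1,0,0,-1],(7,[8,11]),[(4,7,32)],[(3,5,21),(7,11,24)]))
  else (if j < 27 then ([0,0,1,0,-1,0,1,0],(8,[]),[(2,9,27),(6,8,28)],[(4,7,23)])
  else ([0,0,-1,0,0,0,1,0],(8,[9]),[(6,8,33)],[(2,9,26)])))
  else (if j < 30 then (if j < 29 then ([0,0,1,0,-1,1,-1,1],(9,[]),[(2,9,33),(5,10,29),(7,11,32)],[(4,7,24),(6,8,26)])
  else ([0,0,1,0,0,-1,0,1],(9,[10]),[(2,9,35),(7,11,30)],[(5,10,28)]))
  else (if j < 31 then ([0,0,1,0,0,-1,1,-1],(9,[10,11]),[(2,9,40),(6,13,31)],[(5,10,32),(7,11,29)])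
  else ([0,0,1,0,0,0,-1,0],(9,[10,11,13]),[(2,9,41)],[(6,13,30)])))))"

definition tab7_2 :: "nat \<Rightarrow> entry" where "tab7_2 j =
  (if j < 40 then (if j < 36 then (if j < 34 then (if j < 33 then ([0,0,1,0,-1,1,0,-1],(9,[11]),[(2,9,34),(5,10,30)],[(4,7,25),(7,11,28)])
  else ([0,0,-1,0,0,1,-1,1],(10,[]),[(5,10,35),(7,11,34)],[(2,9,28),(6,8,27)]))
  else (if j < 35 then ([0,0,-1,0,0,1,0,-1],(10,[11]),[(5,10,40)],[(2,9,32),(7,11,33)])
  else ([0,0,-1,0,1,-1,0,1],(11,[]),[(4,12,36),(7,11,40)],[(2,9,29),(5,10,33)])))
  else (if j < 38 then (if j < 37 then ([0,0,0,1,-1,0,0,1],(11,[12]),[(3,14,37),(7,11,42)],[(4,12,35)])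
  else ([0,1,0,-1,0,0,0,1],(11,[12,14]),[(1,16,38),(7,11,43)],[(3,14,36)]))
  else (if j < 39 then ([1,-1,0,0,0,0,0,1],(11,[12,14,16]),[(0,18,39),(7,11,44)],[(1,16,37)])
  else ([-1,0,0,0,0,0,0,1],(-7,[-6,-4,-2,0]),[(7,-7,45)],[(0,0,38)]))))
  else (if j < 44 then (if j < 42 then (if j < 41 then ([0,0,-1,0,1,-1,1,-1],(12,[]),[(4,12,42),(6,13,41)],[(2,9,30),(5,10,34),(7,11,35)])
  else ([0,0,-1,0,1,0,-1,0],(12,[13]),[(4,12,46)],[(2,9,31),(6,13,40)]))
  else (if j < 43 then ([0,0,0,1,-1,0,1,-1],(13,[]),[(3,14,43),(6,13,46)],[(4,12,40),(7,11,36)])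
  else ([0,1,0,-1,0,0,1,-1],(13,[14]),[(1,16,44),(6,13,48)],[(3,14,42),(7,11,37)])))
  else (if j < 46 then (if j < 45 then ([1,-1,0,0,0,0,1,-1],(13,[14,16]),[(0,18,45),(6,13,49)],[(1,16,43),(7,11,38)])
  else ([-1,0,0,0,0,0,1,-1],(-5,[-4,-2,0]),[(6,-5,50)],[(0,0,44),(7,-7,39)]))
  else (if j < 47 then ([0,0,0,1,-1,1,-1,0],(14,[]),[(3,14,48),(5,15,47)],[(4,12,41),(6,13,42)])
  else ([0,0,0,1,0,-1,0,0],(14,[15]),[(3,14,51)],[(5,15,46)])))))"

definition tab7_3 :: "nat \<Rightarrow> entry" where "tab7_3 j =
  (if j < 52 then (if j < 50 then (if j < 49 then ([0,1,0,-1,0,1,-1,0],(15,[]),[(1,16,49),(5,15,51)],[(3,14,46),(6,13,43)])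
  else ([1,-1,0,0,0,1,-1,0],(15,[16]),[(0,18,50),(5,15,54)],[(1,16,48),(6,13,44)]))
  else (if j < 51 then ([-1,0,0,0,0,1,-1,0],(-3,[-2,0]),[(5,-3,55)],[(0,0,49),(6,-5,45)])
  else ([0,1,0,-1,1,-1,0,0],(16,[]),[(1,16,54),(4,17,52)],[(3,14,47),(5,15,48)])))
  else (if j < 54 then (if j < 53 then ([0,1,1,0,-1,0,0,0],(16,[17]),[(1,16,0),(2,19,53)],[(4,17,51)])
  else ([0,1,-1,0,0,0,0,0],(16,[17,19]),[(1,16,1)],[(2,19,52)]))
  else (if j < 55 then ([1,-1,0,0,1,-1,0,0],(17,[]),[(0,18,55),(4,17,0)],[(1,16,51),(5,15,49)])
  else ([-1,0,0,0,1,-1,0,0],(-1,[0]),[(4,-1,8)],[(0,0,54),(5,-3,50)]))))"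

definition tab7 :: "nat \<Rightarrow> entry" where "tab7 j =
  (if j < 32 then (if j < 16 then tab7_0 j else tab7_1 j) else (if j < 48 then tab7_2 j else tab7_3 j))"

definition tab8_0 :: "nat \<Rightarrow> entry" where "tab8_0 j =
  (if j < 8 then (if j < 4 then (if j < 2 then (if j < 1 then ([1,0,1,0,-1,1,-1,1,-1],(30,[]),[(0,30,34),(2,31,1),(5,32,30),(7,33,33)],[(4,27,229),(6,28,237),(8,29,242)])
  else ([1,0,-1,0,0,1,-1,1,-1],(30,[31]),[(0,30,43),(5,32,2),(7,33,29)],[(2,31,0),(6,28,240),(8,29,243)]))
  else (if j < 3 then ([1,0,-1,0,1,-1,0,1,-1],(30,[31,32]),[(0,30,46),(4,34,26),(7,33,3)],[(2,31,30),(5,32,1),(8,29,244)])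
  else ([1,0,-1,0,1,-1,1,-1,0],(30,[31,32,33]),[(0,30,50),(4,34,4),(6,35,25)],[(2,31,31),(5,32,29),(7,33,2)])))
  else (if j < 6 then (if j < 5 then ([1,0,0,1,-1,0,1,-1,0],(30,[31,32,33,34]),[(0,30,55),(3,37,23),(6,35,5)],[(4,34,3),(7,33,26)])
  else ([1,0,0,1,-1,1,-1,0,0],(30,[31,32,33,34,35]),[(0,30,61),(3,37,6),(5,38,22)],[(4,34,25),(6,35,4)]))
  else (if j < 7 then ([1,1,0,-1,0,1,-1,0,0],(30,[31,32,33,34,35,37]),[(0,30,62),(1,40,21),(5,38,7)],[(3,37,5),(6,35,23)])
  else ([1,1,0,-1,1,-1,0,0,0],(30,[31,32,33,34,35,37,38]),[(0,30,63),(1,40,8),(4,41,19)],[(3,37,22),(5,38,6)]))))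
  else (if j < 12 then (if j < 10 then (if j < 9 then ([1,-1,0,0,1,-1,0,0,0],(30,[31,32,33,34,35,37,38,40]),[(0,30,64),(4,41,9)],[(1,40,7),(5,38,21)])
  else ([1,-1,1,1,-1,0,0,0,0],(30,[31,32,33,34,35,37,38,40,41]),[(0,30,65),(2,43,10),(3,44,18)],[(1,40,19),(4,41,8)]))
  else (if j < 11 then ([1,-1,-1,1,0,0,0,0,0],(30,[31,32,33,34,35,37,38,40,41,43]),[(0,30,66),(3,44,11)],[(1,40,20),(2,43,9)])
  else ([1,0,-1,-1,1,0,0,0,0],(30,[31,32,33,34,35,37,38,40,41,43,44]),[(0,30,67),(4,47,12)],[(2,43,18),(3,44,10)])))
  else (if j < 14 then (if j < 13 then ([1,0,0,0,-1,1,0,0,0],(30,[31,32,33,34,35,37,38,40,41,43,44,47]),[(0,30,68),(5,50,13)],[(4,47,11)])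
  else ([1,0,0,0,0,-1,1,0,0],(30,[31,32,33,34,35,37,38,40,41,43,44,47,50]),[(0,30,69),(6,53,14)],[(5,50,12)]))
  else (if j < 15 then ([1,0,0,0,0,0,-1,1,0],(30,[31,32,33,34,35,37,38,40,41,43,44,47,50,53]),[(0,30,70),(7,56,15)],[(6,53,13)])
  else ([1,0,0,0,0,0,0,-1,1],(30,[31,32,33,34,35,37,38,40,41,43,44,47,50,53,56]),[(0,30,71),(8,59,16)],[(7,56,14)])))))"

definition tab8_1 :: "nat \<Rightarrow> entry" where "tab8_1 j =
  (if j < 24 then (if j < 20 then (if j < 18 then (if j < 17 then ([2,0,0,0,0,0,0,0,-1],(30,[31,32,33,34,35,37,38,40,41,43,44,47,50,53,56,59]),[(0,60,17),(0,30,72)],[(8,59,15)])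
  else ([0,0,0,0,0,0,0,0,0],(0,[1,2,3,4,5,7,8,10,11,13,14,17,20,23,26,29,30]),[(0,0,73)],[(0,30,16)]))
  else (if j < 19 then ([1,0,1,-1,0,0,0,0,0],(30,[31,32,33,34,35,37,38,40,41,44]),[(0,30,74),(2,43,11)],[(3,44,9)])
  else ([1,1,1,0,-1,0,0,0,0],(30,[31,32,33,34,35,37,38,41]),[(0,30,75),(1,40,9),(2,43,20)],[(4,41,7)])))
  else (if j < 22 then (if j < 21 then ([1,1,-1,0,0,0,0,0,0],(30,[31,32,33,34,35,37,38,41,43]),[(0,30,76),(1,40,10)],[(2,43,19)])
  else ([1,-1,0,0,0,1,-1,0,0],(30,[31,32,33,34,35,37,40]),[(0,30,77),(5,38,8)],[(1,40,6),(6,35,24)]))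
  else (if j < 23 then ([1,0,0,1,0,-1,0,0,0],(30,[31,32,33,34,35,38]),[(0,30,78),(3,37,7)],[(5,38,5)])
  else ([1,1,0,-1,0,0,1,-1,0],(30,[31,32,33,34,37]),[(0,30,59),(1,40,24),(6,35,6)],[(3,37,4),(7,33,27)]))))
  else (if j < 28 then (if j < 26 then (if j < 25 then ([1,-1,0,0,0,0,1,-1,0],(30,[31,32,33,34,37,40]),[(0,30,60),(6,35,21)],[(1,40,23),(7,33,28)])
  else ([1,0,-1,0,1,0,-1,0,0],(30,[31,32,33,35]),[(0,30,51),(4,34,5)],[(2,31,32),(6,35,3)]))
  else (if j < 27 then ([1,0,0,1,-1,0,0,1,-1],(30,[31,32,34]),[(0,30,47),(3,37,27),(7,33,4)],[(4,34,2),(8,29,245)])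
  else ([1,1,0,-1,0,0,0,1,-1],(30,[31,32,34,37]),[(0,30,48),(1,40,28),(7,33,23)],[(3,37,26),(8,29,246)])))
  else (if j < 30 then (if j < 29 then ([1,-1,0,0,0,0,0,1,-1],(30,[31,32,34,37,40]),[(0,30,49),(7,33,24)],[(1,40,27),(8,29,247)])
  else ([1,0,-1,0,0,1,0,-1,0],(30,[31,33]),[(0,30,44),(5,32,3)],[(2,31,33),(7,33,1)]))
  else (if j < 31 then ([1,0,1,0,0,-1,0,1,-1],(30,[32]),[(0,30,35),(2,31,2),(7,33,31)],[(5,32,0),(8,29,248)])
  else ([1,0,1,0,0,-1,1,-1,0],(30,[32,33]),[(0,30,36),(2,31,3),(6,35,32)],[(5,32,33),(7,33,30)])))))"

definition tab8_2 :: "nat \<Rightarrow> entry" where "tab8_2 j =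
  (if j < 40 then (if j < 36 then (if j < 34 then (if j < 33 then ([1,0,1,0,0,0,-1,0,0],(30,[32,33,35]),[(0,30,37),(2,31,25)],[(6,35,31)])
  else ([1,0,1,0,-1,1,0,-1,0],(30,[33]),[(0,30,41),(2,31,29),(5,32,31)],[(4,27,233),(7,33,0)]))
  else (if j < 35 then ([-1,0,1,0,-1,1,-1,1,0],(1,[]),[(2,1,43),(5,2,35),(7,3,41)],[(0,0,0),(4,-3,230),(6,-2,238)])
  else ([-1,0,1,0,0,-1,0,1,0],(1,[2]),[(2,1,46),(7,3,36)],[(0,0,30),(5,2,34)])))
  else (if j < 38 then (if j < 37 then ([-1,0,1,0,0,-1,1,-1,1],(1,[2,3]),[(2,1,50),(6,5,37),(8,6,40)],[(0,0,31),(5,2,41),(7,3,35)])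
  else ([-1,0,1,0,0,0,-1,0,1],(1,[2,3,5]),[(2,1,51),(8,6,38)],[(0,0,32),(6,5,36)]))
  else (if j < 39 then ([0,0,1,0,0,0,-1,1,-1],(1,[2,3,5,6]),[(2,1,52),(7,9,39)],[(6,5,40),(8,6,37)])
  else ([0,0,1,0,0,0,0,-1,0],(1,[2,3,5,6,9]),[(2,1,53)],[(7,9,38)]))))
  else (if j < 44 then (if j < 42 then (if j < 41 then ([0,0,1,0,0,-1,1,0,-1],(1,[2,3,6]),[(2,1,54),(6,5,38)],[(5,2,42),(8,6,36)])
  else ([-1,0,1,0,-1,1,0,-1,1],(1,[3]),[(2,1,44),(5,2,36),(8,6,42)],[(0,0,33),(4,-3,231),(7,3,34)]))
  else (if j < 43 then ([0,0,1,0,-1,1,0,0,-1],(1,[3,6]),[(2,1,45),(5,2,40)],[(4,-3,232),(8,6,41)])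
  else ([-1,0,-1,0,0,1,-1,1,0],(2,[]),[(5,2,46),(7,3,44)],[(0,0,1),(2,1,34),(6,-2,239)])))
  else (if j < 46 then (if j < 45 then ([-1,0,-1,0,0,1,0,-1,1],(2,[3]),[(5,2,50),(8,6,45)],[(0,0,29),(2,1,41),(7,3,43)])
  else ([0,0,-1,0,0,1,0,0,-1],(2,[3,6]),[(5,2,54)],[(2,1,42),(8,6,44)]))
  else (if j < 47 then ([-1,0,-1,0,1,-1,0,1,0],(3,[]),[(4,4,47),(7,3,50)],[(0,0,2),(2,1,35),(5,2,43)])
  else ([-1,0,0,1,-1,0,0,1,0],(3,[4]),[(3,7,48),(7,3,55)],[(0,0,26),(4,4,46)])))))"

definition tab8_3 :: "nat \<Rightarrow> entry" where "tab8_3 j =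
  (if j < 56 then (if j < 52 then (if j < 50 then (if j < 49 then ([-1,1,0,-1,0,0,0,1,0],(3,[4,7]),[(1,10,49),(7,3,59)],[(0,0,27),(3,7,47)])
  else ([-1,-1,0,0,0,0,0,1,0],(3,[4,7,10]),[(7,3,60)],[(0,0,28),(1,10,48)]))
  else (if j < 51 then ([-1,0,-1,0,1,-1,1,-1,1],(4,[]),[(4,4,55),(6,5,51),(8,6,54)],[(0,0,3),(2,1,36),(5,2,44),(7,3,46)])
  else ([-1,0,-1,0,1,0,-1,0,1],(4,[5]),[(4,4,61),(8,6,52)],[(0,0,25),(2,1,37),(6,5,50)])))
  else (if j < 54 then (if j < 53 then ([0,0,-1,0,1,0,-1,1,-1],(4,[5,6]),[(4,4,79),(7,9,53)],[(2,1,38),(6,5,54),(8,6,51)])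
  else ([0,0,-1,0,1,0,0,-1,0],(4,[5,6,9]),[(4,4,83)],[(2,1,39),(7,9,52)]))
  else (if j < 55 then ([0,0,-1,0,1,-1,1,0,-1],(4,[6]),[(4,4,56),(6,5,52)],[(2,1,40),(5,2,45),(8,6,50)])
  else ([-1,0,0,1,-1,0,1,-1,1],(5,[]),[(3,7,59),(6,5,61),(8,6,56)],[(0,0,4),(4,4,50),(7,3,47)]))))
  else (if j < 60 then (if j < 58 then (if j < 57 then ([0,0,0,1,-1,0,1,0,-1],(5,[6]),[(3,7,57),(6,5,79)],[(4,4,54),(8,6,55)])
  else ([0,1,0,-1,0,0,1,0,-1],(5,[6,7]),[(1,10,58),(6,5,84)],[(3,7,56),(8,6,59)]))
  else (if j < 59 then ([0,-1,0,0,0,0,1,0,-1],(5,[6,7,10]),[(6,5,87)],[(1,10,57),(8,6,60)])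
  else ([-1,1,0,-1,0,0,1,-1,1],(5,[7]),[(1,10,60),(6,5,62),(8,6,57)],[(0,0,23),(3,7,55),(7,3,48)])))
  else (if j < 62 then (if j < 61 then ([-1,-1,0,0,0,0,1,-1,1],(5,[7,10]),[(6,5,77),(8,6,58)],[(0,0,24),(1,10,59),(7,3,49)])
  else ([-1,0,0,1,-1,1,-1,0,1],(6,[]),[(3,7,62),(5,8,78),(8,6,79)],[(0,0,5),(4,4,51),(6,5,55)]))
  else (if j < 63 then ([-1,1,0,-1,0,1,-1,0,1],(6,[7]),[(1,10,77),(5,8,63),(8,6,84)],[(0,0,6),(3,7,61),(6,5,59)])
  else ([-1,1,0,-1,1,-1,0,0,1],(6,[7,8]),[(1,10,64),(4,11,75),(8,6,88)],[(0,0,7),(3,7,78),(5,8,62)])))))"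

definition tab8_4 :: "nat \<Rightarrow> entry" where "tab8_4 j =
  (if j < 72 then (if j < 68 then (if j < 66 then (if j < 65 then ([-1,-1,0,0,1,-1,0,0,1],(6,[7,8,10]),[(4,11,65),(8,6,89)],[(0,0,8),(1,10,63),(5,8,77)])
  else ([-1,-1,1,1,-1,0,0,0,1],(6,[7,8,10,11]),[(2,13,66),(3,14,74),(8,6,90)],[(0,0,9),(1,10,75),(4,11,64)]))
  else (if j < 67 then ([-1,-1,-1,1,0,0,0,0,1],(6,[7,8,10,11,13]),[(3,14,67),(8,6,91)],[(0,0,10),(1,10,76),(2,13,65)])
  else ([-1,0,-1,-1,1,0,0,0,1],(6,[7,8,10,11,13,14]),[(4,17,68),(8,6,92)],[(0,0,11),(2,13,74),(3,14,66)])))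
  else (if j < 70 then (if j < 69 then ([-1,0,0,0,-1,1,0,0,1],(6,[7,8,10,11,13,14,17]),[(5,20,69),(8,6,93)],[(0,0,12),(4,17,67)])
  else ([-1,0,0,0,0,-1,1,0,1],(6,[7,8,10,11,13,14,17,20]),[(6,23,70),(8,6,94)],[(0,0,13),(5,20,68)]))
  else (if j < 71 then ([-1,0,0,0,0,0,-1,1,1],(6,[7,8,10,11,13,14,17,20,23]),[(7,26,71),(8,6,95)],[(0,0,14),(6,23,69)])
  else ([-1,0,0,0,0,0,0,-1,2],(6,[7,8,10,11,13,14,17,20,23,26]),[(8,29,72),(8,6,96)],[(0,0,15),(7,26,70)]))))
  else (if j < 76 then (if j < 74 then (if j < 73 then ([0,0,0,0,0,0,0,0,0],(6,[7,8,10,11,13,14,17,20,23,26,29]),[(0,30,73),(8,6,97)],[(0,0,16),(8,29,71)])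
  else ([-2,0,0,0,0,0,0,0,1],(-24,[-23,-22,-20,-19,-17,-16,-13,-10,-7,-4,-1,0]),[(8,-24,98)],[(0,-30,17),(0,0,72)]))
  else (if j < 75 then ([-1,0,1,-1,0,0,0,0,1],(6,[7,8,10,11,14]),[(2,13,67),(8,6,99)],[(0,0,18),(3,14,65)])
  else ([-1,1,1,0,-1,0,0,0,1],(6,[7,8,11]),[(1,10,65),(2,13,76),(8,6,100)],[(0,0,19),(4,11,63)])))
  else (if j < 78 then (if j < 77 then ([-1,1,-1,0,0,0,0,0,1],(6,[7,8,11,13]),[(1,10,66),(8,6,101)],[(0,0,20),(2,13,75)])
  else ([-1,-1,0,0,0,1,-1,0,1],(6,[7,10]),[(5,8,64),(8,6,87)],[(0,0,21),(1,10,62),(6,5,60)]))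
  else (if j < 79 then ([-1,0,0,1,0,-1,0,0,1],(6,[8]),[(3,7,63),(8,6,80)],[(0,0,22),(5,8,61)])
  else ([0,0,0,1,-1,1,-1,1,-1],(7,[]),[(3,7,84),(5,8,80),(7,9,83)],[(4,4,52),(6,5,56),(8,6,61)])))))"

definition tab8_5 :: "nat \<Rightarrow> entry" where "tab8_5 j =
  (if j < 88 then (if j < 84 then (if j < 82 then (if j < 81 then ([0,0,0,1,0,-1,0,1,-1],(7,[8]),[(3,7,88),(7,9,81)],[(5,8,79),(8,6,78)])
  else ([0,0,0,1,0,-1,1,-1,0],(7,[8,9]),[(3,7,102),(6,12,82)],[(5,8,83),(7,9,80)]))
  else (if j < 83 then ([0,0,0,1,0,0,-1,0,0],(7,[8,9,12]),[(3,7,112)],[(6,12,81)])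
  else ([0,0,0,1,-1,1,0,-1,0],(7,[9]),[(3,7,85),(5,8,81)],[(4,4,53),(7,9,79)])))
  else (if j < 86 then (if j < 85 then ([0,1,0,-1,0,1,-1,1,-1],(8,[]),[(1,10,87),(5,8,88),(7,9,85)],[(3,7,79),(6,5,57),(8,6,62)])
  else ([0,1,0,-1,0,1,0,-1,0],(8,[9]),[(1,10,86),(5,8,102)],[(3,7,83),(7,9,84)]))
  else (if j < 87 then ([0,-1,0,0,0,1,0,-1,0],(8,[9,10]),[(5,8,113)],[(1,10,85),(7,9,87)])
  else ([0,-1,0,0,0,1,-1,1,-1],(8,[10]),[(5,8,89),(7,9,86)],[(1,10,84),(6,5,58),(8,6,77)]))))
  else (if j < 92 then (if j < 90 then (if j < 89 then ([0,1,0,-1,1,-1,0,1,-1],(9,[]),[(1,10,89),(4,11,100),(7,9,102)],[(3,7,80),(5,8,84),(8,6,63)])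
  else ([0,-1,0,0,1,-1,0,1,-1],(9,[10]),[(4,11,90),(7,9,113)],[(1,10,88),(5,8,87),(8,6,64)]))
  else (if j < 91 then ([0,-1,1,1,-1,0,0,1,-1],(9,[10,11]),[(2,13,91),(3,14,99),(7,9,115)],[(1,10,100),(4,11,89),(8,6,65)])
  else ([0,-1,-1,1,0,0,0,1,-1],(9,[10,11,13]),[(3,14,92),(7,9,116)],[(1,10,101),(2,13,90),(8,6,66)])))
  else (if j < 94 then (if j < 93 then ([0,0,-1,-1,1,0,0,1,-1],(9,[10,11,13,14]),[(4,17,93),(7,9,117)],[(2,13,99),(3,14,91),(8,6,67)])
  else ([0,0,0,0,-1,1,0,1,-1],(9,[10,11,13,14,17]),[(5,20,94),(7,9,118)],[(4,17,92),(8,6,68)]))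
  else (if j < 95 then ([0,0,0,0,0,-1,1,1,-1],(9,[10,11,13,14,17,20]),[(6,23,95),(7,9,119)],[(5,20,93),(8,6,69)])
  else ([0,0,0,0,0,0,-1,2,-1],(9,[10,11,13,14,17,20,23]),[(7,26,96),(7,9,120)],[(6,23,94),(8,6,70)])))))"

definition tab8_6 :: "nat \<Rightarrow> entry" where "tab8_6 j =
  (if j < 104 then (if j < 100 then (if j < 98 then (if j < 97 then ([0,0,0,0,0,0,0,0,0],(9,[10,11,13,14,17,20,23,26]),[(7,9,121),(8,29,97)],[(7,26,95),(8,6,71)])
  else ([1,0,0,0,0,0,0,1,-2],(9,[10,11,13,14,17,20,23,26,29]),[(0,30,98),(7,9,122)],[(8,6,72),(8,29,96)]))
  else (if j < 99 then ([-1,0,0,0,0,0,0,1,-1],(-21,[-20,-19,-17,-16,-13,-10,-7,-4,-1,0]),[(7,-21,123)],[(0,0,97),(8,-24,73)])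
  else ([0,0,1,-1,0,0,0,1,-1],(9,[10,11,14]),[(2,13,92),(7,9,124)],[(3,14,90),(8,6,74)])))
  else (if j < 102 then (if j < 101 then ([0,1,1,0,-1,0,0,1,-1],(9,[11]),[(1,10,90),(2,13,101),(7,9,103)],[(4,11,88),(8,6,75)])
  else ([0,1,-1,0,0,0,0,1,-1],(9,[11,13]),[(1,10,91),(7,9,111)],[(2,13,100),(8,6,76)]))
  else (if j < 103 then ([0,1,0,-1,1,-1,1,-1,0],(10,[]),[(1,10,113),(4,11,103),(6,12,112)],[(3,7,81),(5,8,85),(7,9,88)])
  else ([0,1,1,0,-1,0,1,-1,0],(10,[11]),[(1,10,115),(2,13,111),(6,12,104)],[(4,11,102),(7,9,100)]))))
  else (if j < 108 then (if j < 106 then (if j < 105 then ([0,1,1,0,-1,1,-1,0,0],(10,[11,12]),[(1,10,125),(2,13,105),(5,15,110)],[(4,11,112),(6,12,103)])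
  else ([0,1,-1,0,0,1,-1,0,0],(10,[11,12,13]),[(1,10,130),(5,15,106)],[(2,13,104),(6,12,111)]))
  else (if j < 107 then ([0,1,-1,0,1,-1,0,0,0],(10,[11,12,13,15]),[(1,10,131),(4,16,107)],[(2,13,110),(5,15,105)])
  else ([0,1,0,1,-1,0,0,0,0],(10,[11,12,13,15,16]),[(1,10,132),(3,19,108)],[(4,16,106)])))
  else (if j < 110 then (if j < 109 then ([0,2,0,-1,0,0,0,0,0],(10,[11,12,13,15,16,19]),[(1,21,109),(1,10,133)],[(3,19,107)])
  else ([0,0,0,0,0,0,0,0,0],(10,[11,12,13,15,16,19,21]),[(1,10,134)],[(1,21,108)]))
  else (if j < 111 then ([0,1,1,0,0,-1,0,0,0],(10,[11,12,15]),[(1,10,129),(2,13,106)],[(5,15,104)])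
  else ([0,1,-1,0,0,0,1,-1,0],(10,[11,13]),[(1,10,116),(6,12,105)],[(2,13,103),(7,9,101)])))))"

definition tab8_7 :: "nat \<Rightarrow> entry" where "tab8_7 j =
  (if j < 120 then (if j < 116 then (if j < 114 then (if j < 113 then ([0,1,0,-1,1,0,-1,0,0],(10,[12]),[(1,10,114),(4,11,104)],[(3,7,82),(6,12,102)])
  else ([0,-1,0,0,1,-1,1,-1,0],(11,[]),[(4,11,115),(6,12,114)],[(1,10,102),(5,8,86),(7,9,89)]))
  else (if j < 115 then ([0,-1,0,0,1,0,-1,0,0],(11,[12]),[(4,11,125)],[(1,10,112),(6,12,113)])
  else ([0,-1,1,1,-1,0,1,-1,0],(12,[]),[(2,13,116),(3,14,124),(6,12,125)],[(1,10,103),(4,11,113),(7,9,90)])))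
  else (if j < 118 then (if j < 117 then ([0,-1,-1,1,0,0,1,-1,0],(12,[13]),[(3,14,117),(6,12,130)],[(1,10,111),(2,13,115),(7,9,91)])
  else ([0,0,-1,-1,1,0,1,-1,0],(12,[13,14]),[(4,17,118),(6,12,135)],[(2,13,124),(3,14,116),(7,9,92)]))
  else (if j < 119 then ([0,0,0,0,-1,1,1,-1,0],(12,[13,14,17]),[(5,20,119),(6,12,136)],[(4,17,117),(7,9,93)])
  else ([0,0,0,0,0,-1,2,-1,0],(12,[13,14,17,20]),[(6,23,120),(6,12,137)],[(5,20,118),(7,9,94)]))))
  else (if j < 124 then (if j < 122 then (if j < 121 then ([0,0,0,0,0,0,0,0,0],(12,[13,14,17,20,23]),[(6,12,138),(7,26,121)],[(6,23,119),(7,9,95)])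
  else ([0,0,0,0,0,0,1,-2,1],(12,[13,14,17,20,23,26]),[(6,12,139),(8,29,122)],[(7,9,96),(7,26,120)]))
  else (if j < 123 then ([1,0,0,0,0,0,1,-1,-1],(12,[13,14,17,20,23,26,29]),[(0,30,123),(6,12,140)],[(7,9,97),(8,29,121)])
  else ([-1,0,0,0,0,0,1,-1,0],(-18,[-17,-16,-13,-10,-7,-4,-1,0]),[(6,-18,141)],[(0,0,122),(7,-21,98)])))
  else (if j < 126 then (if j < 125 then ([0,0,1,-1,0,0,1,-1,0],(12,[14]),[(2,13,117),(6,12,126)],[(3,14,115),(7,9,99)])
  else ([0,-1,1,1,-1,1,-1,0,0],(13,[]),[(2,13,130),(3,14,126),(5,15,129)],[(1,10,104),(4,11,114),(6,12,115)]))
  else (if j < 127 then ([0,0,1,-1,0,1,-1,0,0],(13,[14]),[(2,13,135),(5,15,127)],[(3,14,125),(6,12,124)])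
  else ([0,0,1,-1,1,-1,0,0,0],(13,[14,15]),[(2,13,142),(4,17,128)],[(3,14,129),(5,15,126)])))))"

definition tab8_8 :: "nat \<Rightarrow> entry" where "tab8_8 j =
  (if j < 136 then (if j < 132 then (if j < 130 then (if j < 129 then ([0,0,2,0,-1,0,0,0,0],(13,[14,15,17]),[(2,13,143)],[(4,17,127)])
  else ([0,-1,1,1,0,-1,0,0,0],(13,[15]),[(2,13,131),(3,14,127)],[(1,10,110),(5,15,125)]))
  else (if j < 131 then ([0,-1,-1,1,0,1,-1,0,0],(14,[]),[(3,14,135),(5,15,131)],[(1,10,105),(2,13,125),(6,12,116)])
  else ([0,-1,-1,1,1,-1,0,0,0],(14,[15]),[(3,14,142),(4,16,132)],[(1,10,106),(2,13,129),(5,15,130)])))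
  else (if j < 134 then (if j < 133 then ([0,-1,0,2,-1,0,0,0,0],(14,[15,16]),[(3,19,133),(3,14,150)],[(1,10,107),(4,16,131)])
  else ([0,0,0,0,0,0,0,0,0],(14,[15,16,19]),[(1,21,134),(3,14,151)],[(1,10,108),(3,19,132)]))
  else (if j < 135 then ([0,-2,0,1,0,0,0,0,0],(14,[15,16,19,21]),[(3,14,152)],[(1,10,109),(1,21,133)])
  else ([0,0,-1,-1,1,1,-1,0,0],(15,[]),[(4,17,136),(5,15,142)],[(2,13,126),(3,14,130),(6,12,117)]))))
  else (if j < 140 then (if j < 138 then (if j < 137 then ([0,0,0,0,-1,2,-1,0,0],(15,[17]),[(5,20,137),(5,15,143)],[(4,17,135),(6,12,118)])
  else ([0,0,0,0,0,0,0,0,0],(15,[17,20]),[(5,15,145),(6,23,138)],[(5,20,136),(6,12,119)]))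
  else (if j < 139 then ([0,0,0,0,0,1,-2,1,0],(15,[17,20,23]),[(5,15,146),(7,26,139)],[(6,12,120),(6,23,137)])
  else ([0,0,0,0,0,1,-1,-1,1],(15,[17,20,23,26]),[(5,15,147),(8,29,140)],[(6,12,121),(7,26,138)])))
  else (if j < 142 then (if j < 141 then ([1,0,0,0,0,1,-1,0,-1],(15,[17,20,23,26,29]),[(0,30,141),(5,15,148)],[(6,12,122),(8,29,139)])
  else ([-1,0,0,0,0,1,-1,0,0],(-15,[-13,-10,-7,-4,-1,0]),[(5,-15,149)],[(0,0,140),(6,-18,123)]))
  else (if j < 143 then ([0,0,-1,-1,2,-1,0,0,0],(16,[]),[(4,16,150),(4,17,143)],[(2,13,127),(3,14,131),(5,15,135)])
  else ([0,0,0,0,0,0,0,0,0],(16,[17]),[(2,18,144),(4,16,153),(5,20,145)],[(2,13,128),(4,17,142),(5,15,136)])))))"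

definition tab8_9 :: "nat \<Rightarrow> entry" where "tab8_9 j =
  (if j < 152 then (if j < 148 then (if j < 146 then (if j < 145 then ([0,0,-2,0,1,0,0,0,0],(16,[17,18]),[(4,16,171)],[(2,18,143)])
  else ([0,0,0,0,1,-2,1,0,0],(16,[17,20]),[(4,16,166),(6,23,146)],[(5,15,137),(5,20,143)]))
  else (if j < 147 then ([0,0,0,0,1,-1,-1,1,0],(16,[17,20,23]),[(4,16,167),(7,26,147)],[(5,15,138),(6,23,145)])
  else ([0,0,0,0,1,-1,0,-1,1],(16,[17,20,23,26]),[(4,16,168),(8,29,148)],[(5,15,139),(7,26,146)])))
  else (if j < 150 then (if j < 149 then ([1,0,0,0,1,-1,0,0,-1],(16,[17,20,23,26,29]),[(0,30,149),(4,16,169)],[(5,15,140),(8,29,147)])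
  else ([-1,0,0,0,1,-1,0,0,0],(-14,[-13,-10,-7,-4,-1,0]),[(4,-14,170)],[(0,0,148),(5,-15,141)]))
  else (if j < 151 then ([0,0,0,0,0,0,0,0,0],(17,[]),[(3,19,151),(4,17,153)],[(3,14,132),(4,16,142)])
  else ([0,1,0,-2,1,0,0,0,0],(17,[19]),[(1,21,152),(4,17,154)],[(3,14,133),(3,19,150)]))))
  else (if j < 156 then (if j < 154 then (if j < 153 then ([0,-1,0,-1,1,0,0,0,0],(17,[19,21]),[(4,17,165)],[(1,21,151),(3,14,134)])
  else ([0,0,1,1,-2,1,0,0,0],(18,[]),[(2,18,171),(3,19,154),(5,20,166)],[(4,17,150),(4,16,143)]))
  else (if j < 155 then ([0,1,1,-1,-1,1,0,0,0],(18,[19]),[(1,21,165),(2,18,177),(5,20,155)],[(3,19,153),(4,17,151)])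
  else ([0,1,1,-1,0,-1,1,0,0],(18,[19,20]),[(1,21,156),(2,18,179),(6,23,161)],[(3,19,166),(5,20,154)])))
  else (if j < 158 then (if j < 157 then ([0,-1,1,0,0,-1,1,0,0],(18,[19,20,21]),[(2,18,199),(6,23,157)],[(1,21,155),(5,20,165)])
  else ([0,-1,1,0,0,0,-1,1,0],(18,[19,20,21,23]),[(2,18,200),(7,26,158)],[(1,21,161),(6,23,156)]))
  else (if j < 159 then ([0,-1,1,0,0,0,0,-1,1],(18,[19,20,21,23,26]),[(2,18,201),(8,29,159)],[(1,21,162),(7,26,157)])
  else ([1,-1,1,0,0,0,0,0,-1],(18,[19,20,21,23,26,29]),[(0,30,160),(2,18,202)],[(1,21,163),(8,29,158)])))))"

definition tab8_10 :: "nat \<Rightarrow> entry" where "tab8_10 j =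
  (if j < 168 then (if j < 164 then (if j < 162 then (if j < 161 then ([-1,-1,1,0,0,0,0,0,0],(-12,[-11,-10,-9,-7,-4,-1,0]),[(2,-12,203)],[(0,0,159),(1,-9,164)])
  else ([0,1,1,-1,0,0,-1,1,0],(18,[19,20,23]),[(1,21,157),(2,18,195),(7,26,162)],[(3,19,167),(6,23,155)]))
  else (if j < 163 then ([0,1,1,-1,0,0,0,-1,1],(18,[19,20,23,26]),[(1,21,158),(2,18,196),(8,29,163)],[(3,19,168),(7,26,161)])
  else ([1,1,1,-1,0,0,0,0,-1],(18,[19,20,23,26,29]),[(0,30,164),(1,21,159),(2,18,197)],[(3,19,169),(8,29,162)])))
  else (if j < 166 then (if j < 165 then ([-1,1,1,-1,0,0,0,0,0],(-12,[-11,-10,-7,-4,-1,0]),[(1,-9,160),(2,-12,198)],[(0,0,163),(3,-11,170)])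
  else ([0,-1,1,0,-1,1,0,0,0],(18,[19,21]),[(2,18,178),(5,20,156)],[(1,21,154),(4,17,152)]))
  else (if j < 167 then ([0,0,1,1,-1,-1,1,0,0],(18,[20]),[(2,18,172),(3,19,155),(6,23,167)],[(4,16,145),(5,20,153)])
  else ([0,0,1,1,-1,0,-1,1,0],(18,[20,23]),[(2,18,173),(3,19,161),(7,26,168)],[(4,16,146),(6,23,166)]))))
  else (if j < 172 then (if j < 170 then (if j < 169 then ([0,0,1,1,-1,0,0,-1,1],(18,[20,23,26]),[(2,18,174),(3,19,162),(8,29,169)],[(4,16,147),(7,26,167)])
  else ([1,0,1,1,-1,0,0,0,-1],(18,[20,23,26,29]),[(0,30,170),(2,18,175),(3,19,163)],[(4,16,148),(8,29,168)]))
  else (if j < 171 then ([-1,0,1,1,-1,0,0,0,0],(-12,[-10,-7,-4,-1,0]),[(2,-12,176),(3,-11,164)],[(0,0,169),(4,-14,149)])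
  else ([0,0,-1,1,-1,1,0,0,0],(19,[]),[(3,19,177),(5,20,172)],[(2,18,153),(4,16,144)])))
  else (if j < 174 then (if j < 173 then ([0,0,-1,1,0,-1,1,0,0],(19,[20]),[(3,19,179),(6,23,173)],[(2,18,166),(5,20,171)])
  else ([0,0,-1,1,0,0,-1,1,0],(19,[20,23]),[(3,19,195),(7,26,174)],[(2,18,167),(6,23,172)]))
  else (if j < 175 then ([0,0,-1,1,0,0,0,-1,1],(19,[20,23,26]),[(3,19,196),(8,29,175)],[(2,18,168),(7,26,173)])
  else ([1,0,-1,1,0,0,0,0,-1],(19,[20,23,26,29]),[(0,30,176),(3,19,197)],[(2,18,169),(8,29,174)])))))"

definition tab8_11 :: "nat \<Rightarrow> entry" where "tab8_11 j =
  (if j < 184 then (if j < 180 then (if j < 178 then (if j < 177 then ([-1,0,-1,1,0,0,0,0,0],(-11,[-10,-7,-4,-1,0]),[(3,-11,198)],[(0,0,175),(2,-12,170)])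
  else ([0,1,-1,-1,0,1,0,0,0],(20,[]),[(1,21,178),(5,20,179)],[(2,18,154),(3,19,171)]))
  else (if j < 179 then ([0,-1,-1,0,0,1,0,0,0],(20,[21]),[(5,20,199)],[(1,21,177),(2,18,165)])
  else ([0,1,-1,-1,1,-1,1,0,0],(21,[]),[(1,21,199),(4,22,180),(6,23,195)],[(2,18,155),(3,19,172),(5,20,177)])))
  else (if j < 182 then (if j < 181 then ([0,1,0,0,-1,0,1,0,0],(21,[22]),[(1,21,204),(6,23,181)],[(4,22,179)])
  else ([0,1,0,0,-1,1,-1,1,0],(21,[22,23]),[(1,21,206),(5,25,182),(7,26,192)],[(4,22,195),(6,23,180)]))
  else (if j < 183 then ([0,1,0,0,0,-1,0,1,0],(21,[22,23,25]),[(1,21,207),(7,26,183)],[(5,25,181)])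
  else ([0,1,0,0,0,-1,1,-1,1],(21,[22,23,25,26]),[(1,21,208),(6,28,184),(8,29,190)],[(5,25,192),(7,26,182)]))))
  else (if j < 188 then (if j < 186 then (if j < 185 then ([0,1,0,0,0,0,-1,0,1],(21,[22,23,25,26,28]),[(1,21,209),(8,29,185)],[(6,28,183)])
  else ([1,1,0,0,0,0,-1,1,-1],(21,[22,23,25,26,28,29]),[(0,30,186),(1,21,210),(7,33,189)],[(6,28,190),(8,29,184)]))
  else (if j < 187 then ([-1,1,0,0,0,0,-1,1,0],(-9,[-8,-7,-5,-4,-2,-1,0]),[(1,-9,211),(7,3,187)],[(0,0,185),(6,-2,191)])
  else ([-1,1,0,0,0,0,0,-1,1],(-9,[-8,-7,-5,-4,-2,-1,0,3]),[(1,-9,212),(8,6,188)],[(0,0,189),(7,3,186)])))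
  else (if j < 190 then (if j < 189 then ([0,1,0,0,0,0,0,0,-1],(-9,[-8,-7,-5,-4,-2,-1,0,3,6]),[(1,-9,213)],[(8,6,187)])
  else ([1,1,0,0,0,0,0,-1,0],(21,[22,23,25,26,28,29,33]),[(0,30,187),(1,21,214)],[(7,33,185)]))
  else (if j < 191 then ([1,1,0,0,0,-1,1,0,-1],(21,[22,23,25,26,29]),[(0,30,191),(1,21,215),(6,28,185)],[(5,25,193),(8,29,183)])
  else ([-1,1,0,0,0,-1,1,0,0],(-9,[-8,-7,-5,-4,-1,0]),[(1,-9,216),(6,-2,186)],[(0,0,190),(5,-5,194)])))))"

definition tab8_12 :: "nat \<Rightarrow> entry" where "tab8_12 j =
  (if j < 200 then (if j < 196 then (if j < 194 then (if j < 193 then ([0,1,0,0,-1,1,0,-1,1],(21,[22,23,26]),[(1,21,217),(5,25,183),(8,29,193)],[(4,22,196),(7,26,181)])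
  else ([1,1,0,0,-1,1,0,0,-1],(21,[22,23,26,29]),[(0,30,194),(1,21,218),(5,25,190)],[(4,22,197),(8,29,192)]))
  else (if j < 195 then ([-1,1,0,0,-1,1,0,0,0],(-9,[-8,-7,-4,-1,0]),[(1,-9,219),(5,-5,191)],[(0,0,193),(4,-8,198)])
  else ([0,1,-1,-1,1,0,-1,1,0],(21,[23]),[(1,21,200),(4,22,181),(7,26,196)],[(2,18,161),(3,19,173),(6,23,179)])))
  else (if j < 198 then (if j < 197 then ([0,1,-1,-1,1,0,0,-1,1],(21,[23,26]),[(1,21,201),(4,22,192),(8,29,197)],[(2,18,162),(3,19,174),(7,26,195)])
  else ([1,1,-1,-1,1,0,0,0,-1],(21,[23,26,29]),[(0,30,198),(1,21,202),(4,22,193)],[(2,18,163),(3,19,175),(8,29,196)]))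
  else (if j < 199 then ([-1,1,-1,-1,1,0,0,0,0],(-9,[-7,-4,-1,0]),[(1,-9,203),(4,-8,194)],[(0,0,197),(2,-12,164),(3,-11,176)])
  else ([0,-1,-1,0,1,-1,1,0,0],(22,[]),[(4,22,204),(6,23,200)],[(1,21,179),(2,18,156),(5,20,178)]))))
  else (if j < 204 then (if j < 202 then (if j < 201 then ([0,-1,-1,0,1,0,-1,1,0],(22,[23]),[(4,22,206),(7,26,201)],[(1,21,195),(2,18,157),(6,23,199)])
  else ([0,-1,-1,0,1,0,0,-1,1],(22,[23,26]),[(4,22,217),(8,29,202)],[(1,21,196),(2,18,158),(7,26,200)]))
  else (if j < 203 then ([1,-1,-1,0,1,0,0,0,-1],(22,[23,26,29]),[(0,30,203),(4,22,218)],[(1,21,197),(2,18,159),(8,29,201)])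
  else ([-1,-1,-1,0,1,0,0,0,0],(-8,[-7,-4,-1,0]),[(4,-8,219)],[(0,0,202),(1,-9,198),(2,-12,160)])))
  else (if j < 206 then (if j < 205 then ([0,-1,0,1,-1,0,1,0,0],(23,[]),[(3,24,205),(6,23,206)],[(1,21,180),(4,22,199)])
  else ([0,0,0,-1,0,0,1,0,0],(23,[24]),[(6,23,220)],[(3,24,204)]))
  else (if j < 207 then ([0,-1,0,1,-1,1,-1,1,0],(24,[]),[(3,24,220),(5,25,207),(7,26,217)],[(1,21,181),(4,22,200),(6,23,204)])
  else ([0,-1,0,1,0,-1,0,1,0],(24,[25]),[(3,24,224),(7,26,208)],[(1,21,182),(5,25,206)])))))"

definition tab8_13 :: "nat \<Rightarrow> entry" where "tab8_13 j =
  (if j < 216 then (if j < 212 then (if j < 210 then (if j < 209 then ([0,-1,0,1,0,-1,1,-1,1],(24,[25,26]),[(3,24,227),(6,28,209),(8,29,215)],[(1,21,183),(5,25,217),(7,26,207)])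
  else ([0,-1,0,1,0,0,-1,0,1],(24,[25,26,28]),[(3,24,228),(8,29,210)],[(1,21,184),(6,28,208)]))
  else (if j < 211 then ([1,-1,0,1,0,0,-1,1,-1],(24,[25,26,28,29]),[(0,30,211),(3,24,229),(7,33,214)],[(1,21,185),(6,28,215),(8,29,209)])
  else ([-1,-1,0,1,0,0,-1,1,0],(-6,[-5,-4,-2,-1,0]),[(3,-6,230),(7,3,212)],[(0,0,210),(1,-9,186),(6,-2,216)])))
  else (if j < 214 then (if j < 213 then ([-1,-1,0,1,0,0,0,-1,1],(-6,[-5,-4,-2,-1,0,3]),[(3,-6,231),(8,6,213)],[(0,0,214),(1,-9,187),(7,3,211)])
  else ([0,-1,0,1,0,0,0,0,-1],(-6,[-5,-4,-2,-1,0,3,6]),[(3,-6,232)],[(1,-9,188),(8,6,212)]))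
  else (if j < 215 then ([1,-1,0,1,0,0,0,-1,0],(24,[25,26,28,29,33]),[(0,30,212),(3,24,233)],[(1,21,189),(7,33,210)])
  else ([1,-1,0,1,0,-1,1,0,-1],(24,[25,26,29]),[(0,30,216),(3,24,234),(6,28,210)],[(1,21,190),(5,25,218),(8,29,208)]))))
  else (if j < 220 then (if j < 218 then (if j < 217 then ([-1,-1,0,1,0,-1,1,0,0],(-6,[-5,-4,-1,0]),[(3,-6,235),(6,-2,211)],[(0,0,215),(1,-9,191),(5,-5,219)])
  else ([0,-1,0,1,-1,1,0,-1,1],(24,[26]),[(3,24,221),(5,25,208),(8,29,218)],[(1,21,192),(4,22,201),(7,26,206)]))
  else (if j < 219 then ([1,-1,0,1,-1,1,0,0,-1],(24,[26,29]),[(0,30,219),(3,24,222),(5,25,215)],[(1,21,193),(4,22,202),(8,29,217)])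
  else ([-1,-1,0,1,-1,1,0,0,0],(-6,[-4,-1,0]),[(3,-6,223),(5,-5,216)],[(0,0,218),(1,-9,194),(4,-8,203)])))
  else (if j < 222 then (if j < 221 then ([0,0,0,-1,0,1,-1,1,0],(25,[]),[(5,25,224),(7,26,221)],[(3,24,206),(6,23,205)])
  else ([0,0,0,-1,0,1,0,-1,1],(25,[26]),[(5,25,227),(8,29,222)],[(3,24,217),(7,26,220)]))
  else (if j < 223 then ([1,0,0,-1,0,1,0,0,-1],(25,[26,29]),[(0,30,223),(5,25,234)],[(3,24,218),(8,29,221)])
  else ([-1,0,0,-1,0,1,0,0,0],(-5,[-4,-1,0]),[(5,-5,235)],[(0,0,222),(3,-6,219)])))))"

definition tab8_14 :: "nat \<Rightarrow> entry" where "tab8_14 j =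
  (if j < 232 then (if j < 228 then (if j < 226 then (if j < 225 then ([0,0,0,-1,1,-1,0,1,0],(26,[]),[(4,27,225),(7,26,227)],[(3,24,207),(5,25,220)])
  else ([0,0,1,0,-1,0,0,1,0],(26,[27]),[(2,31,226),(7,26,236)],[(4,27,224)]))
  else (if j < 227 then ([0,0,-1,0,0,0,0,1,0],(26,[27,31]),[(7,26,241)],[(2,31,225)])
  else ([0,0,0,-1,1,-1,1,-1,1],(27,[]),[(4,27,236),(6,28,228),(8,29,234)],[(3,24,208),(5,25,221),(7,26,224)])))
  else (if j < 230 then (if j < 229 then ([0,0,0,-1,1,0,-1,0,1],(27,[28]),[(4,27,242),(8,29,229)],[(3,24,209),(6,28,227)])
  else ([1,0,0,-1,1,0,-1,1,-1],(27,[28,29]),[(0,30,230),(4,27,0),(7,33,233)],[(3,24,210),(6,28,234),(8,29,228)]))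
  else (if j < 231 then ([-1,0,0,-1,1,0,-1,1,0],(-3,[-2,-1,0]),[(4,-3,34),(7,3,231)],[(0,0,229),(3,-6,211),(6,-2,235)])
  else ([-1,0,0,-1,1,0,0,-1,1],(-3,[-2,-1,0,3]),[(4,-3,41),(8,6,232)],[(0,0,233),(3,-6,212),(7,3,230)]))))
  else (if j < 236 then (if j < 234 then (if j < 233 then ([0,0,0,-1,1,0,0,0,-1],(-3,[-2,-1,0,3,6]),[(4,-3,42)],[(3,-6,213),(8,6,231)])
  else ([1,0,0,-1,1,0,0,-1,0],(27,[28,29,33]),[(0,30,231),(4,27,33)],[(3,24,214),(7,33,229)]))
  else (if j < 235 then ([1,0,0,-1,1,-1,1,0,-1],(27,[29]),[(0,30,235),(4,27,237),(6,28,229)],[(3,24,215),(5,25,222),(8,29,227)])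
  else ([-1,0,0,-1,1,-1,1,0,0],(-3,[-1,0]),[(4,-3,238),(6,-2,230)],[(0,0,234),(3,-6,216),(5,-5,223)])))
  else (if j < 238 then (if j < 237 then ([0,0,1,0,-1,0,1,-1,1],(28,[]),[(2,31,241),(6,28,242),(8,29,237)],[(4,27,227),(7,26,225)])
  else ([1,0,1,0,-1,0,1,0,-1],(28,[29]),[(0,30,238),(2,31,240),(6,28,0)],[(4,27,234),(8,29,236)]))
  else (if j < 239 then ([-1,0,1,0,-1,0,1,0,0],(-2,[-1,0]),[(2,1,239),(6,-2,34)],[(0,0,237),(4,-3,235)])
  else ([-1,0,-1,0,0,0,1,0,0],(-2,[-1,0,1]),[(6,-2,43)],[(0,0,240),(2,1,238)])))))"

definition tab8_15 :: "nat \<Rightarrow> entry" where "tab8_15 j =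
  (if j < 244 then (if j < 242 then (if j < 241 then ([1,0,-1,0,0,0,1,0,-1],(28,[29,31]),[(0,30,239),(6,28,1)],[(2,31,237),(8,29,241)])
  else ([0,0,-1,0,0,0,1,-1,1],(28,[31]),[(6,28,243),(8,29,240)],[(2,31,236),(7,26,226)]))
  else (if j < 243 then ([0,0,1,0,-1,1,-1,0,1],(29,[]),[(2,31,243),(5,32,248),(8,29,0)],[(4,27,228),(6,28,236)])
  else ([0,0,-1,0,0,1,-1,0,1],(29,[31]),[(5,32,244),(8,29,1)],[(2,31,242),(6,28,241)])))
  else (if j < 246 then (if j < 245 then ([0,0,-1,0,1,-1,0,0,1],(29,[31,32]),[(4,34,245),(8,29,2)],[(2,31,248),(5,32,243)])
  else ([0,0,0,1,-1,0,0,0,1],(29,[31,32,34]),[(3,37,246),(8,29,26)],[(4,34,244)]))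
  else (if j < 247 then ([0,1,0,-1,0,0,0,0,1],(29,[31,32,34,37]),[(1,40,247),(8,29,27)],[(3,37,245)])
  else (if j < 248 then ([0,-1,0,0,0,0,0,0,1],(29,[31,32,34,37,40]),[(8,29,28)],[(1,40,246)])
  else ([0,0,1,0,0,-1,0,0,1],(29,[32]),[(2,31,244),(8,29,30)],[(5,32,242)])))))"

definition tab8 :: "nat \<Rightarrow> entry" where "tab8 j =
  (if j < 128 then (if j < 64 then (if j < 32 then (if j < 16 then tab8_0 j else tab8_1 j) else (if j < 48 then tab8_2 j else tab8_3 j)) else (if j < 96 then (if j < 80 then tab8_4 j else tab8_5 j) else (if j < 112 then tab8_6 j else tab8_7 j))) else (if j < 192 then (if j < 160 then (if j < 144 then tab8_8 j else tab8_9 j) else (if j < 176 then tab8_10 j else tab8_11 j)) else (if j < 224 then (if j < 208 then tab8_12 j else tab8_13 j) else (if j < 240 then tab8_14 j else tab8_15 j))))"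

fun ent :: "affine_type \<Rightarrow> nat \<Rightarrow> entry" where
  "ent E6 j = tab6 j" | "ent E7 j = tab7 j" | "ent E8 j = tab8 j"

fun ncls :: "affine_type \<Rightarrow> nat" where
  "ncls E6 = 27" | "ncls E7 = 56" | "ncls E8 = 249"

section \<open>The finite checks that certify the table\<close>

type_synonym cdata = "int \<times> int list"

fun mem :: "int \<Rightarrow> cdata \<Rightarrow> bool" where
  "mem n (a, xs) \<longleftrightarrow> n < a \<or> List.member xs n"

text \<open>Moves listed blocks that directly follow the initial segment into it. A column then has
  only one representation, and equality of columns becomes equality of data.\<close>

fun adv :: "int \<Rightarrow> int list \<Rightarrow> cdata" where
  "adv a [] = (a, [])"
| "adv a (x # xs) = (if x = a then adv (a + 1) xs else (a, x # xs))"

fun insn :: "int \<Rightarrow> int list \<Rightarrow> int list" where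
  "insn n [] = [n]"
| "insn n (x # xs) = (if n < x then n # x # xs else x # insn n xs)"

fun cins :: "int \<Rightarrow> cdata \<Rightarrow> cdata" where
  "cins n (a, xs) = (if n = a then adv (a + 1) xs else (a, insn n xs))"

fun csh :: "int \<Rightarrow> cdata \<Rightarrow> cdata" where
  "csh d (a, xs) = (a + d, map (\<lambda>x. x + d) xs)"

fun lastd :: "int \<Rightarrow> int list \<Rightarrow> int" where
  "lastd a [] = a" | "lastd a (x # xs) = lastd x xs"

fun asc :: "int \<Rightarrow> int list \<Rightarrow> bool" where
  "asc a [] = True" | "asc a (x # xs) \<longleftrightarrow> a < x \<and> asc x xs"

fun lexless :: "int list \<Rightarrow> int list \<Rightarrow> bool" where
  "lexless [] [] = False" | "lexless [] (y # ys) = True" | "lexless (x # xs) [] = False"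
| "lexless (x # xs) (y # ys) \<longleftrightarrow> x < y \<or> (x = y \<and> lexless xs ys)"

definition wlist :: "affine_type \<Rightarrow> nat \<Rightarrow> int list" where
  "wlist T j = fst (ent T j)"
definition rep :: "affine_type \<Rightarrow> nat \<Rightarrow> cdata" where
  "rep T j = fst (snd (ent T j))"
definition outs :: "affine_type \<Rightarrow> nat \<Rightarrow> (nat \<times> int \<times> nat) list" where
  "outs T j = fst (snd (snd (ent T j)))"
definition inns :: "affine_type \<Rightarrow> nat \<Rightarrow> (nat \<times> int \<times> nat) list" where
  "inns T j = snd (snd (snd (ent T j)))"

text \<open>Entries 128 and 144 are the classes S1 and S2, the only columns with a block that is not
  fully supported.\<close>

definition special :: "affine_type \<Rightarrow> nat \<Rightarrow> bool" where
  "special T j \<longleftrightarrow> T = E8 \<and> (j = 128 \<or> j = 144)"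

text \<open>The representatives are chosen so that only arrows of colour 0 lead to a neighbouring
  period; the exponent of \<open>z\<close> will change at the same places.\<close>

definition sup0 :: "affine_type \<Rightarrow> nat \<Rightarrow> int" where
  "sup0 T i = (if i = 0 then nblk T else 0)"

definition key :: "affine_type \<Rightarrow> cdata \<Rightarrow> int list" where
  "key T c = (case c of (a, xs) \<Rightarrow> a mod nblk T # map (\<lambda>x. x - a) xs)"

definition supported :: "affine_type \<Rightarrow> int \<Rightarrow> cdata \<Rightarrow> bool" where
  "supported T n c = list_all (\<lambda>d. mem (n - d) c) (offs T n)"

text \<open>A block rests on blocks at most 6 numbers lower, so a block that can be added lies at
  most 6 above the highest block present. Testing this window shows that \<open>outs\<close> lists
  every missing block that is supported.\<close>

definition chk_ideal :: "affine_type \<Rightarrow> nat \<Rightarrow> bool" where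
  "chk_ideal T j = (case ent T j of (w, (a, xs), ou, inn) \<Rightarrow>
     asc a xs \<and>
     (special T j \<or>
      list_all (\<lambda>n. supported T n (a, xs)) xs \<and>
      list_all (\<lambda>n. mem n (a, xs) \<or> (if supported T n (a, xs) then list_ex (\<lambda>(i, m, k). m = n) ou else True))
        [a..lastd a xs + 6]))"

definition chk_edges :: "affine_type \<Rightarrow> nat \<Rightarrow> bool" where
  "chk_edges T j = (case ent T j of (w, c, ou, inn) \<Rightarrow>
     list_all (\<lambda>(i, n, k). i = zcol T n \<and> \<not> mem n c \<and> k < ncls T \<and>
        cins n c = csh (sup0 T i) (rep T k) \<and> List.member (inns T k) (i, n - sup0 T i, j)) ou \<and>
     list_all (\<lambda>(i, n, k). k < ncls T \<and> List.member (outs T k) (i, n + sup0 T i, j)) inn)"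

text \<open>\<open>key\<close> is invariant under shifts by periods. Strictly increasing keys show
  that all columns of the table are inequivalent, with one comparison for each entry instead of one
  for each pair.\<close>

definition chk_key :: "affine_type \<Rightarrow> nat \<Rightarrow> bool" where
  "chk_key T j = (if Suc j < ncls T then lexless (key T (rep T j)) (key T (rep T (Suc j))) else True)"

text \<open>The columns of weight zero: \<open>Some i\<close> marks the column that corresponds to \<open>y\<^sub>i\<close>, or to \<open>\<emptyset>\<close>
  if \<open>i = 0\<close>.\<close>

fun kind :: "affine_type \<Rightarrow> nat \<Rightarrow> nat option" where
  "kind E6 j = None" | "kind E7 j = None"
| "kind E8 j = map_of (zip [17,109,143,133,150,137,120,96,72] [0,1,2,3,4,5,6,7,8]) j"

text \<open>The column without raising arrows of nonzero colour; its weight is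
  \<open>\<Lambda>\<^sub>1 - \<Lambda>\<^sub>0\<close>,
  \<open>\<Lambda>\<^sub>7 - \<Lambda>\<^sub>0\<close> or the highest root. Inductions along raising
  arrows end here.\<close>

fun top_cls :: "affine_type \<Rightarrow> nat" where
  "top_cls E6 = 21" | "top_cls E7 = 39" | "top_cls E8 = 73"

fun alph :: "affine_type \<Rightarrow> int list list" where
  "alph E6 = [[2,0,-1,0,0,0,0],[0,2,0,-1,0,0,0],[-1,0,2,0,-1,0,0],[0,-1,0,2,-1,0,0],[0,0,-1,-1,2,-1,0],[0,0,0,0,-1,2,-1],[0,0,0,0,0,-1,2]]"
| "alph E7 = [[2,-1,0,0,0,0,0,0],[-1,2,0,-1,0,0,0,0],[0,0,2,0,-1,0,0,0],[0,-1,0,2,-1,0,0,0],[0,0,-1,-1,2,-1,0,0],[0,0,0,0,-1,2,-1,0],[0,0,0,0,0,-1,2,-1],[0,0,0,0,0,0,-1,2]]"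
| "alph E8 = [[2,0,0,0,0,0,0,0,-1],[0,2,0,-1,0,0,0,0,0],[0,0,2,0,-1,0,0,0,0],[0,-1,0,2,-1,0,0,0,0],[0,0,-1,-1,2,-1,0,0,0],[0,0,0,0,-1,2,-1,0,0],[0,0,0,0,0,-1,2,-1,0],[0,0,0,0,0,0,-1,2,-1],[-1,0,0,0,0,0,0,-1,2]]"

definition findc :: "nat \<Rightarrow> (nat \<times> int \<times> nat) list \<Rightarrow> (nat \<times> int \<times> nat) option" where
  "findc i L = List.find (\<lambda>e. fst e = i) L"

definition onc :: "affine_type \<Rightarrow> nat \<Rightarrow> int \<Rightarrow> bool" where
  "onc T c n = list_ex (\<lambda>d. zcol T (n - d) = c) (offs T n)"

definition beats_add :: "affine_type \<Rightarrow> nat \<Rightarrow> int \<Rightarrow> int \<Rightarrow> bool" where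
  "beats_add T i n n' = (if i = 4 then onc T 5 n \<and> \<not> onc T 5 n' else zcube T n' < zcube T n)"

definition beats_rem :: "affine_type \<Rightarrow> nat \<Rightarrow> int \<Rightarrow> int \<Rightarrow> bool" where
  "beats_rem T i n n' = (if i = 4 then onc T 3 n \<and> \<not> onc T 3 n' else zcube T n < zcube T n')"

definition chk_ties :: "affine_type \<Rightarrow> nat \<Rightarrow> bool" where
  "chk_ties T j = (case ent T j of (w, c, ou, inn) \<Rightarrow>
     list_all (\<lambda>(i, n, k). case findc i ou of None \<Rightarrow> False
       | Some (i', n', k') \<Rightarrow> (if n = n' then True else beats_add T i n' n)) ou \<and>
     list_all (\<lambda>(i, n, k). case findc i inn of None \<Rightarrow> False
       | Some (i', n', k') \<Rightarrow> (if n = n' then True else beats_rem T i n' n)) inn)"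

definition fst_out :: "affine_type \<Rightarrow> nat \<Rightarrow> nat \<Rightarrow> nat option" where
  "fst_out T i k = map_option (snd \<circ> snd) (findc i (outs T k))"

definition fst_inn :: "affine_type \<Rightarrow> nat \<Rightarrow> nat \<Rightarrow> nat option" where
  "fst_inn T i k = map_option (snd \<circ> snd) (findc i (inns T k))"

definition midt :: "affine_type \<Rightarrow> nat \<Rightarrow> nat \<Rightarrow> bool" where
  "midt T j i = (case ent T j of (w, c, ou, inn) \<Rightarrow>
     (if findc i ou = None \<or> findc i inn = None then False else
       list_ex (\<lambda>(i', n, k). i' = i \<and> fst_out T i k = Some j) inn \<or>
       list_ex (\<lambda>(i', n, k). i' = i \<and> fst_inn T i k = Some j) ou))"

text \<open>The middles of strings of length two are exactly the columns marked by
  \<open>kind\<close>. Rule (b) thereby reduces to the case distinction on \<open>kind\<close> in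
  \<open>F\<close> and \<open>E\<close>.\<close>

definition chk_mid :: "affine_type \<Rightarrow> nat \<Rightarrow> bool" where
  "chk_mid T j = list_all (\<lambda>i. midt T j i = (kind T j = Some i)) [0..<Suc (rnk T)]"

text \<open>The lowering arrows of the finite graph shared by the Young columns and the perfect
  crystal: at a marked column only the arrow of its own colour is kept.\<close>

definition F :: "affine_type \<Rightarrow> nat \<Rightarrow> nat \<Rightarrow> nat option" where
  "F T j i = (case kind T j of None \<Rightarrow> fst_out T i j | Some k \<Rightarrow> (if k = i then fst_out T i j else None))"

definition E :: "affine_type \<Rightarrow> nat \<Rightarrow> nat \<Rightarrow> nat option" where
  "E T j i = (case kind T j of None \<Rightarrow> fst_inn T i j | Some k \<Rightarrow> (if k = i then fst_inn T i j else None))"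

text \<open>The value 3 stands for a length of at least 3 and does not occur.\<close>

definition fl :: "affine_type \<Rightarrow> nat \<Rightarrow> nat \<Rightarrow> int" where
  "fl T j i = (case F T j i of None \<Rightarrow> 0 | Some k \<Rightarrow> (case F T k i of None \<Rightarrow> 1 | Some l \<Rightarrow>
     (case F T l i of None \<Rightarrow> 2 | Some _ \<Rightarrow> 3)))"

definition el :: "affine_type \<Rightarrow> nat \<Rightarrow> nat \<Rightarrow> int" where
  "el T j i = (case E T j i of None \<Rightarrow> 0 | Some k \<Rightarrow> (case E T k i of None \<Rightarrow> 1 | Some l \<Rightarrow>
     (case E T l i of None \<Rightarrow> 2 | Some _ \<Rightarrow> 3)))"

text \<open>The last condition says that an element of nonzero weight lies at an end of each of its
  strings. Only a marked column can be interior, and only for its own colour.\<close>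

definition chk_str :: "affine_type \<Rightarrow> nat option \<Rightarrow> nat \<Rightarrow> int \<Rightarrow> int \<Rightarrow> int \<Rightarrow> bool" where
  "chk_str T k i x f e = (x = f - e \<and> f \<noteq> 3 \<and> e \<noteq> 3 \<and> (f = 0 \<or> e = 0 \<or> k = Some i))"

definition chk_wt :: "affine_type \<Rightarrow> nat \<Rightarrow> bool" where
  "chk_wt T j = (case wlist T j of w \<Rightarrow>
     length w = Suc (rnk T) \<and> (kind T j = None) = list_ex (\<lambda>x. x \<noteq> 0) w \<and>
     list_all (\<lambda>i.
       (case F T j i of None \<Rightarrow> True
         | Some k \<Rightarrow> wlist T k = map2 (-) w (alph T ! i) \<and> E T k i = Some j) \<and>
       (case E T j i of None \<Rightarrow> True | Some k \<Rightarrow> F T k i = Some j) \<and>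
       chk_str T (kind T j) i (w ! i) (fl T j i) (el T j i)) [0..<Suc (rnk T)])"

definition chk_top :: "affine_type \<Rightarrow> nat \<Rightarrow> bool" where
  "chk_top T j = (if j = top_cls T then True else if kind T j = Some 0 then E T j 0 \<noteq> None
     else list_ex (\<lambda>i. E T j i \<noteq> None) [1..<Suc (rnk T)])"

definition chk :: "affine_type \<Rightarrow> nat \<Rightarrow> bool" where
  "chk T j \<longleftrightarrow> chk_ideal T j \<and> chk_edges T j \<and> chk_key T j \<and> chk_ties T j \<and> chk_mid T j \<and>
     chk_wt T j \<and> chk_top T j"

lemma chk_E6_0: "list_all (chk E6) [0..<27]"
  by code_simp

lemma chk_E7_0: "list_all (chk E7) [0..<28]"
  by code_simp

lemma chk_E7_28: "list_all (chk E7) [28..<56]"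
  by code_simp

lemma chk_E8_0: "list_all (chk E8) [0..<25]"
  by code_simp

lemma chk_E8_25: "list_all (chk E8) [25..<50]"
  by code_simp

lemma chk_E8_50: "list_all (chk E8) [50..<75]"
  by code_simp

lemma chk_E8_75: "list_all (chk E8) [75..<100]"
  by code_simp

lemma chk_E8_100: "list_all (chk E8) [100..<125]"
  by code_simp

lemma chk_E8_125: "list_all (chk E8) [125..<150]"
  by code_simp

lemma chk_E8_150: "list_all (chk E8) [150..<175]"
  by code_simp

lemma chk_E8_175: "list_all (chk E8) [175..<200]"
  by code_simp

lemma chk_E8_200: "list_all (chk E8) [200..<225]"
  by code_simp

lemma chk_E8_225: "list_all (chk E8) [225..<249]"
  by code_simp

lemma chk_all: "j < ncls T \<Longrightarrow> chk T j"
proof (cases T)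
  case E6
  then show "j < ncls T \<Longrightarrow> chk T j" using chk_E6_0 by (simp add: list_all_iff)
next
  case E7
  have "[0..<56] = [0..<28] @ [28..<56]" using upt_add_eq_append[of 0 28 28] by simp
  then have "list_all (chk E7) [0..<56]" using chk_E7_0 chk_E7_28 by (simp only: list_all_append)
  then show "j < ncls T \<Longrightarrow> chk T j" using E7 by (simp add: list_all_iff)
next
  case E8
  assume j: "j < ncls T"
  have "chk E8 j" if "a \<le> j" "j < b" "list_all (chk E8) [a..<b]" for a b
    using that by (simp add: list_all_iff)
  note H = this
  note c0 = H[OF _ _ chk_E8_0]
  note c25 = H[OF _ _ chk_E8_25]
  note c50 = H[OF _ _ chk_E8_50]
  note c75 = H[OF _ _ chk_E8_75]
  note c100 = H[OF _ _ chk_E8_100]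
  note c125 = H[OF _ _ chk_E8_125]
  note c150 = H[OF _ _ chk_E8_150]
  note c175 = H[OF _ _ chk_E8_175]
  note c200 = H[OF _ _ chk_E8_200]
  note c225 = H[OF _ _ chk_E8_225]
  show ?thesis
    using j unfolding E8 ncls.simps
    by (cases "j < 125"; cases "j < 50"; cases "j < 25"; cases "j < 75"; cases "j < 100"; cases "j < 150"; cases "j < 175"; cases "j < 200"; cases "j < 225")
      (auto intro: c0 c25 c50 c75 c100 c125 c150 c175 c200 c225)
qed


section \<open>Young columns as sets of integers\<close>

lemma nblk_nz [simp]: "nblk T \<noteq> 0"
  by (cases T) auto

definition cset :: "cdata \<Rightarrow> int set" where
  "cset c = {n. mem n c}"

definition shift :: "int \<Rightarrow> int set \<Rightarrow> int set" where
  "shift d Y = (\<lambda>n. n + d) ` Y"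

definition zcol_set :: "affine_type \<Rightarrow> nat \<Rightarrow> int \<Rightarrow> int set" where
  "zcol_set T j q = shift (nblk T * q) (cset (rep T j))"

definition ideal :: "affine_type \<Rightarrow> int set \<Rightarrow> bool" where
  "ideal T Y \<longleftrightarrow> Y \<noteq> {} \<and> bdd_above Y \<and> (\<forall>n \<in> Y. \<forall>d \<in> set (offs T n). n - d \<in> Y)"

definition zcols :: "affine_type \<Rightarrow> int set set" where
  "zcols T = {Y. ideal T Y \<or> (\<exists>j q. special T j \<and> Y = zcol_set T j q)}"

lemma cset_eq: "cset (a, xs) = {..<a} \<union> set xs"
  by (auto simp: cset_def)

lemma mem_adv: "mem n (adv a xs) \<longleftrightarrow> n < a \<or> n \<in> set xs"
proof (induction a xs rule: adv.induct)
  case (2 a x xs)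
  have "n < a + 1 \<longleftrightarrow> n < a \<or> n = a" by linarith
  then show ?case using 2 by auto
qed simp

lemma cset_adv: "cset (adv a xs) = {..<a} \<union> set xs"
  unfolding cset_def mem_adv by blast

lemma set_insn: "set (insn n xs) = insert n (set xs)"
  by (induction xs) auto

lemma cset_cins: "cset (cins n c) = insert n (cset c)"
proof (cases c)
  case (Pair a xs)
  have "{..<a + 1} = insert a {..<a}" by auto
  then show ?thesis by (simp add: Pair cset_eq cset_adv set_insn)
qed

lemma cset_csh: "cset (csh d c) = shift d (cset c)"
proof (cases c)
  case (Pair a xs)
  have "{..<a + d} = (\<lambda>n. n + d) ` {..<a}"
  proof (intro equalityI subsetI)
    fix x assume "x \<in> {..<a + d}"
    then have "x = (x - d) + d" "x - d \<in> {..<a}" by auto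
    then show "x \<in> (\<lambda>n. n + d) ` {..<a}" by blast
  qed auto
  then show ?thesis by (simp add: Pair cset_eq shift_def image_Un)
qed

lemma shift_iff [simp]: "n \<in> shift d Y \<longleftrightarrow> n - d \<in> Y"
proof
  assume "n - d \<in> Y"
  then have "(n - d) + d \<in> shift d Y" unfolding shift_def by (rule imageI)
  then show "n \<in> shift d Y" by simp
qed (auto simp: shift_def)

lemma shift_shift [simp]: "shift d (shift e Y) = shift (d + e) Y"
  by (rule set_eqI) (simp add: diff_diff_eq add.commute)

lemma shift_0 [simp]: "shift 0 Y = Y"
  by (rule set_eqI) simp

lemma shift_insert: "shift d (insert n Y) = insert (n + d) (shift d Y)"
  by (simp add: shift_def)

lemma shift_zcol_set: "shift (nblk T * p) (zcol_set T j q) = zcol_set T j (q + p)"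
  by (simp add: zcol_set_def algebra_simps)

lemma zcol_set_0: "zcol_set T j 0 = cset (rep T j)"
  by (simp add: zcol_set_def)

lemma ent_eq: "ent T j = (wlist T j, rep T j, outs T j, inns T j)"
  by (simp add: wlist_def rep_def outs_def inns_def)

lemma asc_bound: "asc a xs \<Longrightarrow> x \<in> set xs \<Longrightarrow> a < x"
  by (induction a xs rule: asc.induct) auto

lemma asc_sorted: "asc a xs \<Longrightarrow> sorted_wrt (<) xs"
  by (induction a xs rule: asc.induct) (auto dest: asc_bound)

lemma lastd_ge: "asc a xs \<Longrightarrow> a \<le> lastd a xs \<and> (\<forall>x \<in> set xs. x \<le> lastd a xs)"
  by (induction a xs rule: asc.induct) auto

lemma asc_csh: "asc a xs \<Longrightarrow> asc (a + d) (map (\<lambda>x. x + d) xs)"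
  by (induction a xs rule: asc.induct) auto

text \<open>The initial segment is recovered from the set because \<open>a\<close> is the least
  missing number.\<close>

lemma cset_inject:
  assumes "asc a xs" "asc b ys" "cset (a, xs) = cset (b, ys)"
  shows "a = b \<and> xs = ys"
proof -
  have "a \<notin> cset (b, ys)" "b \<notin> cset (a, xs)"
    using assms asc_bound by (fastforce simp: cset_eq)+
  then have ab: "a = b" by (auto simp: cset_eq)
  have "set xs = cset (a, xs) - {..<a}" "set ys = cset (b, ys) - {..<b}"
    using assms(1,2) by (fastforce simp: cset_eq dest: asc_bound)+
  then have "set xs = set ys" using assms(3) ab by simp
  then show ?thesis using ab strict_sorted_equal[OF asc_sorted[OF assms(1)] asc_sorted[OF assms(2)]] by simp
qed

lemma lexless_irrefl: "\<not> lexless xs xs"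
  by (induction xs) auto

lemma lexless_trans: "lexless xs ys \<Longrightarrow> lexless ys zs \<Longrightarrow> lexless xs zs"
proof (induction xs ys arbitrary: zs rule: lexless.induct)
  case (2 y ys) then show ?case by (cases zs) auto
next
  case (4 x xs y ys) then show ?case by (cases zs) auto
qed auto

lemma key_mono: "j < k \<Longrightarrow> k < ncls T \<Longrightarrow> lexless (key T (rep T j)) (key T (rep T k))"
proof (induction k)
  case (Suc k)
  have s: "lexless (key T (rep T k)) (key T (rep T (Suc k)))"
    using chk_all[of k T] Suc.prems by (simp add: chk_def chk_key_def)
  then show ?case using Suc lexless_trans by (cases "j = k") auto
qed simp

lemma rep_asc: "j < ncls T \<Longrightarrow> rep T j = (a, xs) \<Longrightarrow> asc a xs"
  using chk_all[of j T] by (simp add: chk_def chk_ideal_def ent_eq)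

text \<open>Equal sets have equal data up to the shift, hence equal keys, which determine the entry;
  comparing the initial segments then determines the shift.\<close>

lemma zcol_set_inject:
  assumes "zcol_set T j q = zcol_set T k p" "j < ncls T" "k < ncls T"
  shows "j = k \<and> q = p"
proof -
  obtain a xs b ys where r: "rep T j = (a, xs)" "rep T k = (b, ys)" by fastforce
  have "cset (a + nblk T * q, map (\<lambda>x. x + nblk T * q) xs) =
      cset (b + nblk T * p, map (\<lambda>x. x + nblk T * p) ys)"
    using assms(1) cset_csh[of "nblk T * q" "(a, xs)"] cset_csh[of "nblk T * p" "(b, ys)"]
    by (simp add: zcol_set_def r)
  then have e: "a + nblk T * q = b + nblk T * p"
      "map (\<lambda>x. x + nblk T * q) xs = map (\<lambda>x. x + nblk T * p) ys"
    using cset_inject asc_csh rep_asc[OF assms(2) r(1)] rep_asc[OF assms(3) r(2)] by metis+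
  have "a mod nblk T = b mod nblk T" using e(1) by (metis mod_mult_self2)
  moreover have "map (\<lambda>x. x - a) xs = map (\<lambda>x. x - b) ys"
  proof -
    have "map (\<lambda>x. x - (a + nblk T * q)) (map (\<lambda>x. x + nblk T * q) xs) =
        map (\<lambda>x. x - (b + nblk T * p)) (map (\<lambda>x. x + nblk T * p) ys)"
      using e by simp
    then show ?thesis by (simp add: o_def)
  qed
  ultimately have "key T (rep T j) = key T (rep T k)" by (simp add: key_def r)
  then have "j = k" using key_mono assms(2,3) lexless_irrefl by (metis linorder_neqE_nat)
  moreover from this have "q = p" using e(1) r nblk_pos[of T] by simp
  ultimately show ?thesis by simp
qed

lemma outs_edge:
  assumes "(i, n, k) \<in> set (outs T j)" "j < ncls T"
  shows "zcol T n = i" "n \<notin> cset (rep T j)" "k < ncls T"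
    "insert n (cset (rep T j)) = zcol_set T k (if i = 0 then 1 else 0)"
    "(i, n - sup0 T i, j) \<in> set (inns T k)"
proof -
  have *: "i = zcol T n \<and> \<not> mem n (rep T j) \<and> k < ncls T \<and>
        cins n (rep T j) = csh (sup0 T i) (rep T k) \<and> List.member (inns T k) (i, n - sup0 T i, j)"
    using chk_all[OF assms(2)] assms(1) by (auto simp: chk_def chk_edges_def ent_eq list_all_iff)
  then show "zcol T n = i" "n \<notin> cset (rep T j)" "k < ncls T" "(i, n - sup0 T i, j) \<in> set (inns T k)"
    by (auto simp: cset_def)
  have "insert n (cset (rep T j)) = shift (sup0 T i) (cset (rep T k))"
    using * by (metis cset_cins cset_csh)
  then show "insert n (cset (rep T j)) = zcol_set T k (if i = 0 then 1 else 0)"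
    by (auto simp: zcol_set_def sup0_def)
qed

lemma inns_edge:
  assumes "(i, n, k) \<in> set (inns T j)" "j < ncls T"
  shows "k < ncls T" "(i, n + sup0 T i, j) \<in> set (outs T k)"
  using chk_all[OF assms(2)] assms(1) by (auto simp: chk_def chk_edges_def ent_eq list_all_iff)

lemma offs_nonempty: "offs T n \<noteq> []"
proof -
  have "list_all (\<lambda>l. l \<noteq> []) (off_list T)" "length (off_list T) = nat (nblk T)" by (cases T; simp)+
  moreover have "nat (n mod nblk T) < nat (nblk T)" using nblk_pos[of T] by (simp add: nat_less_iff)
  ultimately show ?thesis by (simp add: list_all_length offs_def)
qed

lemma rep_ideal:
  assumes "j < ncls T" "\<not> special T j"
  shows "ideal T (cset (rep T j))"
proof -
  obtain a xs where r: "rep T j = (a, xs)" by fastforce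
  have c: "\<forall>n \<in> set xs. \<forall>d \<in> set (offs T n). n - d \<in> cset (a, xs)" and s: "asc a xs"
    using chk_all[OF assms(1)] assms(2)
    by (auto simp: chk_def chk_ideal_def ent_eq r list_all_iff supported_def cset_def)
  have "bdd_above (cset (a, xs))" by (simp add: cset_eq)
  moreover have "a - 1 \<in> cset (a, xs)" by (simp add: cset_eq)
  moreover have "n - d \<in> cset (a, xs)" if "n \<in> cset (a, xs)" "d \<in> set (offs T n)" for n d
    using that c offs_range[OF that(2)] by (auto simp: cset_eq)
  ultimately show ?thesis unfolding ideal_def r by blast
qed

lemma outs_complete:
  assumes "j < ncls T" "\<not> special T j" "n \<notin> cset (rep T j)"
    "\<forall>d \<in> set (offs T n). n - d \<in> cset (rep T j)"
  shows "\<exists>i k. (i, n, k) \<in> set (outs T j)"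
proof -
  obtain a xs where r: "rep T j = (a, xs)" by fastforce
  have s: "asc a xs" and c: "\<forall>n \<in> {a..lastd a xs + 6}. mem n (a, xs) \<or>
      (supported T n (a, xs) \<longrightarrow> (\<exists>(i, m, k) \<in> set (outs T j). m = n))"
    using chk_all[OF assms(1)] assms(2)
    by (auto simp: chk_def chk_ideal_def ent_eq r list_all_iff list_ex_iff)
  obtain d where d: "d \<in> set (offs T n)" using offs_nonempty[of T n] by (cases "offs T n") auto
  have "n - d \<le> lastd a xs" using assms(4) d lastd_ge[OF s] by (auto simp: r cset_eq)
  then have "n \<le> lastd a xs + 6" using offs_range[OF d] by linarith
  moreover have "a \<le> n" using assms(3) by (auto simp: r cset_eq)
  ultimately have "\<exists>(i, m, k) \<in> set (outs T j). m = n"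
    using c assms(3,4) by (auto simp: r cset_def supported_def list_all_iff)
  then show ?thesis by blast
qed

lemma ideal_shift: "ideal T Y \<Longrightarrow> ideal T (shift (nblk T * q) Y)"
proof -
  assume Y: "ideal T Y"
  then obtain M where M: "\<And>y. y \<in> Y \<Longrightarrow> y \<le> M" by (auto simp: ideal_def bdd_above_def)
  have "bdd_above (shift (nblk T * q) Y)"
    by (rule bdd_aboveI[where M = "M + nblk T * q"]) (use M in force)
  moreover have "shift (nblk T * q) Y \<noteq> {}" using Y by (auto simp: ideal_def shift_def)
  moreover have "n - d \<in> shift (nblk T * q) Y" if "n \<in> shift (nblk T * q) Y" "d \<in> set (offs T n)" for n d
  proof -
    have "offs T (n - nblk T * q) = offs T n" using offs_period[of T "n - nblk T * q" q] by simp
    then have "n - nblk T * q - d \<in> Y" using Y that by (auto simp: ideal_def)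
    then show ?thesis by (simp add: algebra_simps)
  qed
  ultimately show ?thesis by (auto simp: ideal_def)
qed

lemma zcols_shift: "Y \<in> zcols T \<Longrightarrow> shift (nblk T * q) Y \<in> zcols T"
  unfolding zcols_def using ideal_shift shift_zcol_set by blast

section \<open>Every ideal contains all sufficiently low blocks\<close>

fun up_list :: "affine_type \<Rightarrow> nat list list" where
  "up_list E6 = [[2],[1,2],[2],[1,2],[2,3],[2],[2,3],[2],[3],[1,2],[2,3],[2]]"
| "up_list E7 = [[3],[3],[1,2],[2],[1,2],[2],[1,2],[2,3],[2,3],[3],[2,3],[2],[2,3],[2],[2,3],[2],
     [2,4],[2,3]]"
| "up_list E8 = [[6],[3],[2,3],[2,3],[3,4],[3,4],[3],[3,4],[3,4],[3],[4],[2,3,4],[3],[3,4],[3],[1],[2,3],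
     [1,3],[4],[2,3],[2,3],[3],[2,3],[2,3],[3],[2,3],[2,3],[4,5],[4,5],[1,4]]"

text \<open>Block \<open>n + u\<close> rests on block \<open>n\<close> for each listed
  \<open>u\<close>; this is a converse of \<open>offs\<close>.\<close>

definition ups :: "affine_type \<Rightarrow> int \<Rightarrow> nat list" where
  "ups T n = up_list T ! nat (n mod nblk T)"

text \<open>A window of six numbers is moved downwards; flag \<open>u\<close> records that
  \<open>m + u\<close> is known to lie in the ideal, and the new bottom number is added if some
  block resting on it is flagged. A full window suffices, since every lower block then supports a
  block at most 6 higher that has already been reached.\<close>

fun scan :: "affine_type \<Rightarrow> nat \<Rightarrow> int \<Rightarrow> bool list \<Rightarrow> bool" where
  "scan T 0 m bs = list_all id bs"
| "scan T (Suc k) m bs = (if list_all id bs then True else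
     scan T k (m - 1) (list_ex (\<lambda>u. bs ! (u - 1)) (ups T (m - 1)) # butlast bs))"

text \<open>Starting from a single block of any residue, 36 steps are enough to fill the
  window.\<close>

definition scan_ok :: "affine_type \<Rightarrow> bool" where
  "scan_ok T = list_all (\<lambda>t.
     list_all (\<lambda>u. \<not> u < 1 \<and> \<not> 6 < u \<and> List.member (offs T (t + int u)) (int u)) (ups T t) \<and>
     ups T t \<noteq> [] \<and>
     scan T 36 t [True, False, False, False, False, False]) [0..nblk T - 1]"

lemma scan_ok: "scan_ok T"
proof (cases T)
  case E6 show ?thesis unfolding E6 by code_simp
next
  case E7 show ?thesis unfolding E7 by code_simp
next
  case E8 show ?thesis unfolding E8 by code_simp
qed

lemma scan_okD:
  assumes "t \<in> set [0..nblk T - 1]"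
  shows "(\<forall>u \<in> set (ups T t). 1 \<le> u \<and> u \<le> 6 \<and> int u \<in> set (offs T (t + int u)))"
    "ups T t \<noteq> []" "scan T 36 t [True, False, False, False, False, False]"
proof -
  note * = bspec[OF scan_ok[of T, unfolded scan_ok_def list_all_iff] assms]
  show "(\<forall>u \<in> set (ups T t). 1 \<le> u \<and> u \<le> 6 \<and> int u \<in> set (offs T (t + int u)))"
  proof
    fix u assume "u \<in> set (ups T t)"
    with * have "\<not> u < 1 \<and> \<not> 6 < u \<and> List.member (offs T (t + int u)) (int u)" by blast
    then show "1 \<le> u \<and> u \<le> 6 \<and> int u \<in> set (offs T (t + int u))" by simp
  qed
  show "ups T t \<noteq> []" using * by blast
  show "scan T 36 t [True, False, False, False, False, False]" using * by blast
qed

lemma ups_offs: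
  assumes "u \<in> set (ups T n)"
  shows "1 \<le> u \<and> u \<le> 6 \<and> int u \<in> set (offs T (n + int u))"
proof -
  define t where "t = n mod nblk T"
  have t: "t \<in> set [0..nblk T - 1]" using nblk_pos[of T] by (simp add: t_def)
  have n: "n = t + nblk T * (n div nblk T)" by (simp add: t_def)
  have "ups T t = ups T n" by (simp add: ups_def t_def)
  then have "1 \<le> u \<and> u \<le> 6 \<and> int u \<in> set (offs T (t + int u))"
    using scan_okD(1)[OF t] assms by metis
  moreover have "offs T (n + int u) = offs T (t + int u)"
    by (metis offs_period n add.assoc add.commute)
  ultimately show ?thesis by simp
qed

lemma ups_nonempty: "ups T n \<noteq> []"
proof -
  have "n mod nblk T \<in> set [0..nblk T - 1]" using nblk_pos[of T] by simp
  then have "ups T (n mod nblk T) \<noteq> []" by (rule scan_okD)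
  then show ?thesis by (simp add: ups_def)
qed

lemma scan_sound:
  assumes "scan T k m bs" "length bs = 6" "\<forall>u < 6. bs ! u \<longrightarrow> m + int u \<in> Y"
    "\<forall>n \<in> Y. \<forall>d \<in> set (offs T n). n - d \<in> Y"
  shows "\<exists>l. \<forall>u < 6. l + int u \<in> Y"
  using assms(1-3)
proof (induction k arbitrary: m bs)
  case 0
  then have "\<forall>u < 6. m + int u \<in> Y" by (auto simp: list_all_length)
  then show ?case by blast
next
  case (Suc k)
  show ?case
  proof (cases "list_all id bs")
    case True
    then have "\<forall>u < 6. m + int u \<in> Y" using Suc by (auto simp: list_all_length)
    then show ?thesis by blast
  next
    case False
    let ?b = "list_ex (\<lambda>u. bs ! (u - 1)) (ups T (m - 1))"
    have b: "m - 1 \<in> Y" if bb: ?b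
    proof -
      obtain u where u: "u \<in> set (ups T (m - 1))" "bs ! (u - 1)" using bb unfolding list_ex_iff by blast
      note uu = ups_offs[OF u(1)]
      have "u - 1 < 6" using uu by linarith
      then have "m + int (u - 1) \<in> Y" using u(2) Suc.prems(3) by blast
      then have "(m - 1) + int u \<in> Y" using uu by (simp add: of_nat_diff algebra_simps)
      then have "(m - 1) + int u - int u \<in> Y" using uu assms(4) by blast
      then show ?thesis by simp
    qed
    have "\<forall>u < 6. (?b # butlast bs) ! u \<longrightarrow> m - 1 + int u \<in> Y"
    proof (intro allI impI)
      fix u :: nat assume u: "u < 6" "(?b # butlast bs) ! u"
      show "m - 1 + int u \<in> Y"
      proof (cases u)
        case 0 then show ?thesis using u b by simp
      next
        case (Suc v)
        then have "bs ! v" using u Suc.prems(2) by (simp add: nth_butlast)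
        then show ?thesis using Suc u Suc.prems(3) by simp
      qed
    qed
    then show ?thesis using Suc.IH[of "m - 1" "?b # butlast bs"] Suc.prems False by simp
  qed
qed

lemma ideal_contains:
  assumes "ideal T Y"
  shows "\<exists>a. {..<a} \<subseteq> Y"
proof -
  have cl: "\<forall>n \<in> Y. \<forall>d \<in> set (offs T n). n - d \<in> Y" using assms by (simp add: ideal_def)
  obtain n where n: "n \<in> Y" using assms by (auto simp: ideal_def)
  define q where "q = n div nblk T"
  define t where "t = n mod nblk T"
  have nt: "n = t + nblk T * q" and t: "t \<in> set [0..nblk T - 1]"
    using nblk_pos[of T] by (simp_all add: t_def q_def)
  define Z where "Z = shift (nblk T * (- q)) Y"
  have Z: "ideal T Z" unfolding Z_def by (rule ideal_shift[OF assms])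
  have tZ: "t \<in> Z" using n by (simp add: Z_def nt)
  have clZ: "\<forall>n \<in> Z. \<forall>d \<in> set (offs T n). n - d \<in> Z" using Z by (simp add: ideal_def)
  have init: "\<forall>u < 6. [True, False, False, False, False, False] ! u \<longrightarrow> t + int u \<in> Z"
    using tZ by (auto simp: nth_Cons split: nat.splits)
  obtain l where l: "\<forall>u < 6. l + int u \<in> Z"
    using scan_sound[OF scan_okD(3)[OF t] _ init clZ] by auto
  have "\<forall>m. m < l + 6 \<longrightarrow> m \<in> Z"
  proof (intro allI impI)
    fix m assume "m < l + 6"
    then show "m \<in> Z"
    proof (induction "nat (l + 6 - m)" arbitrary: m rule: less_induct)
      case less
      show ?case
      proof (cases "l \<le> m")
        case True
        then have "m = l + int (nat (m - l))" "nat (m - l) < 6" using less.prems by auto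
        then show ?thesis using l by metis
      next
        case False
        obtain u where u: "u \<in> set (ups T m)" using ups_nonempty[of T m] by (cases "ups T m") auto
        note uu = ups_offs[OF u]
        have "m + int u \<in> Z" using less.hyps[of "m + int u"] uu less.prems False by auto
        then have "m + int u - int u \<in> Z" using uu clZ by blast
        then show ?thesis by simp
      qed
    qed
  qed
  then have "x \<in> Y" if "x < l + 6 + nblk T * q" for x
    using that by (force simp: Z_def dest: spec[of _ "x - nblk T * q"])
  then have "{..<l + 6 + nblk T * q} \<subseteq> Y" by auto
  then show ?thesis by blast
qed

section \<open>The exceptional columns and the classification of all columns\<close>

fun start_cls :: "affine_type \<Rightarrow> nat" where
  "start_cls E6 = 4" | "start_cls E7 = 8" | "start_cls E8 = 34"

lemma start_check: "list_all (\<lambda>T. rep T (start_cls T) = (1, []) \<and> start_cls T < ncls T) [E6, E7, E8]"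
  by code_simp

lemma start_cls: "rep T (start_cls T) = (1, [])" "start_cls T < ncls T" "\<not> special T (start_cls T)"
  using start_check by (cases T; simp add: special_def)+

lemma special_check: "list_all (\<lambda>(s, a, xs, e, d). rep E8 s = (a, xs) \<and> mem e (a, xs) \<and> d = a \<and>
     List.member (offs E8 e) (e - d) \<and>
     list_ex (\<lambda>(i, n, k). n = d) (outs E8 s) \<and>
     list_ex (\<lambda>(i, n, k). n = e \<and> i \<noteq> 0 \<and> \<not> special E8 k) (inns E8 s))
    [(128, 13, [14, 15, 17], 17, 13), (144, 16, [17, 18], 18, 16)]"
  by code_simp

lemma idealD: "ideal T Y \<Longrightarrow> n \<in> Y \<Longrightarrow> d \<in> set (offs T n) \<Longrightarrow> n - d \<in> Y"
  by (simp add: ideal_def)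

text \<open>\<open>spa s\<close> is the gap of the exceptional column, namely its lowest missing
  block, and \<open>spe s\<close> is the block lying over this gap.\<close>

definition spa :: "nat \<Rightarrow> int" where "spa s = (if s = 128 then 13 else 16)"

definition spe :: "nat \<Rightarrow> int" where "spe s = (if s = 128 then 17 else 18)"

lemma special_facts:
  assumes "special T s"
  shows "T = E8" "s < ncls T" "spe s \<in> cset (rep T s)" "spa s \<notin> cset (rep T s)" "{..<spa s} \<subseteq> cset (rep T s)"
    "spe s - spa s \<in> set (offs T (spe s))" "\<exists>i k. (i, spa s, k) \<in> set (outs T s)"
    "\<exists>i k. (i, spe s, k) \<in> set (inns T s) \<and> i \<noteq> 0"
proof -
  show T: "T = E8" using assms by (auto simp: special_def)
  have s: "s = 128 \<or> s = 144" using assms by (auto simp: special_def)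
  show "s < ncls T" using T s by auto
  note c = special_check[unfolded list_all_iff list_ex_iff]
  show "spe s \<in> cset (rep T s)" "spa s \<notin> cset (rep T s)" "{..<spa s} \<subseteq> cset (rep T s)"
    "spe s - spa s \<in> set (offs T (spe s))"
    using s c unfolding T by (auto simp: spa_def spe_def cset_eq)
  show "\<exists>i k. (i, spa s, k) \<in> set (outs T s)"
    using s c unfolding T by (fastforce simp: spa_def)
  show "\<exists>i k. (i, spe s, k) \<in> set (inns T s) \<and> i \<noteq> 0"
    using s c unfolding T by (fastforce simp: spe_def)
qed

lemma special_not_ideal: "special T s \<Longrightarrow> \<not> ideal T (zcol_set T s q)"
proof
  assume s: "special T s" and i: "ideal T (zcol_set T s q)"
  have j: "ideal T (cset (rep T s))"
    using ideal_shift[OF i, of "- q", unfolded shift_zcol_set] by (simp add: zcol_set_0)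
  note f = special_facts[OF s]
  have "spe s - (spe s - spa s) \<in> cset (rep T s)" by (rule idealD[OF j f(3,6)])
  then show False using f(4) by simp
qed

lemma zcol_set_ideal: "j < ncls T \<Longrightarrow> \<not> special T j \<Longrightarrow> ideal T (zcol_set T j q)"
  unfolding zcol_set_def by (intro ideal_shift rep_ideal)

lemma outs_edge_shift:
  assumes "(i, n, k) \<in> set (outs T j)" "j < ncls T"
  shows "n + nblk T * q \<notin> zcol_set T j q" "zcol T (n + nblk T * q) = i"
    "insert (n + nblk T * q) (zcol_set T j q) = zcol_set T k (q + (if i = 0 then 1 else 0))"
proof -
  note e = outs_edge[OF assms]
  show "n + nblk T * q \<notin> zcol_set T j q" "zcol T (n + nblk T * q) = i"
    using e by (simp_all add: zcol_set_def)
  show "insert (n + nblk T * q) (zcol_set T j q) = zcol_set T k (q + (if i = 0 then 1 else 0))"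
    using arg_cong[OF e(4), of "shift (nblk T * q)"]
    unfolding shift_zcol_set shift_insert by (simp add: zcol_set_def add.commute)
qed

lemma ideal_insert:
  assumes "ideal T Y" "\<forall>d \<in> set (offs T n). n - d \<in> Y"
  shows "ideal T (insert n Y)"
  using assms by (auto simp: ideal_def)

text \<open>Start from an initial segment so low that it is contained in the ideal, and add the
  least missing block again and again. Minimality makes it supported, so completeness of the table
  provides the next entry, and the number of missing blocks drops.\<close>

lemma ideal_is_zcol_set:
  assumes Y: "ideal T Y"
  shows "\<exists>j q. j < ncls T \<and> \<not> special T j \<and> Y = zcol_set T j q"
proof -
  obtain a where a: "{..<a} \<subseteq> Y" using ideal_contains[OF Y] by blast
  obtain M where M: "\<And>y. y \<in> Y \<Longrightarrow> y \<le> M" using Y by (auto simp: ideal_def bdd_above_def)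
  \<comment> \<open>A period has at least 12 blocks, so this many shifts place the segment below
    \<open>a\<close> whatever the sign of \<open>a\<close>.\<close>
  define q where "q = - \<bar>a\<bar> - 1"
  have "nblk T * q \<le> 1 * q" using nblk_ge[of T] by (intro mult_right_mono_neg) (auto simp: q_def)
  then have q: "1 + nblk T * q \<le> a" by (simp add: q_def)
  let ?Z = "zcol_set T (start_cls T) q"
  have Z: "?Z = {..<1 + nblk T * q}"
    by (auto simp: zcol_set_def start_cls cset_eq)
  have "Y - ?Z \<subseteq> {1 + nblk T * q..M}" using M by (auto simp: Z)
  then have fin: "finite (Y - ?Z)" by (rule finite_subset) simp
  have "?Z \<subseteq> Y" using a q by (auto simp: Z)
  moreover have "\<exists>j q. j < ncls T \<and> \<not> special T j \<and> Y = zcol_set T j q"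
    if "zcol_set T j q \<subseteq> Y" "finite (Y - zcol_set T j q)" "j < ncls T" "\<not> special T j" for j q
    using that
  proof (induction "card (Y - zcol_set T j q)" arbitrary: j q rule: less_induct)
    case (less j q)
    let ?Z = "zcol_set T j q"
    show ?case
    proof (cases "Y - ?Z = {}")
      case True
      then have "Y = ?Z" using less.prems by auto
      then show ?thesis using less.prems by blast
    next
      case False
      define n where "n = Min (Y - ?Z)"
      have n: "n \<in> Y - ?Z" using Min_in[OF less.prems(2) False] by (simp add: n_def)
      have sup: "\<forall>d \<in> set (offs T n). n - d \<in> ?Z"
      proof
        fix d assume d: "d \<in> set (offs T n)"
        then have "n - d \<in> Y" using idealD[OF Y _ d] n by simp
        moreover have "\<not> n \<le> n - d" using offs_range[OF d] by linarith
        ultimately show "n - d \<in> ?Z" using Min_le[OF less.prems(2), of "n - d"] n_def by blast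
      qed
      let ?n = "n - nblk T * q"
      have "offs T ?n = offs T n" using offs_period[of T ?n q] by simp
      then have "\<exists>i k. (i, ?n, k) \<in> set (outs T j)"
        using n sup by (intro outs_complete[OF less.prems(3,4)]) (auto simp: zcol_set_def algebra_simps)
      then obtain i k where ik: "(i, ?n, k) \<in> set (outs T j)" by blast
      define p where "p = q + (if i = 0 then 1 else 0)"
      have ins: "insert n ?Z = zcol_set T k p"
        using outs_edge_shift(3)[OF ik less.prems(3), of q] by (simp add: p_def)
      have "ideal T (insert n ?Z)" using ideal_insert[OF zcol_set_ideal[OF less.prems(3,4)] sup] .
      then have k: "\<not> special T k" using special_not_ideal unfolding ins by blast
      have sub: "zcol_set T k p \<subseteq> Y" using less.prems(1) n unfolding ins[symmetric] by blast
      have "Y - zcol_set T k p = (Y - ?Z) - {n}" unfolding ins[symmetric] by blast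
      then have "finite (Y - zcol_set T k p)" "card (Y - zcol_set T k p) < card (Y - ?Z)"
        using less.prems(2) n card_Diff1_less[OF less.prems(2) n] by auto
      then show ?thesis using less.hyps[OF _ sub _ outs_edge(3)[OF ik less.prems(3)] k] by blast
    qed
  qed
  ultimately show ?thesis using fin start_cls(2,3) by blast
qed

lemma zcols_eq: "zcols T = {zcol_set T j q | j q. j < ncls T}"
proof (intro equalityI subsetI)
  fix Y assume "Y \<in> zcols T"
  then consider "ideal T Y" | j q where "special T j" "Y = zcol_set T j q" by (auto simp: zcols_def)
  then show "Y \<in> {zcol_set T j q | j q. j < ncls T}"
  proof cases
    case 1 then show ?thesis using ideal_is_zcol_set by blast
  next
    case 2 then show ?thesis using special_facts by blast
  qed
next
  fix Y assume "Y \<in> {zcol_set T j q | j q. j < ncls T}"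
  then show "Y \<in> zcols T" unfolding zcols_def using zcol_set_ideal by blast
qed


text \<open>The exceptional columns need a separate argument. If a block is added to one of them and
  the result is an ideal, the gap has been filled; if one of them arises from an ideal, the block
  over the gap has been added. Both arrows are tabulated. Passing from one exceptional column to
  another without filling the gap is impossible.\<close>

lemma outs_iff:
  assumes j: "j < ncls T" and n: "n \<notin> cset (rep T j)"
  shows "insert n (cset (rep T j)) \<in> zcols T \<longleftrightarrow> (\<exists>i k. (i, n, k) \<in> set (outs T j))"
proof
  assume "\<exists>i k. (i, n, k) \<in> set (outs T j)"
  then show "insert n (cset (rep T j)) \<in> zcols T"
    using outs_edge(3,4)[OF _ j] unfolding zcols_eq by blast
next
  let ?Y = "cset (rep T j)"
  assume "insert n ?Y \<in> zcols T"
  then consider (ideal) "ideal T (insert n ?Y)"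
    | (special) s q where "special T s" "insert n ?Y = zcol_set T s q" by (auto simp: zcols_def)
  then show "\<exists>i k. (i, n, k) \<in> set (outs T j)"
  proof cases
    case ideal
    show ?thesis
    proof (cases "special T j")
      case False
      have "n - d \<in> ?Y" if "d \<in> set (offs T n)" for d
        using idealD[OF ideal insertI1 that] offs_range[OF that] by auto
      then show ?thesis by (intro outs_complete[OF j False n]) auto
    next
      case True
      note f = special_facts[OF True]
      have "spe j - (spe j - spa j) \<in> insert n ?Y" using idealD[OF ideal _ f(6)] f(3) by blast
      then show ?thesis using f(4,7) by auto
    qed
  next
    case special
    note f = special_facts[OF special(1)]
    obtain i k where r: "(i, spe s, k) \<in> set (inns T s)" "i \<noteq> 0" using f(8) by blast
    show ?thesis
    proof (cases "special T j")
      case False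
      have eY: "spe s + nblk T * q \<in> insert n ?Y" "spa s + nblk T * q \<notin> insert n ?Y"
        using f(3,4) by (simp_all add: special(2) zcol_set_def del: insert_iff)
      have e: "spe s + nblk T * q = n"
      proof (rule ccontr)
        assume "spe s + nblk T * q \<noteq> n"
        then have "spe s + nblk T * q \<in> ?Y" using eY by blast
        moreover have "spe s - spa s \<in> set (offs T (spe s + nblk T * q))" using f(6) by simp
        ultimately have "spe s + nblk T * q - (spe s - spa s) \<in> ?Y"
          by (rule idealD[OF rep_ideal[OF j False]])
        then show False using eY by (simp add: add.commute)
      qed
      have ek: "(i, spe s, s) \<in> set (outs T k)" "k < ncls T"
        using inns_edge[OF r(1) f(2)] r(2) by (simp_all add: sup0_def)
      note o = outs_edge_shift[OF ek, of q]
      have "insert n ?Y = insert n (zcol_set T k q)" using o(3) special(2) r(2) e by simp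
      then have "?Y = zcol_set T k q" using n o(1) e insert_ident by metis
      then have "j = k \<and> 0 = q" using zcol_set_inject[of T j 0 k q] j ek by (simp add: zcol_set_0)
      then show ?thesis using ek e by auto
    next
      case True
      note g = special_facts[OF True]
      show ?thesis
      proof (cases "n = spa j")
        case True then show ?thesis using g(7) by simp
      next
        case False
        have eq: "insert n ?Y = shift (nblk T * q) (cset (rep T s))"
          using special(2) by (simp add: zcol_set_def)
        have "spa j \<notin> shift (nblk T * q) (cset (rep T s))" using g(4) False unfolding eq[symmetric] by blast
        then have "\<not> spa j - nblk T * q < spa s" using f(5) by auto
        moreover have "spa s + nblk T * q \<notin> insert n ?Y" unfolding eq using f(4) by simp
        then have "\<not> spa s + nblk T * q < spa j" using g(5) by auto
        \<comment> \<open>The lowest gaps of both columns coincide, and 13 and 16 differ modulo 30,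
          so the two columns are the same.\<close>
        ultimately have "spa j = spa s + 30 * q" using f(1) by simp
        then have q: "q = 0" "spa j = spa s" by (simp_all add: spa_def split: if_splits)
        then have "j = s" using True special(1) by (auto simp: special_def spa_def split: if_splits)
        then have "insert n ?Y = ?Y" using special(2) q by (simp add: zcol_set_0)
        then show ?thesis using n by blast
      qed
    qed
  qed
qed

lemma add_iff:
  assumes j: "j < ncls T" and n: "n \<notin> zcol_set T j q"
  shows "insert n (zcol_set T j q) \<in> zcols T \<longleftrightarrow> (\<exists>i k. (i, n - nblk T * q, k) \<in> set (outs T j))"
proof -
  have "insert n (zcol_set T j q) = shift (nblk T * q) (insert (n - nblk T * q) (cset (rep T j)))"
    by (simp add: shift_insert zcol_set_def)
  moreover have "shift (nblk T * q) Y \<in> zcols T \<longleftrightarrow> Y \<in> zcols T" for Y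
    using zcols_shift[of Y T q] zcols_shift[of "shift (nblk T * q) Y" T "- q"] by auto
  ultimately show ?thesis using outs_iff[OF j, of "n - nblk T * q"] n by (simp add: zcol_set_def)
qed

lemma inns_edge_shift:
  assumes "(i, n, k) \<in> set (inns T j)" "j < ncls T"
  shows "n + nblk T * q \<in> zcol_set T j q" "zcol T (n + nblk T * q) = i" "k < ncls T"
    "zcol_set T j q - {n + nblk T * q} = zcol_set T k (q - (if i = 0 then 1 else 0))"
proof -
  note e = inns_edge[OF assms]
  let ?p = "q - (if i = 0 then 1 else 0)"
  have n: "n + sup0 T i + nblk T * ?p = n + nblk T * q" by (simp add: sup0_def algebra_simps)
  note o = outs_edge_shift[OF e(2,1), of ?p, unfolded n]
  show "k < ncls T" by (rule e)
  show "zcol T (n + nblk T * q) = i" by (rule o)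
  have i: "insert (n + nblk T * q) (zcol_set T k ?p) = zcol_set T j q" using o(3) by simp
  then show "n + nblk T * q \<in> zcol_set T j q" by blast
  show "zcol_set T j q - {n + nblk T * q} = zcol_set T k ?p"
    using o(1) unfolding i[symmetric] by simp
qed

text \<open>Removing a block is undone by inserting it into the smaller column, whose entry lists
  this insertion; the lists of the table are inverse to each other.\<close>

lemma remove_iff:
  assumes j: "j < ncls T" and n: "n \<in> zcol_set T j q"
  shows "zcol_set T j q - {n} \<in> zcols T \<longleftrightarrow> (\<exists>i k. (i, n - nblk T * q, k) \<in> set (inns T j))"
proof
  assume "\<exists>i k. (i, n - nblk T * q, k) \<in> set (inns T j)"
  then obtain i k where ik: "(i, n - nblk T * q, k) \<in> set (inns T j)" by blast
  show "zcol_set T j q - {n} \<in> zcols T"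
    using inns_edge_shift(3)[OF ik j] inns_edge_shift(4)[OF ik j, of q] by (auto simp: zcols_eq)
next
  assume "zcol_set T j q - {n} \<in> zcols T"
  then obtain k p where k: "k < ncls T" "zcol_set T j q - {n} = zcol_set T k p" by (auto simp: zcols_eq)
  have ins: "insert n (zcol_set T k p) = zcol_set T j q" using n unfolding k(2)[symmetric] by blast
  have nn: "n \<notin> zcol_set T k p" unfolding k(2)[symmetric] by blast
  have "insert n (zcol_set T k p) \<in> zcols T" using j by (auto simp: ins zcols_eq)
  then obtain i l where il: "(i, n - nblk T * p, l) \<in> set (outs T k)" using add_iff[OF k(1) nn] by blast
  have "zcol_set T l (p + (if i = 0 then 1 else 0)) = zcol_set T j q"
    using outs_edge_shift(3)[OF il k(1), of p] ins by simp
  then have l: "l = j" "q = p + (if i = 0 then 1 else 0)"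
    using zcol_set_inject outs_edge(3)[OF il k(1)] j by blast+
  have "(i, n - nblk T * p - sup0 T i, k) \<in> set (inns T j)" using outs_edge(5)[OF il k(1)] l by simp
  moreover have "n - nblk T * p - sup0 T i = n - nblk T * q" by (simp add: l sup0_def algebra_simps)
  ultimately show "\<exists>i k. (i, n - nblk T * q, k) \<in> set (inns T j)" by metis
qed

section \<open>From sets of integers back to sets of blocks\<close>

lemma blk_image_iff [simp]: "blk T ` Y = blk T ` Z \<longleftrightarrow> Y = Z"
  by (rule inj_image_eq_iff[OF inj_blk])

lemma blk_mem_image [simp]: "blk T n \<in> blk T ` Y \<longleftrightarrow> n \<in> Y"
  by (rule inj_image_mem_iff[OF inj_blk])

lemma subset_blocksE:
  assumes "S \<subseteq> blocks T"
  obtains Y where "S = blk T ` Y"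
proof
  show "S = blk T ` (blk T -` S)" using assms by (auto simp: blocks_eq)
qed

lemma zcube_decomp: "zcube T n = ncub T * (n div nblk T) + cube_list T ! nat (n mod nblk T)"
  and zcube_c: "1 \<le> cube_list T ! nat (n mod nblk T)" "cube_list T ! nat (n mod nblk T) \<le> ncub T"
proof -
  have "nat (n mod nblk T) < nat (nblk T)" using nblk_pos[of T] by (simp add: nat_less_iff)
  then show "1 \<le> cube_list T ! nat (n mod nblk T)" "cube_list T ! nat (n mod nblk T) \<le> ncub T"
    by (rule cube_list_range)+
qed (rule zcube_def)

lemma bdd_zcube: "bdd_above Y \<longleftrightarrow> (\<exists>K. \<forall>n \<in> Y. zcube T n \<le> K)"
proof
  assume "bdd_above Y"
  then obtain M where M: "\<And>n. n \<in> Y \<Longrightarrow> n \<le> M" by (auto simp: bdd_above_def)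
  have "zcube T n \<le> ncub T * (M div nblk T) + ncub T" if "n \<in> Y" for n
  proof -
    have "n div nblk T \<le> M div nblk T" using M[OF that] nblk_pos[of T] by (simp add: zdiv_mono1)
    then have "ncub T * (n div nblk T) \<le> ncub T * (M div nblk T)"
      using ncub_pos[of T] by (simp add: mult_left_mono)
    then show ?thesis using zcube_c(2)[of T n] unfolding zcube_decomp by linarith
  qed
  then show "\<exists>K. \<forall>n \<in> Y. zcube T n \<le> K" by blast
next
  assume "\<exists>K. \<forall>n \<in> Y. zcube T n \<le> K"
  then obtain K where K: "\<And>n. n \<in> Y \<Longrightarrow> zcube T n \<le> K" by blast
  have "n \<le> nblk T * (\<bar>K\<bar> + 1)" if "n \<in> Y" for n
  proof -
    have "ncub T * (n div nblk T) \<le> \<bar>K\<bar>"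
      using K[OF that] zcube_c(1)[of T n] unfolding zcube_decomp by linarith
    moreover have "1 \<le> ncub T" using ncub_pos[of T] by linarith
    then have "\<bar>K\<bar> \<le> ncub T * \<bar>K\<bar>" using mult_right_mono[of 1 "ncub T" "\<bar>K\<bar>"] by simp
    ultimately have "ncub T * (n div nblk T) \<le> ncub T * \<bar>K\<bar>" by linarith
    then have "n div nblk T \<le> \<bar>K\<bar>" using ncub_pos[of T] by (simp only: mult_le_cancel_left_pos)
    then have "nblk T * (n div nblk T) \<le> nblk T * \<bar>K\<bar>"
      using nblk_pos[of T] by (simp add: mult_left_mono)
    moreover have "n mod nblk T < nblk T" using nblk_pos[of T] by simp
    ultimately show ?thesis using mult_div_mod_eq[of "nblk T" n] unfolding distrib_left by linarith
  qed
  then show "bdd_above Y" by (auto simp: bdd_above_def)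
qed

lemma proper_column_blk: "proper_column T (blk T ` Y) \<longleftrightarrow> ideal T Y"
proof -
  have "(\<forall>b \<in> blk T ` Y. \<forall>c \<in> blocks T. rests_on b c \<longrightarrow> c \<in> blk T ` Y) \<longleftrightarrow>
      (\<forall>n \<in> Y. \<forall>m. n - m \<in> set (offs T n) \<longrightarrow> m \<in> Y)"
    by (auto simp: blocks_eq rests_on_blk)
  also have "\<dots> \<longleftrightarrow> (\<forall>n \<in> Y. \<forall>d \<in> set (offs T n). n - d \<in> Y)"
  proof -
    have "(\<forall>m. n - m \<in> set (offs T n) \<longrightarrow> m \<in> Y) \<longleftrightarrow> (\<forall>d \<in> set (offs T n). n - d \<in> Y)" for n
    proof
      assume *: "\<forall>m. n - m \<in> set (offs T n) \<longrightarrow> m \<in> Y"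
      show "\<forall>d \<in> set (offs T n). n - d \<in> Y"
      proof
        fix d assume "d \<in> set (offs T n)"
        then show "n - d \<in> Y" using *[rule_format, of "n - d"] by simp
      qed
    next
      assume *: "\<forall>d \<in> set (offs T n). n - d \<in> Y"
      show "\<forall>m. n - m \<in> set (offs T n) \<longrightarrow> m \<in> Y"
      proof (intro allI impI)
        fix m assume "n - m \<in> set (offs T n)"
        from bspec[OF * this] show "m \<in> Y" by simp
      qed
    qed
    then show ?thesis by simp
  qed
  finally show ?thesis
    unfolding proper_column_def ideal_def bdd_zcube[of Y T] by (auto simp: blocks_eq)
qed

definition colset :: "affine_type \<Rightarrow> nat \<Rightarrow> int \<Rightarrow> block set" where
  "colset T j q = blk T ` zcol_set T j q"

lemma zcol_set_0mem: "\<exists>p. nblk T * p \<in> zcol_set T j q"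
proof -
  obtain a xs where r: "rep T j = (a, xs)" by fastforce
  define p where "p = - \<bar>a\<bar> - 1"
  have "nblk T * p \<le> 1 * p" using nblk_ge[of T] by (intro mult_right_mono_neg) (auto simp: p_def)
  then have "nblk T * p < a" by (simp add: p_def)
  then have "nblk T * (p + q) \<in> zcol_set T j q" by (simp add: zcol_set_def r cset_eq distrib_left)
  then show ?thesis by blast
qed

lemma shift_blk: "blk T ` shift (nblk T * q) Y = move T (ncub T * q) (flips T q) ` blk T ` Y"
  by (simp add: shift_def image_image move_blk)

text \<open>A single 0-block of the column already fixes the move, by
  \<open>symmetry_of_pattern\<close>. Equivalence of Young columns is therefore the same as a shift
  by periods.\<close>

lemma column_equiv_blk:
  assumes "nblk T * p \<in> Y"
  shows "column_equiv T (blk T ` Y) Z \<longleftrightarrow> (\<exists>q. Z = blk T ` shift (nblk T * q) Y)"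
proof
  assume "column_equiv T (blk T ` Y) Z"
  then obtain d \<rho> where dr: "Z = move T d \<rho> ` blk T ` Y"
    "\<And>b. b \<in> blk T ` Y \<Longrightarrow> move T d \<rho> b \<in> blocks T \<and> colour T (move T d \<rho> b) = colour T b"
    unfolding column_equiv_def by blast
  have "colour T (blk T (nblk T * p)) = 0" by (simp add: colour_blk zcol_0_iff)
  then obtain q where "d = ncub T * q" "\<rho> = flips T q"
    using symmetry_of_pattern[of T d \<rho> p] dr(2)[OF imageI[OF assms]] by metis
  then show "\<exists>q. Z = blk T ` shift (nblk T * q) Y" using dr(1) by (auto simp: shift_blk)
next
  assume "\<exists>q. Z = blk T ` shift (nblk T * q) Y"
  then obtain q where "Z = move T (ncub T * q) (flips T q) ` blk T ` Y" by (auto simp: shift_blk)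
  moreover have "move T (ncub T * q) (flips T q) b \<in> blocks T \<and>
      colour T (move T (ncub T * q) (flips T q) b) = colour T b" if "b \<in> blk T ` Y" for b
    using that by (auto simp: move_blk colour_blk blocks_eq)
  ultimately show "column_equiv T (blk T ` Y) Z" unfolding column_equiv_def by blast
qed

lemma column_equiv_colset: "column_equiv T (colset T j p) Z \<longleftrightarrow> (\<exists>q. Z = colset T j q)"
proof -
  obtain m where m: "nblk T * m \<in> zcol_set T j p" using zcol_set_0mem by blast
  have "column_equiv T (colset T j p) Z \<longleftrightarrow> (\<exists>q. Z = colset T j (p + q))"
    unfolding colset_def column_equiv_blk[OF m] shift_zcol_set ..
  also have "\<dots> \<longleftrightarrow> (\<exists>q. Z = colset T j q)" by (metis add.commute diff_add_cancel)
  finally show ?thesis .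
qed

lemma cube_blocks_zcube: "cube_blocks T k = blk T ` {n. zcube T n = k}"
proof (intro equalityI subsetI)
  fix b assume b: "b \<in> cube_blocks T k"
  then have "b \<in> blocks T" by (auto simp: blocks_def)
  then obtain n where n: "b = blk T n" by (auto simp: blocks_eq)
  have "fst b = k" using cube_blocks_cells[OF b] by simp
  then show "b \<in> blk T ` {n. zcube T n = k}" using n by simp
next
  fix b assume "b \<in> blk T ` {n. zcube T n = k}"
  then show "b \<in> cube_blocks T k" using blk_in_cube by auto
qed

lemma zcube_mono: "n \<le> m \<Longrightarrow> zcube T n \<le> zcube T m"
proof -
  assume nm: "n \<le> m"
  have d: "n div nblk T \<le> m div nblk T" using nm nblk_pos[of T] by (simp add: zdiv_mono1)
  show ?thesis
  proof (cases "n div nblk T = m div nblk T")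
    case True
    have s: "sorted (cube_list T)" "length (cube_list T) = nat (nblk T)" by (cases T; simp)+
    have "n mod nblk T \<le> m mod nblk T"
      using nm mult_div_mod_eq[of "nblk T" n, unfolded True] mult_div_mod_eq[of "nblk T" m] by linarith
    then have "nat (n mod nblk T) \<le> nat (m mod nblk T)" by simp
    moreover have "nat (m mod nblk T) < nat (nblk T)" using nblk_pos[of T] by (simp add: nat_less_iff)
    ultimately show ?thesis using sorted_nth_mono[OF s(1)] s(2) by (simp add: zcube_decomp True)
  next
    case False
    then have "n div nblk T + 1 \<le> m div nblk T" using d by linarith
    then have "ncub T * (n div nblk T + 1) \<le> ncub T * (m div nblk T)"
      by (rule mult_left_mono[OF _ less_imp_le[OF ncub_pos]])
    then show ?thesis
      using zcube_c(2)[of T n] zcube_c(1)[of T m] unfolding zcube_decomp distrib_left by linarith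
  qed
qed

lemma zcube_le_iff:
  assumes "zcube T m = k" "zcube T (m + 1) = k + 1"
  shows "zcube T n \<le> k \<longleftrightarrow> n \<le> m"
  using assms zcube_mono[of n m T] zcube_mono[of "m + 1" n T] by force

lemma special_blocks_check:
  "zcube E8 12 = 4 \<and> zcube E8 13 = 5 \<and> zcube E8 14 = 5 \<and> zcube E8 15 = 5 \<and> zcube E8 16 = 6 \<and>
   zcube E8 17 = 6 \<and> zcube E8 18 = 7 \<and> zcube E8 19 = 7 \<and> zcube E8 20 = 7 \<and> zcube E8 21 = 8 \<and>
   zcol E8 13 = 2 \<and> zcol E8 14 = 3 \<and> zcol E8 15 = 5 \<and> zcol E8 18 = 2 \<and> zcol E8 19 = 3 \<and> zcol E8 20 = 5 \<and>
   base_cells E8 17 = filter (\<lambda>x. fst x > 3) (cell_list E8) \<and> rep E8 128 = (13, [14, 15, 17]) \<and>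
   rep E8 144 = (16, [17, 18])"
  by code_simp

lemma blk_17: "blk E8 17 = (6, {4..6} \<times> UNIV)"
  using special_blocks_check half_cells(2) by (simp add: blk_def move_rotq flips_def)

lemma zcube_5: "zcube E8 n = 5 \<longleftrightarrow> n = 13 \<or> n = 14 \<or> n = 15"
proof -
  have "zcube E8 n \<le> 4 \<longleftrightarrow> n \<le> 12" "zcube E8 n \<le> 5 \<longleftrightarrow> n \<le> 15"
    using zcube_le_iff[of E8 12 4 n] zcube_le_iff[of E8 15 5 n] special_blocks_check by simp_all
  then show ?thesis by presburger
qed

lemma zcube_7: "zcube E8 n = 7 \<longleftrightarrow> n = 18 \<or> n = 19 \<or> n = 20"
proof -
  have "zcube E8 n \<le> 6 \<longleftrightarrow> n \<le> 17" "zcube E8 n \<le> 7 \<longleftrightarrow> n \<le> 20"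
    using zcube_le_iff[of E8 17 6 n] zcube_le_iff[of E8 20 7 n] special_blocks_check by simp_all
  then show ?thesis by presburger
qed

lemma special1_eq: "special1 = colset E8 128 0"
proof -
  have a: "(\<Union>k \<in> {..4}. cube_blocks E8 k) = blk E8 ` {..12}"
    using zcube_le_iff[of E8 12 4] special_blocks_check by (auto simp: cube_blocks_zcube)
  have b: "{b \<in> cube_blocks E8 5. colour E8 b \<in> {5, 3}} = blk E8 ` {14, 15}"
    using special_blocks_check by (auto simp: cube_blocks_zcube colour_blk zcube_5)
  have "special1 = blk E8 ` ({..12} \<union> {14, 15} \<union> {17})"
    unfolding special1_def a b blk_17[symmetric] by auto
  also have "{..12} \<union> {14, 15} \<union> {17} = cset (rep E8 128)"
    using special_blocks_check by (auto simp: cset_eq)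
  finally show ?thesis by (simp add: colset_def zcol_set_0)
qed

lemma special2_eq: "special2 = colset E8 144 0"
proof -
  have a: "(\<Union>k \<in> {..5}. cube_blocks E8 k) = blk E8 ` {..15}"
    using zcube_le_iff[of E8 15 5] special_blocks_check by (auto simp: cube_blocks_zcube)
  have b: "{b \<in> cube_blocks E8 7. colour E8 b = 2} = blk E8 ` {18}"
    using special_blocks_check by (auto simp: cube_blocks_zcube colour_blk zcube_7)
  have "special2 = blk E8 ` ({..15} \<union> {17} \<union> {18})"
    unfolding special2_def a b blk_17[symmetric] by auto
  also have "{..15} \<union> {17} \<union> {18} = cset (rep E8 144)"
    using special_blocks_check by (auto simp: cset_eq)
  finally show ?thesis by (simp add: colset_def zcol_set_0)
qed

lemma columns_eq_zcols: "columns T = (`) (blk T) ` zcols T"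
proof (intro equalityI subsetI)
  fix S assume S: "S \<in> columns T"
  show "S \<in> (`) (blk T) ` zcols T"
  proof (cases "proper_column T S")
    case True
    then have "S \<subseteq> blocks T" by (simp add: proper_column_def)
    then obtain Y where Y: "S = blk T ` Y" by (rule subset_blocksE)
    then have "Y \<in> zcols T" using True by (simp add: proper_column_blk zcols_def)
    then show ?thesis using Y by blast
  next
    case False
    then have T: "T = E8" and "column_equiv E8 special1 S \<or> column_equiv E8 special2 S"
      using S by (auto simp: columns_def)
    then obtain s q where "special T s" "S = colset T s q"
      unfolding special1_eq special2_eq column_equiv_colset by (auto simp: special_def)
    then show ?thesis by (auto simp: colset_def zcols_def)
  qed
next
  fix S assume "S \<in> (`) (blk T) ` zcols T"
  then obtain Y where Y: "S = blk T ` Y" "Y \<in> zcols T" by blast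
  then consider "ideal T Y" | s q where "special T s" "Y = zcol_set T s q" by (auto simp: zcols_def)
  then show "S \<in> columns T"
  proof cases
    case 1 then show ?thesis using Y by (simp add: columns_def proper_column_blk)
  next
    case 2
    then have "T = E8" "s = 128 \<or> s = 144" by (auto simp: special_def)
    moreover from this have "S = colset E8 s q" using 2 Y by (simp add: colset_def)
    ultimately have "column_equiv E8 special1 S \<or> column_equiv E8 special2 S"
      unfolding special1_eq special2_eq column_equiv_colset by blast
    then show ?thesis using \<open>T = E8\<close> by (simp add: columns_def)
  qed
qed

lemma columns_eq: "columns T = {colset T j q | j q. j < ncls T}"
  unfolding columns_eq_zcols zcols_eq colset_def by blast

lemma blk_in_columns: "blk T ` Y \<in> columns T \<longleftrightarrow> Y \<in> zcols T"
  by (auto simp: columns_eq_zcols)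

lemma colset_inject: "j < ncls T \<Longrightarrow> k < ncls T \<Longrightarrow> colset T j q = colset T k p \<longleftrightarrow> j = k \<and> q = p"
  using zcol_set_inject[of T j q k p] by (auto simp: colset_def)

lemma colset_in_columns [simp]: "j < ncls T \<Longrightarrow> colset T j q \<in> columns T"
  by (auto simp: columns_eq)


section \<open>The crystal of Young columns\<close>

definition dz :: "nat \<Rightarrow> int" where
  "dz i = (if i = 0 then 1 else 0)"

lemma zcube_period: "zcube T (n + nblk T * q) = zcube T n + ncub T * q"
  by (simp add: zcube_def distrib_left)

lemma onc_period: "onc T c (n + nblk T * q) = onc T c n"
proof -
  have "zcol T (n + nblk T * q - d) = zcol T (n - d)" for d
    using zcol_period[of T "n - d" q] by (simp add: algebra_simps)
  then show ?thesis by (simp add: onc_def)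
qed

lemma on_colour_blk: "on_colour T c (blk T n) \<longleftrightarrow> onc T c n"
proof -
  have "on_colour T c (blk T n) \<longleftrightarrow> (\<exists>m. n - m \<in> set (offs T n) \<and> zcol T m = c)"
    by (auto simp: on_colour_def blocks_eq rests_on_blk colour_blk)
  also have "\<dots> \<longleftrightarrow> (\<exists>d \<in> set (offs T n). zcol T (n - d) = c)"
  proof
    assume "\<exists>m. n - m \<in> set (offs T n) \<and> zcol T m = c"
    then obtain m where "n - m \<in> set (offs T n)" "zcol T (n - (n - m)) = c" by auto
    then show "\<exists>d \<in> set (offs T n). zcol T (n - d) = c" by blast
  next
    assume "\<exists>d \<in> set (offs T n). zcol T (n - d) = c"
    then obtain d where "n - (n - d) \<in> set (offs T n)" "zcol T (n - d) = c" by auto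
    then show "\<exists>m. n - m \<in> set (offs T n) \<and> zcol T m = c" by blast
  qed
  finally show ?thesis by (simp add: onc_def list_ex_iff)
qed

lemma addable_colset:
  assumes j: "j < ncls T"
  shows "addable T i (colset T j q) = {blk T (n + nblk T * q) | n k. (i, n, k) \<in> set (outs T j)}"
proof (intro equalityI subsetI)
  fix b assume b: "b \<in> addable T i (colset T j q)"
  then obtain m where m: "b = blk T m" by (auto simp: addable_def blocks_eq)
  have mm: "zcol T m = i" "m \<notin> zcol_set T j q"
    using b by (auto simp: addable_def m colour_blk colset_def)
  have "insert (blk T m) (colset T j q) = blk T ` insert m (zcol_set T j q)" by (simp add: colset_def)
  then have "insert m (zcol_set T j q) \<in> zcols T"
    using b blk_in_columns[of T "insert m (zcol_set T j q)"] by (simp add: addable_def m)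
  then obtain i' k where k: "(i', m - nblk T * q, k) \<in> set (outs T j)" using add_iff[OF j mm(2)] by blast
  have "i' = i" using outs_edge_shift(2)[OF k j, of q] mm(1) by simp
  then have "b = blk T ((m - nblk T * q) + nblk T * q)" "(i, m - nblk T * q, k) \<in> set (outs T j)"
    using k m by simp_all
  then show "b \<in> {blk T (n + nblk T * q) | n k. (i, n, k) \<in> set (outs T j)}" by blast
next
  fix b assume "b \<in> {blk T (n + nblk T * q) | n k. (i, n, k) \<in> set (outs T j)}"
  then obtain n k where n: "b = blk T (n + nblk T * q)" "(i, n, k) \<in> set (outs T j)" by blast
  note e = outs_edge_shift[OF n(2) j, of q]
  have "insert b (colset T j q) = colset T k (q + (if i = 0 then 1 else 0))"
    using arg_cong[OF e(3), of "(`) (blk T)"] by (simp add: colset_def n(1))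
  then show "b \<in> addable T i (colset T j q)"
    using e outs_edge(3)[OF n(2) j] by (simp add: addable_def n(1) colour_blk blocks_eq) (simp add: colset_def)
qed

lemma removable_colset:
  assumes j: "j < ncls T"
  shows "removable T i (colset T j q) = {blk T (n + nblk T * q) | n k. (i, n, k) \<in> set (inns T j)}"
proof (intro equalityI subsetI)
  fix b assume b: "b \<in> removable T i (colset T j q)"
  then obtain m where m: "b = blk T m" "m \<in> zcol_set T j q" by (auto simp: removable_def colset_def)
  have mm: "zcol T m = i" using b by (simp add: removable_def m colour_blk)
  have "colset T j q - {blk T m} = blk T ` (zcol_set T j q - {m})" by (auto simp: colset_def)
  then have "zcol_set T j q - {m} \<in> zcols T"
    using b blk_in_columns[of T "zcol_set T j q - {m}"] by (simp add: removable_def m)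
  then obtain i' k where k: "(i', m - nblk T * q, k) \<in> set (inns T j)" using remove_iff[OF j m(2)] by blast
  have "i' = i" using inns_edge_shift(2)[OF k j, of q] mm by simp
  then have "b = blk T ((m - nblk T * q) + nblk T * q)" "(i, m - nblk T * q, k) \<in> set (inns T j)"
    using k m by simp_all
  then show "b \<in> {blk T (n + nblk T * q) | n k. (i, n, k) \<in> set (inns T j)}" by blast
next
  fix b assume "b \<in> {blk T (n + nblk T * q) | n k. (i, n, k) \<in> set (inns T j)}"
  then obtain n k where n: "b = blk T (n + nblk T * q)" "(i, n, k) \<in> set (inns T j)" by blast
  note e = inns_edge_shift(1,2)[OF n(2) j, of q] inns_edge_shift(4)[OF n(2) j, of q]
  have "colset T j q - {b} = blk T ` (zcol_set T j q - {n + nblk T * q})"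
    by (auto simp: colset_def n(1))
  then have "colset T j q - {b} = colset T k (q - (if i = 0 then 1 else 0))"
    by (simp only: e(3)) (simp add: colset_def)
  then show "b \<in> removable T i (colset T j q)"
    using e inns_edge_shift(3)[OF n(2) j] by (simp add: removable_def n(1) colour_blk) (simp add: colset_def)
qed

lemma findc_Some: "findc i L = Some (i', n, k) \<Longrightarrow> i' = i \<and> (i, n, k) \<in> set L"
  unfolding findc_def by (induction L) (auto split: if_splits)

lemma findc_None: "findc i L = None \<longleftrightarrow> (\<forall>n k. (i, n, k) \<notin> set L)"
  unfolding findc_def by (auto simp: find_None_iff)

lemma beats_add_all:
  assumes "findc i (outs T j) = Some (i', n, k)" "j < ncls T" "(i, n', k') \<in> set (outs T j)" "n' \<noteq> n"
  shows "beats_add T i n n'"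
  using chk_all[OF assms(2)] assms by (fastforce simp: chk_def chk_ties_def ent_eq list_all_iff)

lemma beats_rem_all:
  assumes "findc i (inns T j) = Some (i', n, k)" "j < ncls T" "(i, n', k') \<in> set (inns T j)" "n' \<noteq> n"
  shows "beats_rem T i n n'"
  using chk_all[OF assms(2)] assms by (fastforce simp: chk_def chk_ties_def ent_eq list_all_iff)

text \<open>For colour 4 the rule only asks the selected block to lie on a 5-block. Uniqueness also
  needs that no competitor lies on one, which is why \<open>beats_add\<close> demands both.\<close>

lemma add_block_colset:
  assumes f: "findc i (outs T j) = Some (i', n, k)" and j: "j < ncls T"
  shows "add_block T i (colset T j q) = blk T (n + nblk T * q)"
  unfolding add_block_def
proof (rule the_equality)
  let ?A = "addable T i (colset T j q)" and ?b = "blk T (n + nblk T * q)"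
  have n: "(i, n, k) \<in> set (outs T j)" using findc_Some[OF f] by simp
  have mem: "?b \<in> ?A" using n unfolding addable_colset[OF j] by blast
  have beat: "if i = 4 then on_colour T 5 ?b \<and> \<not> on_colour T 5 b' else fst b' < fst ?b"
    if b': "b' \<in> ?A - {?b}" for b'
  proof -
    obtain n' k' where n': "b' = blk T (n' + nblk T * q)" "(i, n', k') \<in> set (outs T j)"
      using b' unfolding addable_colset[OF j] by blast
    then have "n' \<noteq> n" using b' by auto
    from beats_add_all[OF f j n'(2) this] show ?thesis
      by (simp add: beats_add_def n'(1) on_colour_blk onc_period zcube_period)
  qed
  show "?b \<in> ?A \<and> (\<forall>b' \<in> ?A - {?b}. if i = 4 then on_colour T 5 ?b else fst b' < fst ?b)"
    using mem beat by (auto split: if_splits)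
  fix b assume b: "b \<in> ?A \<and> (\<forall>b' \<in> ?A - {b}. if i = 4 then on_colour T 5 b else fst b' < fst b)"
  show "b = ?b"
  proof (rule ccontr)
    assume "b \<noteq> ?b"
    then have "if i = 4 then on_colour T 5 b else fst ?b < fst b" using b mem by blast
    moreover have "if i = 4 then on_colour T 5 ?b \<and> \<not> on_colour T 5 b else fst b < fst ?b"
      using beat[of b] b \<open>b \<noteq> ?b\<close> by blast
    ultimately show False by (auto split: if_splits)
  qed
qed

lemma remove_block_colset:
  assumes f: "findc i (inns T j) = Some (i', n, k)" and j: "j < ncls T"
  shows "remove_block T i (colset T j q) = blk T (n + nblk T * q)"
  unfolding remove_block_def
proof (rule the_equality)
  let ?A = "removable T i (colset T j q)" and ?b = "blk T (n + nblk T * q)"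
  have n: "(i, n, k) \<in> set (inns T j)" using findc_Some[OF f] by simp
  have mem: "?b \<in> ?A" using n unfolding removable_colset[OF j] by blast
  have beat: "if i = 4 then on_colour T 3 ?b \<and> \<not> on_colour T 3 b' else fst ?b < fst b'"
    if b': "b' \<in> ?A - {?b}" for b'
  proof -
    obtain n' k' where n': "b' = blk T (n' + nblk T * q)" "(i, n', k') \<in> set (inns T j)"
      using b' unfolding removable_colset[OF j] by blast
    then have "n' \<noteq> n" using b' by auto
    from beats_rem_all[OF f j n'(2) this] show ?thesis
      by (simp add: beats_rem_def n'(1) on_colour_blk onc_period zcube_period)
  qed
  show "?b \<in> ?A \<and> (\<forall>b' \<in> ?A - {?b}. if i = 4 then on_colour T 3 ?b else fst ?b < fst b')"
    using mem beat by (auto split: if_splits)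
  fix b assume b: "b \<in> ?A \<and> (\<forall>b' \<in> ?A - {b}. if i = 4 then on_colour T 3 b else fst b < fst b')"
  show "b = ?b"
  proof (rule ccontr)
    assume "b \<noteq> ?b"
    then have "if i = 4 then on_colour T 3 b else fst b < fst ?b" using b mem by blast
    moreover have "if i = 4 then on_colour T 3 ?b \<and> \<not> on_colour T 3 b else fst ?b < fst b"
      using beat[of b] b \<open>b \<noteq> ?b\<close> by blast
    ultimately show False by (auto split: if_splits)
  qed
qed

lemma add_step_colset:
  assumes j: "j < ncls T"
  shows "add_step T i (colset T j q) = map_option (\<lambda>k. colset T k (q + dz i)) (fst_out T i j)"
proof (cases "findc i (outs T j)")
  case None
  then have "addable T i (colset T j q) = {}" by (auto simp: addable_colset[OF j] findc_None)
  then show ?thesis by (simp add: add_step_def fst_out_def None)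
next
  case (Some e)
  obtain i' n k where e: "e = (i', n, k)" by (cases e)
  have n: "(i, n, k) \<in> set (outs T j)" using findc_Some Some e by blast
  have "addable T i (colset T j q) \<noteq> {}" using n unfolding addable_colset[OF j] by blast
  moreover have "insert (blk T (n + nblk T * q)) (colset T j q) = colset T k (q + dz i)"
    using arg_cong[OF outs_edge_shift(3)[OF n j, of q], of "(`) (blk T)"] by (simp add: colset_def dz_def)
  ultimately show ?thesis
    using add_block_colset[OF Some[unfolded e] j, of q] by (simp add: add_step_def fst_out_def Some e)
qed

lemma remove_step_colset:
  assumes j: "j < ncls T"
  shows "remove_step T i (colset T j q) = map_option (\<lambda>k. colset T k (q - dz i)) (fst_inn T i j)"
proof (cases "findc i (inns T j)")
  case None
  then have "removable T i (colset T j q) = {}" by (auto simp: removable_colset[OF j] findc_None)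
  then show ?thesis by (simp add: remove_step_def fst_inn_def None)
next
  case (Some e)
  obtain i' n k where e: "e = (i', n, k)" by (cases e)
  have n: "(i, n, k) \<in> set (inns T j)" using findc_Some Some e by blast
  have "removable T i (colset T j q) \<noteq> {}" using n unfolding removable_colset[OF j] by blast
  moreover have "colset T j q - {blk T (n + nblk T * q)} = blk T ` (zcol_set T j q - {n + nblk T * q})"
    by (auto simp: colset_def)
  then have "colset T j q - {blk T (n + nblk T * q)} = colset T k (q - dz i)"
    using inns_edge_shift(4)[OF n j, of q] by (simp add: colset_def dz_def)
  ultimately show ?thesis
    using remove_block_colset[OF Some[unfolded e] j, of q] by (simp add: remove_step_def fst_inn_def Some e)
qed

lemma fst_out_SomeD:
  assumes "fst_out T i j = Some k" "j < ncls T"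
  shows "k < ncls T" "\<exists>n. (i, n, k) \<in> set (outs T j)" "\<exists>n. (i, n, j) \<in> set (inns T k)"
proof -
  obtain i' n where "findc i (outs T j) = Some (i', n, k)" using assms by (auto simp: fst_out_def)
  then have n: "(i, n, k) \<in> set (outs T j)" using findc_Some by blast
  show "k < ncls T" "\<exists>n. (i, n, k) \<in> set (outs T j)" "\<exists>n. (i, n, j) \<in> set (inns T k)"
    using outs_edge(3,5)[OF n assms(2)] n by blast+
qed

lemma fst_inn_SomeD:
  assumes "fst_inn T i j = Some k" "j < ncls T"
  shows "k < ncls T" "\<exists>n. (i, n, k) \<in> set (inns T j)" "\<exists>n. (i, n, j) \<in> set (outs T k)"
proof -
  obtain i' n where "findc i (inns T j) = Some (i', n, k)" using assms by (auto simp: fst_inn_def)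
  then have n: "(i, n, k) \<in> set (inns T j)" using findc_Some by blast
  show "k < ncls T" "\<exists>n. (i, n, k) \<in> set (inns T j)" "\<exists>n. (i, n, j) \<in> set (outs T k)"
    using inns_edge[OF n assms(2)] n by blast+
qed

lemma mid_string_colset:
  assumes j: "j < ncls T"
  shows "mid_string T i (colset T j q) \<longleftrightarrow> midt T j i"
proof -
  have a: "addable T i (colset T j q) \<noteq> {} \<longleftrightarrow> findc i (outs T j) \<noteq> None"
    unfolding addable_colset[OF j] findc_None by blast
  have r: "removable T i (colset T j q) \<noteq> {} \<longleftrightarrow> findc i (inns T j) \<noteq> None"
    unfolding removable_colset[OF j] findc_None by blast
  have out: "(\<exists>Y' \<in> columns T. add_step T i Y' = Some (colset T j q)) \<longleftrightarrow>
      (\<exists>n k. (i, n, k) \<in> set (inns T j) \<and> fst_out T i k = Some j)" (is "?L \<longleftrightarrow> ?R")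
  proof
    assume ?L
    then obtain k p where k: "k < ncls T" "add_step T i (colset T k p) = Some (colset T j q)"
      by (auto simp: columns_eq)
    then obtain l where l: "fst_out T i k = Some l" "colset T l (p + dz i) = colset T j q"
      by (auto simp: add_step_colset)
    have "l = j" using l colset_inject fst_out_SomeD(1)[OF l(1) k(1)] j by blast
    then show ?R using l fst_out_SomeD(3)[OF l(1) k(1)] by blast
  next
    assume ?R
    then obtain n k where k: "(i, n, k) \<in> set (inns T j)" "fst_out T i k = Some j" by blast
    have "k < ncls T" using inns_edge(1)[OF k(1) j] .
    then have "colset T k (q - dz i) \<in> columns T" "add_step T i (colset T k (q - dz i)) = Some (colset T j q)"
      using k by (simp_all add: add_step_colset)
    then show ?L by blast
  qed
  have inn: "(\<exists>Y' \<in> columns T. remove_step T i Y' = Some (colset T j q)) \<longleftrightarrow>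
      (\<exists>n k. (i, n, k) \<in> set (outs T j) \<and> fst_inn T i k = Some j)" (is "?L \<longleftrightarrow> ?R")
  proof
    assume ?L
    then obtain k p where k: "k < ncls T" "remove_step T i (colset T k p) = Some (colset T j q)"
      by (auto simp: columns_eq)
    then obtain l where l: "fst_inn T i k = Some l" "colset T l (p - dz i) = colset T j q"
      by (auto simp: remove_step_colset)
    have "l = j" using l colset_inject fst_inn_SomeD(1)[OF l(1) k(1)] j by blast
    then show ?R using l fst_inn_SomeD(3)[OF l(1) k(1)] by blast
  next
    assume ?R
    then obtain n k where k: "(i, n, k) \<in> set (outs T j)" "fst_inn T i k = Some j" by blast
    have "k < ncls T" using outs_edge(3)[OF k(1) j] .
    then have "colset T k (q + dz i) \<in> columns T" "remove_step T i (colset T k (q + dz i)) = Some (colset T j q)"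
      using k by (simp_all add: remove_step_colset)
    then show ?L by blast
  qed
  have "midt T j i \<longleftrightarrow> findc i (outs T j) \<noteq> None \<and> findc i (inns T j) \<noteq> None \<and>
      ((\<exists>n k. (i, n, k) \<in> set (inns T j) \<and> fst_out T i k = Some j) \<or>
       (\<exists>n k. (i, n, k) \<in> set (outs T j) \<and> fst_inn T i k = Some j))"
    unfolding midt_def ent_eq by (auto simp: list_ex_iff; blast)
  then show ?thesis
    unfolding mid_string_def out inn a r using findc_None by blast
qed

lemma Iset_iff: "i \<in> Iset T \<longleftrightarrow> i < Suc (rnk T)"
  by (auto simp: Iset_def)

lemma kind_lt: "kind T j = Some i \<Longrightarrow> T = E8 \<and> i \<in> Iset T"
  by (cases T) (auto simp: Iset_def split: if_splits)

lemma mid_string_kind: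
  assumes "j < ncls T" "i \<in> Iset T"
  shows "mid_string T i (colset T j q) \<longleftrightarrow> kind T j = Some i"
  using chk_all[OF assms(1)] assms(2)
  by (simp add: mid_string_colset[OF assms(1)] chk_def chk_mid_def list_all_iff Iset_iff del: upt_Suc)

lemma column_ff_colset:
  assumes "j < ncls T" "i \<in> Iset T"
  shows "column_ff T i (colset T j q) = map_option (\<lambda>k. colset T k (q + dz i)) (F T j i)"
proof -
  have "(T = E8 \<and> (\<exists>k \<in> Iset T - {i}. mid_string T k (colset T j q))) \<longleftrightarrow> (\<exists>k. kind T j = Some k \<and> k \<noteq> i)"
    using mid_string_kind[OF assms(1)] kind_lt[of T j] by auto
  then show ?thesis
    using add_step_colset[OF assms(1), of i q] by (auto simp: column_ff_def F_def split: option.splits)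
qed

lemma column_ee_colset:
  assumes "j < ncls T" "i \<in> Iset T"
  shows "column_ee T i (colset T j q) = map_option (\<lambda>k. colset T k (q - dz i)) (E T j i)"
proof -
  have "(T = E8 \<and> (\<exists>k \<in> Iset T - {i}. mid_string T k (colset T j q))) \<longleftrightarrow> (\<exists>k. kind T j = Some k \<and> k \<noteq> i)"
    using mid_string_kind[OF assms(1)] kind_lt[of T j] by auto
  then show ?thesis
    using remove_step_colset[OF assms(1), of i q] by (auto simp: column_ee_def E_def split: option.splits)
qed

lemma F_lt: "F T j i = Some k \<Longrightarrow> j < ncls T \<Longrightarrow> k < ncls T"
  using fst_out_SomeD(1) by (auto simp: F_def split: option.splits if_splits)

lemma E_lt: "E T j i = Some k \<Longrightarrow> j < ncls T \<Longrightarrow> k < ncls T"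
  using fst_inn_SomeD(1) by (auto simp: E_def split: option.splits if_splits)

lemma chk_wtD:
  assumes "j < ncls T"
  shows "length (wlist T j) = Suc (rnk T)" "kind T j = None \<longleftrightarrow> (\<exists>x \<in> set (wlist T j). x \<noteq> 0)"
    "i \<in> Iset T \<Longrightarrow> F T j i = Some k \<Longrightarrow> wlist T k = map2 (-) (wlist T j) (alph T ! i) \<and> E T k i = Some j"
    "i \<in> Iset T \<Longrightarrow> E T j i = Some k \<Longrightarrow> F T k i = Some j"
    "i \<in> Iset T \<Longrightarrow> chk_str T (kind T j) i (wlist T j ! i) (fl T j i) (el T j i)"
proof -
  have c: "chk_wt T j" using chk_all[OF assms] by (simp add: chk_def)
  show "length (wlist T j) = Suc (rnk T)" "kind T j = None \<longleftrightarrow> (\<exists>x \<in> set (wlist T j). x \<noteq> 0)"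
    using c by (simp_all add: chk_wt_def list_ex_iff del: upt_Suc)
  have *: "\<forall>i \<in> set [0..<Suc (rnk T)]. (case F T j i of None \<Rightarrow> True
         | Some k \<Rightarrow> wlist T k = map2 (-) (wlist T j) (alph T ! i) \<and> E T k i = Some j) \<and>
       (case E T j i of None \<Rightarrow> True | Some k \<Rightarrow> F T k i = Some j) \<and>
       chk_str T (kind T j) i (wlist T j ! i) (fl T j i) (el T j i)"
    using c unfolding chk_wt_def list_all_iff by blast
  {
    assume i: "i \<in> Iset T"
    then have "i \<in> set [0..<Suc (rnk T)]" by (simp add: Iset_iff del: upt_Suc)
    note r = bspec[OF * this]
    show "chk_str T (kind T j) i (wlist T j ! i) (fl T j i) (el T j i)" using r by blast
    show "F T j i = Some k \<Longrightarrow> wlist T k = map2 (-) (wlist T j) (alph T ! i) \<and> E T k i = Some j"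
      using r by simp
    show "E T j i = Some k \<Longrightarrow> F T k i = Some j" using r by simp
  }
qed

lemma F_E: "F T j i = Some k \<longleftrightarrow> E T k i = Some j" if "j < ncls T" "k < ncls T" "i \<in> Iset T"
  using chk_wtD(3)[OF that(1,3)] chk_wtD(4)[OF that(2,3)] by blast

definition cls :: "affine_type \<Rightarrow> nat \<Rightarrow> block set set" where
  "cls T j = range (colset T j)"

lemma column_class_colset: "j < ncls T \<Longrightarrow> column_class T (colset T j q) = cls T j"
  by (auto simp: column_class_def column_equiv_colset cls_def)

lemma cls_inject: "j < ncls T \<Longrightarrow> k < ncls T \<Longrightarrow> cls T j = cls T k \<longleftrightarrow> j = k"
proof
  assume jk: "j < ncls T" "k < ncls T" "cls T j = cls T k"
  then have "colset T j 0 \<in> cls T k" by (auto simp: cls_def)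
  then show "j = k" using colset_inject jk by (auto simp: cls_def)
qed simp

lemma classes_eq: "column_class T ` columns T = cls T ` {..<ncls T}"
proof -
  have "columns T = (\<Union>j \<in> {..<ncls T}. range (colset T j))" by (auto simp: columns_eq)
  then show ?thesis by (force simp: column_class_colset image_iff)
qed

text \<open>The operator acts in the same way on all translates of a column, so the representative
  chosen by \<open>SOME\<close> is immaterial.\<close>

lemma class_op_cls:
  assumes "\<And>q. g (colset T j q) = map_option (\<lambda>k. colset T k (q + d)) r" "r = Some k \<Longrightarrow> k < ncls T"
    "\<And>l. r = Some l \<Longrightarrow> l < ncls T"
  shows "class_op T g (cls T j) = map_option (cls T) r"
proof -
  have "(SOME Y. Y \<in> cls T j) \<in> cls T j" by (rule someI[of _ "colset T j 0"]) (simp add: cls_def)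
  then obtain q where "(SOME Y. Y \<in> cls T j) = colset T j q" by (auto simp: cls_def)
  then show ?thesis using assms by (cases r) (simp_all add: class_op_def column_class_colset)
qed

lemma class_ff: "j < ncls T \<Longrightarrow> i \<in> Iset T \<Longrightarrow> class_op T (column_ff T i) (cls T j) = map_option (cls T) (F T j i)"
  by (rule class_op_cls[where d = "dz i"]) (auto simp: column_ff_colset F_lt)

lemma class_ee: "j < ncls T \<Longrightarrow> i \<in> Iset T \<Longrightarrow> class_op T (column_ee T i) (cls T j) = map_option (cls T) (E T j i)"
  by (rule class_op_cls[where d = "- dz i"]) (auto simp: column_ee_colset E_lt)


section \<open>The level 1 perfect crystals\<close>

definition wfun :: "affine_type \<Rightarrow> nat \<Rightarrow> cweight" where
  "wfun T j = (\<lambda>i. if i \<in> Iset T then wlist T j ! i else 0)"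

definition pel :: "affine_type \<Rightarrow> nat \<Rightarrow> perfect_elt" where
  "pel T j = (if T = E8 then (case kind T j of None \<Rightarrow> Xel (wfun T j)
     | Some k \<Rightarrow> if k = 0 then Empt else Yel k) else Bel (wfun T j))"

lemma alph_check: "list_all (\<lambda>T. alph T = map (\<lambda>i. map (\<lambda>k. cartan T k i) [0..<Suc (rnk T)]) [0..<Suc (rnk T)])
    [E6, E7, E8]"
  by code_simp

lemma alph_eq: "alph T = map (\<lambda>i. map (\<lambda>k. cartan T k i) [0..<Suc (rnk T)]) [0..<Suc (rnk T)]"
proof -
  have "T \<in> set [E6, E7, E8]" by (cases T) auto
  then show ?thesis using alph_check unfolding list_all_iff by blast
qed

lemma alph_nth:
  assumes "i \<in> Iset T"
  shows "length (alph T ! i) = Suc (rnk T)" "l \<in> Iset T \<Longrightarrow> alph T ! i ! l = csroot T i l"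
proof -
  have i: "i < length [0..<Suc (rnk T)]" "[0..<Suc (rnk T)] ! i = i"
    using assms by (simp_all add: Iset_iff del: upt_Suc)
  have *: "alph T ! i = map (\<lambda>k. cartan T k i) [0..<Suc (rnk T)]"
    using i unfolding alph_eq by (simp del: upt_Suc)
  show "length (alph T ! i) = Suc (rnk T)" unfolding * by simp
  assume l: "l \<in> Iset T"
  then have "l < length [0..<Suc (rnk T)]" "[0..<Suc (rnk T)] ! l = l"
    by (simp_all add: Iset_iff del: upt_Suc)
  then show "alph T ! i ! l = csroot T i l"
    using l unfolding * by (simp add: csroot_def fund_comb_def del: upt_Suc)
qed

lemma csroot_out: "l \<notin> Iset T \<Longrightarrow> csroot T i l = 0"
  by (simp add: csroot_def fund_comb_def)

lemma csroot_self: "i \<in> Iset T \<Longrightarrow> csroot T i i = 2"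
  by (simp add: csroot_def fund_comb_def cartan_def)

lemma wfun_out: "l \<notin> Iset T \<Longrightarrow> wfun T j l = 0"
  by (simp add: wfun_def)

lemma wfun_F:
  assumes "j < ncls T" "i \<in> Iset T" "F T j i = Some k"
  shows "wfun T k = wfun T j - csroot T i"
proof
  fix l
  show "wfun T k l = (wfun T j - csroot T i) l"
  proof (cases "l \<in> Iset T")
    case True
    have "wlist T k = map2 (-) (wlist T j) (alph T ! i)" using chk_wtD(3)[OF assms] by simp
    then have "wlist T k ! l = wlist T j ! l - alph T ! i ! l"
      using chk_wtD(1)[OF assms(1)] alph_nth(1)[OF assms(2)] True by (simp add: Iset_iff)
    then show ?thesis using True alph_nth(2)[OF assms(2) True] by (simp add: wfun_def)
  qed (simp add: wfun_out csroot_out)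
qed

lemma wfun_E:
  assumes "j < ncls T" "i \<in> Iset T" "E T j i = Some k"
  shows "wfun T k = wfun T j + csroot T i"
proof -
  have k: "k < ncls T" using E_lt assms by blast
  then have "F T k i = Some j" using F_E[OF k assms(1,2)] assms(3) by simp
  from wfun_F[OF k assms(2) this] show ?thesis by simp
qed

lemma chk_strD:
  assumes "j < ncls T" "i \<in> Iset T"
  shows "wfun T j i = fl T j i - el T j i" "fl T j i \<noteq> 3" "el T j i \<noteq> 3"
    "fl T j i = 0 \<or> el T j i = 0 \<or> kind T j = Some i"
  using chk_wtD(5)[OF assms] assms(2) by (auto simp: chk_str_def wfun_def)

lemma fl_None: "F T j i = None \<Longrightarrow> fl T j i = 0"
  and el_None: "E T j i = None \<Longrightarrow> el T j i = 0"
  by (simp_all add: fl_def el_def)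

lemma fl_Some: "F T j i = Some k \<Longrightarrow> fl T j i \<noteq> 3 \<Longrightarrow> fl T j i = fl T k i + 1"
  by (auto simp: fl_def split: option.splits)

lemma el_Some: "E T j i = Some k \<Longrightarrow> el T j i \<noteq> 3 \<Longrightarrow> el T j i = el T k i + 1"
  by (auto simp: el_def split: option.splits)

lemma fl_nonneg: "0 \<le> fl T j i" and el_nonneg: "0 \<le> el T j i"
  by (auto simp: fl_def el_def split: option.splits)

lemma fl_pos: "fl T j i \<noteq> 0 \<longleftrightarrow> F T j i \<noteq> None"
  and el_pos: "el T j i \<noteq> 0 \<longleftrightarrow> E T j i \<noteq> None"
  by (auto simp: fl_def el_def split: option.splits)

lemma str_F:
  assumes "j < ncls T" "i \<in> Iset T" "F T j i = Some k"
  shows "k < ncls T" "E T k i = Some j" "fl T j i = fl T k i + 1" "el T k i = el T j i + 1"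
proof -
  show k: "k < ncls T" using F_lt assms by blast
  show e: "E T k i = Some j" using F_E[OF assms(1) k assms(2)] assms(3) by simp
  show "fl T j i = fl T k i + 1" using fl_Some assms(3) chk_strD(2)[OF assms(1,2)] by blast
  show "el T k i = el T j i + 1" using el_Some e chk_strD(3)[OF k assms(2)] by blast
qed

lemma str_E:
  assumes "j < ncls T" "i \<in> Iset T" "E T j i = Some k"
  shows "k < ncls T" "F T k i = Some j" "el T j i = el T k i + 1" "fl T k i = fl T j i + 1"
proof -
  show k: "k < ncls T" using E_lt assms by blast
  show f: "F T k i = Some j" using F_E[OF k assms(1,2)] assms(3) by simp
  show "el T j i = el T k i + 1" "fl T k i = fl T j i + 1" using str_F[OF k assms(2) f] by simp_all
qed

lemma kind_wfun:
  assumes "j < ncls T"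
  shows "kind T j = None \<longleftrightarrow> wfun T j \<noteq> 0"
proof -
  have "(\<exists>x \<in> set (wlist T j). x \<noteq> 0) \<longleftrightarrow> (\<exists>i \<in> Iset T. wlist T j ! i \<noteq> 0)"
    unfolding in_set_conv_nth Iset_iff Bex_def using chk_wtD(1)[OF assms] by auto
  also have "\<dots> \<longleftrightarrow> wfun T j \<noteq> 0" by (auto simp: wfun_def fun_eq_iff)
  finally show ?thesis using chk_wtD(2)[OF assms] by simp
qed

lemma kind_Some_wfun: "j < ncls T \<Longrightarrow> kind T j = Some k \<Longrightarrow> wfun T j = 0"
  using kind_wfun by fastforce

lemma kind_inj: "kind T j = Some i \<Longrightarrow> kind T k = Some i \<Longrightarrow> j = k"
  by (cases T) (auto split: if_splits)

declare kind.simps [simp del]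

lemma kind_ex_check: "list_all (\<lambda>i. [17,109,143,133,150,137,120,96,72] ! i < ncls E8 \<and>
    kind E8 ([17,109,143,133,150,137,120,96,72] ! i) = Some i) [0..<Suc (rnk E8)]"
  by code_simp

lemma kind_ex: "i \<in> Iset E8 \<Longrightarrow> \<exists>j < ncls E8. kind E8 j = Some i"
  using kind_ex_check unfolding list_all_iff Iset_def atLeast0AtMost set_upt by (metis atLeastLessThanSuc_atLeastAtMost atLeast0AtMost)

lemma kind_F:
  assumes "j < ncls T" "kind T j = Some i"
  shows "F T j i \<noteq> None" "E T j i \<noteq> None"
proof -
  have i: "i \<in> Iset T" using kind_lt assms by blast
  have "midt T j i" using mid_string_kind[OF assms(1) i] mid_string_colset[OF assms(1)] assms(2) by blast
  then have "findc i (outs T j) \<noteq> None" "findc i (inns T j) \<noteq> None"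
    by (auto simp: midt_def ent_eq split: if_splits)
  then show "F T j i \<noteq> None" "E T j i \<noteq> None"
    using assms(2) by (simp_all add: F_def E_def fst_out_def fst_inn_def)
qed

lemma kind_F_colour: "kind T j = Some k \<Longrightarrow> F T j i \<noteq> None \<Longrightarrow> k = i"
  and kind_E_colour: "kind T j = Some k \<Longrightarrow> E T j i \<noteq> None \<Longrightarrow> k = i"
  by (auto simp: F_def E_def split: if_splits)

section \<open>Heights of weights; the weight determines an element of nonzero weight\<close>

fun rho_list :: "affine_type \<Rightarrow> int list" where
  "rho_list E6 = [0, 16, 22, 30, 42, 30, 16]"
| "rho_list E7 = [0, 34, 49, 66, 96, 75, 52, 27]"
| "rho_list E8 = [0, 92, 136, 182, 270, 220, 168, 114, 58]"

text \<open>\<open>rho_list\<close> contains the coefficients of the sum of the positive coroots.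
  Each simple root of nonzero index has height 2, and \<alpha>_0, which is -\<theta> modulo
  \<delta>, has height 2 - 2h with h = \<open>nblk T\<close> the Coxeter number.\<close>

definition hgt :: "affine_type \<Rightarrow> cweight \<Rightarrow> int" where
  "hgt T c = (\<Sum>l \<in> Iset T. rho_list T ! l * c l)"

lemma Iset_E: "Iset E6 = {0,1,2,3,4,5,6}" "Iset E7 = {0,1,2,3,4,5,6,7}" "Iset E8 = {0,1,2,3,4,5,6,7,8}"
  by (auto simp: Iset_def)

lemma finite_Iset [simp]: "finite (Iset T)" by (simp add: Iset_def)

lemma hgt_check: "list_all (\<lambda>T. length (rho_list T) = Suc (rnk T) \<and>
    list_all (\<lambda>i. sum_list (map2 (*) (rho_list T) (alph T ! i)) = (if i = 0 then 2 - 2 * nblk T else 2))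
      [0..<Suc (rnk T)]) [E6, E7, E8]"
  by code_simp

lemma hgt_csroot:
  assumes i: "i \<in> Iset T"
  shows "hgt T (csroot T i) = (if i = 0 then 2 - 2 * nblk T else 2)"
proof -
  have "T \<in> set [E6, E7, E8]" by (cases T) auto
  then have c: "length (rho_list T) = Suc (rnk T)"
    "\<forall>i \<in> set [0..<Suc (rnk T)]. sum_list (map2 (*) (rho_list T) (alph T ! i)) = (if i = 0 then 2 - 2 * nblk T else 2)"
    using hgt_check unfolding list_all_iff by blast+
  have "hgt T (csroot T i) = (\<Sum>l \<in> Iset T. rho_list T ! l * alph T ! i ! l)"
    unfolding hgt_def by (rule sum.cong) (simp_all add: alph_nth[OF i])
  also have "\<dots> = sum_list (map2 (*) (rho_list T) (alph T ! i))"
    using c(1) alph_nth(1)[OF i] by (simp add: sum_list_sum_nth Iset_def atLeast0AtMost lessThan_Suc_atMost atLeast0LessThan)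
  also have "\<dots> = (if i = 0 then 2 - 2 * nblk T else 2)"
    using c(2) i by (simp add: Iset_iff del: upt_Suc)
  finally show ?thesis .
qed

lemma hgt_add: "hgt T (a + b) = hgt T a + hgt T b"
  by (simp add: hgt_def distrib_left sum.distrib)

lemma hgt_diff: "hgt T (a - b) = hgt T a - hgt T b"
  by (simp add: hgt_def right_diff_distrib sum_subtractf)

text \<open>Raising by a nonzero colour increases the height by 2, so the distance to the maximal
  height is a measure for inductions towards the top column.\<close>

definition hrank :: "affine_type \<Rightarrow> nat \<Rightarrow> nat" where
  "hrank T j = nat (Max ((\<lambda>j. hgt T (wfun T j)) ` {..<ncls T}) - hgt T (wfun T j))"

lemma hrank_E:
  assumes "j < ncls T" "i \<in> Iset T - {0}" "E T j i = Some k"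
  shows "hrank T k < hrank T j"
proof -
  have k: "k < ncls T" using E_lt assms by blast
  have "hgt T (wfun T k) = hgt T (wfun T j) + 2"
    using wfun_E[OF assms(1) _ assms(3)] assms(2) by (simp add: hgt_add hgt_csroot)
  moreover have "hgt T (wfun T k) \<le> Max ((\<lambda>j. hgt T (wfun T j)) ` {..<ncls T})" using k by (intro Max_ge) auto
  ultimately show ?thesis by (simp add: hrank_def)
qed

lemma ex_E:
  assumes "j < ncls T" "kind T j \<noteq> Some 0" "j \<noteq> top_cls T"
  shows "\<exists>i \<in> Iset T - {0}. E T j i \<noteq> None"
proof -
  have "list_ex (\<lambda>i. E T j i \<noteq> None) [1..<Suc (rnk T)]"
    using chk_all[OF assms(1)] assms(2,3) by (simp add: chk_def chk_top_def del: upt_Suc)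
  then show ?thesis by (auto simp: list_ex_iff Iset_iff simp del: upt_Suc)
qed

text \<open>Two columns of equal nonzero weight have equal string lengths, because each lies at an
  end of its strings. Hence some arrow raises both; their upper neighbours agree by induction or, if
  these have weight zero, because the colour determines the marked column.\<close>

lemma wfun_inject:
  assumes "j < ncls T" "k < ncls T" "kind T j = None" "kind T k = None" "wfun T j = wfun T k"
  shows "j = k"
  using assms
proof (induction "hrank T j" arbitrary: j k rule: less_induct)
  case less
  show ?case
  proof (rule ccontr)
    assume ne: "j \<noteq> k"
    then have "j \<noteq> top_cls T \<or> k \<noteq> top_cls T" by auto
    then obtain i where i: "i \<in> Iset T" "i \<noteq> 0" "E T j i \<noteq> None \<or> E T k i \<noteq> None"
      using ex_E[of j T] ex_E[of k T] less.prems by fastforce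
    have z: "fl T j i = 0 \<or> el T j i = 0" "fl T k i = 0 \<or> el T k i = 0"
      using chk_strD(4) less.prems i(1) by fastforce+
    have "fl T j i - el T j i = fl T k i - el T k i"
      using chk_strD(1) less.prems i(1) by metis
    then have "el T j i = el T k i"
      using z fl_nonneg[of T j i] el_nonneg[of T j i] fl_nonneg[of T k i] el_nonneg[of T k i] by auto
    then obtain j' k' where jk: "E T j i = Some j'" "E T k i = Some k'"
      using i(3) el_pos by (metis not_None_eq)
    note sj = str_E[OF less.prems(1) i(1) jk(1)] and sk = str_E[OF less.prems(2) i(1) jk(2)]
    have w: "wfun T j' = wfun T k'"
      using wfun_E[OF less.prems(1) i(1) jk(1)] wfun_E[OF less.prems(2) i(1) jk(2)] less.prems(5) by simp
    have "j' = k'"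
    proof (cases "kind T j' = None")
      case True
      then have "kind T k' = None" using kind_wfun sj(1) sk(1) w by auto
      then show ?thesis
        using less.hyps[OF hrank_E[OF less.prems(1) _ jk(1)] sj(1) sk(1) True _ w] i by simp
    next
      case False
      then have "kind T k' \<noteq> None" using kind_wfun sj(1) sk(1) w by auto
      then have "kind T j' = Some i" "kind T k' = Some i"
        using False kind_F_colour sj(2) sk(2) by (metis not_None_eq option.distinct(1))+
      then show ?thesis by (rule kind_inj)
    qed
    then show False using sj(2) sk(2) ne by simp
  qed
qed

lemma kind_not_E8: "T \<noteq> E8 \<Longrightarrow> kind T j = None"
  by (cases T) (auto simp: kind.simps)

lemma pel_inject:
  assumes "j < ncls T" "k < ncls T" "pel T j = pel T k"
  shows "j = k"
proof (cases "T = E8")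
  case True
  show ?thesis
  proof (cases "kind T j")
    case None
    then have "kind T k = None" "wfun T j = wfun T k"
      using assms(3) True by (auto simp: pel_def split: option.splits if_splits)
    then show ?thesis using wfun_inject assms None by blast
  next
    case (Some i)
    then have "kind T k = Some i" using assms(3) True by (auto simp: pel_def split: option.splits if_splits)
    then show ?thesis using Some kind_inj by blast
  qed
next
  case False
  then show ?thesis using assms wfun_inject kind_not_E8 by (auto simp: pel_def)
qed

section \<open>Weyl group orbits and roots\<close>

definition srefl :: "affine_type \<Rightarrow> nat \<Rightarrow> cweight \<Rightarrow> cweight" where
  "srefl T i \<nu> = (\<lambda>j. \<nu> j - \<nu> i * csroot T i j)"

text \<open>An element of nonzero weight lies at one end of its \<open>i\<close>-string, and the
  reflected weight belongs to the other end, at most two arrows away.\<close>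

lemma refl_wfun:
  assumes j: "j < ncls T" "kind T j = None" and i: "i \<in> Iset T"
  shows "\<exists>k < ncls T. kind T k = None \<and> srefl T i (wfun T j) = wfun T k"
proof -
  have ex: "\<exists>k < ncls T. srefl T i (wfun T j) = wfun T k"
  proof -
    have x: "wfun T j i = fl T j i - el T j i" using chk_strD(1) j i by blast
    have z: "fl T j i = 0 \<or> el T j i = 0" using chk_strD(4)[OF j(1) i] j(2) by simp
    consider "fl T j i = 0" "el T j i = 0" | k where "F T j i = Some k" "el T j i = 0"
      | k where "E T j i = Some k" "fl T j i = 0"
      using z fl_pos el_pos by fastforce
    then show ?thesis
    proof cases
      case 1 then show ?thesis using j x by (auto simp: srefl_def)
    next
      case (2 k)
      note s = str_F[OF j(1) i 2(1)]
      show ?thesis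
      proof (cases "F T k i")
        case None
        then have "srefl T i (wfun T j) = wfun T k"
          using fl_None[OF None] s x 2 wfun_F[OF j(1) i 2(1)] by (auto simp: srefl_def fun_eq_iff)
        then show ?thesis using s by blast
      next
        case (Some l)
        note t = str_F[OF s(1) i Some]
        have "F T l i = None"
        proof (rule ccontr)
          assume "F T l i \<noteq> None"
          then have "fl T j i \<noteq> 3 \<and> fl T j i = 3"
            using chk_strD(2)[OF j(1) i] 2 Some by (auto simp: fl_def)
          then show False by simp
        qed
        then have "fl T j i = 2" using fl_None s t by simp
        then have "srefl T i (wfun T j) = wfun T l"
          using x 2 wfun_F[OF j(1) i 2(1)] wfun_F[OF s(1) i Some] by (auto simp: srefl_def fun_eq_iff)
        then show ?thesis using t by blast
      qed
    next
      case (3 k)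
      note s = str_E[OF j(1) i 3(1)]
      show ?thesis
      proof (cases "E T k i")
        case None
        then have "srefl T i (wfun T j) = wfun T k"
          using el_None[OF None] s x 3 wfun_E[OF j(1) i 3(1)] by (auto simp: srefl_def fun_eq_iff)
        then show ?thesis using s by blast
      next
        case (Some l)
        note t = str_E[OF s(1) i Some]
        have "E T l i = None"
        proof (rule ccontr)
          assume "E T l i \<noteq> None"
          then have "el T j i \<noteq> 3 \<and> el T j i = 3"
            using chk_strD(3)[OF j(1) i] 3 Some by (auto simp: el_def)
          then show False by simp
        qed
        then have "el T j i = 2" using el_None s t by simp
        then have "srefl T i (wfun T j) = wfun T l"
          using x 3 wfun_E[OF j(1) i 3(1)] wfun_E[OF s(1) i Some] by (auto simp: srefl_def fun_eq_iff)
        then show ?thesis using t by blast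
      qed
    qed
  qed
  then obtain k where k: "k < ncls T" "srefl T i (wfun T j) = wfun T k" by blast
  have "wfun T k \<noteq> 0"
  proof
    assume z: "wfun T k = 0"
    have *: "wfun T j l - wfun T j i * csroot T i l = 0" for l
    proof -
      have "srefl T i (wfun T j) l = wfun T k l" using k(2) by (rule fun_cong)
      also have "\<dots> = 0" using z by simp
      finally show ?thesis unfolding srefl_def .
    qed
    have "wfun T j i = 0" using *[of i] csroot_self[OF i] by simp
    then have "wfun T j l = 0" for l using *[of l] by simp
    then have "wfun T j = 0" by (simp add: fun_eq_iff)
    then show False using kind_wfun j by blast
  qed
  then show ?thesis using kind_wfun k by blast
qed

lemma weyl_orbit_trans: "\<kappa> \<in> weyl_orbit T \<nu> \<Longrightarrow> \<nu> \<in> weyl_orbit T \<mu> \<Longrightarrow> \<kappa> \<in> weyl_orbit T \<mu>"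
  by (induction rule: weyl_orbit.induct) (auto intro: weyl_orbit.intros)

lemma weyl_orbit_refl: "\<nu> \<in> weyl_orbit T \<mu> \<Longrightarrow> i \<in> Iset T - {0} \<Longrightarrow> srefl T i \<nu> \<in> weyl_orbit T \<mu>"
  unfolding srefl_def by (rule weyl_orbit.reflect)

text \<open>The nonzero weights of the crystal: the roots in type E8, but a minuscule weight orbit
  in types E6 and E7.\<close>

definition roots :: "affine_type \<Rightarrow> cweight set" where
  "roots T = wfun T ` {j. j < ncls T \<and> kind T j = None}"

lemma roots_refl: "\<nu> \<in> roots T \<Longrightarrow> i \<in> Iset T \<Longrightarrow> srefl T i \<nu> \<in> roots T"
  using refl_wfun by (fastforce simp: roots_def)

lemma weyl_orbit_roots: "\<mu> \<in> roots T \<Longrightarrow> weyl_orbit T \<mu> \<subseteq> roots T"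
proof
  fix \<nu> assume "\<mu> \<in> roots T" "\<nu> \<in> weyl_orbit T \<mu>"
  from this(2,1) show "\<nu> \<in> roots T"
    by (induction rule: weyl_orbit.induct) (auto dest: roots_refl simp: srefl_def)
qed

lemma E_step_refl:
  assumes j: "j < ncls T" "kind T j = None" and i: "i \<in> Iset T" and e: "E T j i = Some k" "kind T k = None"
  shows "wfun T j = srefl T i (wfun T k)" "wfun T k = srefl T i (wfun T j)"
proof -
  note s = str_E[OF j(1) i e(1)]
  have "fl T j i = 0" using chk_strD(4)[OF j(1) i] j(2) s el_nonneg[of T k i] by auto
  moreover have "el T k i = 0" using chk_strD(4)[OF s(1) i] e(2) s fl_nonneg[of T j i] by auto
  ultimately have "wfun T k i = 1" "wfun T j i = - 1" using chk_strD(1) j s i by simp_all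
  then show "wfun T j = srefl T i (wfun T k)" "wfun T k = srefl T i (wfun T j)"
    using wfun_E[OF j(1) i e(1)] by (auto simp: srefl_def fun_eq_iff)
qed

lemma top_weights: "wlist E6 21 = [-1,1,0,0,0,0,0] \<and> wlist E7 39 = [-1,0,0,0,0,0,0,1] \<and>
    kind E8 73 = None"
  by code_simp


lemma csroot_nz: "i \<in> Iset T \<Longrightarrow> csroot T i \<noteq> 0"
  using csroot_self[of i T] by auto

lemma kind_E_root:
  assumes "j < ncls T" "kind T j = Some i"
  obtains k where "E T j i = Some k" "k < ncls T" "kind T k = None" "wfun T k = csroot T i"
proof -
  have i: "i \<in> Iset T" using kind_lt assms(2) by blast
  obtain k where k: "E T j i = Some k" using kind_F(2)[OF assms] by auto
  have "wfun T k = csroot T i" using wfun_E[OF assms(1) i k] kind_Some_wfun[OF assms] by simp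
  then show ?thesis using that k str_E(1)[OF assms(1) i k] kind_wfun csroot_nz[OF i] by metis
qed

lemma kind_F_root:
  assumes "j < ncls T" "kind T j = Some i"
  obtains k where "F T j i = Some k" "k < ncls T" "kind T k = None" "wfun T k = - csroot T i"
proof -
  have i: "i \<in> Iset T" using kind_lt assms(2) by blast
  obtain k where k: "F T j i = Some k" using kind_F(1)[OF assms] by auto
  have "wfun T k = - csroot T i" using wfun_F[OF assms(1) i k] kind_Some_wfun[OF assms] by simp
  then show ?thesis using that k str_F(1)[OF assms(1) i k] kind_wfun csroot_nz[OF i]
    by (metis neg_equal_0_iff_equal)
qed

lemma csroot_in_roots: "i \<in> Iset E8 \<Longrightarrow> csroot E8 i \<in> roots E8"
  using kind_ex kind_E_root unfolding roots_def by (metis (mono_tags, lifting) image_eqI mem_Collect_eq)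

text \<open>Positive height keeps the climb away from weight zero, so every raising step is a simple
  reflection.\<close>

lemma top_in_orbit:
  assumes "j < ncls E8" "kind E8 j = None" "hgt E8 (wfun E8 j) > 0"
  shows "wfun E8 (top_cls E8) \<in> weyl_orbit E8 (wfun E8 j)"
  using assms
proof (induction "hrank E8 j" arbitrary: j rule: less_induct)
  case less
  show ?case
  proof (cases "j = top_cls E8")
    case True then show ?thesis by (simp add: weyl_orbit.base)
  next
    case False
    obtain i k where i: "i \<in> Iset E8 - {0}" "E E8 j i = Some k"
      using ex_E[OF less.prems(1) _ False] less.prems(2) by fastforce
    have iI: "i \<in> Iset E8" using i by simp
    have k: "k < ncls E8" by (rule str_E(1)[OF less.prems(1) iI i(2)])
    have "hgt E8 (wfun E8 k) = hgt E8 (wfun E8 j) + 2"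
      using wfun_E[OF less.prems(1) iI i(2)] i by (simp add: hgt_add hgt_csroot)
    then have h: "hgt E8 (wfun E8 k) > 0" using less.prems(3) by linarith
    then have kn: "kind E8 k = None" using kind_wfun[OF k] by (auto simp: hgt_def)
    have "wfun E8 k \<in> weyl_orbit E8 (wfun E8 j)"
      unfolding E_step_refl(2)[OF less.prems(1,2) iI i(2) kn]
      by (rule weyl_orbit_refl[OF weyl_orbit.base i(1)])
    then show ?thesis
      using less.hyps[OF hrank_E[OF less.prems(1) i] k kn h] weyl_orbit_trans by blast
  qed
qed

text \<open>The highest root is reached from a simple root by climbing, and all other roots are
  obtained from it by descending. A descent through weight zero ends at a negative simple root,
  which is the image of a simple root under its own reflection.\<close>

lemma finite_roots_eq: "finite_roots E8 = roots E8"
proof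
  show "finite_roots E8 \<subseteq> roots E8"
    unfolding finite_roots_def using weyl_orbit_roots csroot_in_roots by blast
  have cl: "srefl E8 i \<nu> \<in> finite_roots E8" if "\<nu> \<in> finite_roots E8" "i \<in> Iset E8 - {0}" for \<nu> i
    using that weyl_orbit_refl unfolding finite_roots_def by blast
  have base: "csroot E8 i \<in> finite_roots E8" if "i \<in> Iset E8 - {0}" for i
    using that weyl_orbit.base unfolding finite_roots_def by blast
  have neg: "- csroot E8 i \<in> finite_roots E8" if "i \<in> Iset E8 - {0}" for i
  proof -
    have "srefl E8 i (csroot E8 i) = - csroot E8 i"
      using csroot_self[of i E8] that by (simp add: srefl_def fun_eq_iff)
    then show ?thesis using cl[OF base[OF that] that] by simp
  qed
  have one: "(1::nat) \<in> Iset E8 - {0}" by (simp add: Iset_iff)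
  have top: "wfun E8 (top_cls E8) \<in> finite_roots E8"
  proof -
    obtain k where k: "k < ncls E8" "kind E8 k = None" "wfun E8 k = csroot E8 1"
      using csroot_in_roots[of 1] one by (auto simp: roots_def)
    have "hgt E8 (wfun E8 k) > 0" using one k(3) by (simp add: hgt_csroot)
    from top_in_orbit[OF k(1,2) this] show ?thesis
      using one unfolding k(3) finite_roots_def by blast
  qed
  have "wfun E8 j \<in> finite_roots E8" if "j < ncls E8" "kind E8 j = None" for j
    using that
  proof (induction "hrank E8 j" arbitrary: j rule: less_induct)
    case less
    show ?case
    proof (cases "j = top_cls E8")
      case True then show ?thesis using top by simp
    next
      case False
      obtain i k where i: "i \<in> Iset E8 - {0}" "E E8 j i = Some k"
        using ex_E[OF less.prems(1) _ False] less.prems(2) by fastforce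
      have iI: "i \<in> Iset E8" using i by simp
      note s = str_E[OF less.prems(1) iI i(2)]
      show ?thesis
      proof (cases "kind E8 k")
        case None
        then show ?thesis
          using cl[OF less.hyps[OF hrank_E[OF less.prems(1) i] s(1) None] i(1)]
            E_step_refl(1)[OF less.prems iI i(2) None] by simp
      next
        case (Some m)
        then have m: "m = i" using kind_F_colour s(2) by (metis option.distinct(1))
        have "wfun E8 j = - csroot E8 i"
          using wfun_F[OF s(1) iI s(2)] kind_Some_wfun[OF s(1) Some] by simp
        then show ?thesis using neg[OF i(1)] by simp
      qed
    qed
  qed
  then show "roots E8 \<subseteq> finite_roots E8" by (auto simp: roots_def)
qed

lemma top_lt: "top_cls T < ncls T"
  by (cases T) auto

lemma minuscule_orbit:
  assumes T: "T \<noteq> E8"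
  shows "weyl_orbit T (wfun T (top_cls T)) = roots T"
proof
  have "wfun T (top_cls T) \<in> roots T" using kind_not_E8[OF T] top_lt by (auto simp: roots_def)
  then show "weyl_orbit T (wfun T (top_cls T)) \<subseteq> roots T" by (rule weyl_orbit_roots)
  have "wfun T j \<in> weyl_orbit T (wfun T (top_cls T))" if "j < ncls T" for j
    using that
  proof (induction "hrank T j" arbitrary: j rule: less_induct)
    case less
    show ?case
    proof (cases "j = top_cls T")
      case True then show ?thesis by (simp add: weyl_orbit.base)
    next
      case False
      obtain i k where i: "i \<in> Iset T - {0}" "E T j i = Some k"
        using ex_E[OF less.prems(1) _ False] kind_not_E8[OF T] by fastforce
      have iI: "i \<in> Iset T" using i by simp
      note s = str_E[OF less.prems(1) iI i(2)]
      show ?thesis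
        using weyl_orbit_refl[OF less.hyps[OF hrank_E[OF less.prems(1) i] s(1)] i(1)]
          E_step_refl(1)[OF less.prems(1) kind_not_E8[OF T] iI i(2) kind_not_E8[OF T]] by simp
    qed
  qed
  then show "roots T \<subseteq> weyl_orbit T (wfun T (top_cls T))" by (auto simp: roots_def)
qed

lemma top_wfun: "wfun E6 (top_cls E6) = cfund 1 - cfund 0" "wfun E7 (top_cls E7) = cfund 7 - cfund 0"
proof -
  have 6: "l \<in> {0,1,2,3,4,5,6}" if "l \<in> Iset E6" for l using that by (simp add: Iset_E)
  have 7: "l \<in> {0,1,2,3,4,5,6,7}" if "l \<in> Iset E7" for l using that by (simp add: Iset_E)
  show "wfun E6 (top_cls E6) = cfund 1 - cfund 0"
  proof
    fix l
    show "wfun E6 (top_cls E6) l = (cfund 1 - cfund 0) l"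
    proof (cases "l \<in> Iset E6")
      case True
      from 6[OF this] show ?thesis using top_weights by (auto simp: wfun_def cfund_def Iset_E)
    next
      case False then show ?thesis by (simp add: wfun_def cfund_def Iset_E)
    qed
  qed
  show "wfun E7 (top_cls E7) = cfund 7 - cfund 0"
  proof
    fix l
    show "wfun E7 (top_cls E7) l = (cfund 7 - cfund 0) l"
    proof (cases "l \<in> Iset E7")
      case True
      from 7[OF this] show ?thesis using top_weights by (auto simp: wfun_def cfund_def Iset_E)
    next
      case False then show ?thesis by (simp add: wfun_def cfund_def Iset_E)
    qed
  qed
qed

lemma pel_kinds:
  "T \<noteq> E8 \<Longrightarrow> pel T j = Bel (wfun T j)"
  "kind E8 j = None \<Longrightarrow> pel E8 j = Xel (wfun E8 j)"
  "kind E8 j = Some i \<Longrightarrow> i \<noteq> 0 \<Longrightarrow> pel E8 j = Yel i"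
  "kind E8 j = Some 0 \<Longrightarrow> pel E8 j = Empt"
  by (auto simp: pel_def)

lemma perfect_set_eq: "perfect_set T = pel T ` {..<ncls T}"
proof (cases "T = E8")
  case False
  have "roots T = wfun T ` {..<ncls T}" using kind_not_E8[OF False] by (auto simp: roots_def)
  moreover have "perfect_set T = Bel ` roots T"
    using False minuscule_orbit[OF False] top_wfun by (cases T) auto
  ultimately show ?thesis using pel_kinds(1)[OF False] by (auto simp: image_iff)
next
  case True
  have "pel E8 ` {..<ncls E8} = perfect_set E8"
  proof (intro equalityI subsetI)
    fix b assume "b \<in> pel E8 ` {..<ncls E8}"
    then obtain j where j: "j < ncls E8" "b = pel E8 j" by auto
    show "b \<in> perfect_set E8"
    proof (cases "kind E8 j")
      case None
      then show ?thesis using j by (auto simp: pel_kinds finite_roots_eq roots_def)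
    next
      case (Some i)
      then show ?thesis using j kind_lt[OF Some] by (cases "i = 0") (auto simp: pel_kinds)
    qed
  next
    fix b assume "b \<in> perfect_set E8"
    then consider j where "b = Xel (wfun E8 j)" "j < ncls E8" "kind E8 j = None"
      | i where "b = Yel i" "i \<in> Iset E8" "i \<noteq> 0" | "b = Empt"
      by (auto simp: finite_roots_eq roots_def)
    then show "b \<in> pel E8 ` {..<ncls E8}"
    proof cases
      case 1 then show ?thesis using pel_kinds(2) by (metis imageI lessThan_iff)
    next
      case 2 then show ?thesis using kind_ex[of i] pel_kinds(3) by (metis imageI lessThan_iff)
    next
      case 3
      have "0 \<in> Iset E8" by (simp add: Iset_iff)
      then show ?thesis using 3 kind_ex[of 0] pel_kinds(4) by (metis imageI lessThan_iff)
    qed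
  qed
  then show ?thesis using True by simp
qed

text \<open>If the arrow were missing, the target would lie at least two steps down its
  \<open>i\<close>-string. The element just above it would be interior, hence of weight zero,
  although it has the weight of \<open>j\<close>.\<close>

lemma root_step:
  assumes j: "j < ncls T" "kind T j = None" and l: "l < ncls T" "kind T l = None" and i: "i \<in> Iset T"
    and w: "wfun T l = wfun T j - csroot T i"
  shows "F T j i = Some l"
proof -
  have x: "wfun T l i = wfun T j i - 2" using w csroot_self[OF i] by simp
  have "fl T j i \<noteq> 0"
  proof
    assume f: "fl T j i = 0"
    then have "wfun T l i \<le> - 2" using x chk_strD(1)[OF j(1) i] el_nonneg[of T j i] by linarith
    moreover have ll: "wfun T l i = fl T l i - el T l i" by (rule chk_strD(1)[OF l(1) i])
    ultimately have e2: "el T l i \<ge> 2" using fl_nonneg[of T l i] by linarith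
    then obtain m where m: "E T l i = Some m" using el_pos[of T l i] by force
    note s = str_E[OF l(1) i m]
    have "el T m i \<noteq> 0" "fl T m i \<noteq> 0" using s e2 fl_nonneg[of T l i] by linarith+
    then have "kind T m = Some i" using chk_strD(4)[OF s(1) i] by blast
    then have "wfun T m = 0" using kind_Some_wfun s(1) by blast
    moreover have "wfun T m = wfun T j" using wfun_E[OF l(1) i m] w by simp
    ultimately show False using kind_wfun[OF j(1)] j(2) by simp
  qed
  then obtain k where k: "F T j i = Some k" using fl_pos by auto
  note s = str_F[OF j(1) i k]
  have wk: "wfun T k = wfun T l" using wfun_F[OF j(1) i k] w by simp
  then have "kind T k = None" using kind_wfun s(1) l by auto
  then have "k = l" using wfun_inject s(1) l wk by blast
  then show ?thesis using k by simp
qed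

lemma simple_step:
  assumes j: "j < ncls T" "kind T j = None" and i: "i \<in> Iset T" and T: "T = E8" and w: "wfun T j = csroot T i"
  shows "\<exists>k < ncls T. F T j i = Some k \<and> kind T k = Some i"
proof -
  obtain m where m: "m < ncls T" "kind T m = Some i" using kind_ex i T by blast
  obtain k where k: "E T m i = Some k" "k < ncls T" "kind T k = None" "wfun T k = csroot T i"
    using kind_E_root[OF m] by blast
  have "j = k" using wfun_inject j k w by simp
  then show ?thesis using str_E(2)[OF m(1) i k(1)] m by blast
qed

section \<open>The arrows of the perfect crystal agree with the table\<close>

lemma arrow_src: "arrow T i b b' \<Longrightarrow> b \<in> perfect_set T \<and> i \<in> Iset T"
proof (induction rule: arrow.induct)
  case (into_Yel i)
  then show ?case using finite_roots_eq csroot_in_roots by auto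
next
  case into_Empt
  have "0 \<in> Iset E8" by (simp add: Iset_iff)
  then show ?case using finite_roots_eq csroot_in_roots by (auto simp: highest_root_def)
qed (auto simp: Iset_iff)

lemma arrow_pel_E8:
  assumes j: "j < ncls E8"
  shows "arrow E8 i (pel E8 j) b' \<longleftrightarrow> i \<in> Iset E8 \<and> (\<exists>k. F E8 j i = Some k \<and> b' = pel E8 k)"
proof
  assume ar: "arrow E8 i (pel E8 j) b'"
  have i: "i \<in> Iset E8" using arrow_src[OF ar] by simp
  have gen: "\<exists>k. F E8 j i = Some k \<and> Xel \<beta> = pel E8 k"
    if a: "pel E8 j = Xel \<alpha>" "\<beta> \<in> finite_roots E8" "\<beta> = \<alpha> - csroot E8 i" for \<alpha> \<beta>
  proof -
    have n: "kind E8 j = None" "\<alpha> = wfun E8 j"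
      using a(1) by (auto simp: pel_def split: option.splits if_splits)
    obtain l where l: "l < ncls E8" "kind E8 l = None" "\<beta> = wfun E8 l"
      using a(2) by (auto simp: finite_roots_eq roots_def)
    show ?thesis using root_step[OF j n(1) l(1,2) i] a(3) l(3) n(2) pel_kinds(2)[OF l(2)] by auto
  qed
  have simp: "\<exists>k. F E8 j i = Some k \<and> kind E8 k = Some i" if a: "pel E8 j = Xel (csroot E8 i)"
  proof -
    have n: "kind E8 j = None" "csroot E8 i = wfun E8 j"
      using a by (auto simp: pel_def split: option.splits if_splits)
    show ?thesis using simple_step[OF j n(1) i refl] n(2) by auto
  qed
  have out: "\<exists>k. F E8 j i = Some k \<and> Xel (- csroot E8 i) = pel E8 k" if "kind E8 j = Some i"
  proof -
    obtain k where "F E8 j i = Some k" "kind E8 k = None" "wfun E8 k = - csroot E8 i"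
      using kind_F_root[OF j \<open>kind E8 j = Some i\<close>] by blast
    then show ?thesis using pel_kinds(2) by auto
  qed
  from ar show "i \<in> Iset E8 \<and> (\<exists>k. F E8 j i = Some k \<and> b' = pel E8 k)"
  proof cases
    case minuscule then show ?thesis by simp
  next
    case (real_root \<alpha>)
    then show ?thesis using gen i by blast
  next
    case into_Yel
    then show ?thesis using simp i pel_kinds(3) by fastforce
  next
    case from_Yel
    then have "kind E8 j = Some i" by (auto simp: pel_def split: option.splits if_splits)
    then show ?thesis using out i from_Yel by simp
  next
    case (theta \<alpha>)
    then show ?thesis using gen[of \<alpha> b' for b'] gen[of \<alpha> "\<alpha> + highest_root E8"] i by (simp add: highest_root_def)
  next
    case into_Empt
    then show ?thesis using simp i pel_kinds(4) by (fastforce simp: highest_root_def)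
  next
    case from_Empt
    then have "kind E8 j = Some i" by (auto simp: pel_def split: option.splits if_splits)
    then show ?thesis using out i from_Empt by (simp add: highest_root_def)
  qed
next
  assume "i \<in> Iset E8 \<and> (\<exists>k. F E8 j i = Some k \<and> b' = pel E8 k)"
  then obtain k where i: "i \<in> Iset E8" and k: "F E8 j i = Some k" and b': "b' = pel E8 k" by blast
  note s = str_F[OF j i k]
  have w: "wfun E8 k = wfun E8 j - csroot E8 i" by (rule wfun_F[OF j i k])
  consider "kind E8 j = None" "kind E8 k = None" | m where "kind E8 j = None" "kind E8 k = Some m"
    | m where "kind E8 j = Some m" "kind E8 k = None" | m n where "kind E8 j = Some m" "kind E8 k = Some n"
    by fastforce
  then show "arrow E8 i (pel E8 j) b'"
  proof cases
    case 1
    have r: "wfun E8 j \<in> finite_roots E8" "wfun E8 k \<in> finite_roots E8"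
      using 1 j s(1) by (auto simp: finite_roots_eq roots_def)
    show ?thesis
    proof (cases "i = 0")
      case False
      have "arrow E8 i (Xel (wfun E8 j)) (Xel (wfun E8 j - csroot E8 i))"
        using False i r w by (intro arrow.real_root) simp_all
      then show ?thesis using 1 w by (simp add: b' pel_kinds)
    next
      case True
      have fe: "el E8 j 0 = 0" "fl E8 k 0 = 0"
        using chk_strD(4)[OF j i] chk_strD(4)[OF s(1) i] 1 s(3,4) fl_nonneg[of E8 k i] el_nonneg[of E8 j i] True
        by auto
      \<comment> \<open>The signs of the pairings with \<open>h\<^sub>0\<close> exclude \<theta> as
        source and -\<theta> as target; the other two excluded values would make one of the weights
        zero.\<close>
      have v: "wfun E8 j 0 > 0" "wfun E8 k 0 < 0"
        using chk_strD(1)[OF j i] chk_strD(1)[OF s(1) i] s(3,4) fe True fl_nonneg[of E8 k i] el_nonneg[of E8 j i]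
        by simp_all
      have c: "csroot E8 0 0 = 2" using csroot_self i True by simp
      have nz: "wfun E8 j \<noteq> 0" "wfun E8 k \<noteq> 0" using 1 kind_wfun j s(1) by auto
      have "wfun E8 j \<noteq> - csroot E8 0" "wfun E8 k \<noteq> csroot E8 0" using v c by auto
      moreover have "wfun E8 j \<noteq> csroot E8 0" "wfun E8 k \<noteq> - csroot E8 0"
        using nz w True by auto
      ultimately have "arrow E8 0 (Xel (wfun E8 j)) (Xel (wfun E8 j + highest_root E8))"
        using r w True by (intro arrow.theta) (auto simp: highest_root_def)
      then show ?thesis using 1 w True by (simp add: b' pel_kinds highest_root_def)
    qed
  next
    case (2 m)
    have m: "m = i" using 2 kind_E_colour s(2) by (metis option.distinct(1))
    have "wfun E8 j = csroot E8 i" using w kind_Some_wfun[OF s(1) 2(2)] by simp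
    then show ?thesis
      using 2 m i arrow.into_Yel[of i] arrow.into_Empt
      by (cases "i = 0") (simp_all add: b' pel_kinds highest_root_def)
  next
    case (3 m)
    have m: "m = i" using 3 kind_F_colour k by (metis option.distinct(1))
    have "wfun E8 k = - csroot E8 i" using w kind_Some_wfun[OF j 3(1)] by simp
    then show ?thesis
      using 3 m i arrow.from_Yel[of i] arrow.from_Empt
      by (cases "i = 0") (simp_all add: b' pel_kinds highest_root_def)
  next
    case (4 m n)
    then have "csroot E8 i = 0" using w kind_Some_wfun[OF j 4(1)] kind_Some_wfun[OF s(1) 4(2)] by simp
    then show ?thesis using csroot_nz[OF i] by simp
  qed
qed

lemma arrow_pel_minuscule:
  assumes j: "j < ncls T" and T: "T \<noteq> E8"
  shows "arrow T i (pel T j) b' \<longleftrightarrow> i \<in> Iset T \<and> (\<exists>k. F T j i = Some k \<and> b' = pel T k)"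
proof
  assume ar: "arrow T i (pel T j) b'"
  then have i: "i \<in> Iset T" using arrow_src by blast
  from ar have x: "wfun T j i = 1" "b' = Bel (wfun T j - csroot T i)"
    by (cases; use T pel_kinds(1)[OF T] in simp)+
  then have "fl T j i \<noteq> 0" using chk_strD(1)[OF j i] el_nonneg[of T j i] by auto
  then obtain k where k: "F T j i = Some k" using fl_pos by auto
  then show "i \<in> Iset T \<and> (\<exists>k. F T j i = Some k \<and> b' = pel T k)"
    using i x wfun_F[OF j i k] pel_kinds(1)[OF T] by simp
next
  assume "i \<in> Iset T \<and> (\<exists>k. F T j i = Some k \<and> b' = pel T k)"
  then obtain k where i: "i \<in> Iset T" and k: "F T j i = Some k" and b': "b' = pel T k" by blast
  note s = str_F[OF j i k]
  have "el T j i = 0" "fl T k i = 0"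
    using chk_strD(4)[OF j i] chk_strD(4)[OF s(1) i] kind_not_E8[OF T] s(3,4)
      fl_nonneg[of T k i] el_nonneg[of T j i] by auto
  then have "wfun T j i = 1" using chk_strD(1)[OF j i] s(3) by simp
  moreover have "Bel (wfun T j) \<in> perfect_set T" using j pel_kinds(1)[OF T] by (auto simp: perfect_set_eq)
  ultimately have "arrow T i (Bel (wfun T j)) (Bel (wfun T j - csroot T i))"
    using T i by (intro arrow.minuscule)
  then show "arrow T i (pel T j) b'" using wfun_F[OF j i k] pel_kinds(1)[OF T] b' by simp
qed

lemma arrow_pel:
  "j < ncls T \<Longrightarrow> arrow T i (pel T j) b' \<longleftrightarrow> i \<in> Iset T \<and> (\<exists>k. F T j i = Some k \<and> b' = pel T k)"
  using arrow_pel_E8 arrow_pel_minuscule by (cases "T = E8") auto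

lemma perfect_ff:
  assumes "j < ncls T" "i \<in> Iset T"
  shows "ff (perfect T) i (pel T j) = map_option (pel T) (F T j i)"
  using arrow_pel[OF assms(1), of i] assms(2)
  by (cases "F T j i") (auto simp: perfect_def string_crystal_def partial_fun_def)

lemma perfect_ee:
  assumes k: "k < ncls T" and i: "i \<in> Iset T"
  shows "ee (perfect T) i (pel T k) = map_option (pel T) (E T k i)"
proof -
  have "arrow T i b (pel T k) \<longleftrightarrow> (\<exists>j. E T k i = Some j \<and> b = pel T j)" for b
  proof
    assume a: "arrow T i b (pel T k)"
    then obtain j where j: "j < ncls T" "b = pel T j" using arrow_src[OF a] by (auto simp: perfect_set_eq)
    then obtain l where "F T j i = Some l" "pel T k = pel T l" using a arrow_pel by blast
    then have "F T j i = Some k" using pel_inject k F_lt j by metis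
    then show "\<exists>j. E T k i = Some j \<and> b = pel T j" using F_E[OF j(1) k i] j by blast
  next
    assume "\<exists>j. E T k i = Some j \<and> b = pel T j"
    then obtain j where j: "E T k i = Some j" "b = pel T j" by blast
    then show "arrow T i b (pel T k)" using str_E[OF k i j(1)] i arrow_pel by blast
  qed
  then show ?thesis
    by (cases "E T k i") (auto simp: perfect_def string_crystal_def partial_fun_def)
qed

lemma elts_perfect: "elts (perfect T) = pel T ` {..<ncls T}"
  by (simp add: perfect_def string_crystal_def perfect_set_eq)

section \<open>String lengths, and the crystal structures expressed by the table\<close>

lemma iter_option_Suc: "iter_option g (Suc m) b = Option.bind (g b) (iter_option g m)"
proof (induction m)
  case (Suc m)
  have "iter_option g (Suc (Suc m)) b = Option.bind (Option.bind (g b) (iter_option g m)) g"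
    by (subst iter_option.simps(2)) (simp only: Suc)
  then show ?case by (simp add: Option.bind_assoc)
qed simp

text \<open>A function that vanishes where the arrow is missing and drops by one along each arrow
  counts the remaining steps of the string.\<close>

lemma string_length_map:
  assumes g: "\<And>j. j < n \<Longrightarrow> g (p j) = map_option p (f j)" and cl: "\<And>j k. j < n \<Longrightarrow> f j = Some k \<Longrightarrow> k < n"
    and h0: "\<And>j. j < n \<Longrightarrow> f j = None \<Longrightarrow> h j = (0::int)"
    and h1: "\<And>j k. j < n \<Longrightarrow> f j = Some k \<Longrightarrow> h j = h k + 1 \<and> 0 \<le> h k"
    and j: "j < n"
  shows "int (string_length g (p j)) = h j"
proof -
  have h: "0 \<le> h j" if "j < n" for j using h0[OF that] h1[OF that] by (cases "f j") fastforce+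
  have "iter_option g m (p j) \<noteq> None \<longleftrightarrow> int m \<le> h j" if "j < n" for m j
    using that
  proof (induction m arbitrary: j)
    case 0 then show ?case using h by simp
  next
    case (Suc m)
    show ?case
    proof (cases "f j")
      case None
      then show ?thesis using g[OF Suc.prems] h0[OF Suc.prems] unfolding iter_option_Suc by simp
    next
      case (Some k)
      then show ?thesis
        using g[OF Suc.prems] h1[OF Suc.prems Some] Suc.IH[OF cl[OF Suc.prems Some]] unfolding iter_option_Suc by simp
    qed
  qed
  then have "{m. iter_option g m (p j) \<noteq> None} = {..nat (h j)}" using j h[OF j] by auto
  moreover have "Max {..nat (h j)} = nat (h j)" by (rule Max_eqI) auto
  ultimately show ?thesis using h[OF j] unfolding string_length_def by simp
qed

text \<open>The labelling \<open>p\<close> is left open because the same computation is applied to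
  the perfect crystal and to the classes of Young columns.\<close>

lemma string_crystal_table:
  assumes f: "\<And>j i. j < ncls T \<Longrightarrow> i \<in> Iset T \<Longrightarrow> f i (p j) = map_option p (F T j i)"
    and e: "\<And>j i. j < ncls T \<Longrightarrow> i \<in> Iset T \<Longrightarrow> e i (p j) = map_option p (E T j i)"
    and j: "j < ncls T"
  shows "i \<in> Iset T \<Longrightarrow> eps (string_crystal T X e f) i (p j) = Fin (el T j i)"
    "i \<in> Iset T \<Longrightarrow> phi (string_crystal T X e f) i (p j) = Fin (fl T j i)"
    "wt (string_crystal T X e f) (p j) = wfun T j"
proof -
  have F: "int (string_length (f i) (p j)) = fl T j i" if i: "i \<in> Iset T" for i
    by (rule string_length_map[where n = "ncls T" and f = "\<lambda>j. F T j i"])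
      (use i j f str_F fl_None fl_nonneg in auto)
  have E: "int (string_length (e i) (p j)) = el T j i" if i: "i \<in> Iset T" for i
    by (rule string_length_map[where n = "ncls T" and f = "\<lambda>j. E T j i"])
      (use i j e str_E el_None el_nonneg in auto)
  show "i \<in> Iset T \<Longrightarrow> eps (string_crystal T X e f) i (p j) = Fin (el T j i)"
    "i \<in> Iset T \<Longrightarrow> phi (string_crystal T X e f) i (p j) = Fin (fl T j i)"
    using E F by (simp_all add: string_crystal_def)
  show "wt (string_crystal T X e f) (p j) = wfun T j"
    using E F chk_strD(1)[OF j] by (auto simp: string_crystal_def fund_comb_def wfun_out)
qed

lemma perfect_table:
  assumes "j < ncls T"
  shows "i \<in> Iset T \<Longrightarrow> eps (perfect T) i (pel T j) = Fin (el T j i)"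
    "i \<in> Iset T \<Longrightarrow> phi (perfect T) i (pel T j) = Fin (fl T j i)" "wt (perfect T) (pel T j) = wfun T j"
proof -
  have f: "partial_fun (arrow T i) (pel T j) = map_option (pel T) (F T j i)"
    "partial_fun (\<lambda>b b'. arrow T i b' b) (pel T j) = map_option (pel T) (E T j i)"
    if "j < ncls T" "i \<in> Iset T" for j i
    using perfect_ff[OF that] perfect_ee[OF that] by (simp_all add: perfect_def string_crystal_def)
  note t = string_crystal_table[where p = "pel T" and T = T and f = "\<lambda>i. partial_fun (arrow T i)"
      and e = "\<lambda>i. partial_fun (\<lambda>b b'. arrow T i b' b)" and X = "perfect_set T", OF f assms]
  show "i \<in> Iset T \<Longrightarrow> eps (perfect T) i (pel T j) = Fin (el T j i)"
    "i \<in> Iset T \<Longrightarrow> phi (perfect T) i (pel T j) = Fin (fl T j i)" "wt (perfect T) (pel T j) = wfun T j"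
    unfolding perfect_def by (rule t; assumption)+
qed

lemma column_ops:
  assumes "j < ncls T" "i \<in> Iset T"
  shows "ff (column_crystal T) i (cls T j) = map_option (cls T) (F T j i)"
    "ee (column_crystal T) i (cls T j) = map_option (cls T) (E T j i)"
  using class_ff[OF assms] class_ee[OF assms] by (simp_all add: column_crystal_def string_crystal_def)

lemma column_table:
  assumes "j < ncls T"
  shows "i \<in> Iset T \<Longrightarrow> eps (column_crystal T) i (cls T j) = Fin (el T j i)"
    "i \<in> Iset T \<Longrightarrow> phi (column_crystal T) i (cls T j) = Fin (fl T j i)" "wt (column_crystal T) (cls T j) = wfun T j"
  using string_crystal_table[of T "\<lambda>i. class_op T (column_ff T i)" "cls T" "\<lambda>i. class_op T (column_ee T i)" j]
    class_ff class_ee assms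
  unfolding column_crystal_def by simp_all

lemma elts_columns: "elts (column_crystal T) = cls T ` {..<ncls T}"
  by (simp add: column_crystal_def string_crystal_def classes_eq)

definition pidx :: "affine_type \<Rightarrow> perfect_elt \<Rightarrow> nat" where
  "pidx T b = (THE j. j < ncls T \<and> pel T j = b)"

lemma pidx_pel: "j < ncls T \<Longrightarrow> pidx T (pel T j) = j"
  unfolding pidx_def by (rule the_equality) (auto intro: pel_inject)

lemma psi_exists: "crystal_iso (classical_data T) (perfect T) (column_crystal T) (\<lambda>b. cls T (pidx T b))"
  unfolding crystal_iso_def
proof (intro conjI ballI)
  show "bij_betw (\<lambda>b. cls T (pidx T b)) (elts (perfect T)) (elts (column_crystal T))"
    unfolding bij_betw_def elts_perfect elts_columns
    by (auto simp: inj_on_def pidx_pel cls_inject image_image)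
qed (auto simp: elts_perfect perfect_table column_table column_ops perfect_ff perfect_ee pidx_pel
    classical_data_def option.map_comp o_def F_lt E_lt intro!: map_option_cong)

lemma psi_iso: "crystal_iso (classical_data T) (perfect T) (column_crystal T) (psi T)"
  unfolding psi_def by (rule someI[of "crystal_iso (classical_data T) (perfect T) (column_crystal T)", OF psi_exists])


section \<open>The energy function\<close>

definition bil :: "affine_type \<Rightarrow> (nat \<Rightarrow> int) \<Rightarrow> (nat \<Rightarrow> int) \<Rightarrow> int" where
  "bil T u v = (\<Sum>i \<in> Iset T. \<Sum>j \<in> Iset T. cartan T i j * u i * v j)"

lemma cartan_sym: "cartan T i j = cartan T j i"
  by (auto simp: cartan_def)

lemma cartan_self [simp]: "cartan T i i = 2"
  by (simp add: cartan_def)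

lemma cartan_off: "i \<noteq> j \<Longrightarrow> cartan T i j \<le> 0"
  by (auto simp: cartan_def)

lemma bil_sym: "bil T u v = bil T v u"
  unfolding bil_def by (subst sum.swap) (simp add: cartan_sym mult.commute mult.left_commute)

lemma bil_diff_left: "bil T (\<lambda>i. u i - w i) v = bil T u v - bil T w v"
  by (simp add: bil_def algebra_simps sum_subtractf)

lemma bil_diff_right: "bil T v (\<lambda>i. u i - w i) = bil T v u - bil T v w"
  using bil_diff_left bil_sym by metis

lemma bil_scale_left: "bil T (\<lambda>i. a * u i) v = a * bil T u v"
  by (simp add: bil_def algebra_simps sum_distrib_left)

lemma bil_scale_right: "bil T v (\<lambda>i. a * u i) = a * bil T v u"
  using bil_scale_left bil_sym by metis

definition unit :: "nat \<Rightarrow> nat \<Rightarrow> int" where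
  "unit i = (\<lambda>j. if j = i then 1 else 0)"

lemma bil_unit: "i \<in> Iset T \<Longrightarrow> bil T (unit i) v = (\<Sum>j \<in> Iset T. cartan T i j * v j)"
proof -
  assume i: "i \<in> Iset T"
  have "bil T (unit i) v = (\<Sum>k \<in> Iset T. if k = i then \<Sum>j \<in> Iset T. cartan T i j * v j else 0)"
    unfolding bil_def unit_def by (rule sum.cong) auto
  then show ?thesis using i by simp
qed

lemma bil_unit_unit: "i \<in> Iset T \<Longrightarrow> bil T (unit i) (unit i) = 2"
  by (simp add: bil_unit) (simp add: unit_def if_distrib sum.delta cong: if_cong)

lemma bil_E6: "bil E6 v v = 2 * (v 0 * v 0 + v 1 * v 1 + v 2 * v 2 + v 3 * v 3 + v 4 * v 4 + v 5 * v 5 + v 6 * v 6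
    - v 1 * v 3 - v 3 * v 4 - v 4 * v 5 - v 5 * v 6 - v 4 * v 2 - v 2 * v 0)"
  unfolding bil_def Iset_E by (simp add: cartan_def algebra_simps)

lemma bil_E7: "bil E7 v v = 2 * (v 0 * v 0 + v 1 * v 1 + v 2 * v 2 + v 3 * v 3 + v 4 * v 4 + v 5 * v 5 + v 6 * v 6
    + v 7 * v 7 - v 0 * v 1 - v 1 * v 3 - v 3 * v 4 - v 4 * v 5 - v 5 * v 6 - v 6 * v 7 - v 4 * v 2)"
  unfolding bil_def Iset_E by (simp add: cartan_def algebra_simps)

lemma bil_E8: "bil E8 v v = 2 * (v 0 * v 0 + v 1 * v 1 + v 2 * v 2 + v 3 * v 3 + v 4 * v 4 + v 5 * v 5 + v 6 * v 6
    + v 7 * v 7 + v 8 * v 8 - v 0 * v 8 - v 8 * v 7 - v 7 * v 6 - v 6 * v 5 - v 5 * v 4 - v 4 * v 3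
    - v 3 * v 1 - v 4 * v 2)"
  unfolding bil_def Iset_E by (simp add: cartan_def algebra_simps)

text \<open>Sums of squares \<open>\<Sum> (a\<^sub>j v\<^sub>i - a\<^sub>i v\<^sub>j)\<^sup>2 / (a\<^sub>i a\<^sub>j)\<close> over the edges of the Dynkin diagram, with
  \<open>a\<close> the marks, cleared of denominators.\<close>

lemma sos_E6: "12 * bil E6 v v = 6 * (2 * v 1 - v 3)^2 + 2 * (3 * v 3 - 2 * v 4)^2 + 2 * (2 * v 4 - 3 * v 5)^2
    + 6 * (v 5 - 2 * v 6)^2 + 2 * (2 * v 4 - 3 * v 2)^2 + 6 * (v 2 - 2 * v 0)^2"
  unfolding bil_E6 by (simp add: power2_eq_square algebra_simps)

lemma sos_E7: "24 * bil E7 v v = 12 * (2 * v 0 - v 1)^2 + 4 * (3 * v 1 - 2 * v 3)^2 + 2 * (4 * v 3 - 3 * v 4)^2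
    + 2 * (3 * v 4 - 4 * v 5)^2 + 4 * (2 * v 5 - 3 * v 6)^2 + 12 * (v 6 - 2 * v 7)^2 + 12 * (v 4 - 2 * v 2)^2"
  unfolding bil_E7 by (simp add: power2_eq_square algebra_simps)

lemma sos_E8: "360 * bil E8 v v = 180 * (2 * v 0 - v 8)^2 + 60 * (3 * v 8 - 2 * v 7)^2 + 30 * (4 * v 7 - 3 * v 6)^2
    + 18 * (5 * v 6 - 4 * v 5)^2 + 12 * (6 * v 5 - 5 * v 4)^2 + 60 * (2 * v 4 - 3 * v 3)^2
    + 180 * (v 3 - 2 * v 1)^2 + 180 * (v 4 - 2 * v 2)^2"
  unfolding bil_E8 by (simp add: power2_eq_square algebra_simps)

lemma bil_even: "\<exists>k. bil T v v = 2 * k"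
  using bil_E6[of v] bil_E7[of v] bil_E8[of v] by (cases T) blast+

lemma bil_nonneg: "0 \<le> bil T v v"
proof (cases T)
  case E6
  have "0 \<le> 12 * bil E6 v v" unfolding sos_E6 by simp
  then show ?thesis using E6 by simp
next
  case E7
  have "0 \<le> 24 * bil E7 v v" unfolding sos_E7 by simp
  then show ?thesis using E7 by simp
next
  case E8
  have "0 \<le> 360 * bil E8 v v" unfolding sos_E8 by simp
  then show ?thesis using E8 by simp
qed

lemma sum_squares_0: "(0::int) \<le> a \<Longrightarrow> 0 \<le> b \<Longrightarrow> a + b = 0 \<longleftrightarrow> a = 0 \<and> b = 0"
  by linarith

text \<open>The radical of the form is spanned by \<delta>, all of whose coefficients are nonzero,
  so a null vector with one vanishing coordinate vanishes.\<close>

lemma bil_zero: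
  assumes z: "bil T v v = 0" and k: "k \<in> Iset T" "v k = 0" and i: "i \<in> Iset T"
  shows "v i = 0"
proof (cases T)
  case E6
  have "2 * v 1 - v 3 = 0 \<and> 3 * v 3 - 2 * v 4 = 0 \<and> 2 * v 4 - 3 * v 5 = 0 \<and> v 5 - 2 * v 6 = 0 \<and>
      2 * v 4 - 3 * v 2 = 0 \<and> v 2 - 2 * v 0 = 0"
    using z sos_E6[of v] by (simp add: E6 sum_squares_0)
  then have "v 4 = 0 \<longrightarrow> v 0 = 0 \<and> v 1 = 0 \<and> v 2 = 0 \<and> v 3 = 0 \<and> v 5 = 0 \<and> v 6 = 0" and
    "v k = 0 \<longrightarrow> v 4 = 0"
    using k(1) unfolding E6 Iset_E by auto
  then show ?thesis using k(2) i unfolding E6 Iset_E by auto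
next
  case E7
  have "2 * v 0 - v 1 = 0 \<and> 3 * v 1 - 2 * v 3 = 0 \<and> 4 * v 3 - 3 * v 4 = 0 \<and> 3 * v 4 - 4 * v 5 = 0 \<and>
      2 * v 5 - 3 * v 6 = 0 \<and> v 6 - 2 * v 7 = 0 \<and> v 4 - 2 * v 2 = 0"
    using z sos_E7[of v] by (simp add: E7 sum_squares_0)
  then have "v 4 = 0 \<longrightarrow> v 0 = 0 \<and> v 1 = 0 \<and> v 2 = 0 \<and> v 3 = 0 \<and> v 5 = 0 \<and> v 6 = 0 \<and> v 7 = 0" and
    "v k = 0 \<longrightarrow> v 4 = 0"
    using k(1) unfolding E7 Iset_E by auto
  then show ?thesis using k(2) i unfolding E7 Iset_E by auto
next
  case E8
  have "2 * v 0 - v 8 = 0 \<and> 3 * v 8 - 2 * v 7 = 0 \<and> 4 * v 7 - 3 * v 6 = 0 \<and> 5 * v 6 - 4 * v 5 = 0 \<and>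
      6 * v 5 - 5 * v 4 = 0 \<and> 2 * v 4 - 3 * v 3 = 0 \<and> v 3 - 2 * v 1 = 0 \<and> v 4 - 2 * v 2 = 0"
    using z sos_E8[of v] by (simp add: E8 sum_squares_0)
  then have "v 4 = 0 \<longrightarrow> v 0 = 0 \<and> v 1 = 0 \<and> v 2 = 0 \<and> v 3 = 0 \<and> v 5 = 0 \<and> v 6 = 0 \<and> v 7 = 0 \<and> v 8 = 0" and
    "v k = 0 \<longrightarrow> v 4 = 0"
    using k(1) unfolding E8 Iset_E by auto
  then show ?thesis using k(2) i unfolding E8 Iset_E by auto
qed

lemma bil_ge_2: "k \<in> Iset T \<Longrightarrow> v k = 0 \<Longrightarrow> i \<in> Iset T \<Longrightarrow> v i \<noteq> 0 \<Longrightarrow> 2 \<le> bil T v v"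
  using bil_zero[of T v k i] bil_even[of T v] bil_nonneg[of T v] by fastforce

text \<open>A real root is a nonnegative or a nonpositive combination of simple roots: otherwise its
  positive and negative parts each have norm at least 2 and do not pair positively.\<close>

lemma sign_coherent:
  assumes q: "bil T v v = 2" and j: "j \<in> Iset T" "v j > 0" and i: "i \<in> Iset T"
  shows "0 \<le> v i"
proof (rule ccontr)
  assume neg: "\<not> 0 \<le> v i"
  define p where "p = (\<lambda>k. max (v k) 0)"
  define m where "m = (\<lambda>k. max (- v k) 0)"
  have v: "v = (\<lambda>k. p k - m k)" by (auto simp: p_def m_def)
  have "bil T p m \<le> 0"
    unfolding bil_def
  proof (intro sum_nonpos)
    fix k l
    show "cartan T k l * p k * m l \<le> 0"
    proof (cases "k = l")
      case True then show ?thesis by (auto simp: p_def m_def max_def)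
    next
      case False
      have "0 \<le> p k * m l" by (simp add: p_def m_def)
      then show ?thesis using cartan_off[OF False, of T] by (simp add: mult.assoc mult_nonpos_nonneg)
    qed
  qed
  moreover have "2 \<le> bil T p p" by (rule bil_ge_2[OF i _ j(1)]) (use neg j in \<open>auto simp: p_def\<close>)
  moreover have "2 \<le> bil T m m" by (rule bil_ge_2[OF j(1) _ i]) (use neg j in \<open>auto simp: m_def\<close>)
  moreover have "bil T v v = bil T p p + bil T m m - 2 * bil T p m"
    unfolding v bil_diff_left bil_diff_right using bil_sym[of T m p] by simp
  ultimately show False using q by linarith
qed

text \<open>Vectors list the coefficients of the simple roots. In simply laced affine type the real
  roots are the lattice vectors of norm 2.\<close>

definition posroot :: "affine_type \<Rightarrow> (nat \<Rightarrow> int) \<Rightarrow> bool" where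
  "posroot T v \<longleftrightarrow> (\<forall>i. i \<notin> Iset T \<longrightarrow> v i = 0) \<and> bil T v v = 2 \<and> (\<forall>i \<in> Iset T. 0 \<le> v i)"

definition vrefl :: "affine_type \<Rightarrow> nat \<Rightarrow> (nat \<Rightarrow> int) \<Rightarrow> nat \<Rightarrow> int" where
  "vrefl T i v = (\<lambda>j. v j - bil T (unit i) v * unit i j)"

lemma posroot_unit: "i \<in> Iset T \<Longrightarrow> posroot T (unit i)"
  by (auto simp: posroot_def bil_unit_unit) (auto simp: unit_def)

lemma bil_vrefl: "i \<in> Iset T \<Longrightarrow> bil T (vrefl T i v) (vrefl T i v) = bil T v v"
  unfolding vrefl_def bil_diff_left bil_diff_right bil_scale_left bil_scale_right
  using bil_unit_unit[of i T] bil_sym[of T v "unit i"] by (simp add: algebra_simps)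

text \<open>The reflection changes only the coefficient at \<open>i\<close>. A positive root other
  than \<alpha>_i has another positive coefficient, which survives, and \<open>sign_coherent\<close>
  does the rest.\<close>

lemma posroot_vrefl:
  assumes v: "posroot T v" and i: "i \<in> Iset T" and ne: "v \<noteq> unit i"
  shows "posroot T (vrefl T i v)"
proof -
  have q: "bil T (vrefl T i v) (vrefl T i v) = 2" using v bil_vrefl[OF i] by (simp add: posroot_def)
  have "\<exists>j \<in> Iset T. j \<noteq> i \<and> v j > 0"
  proof (rule ccontr)
    assume "\<not> (\<exists>j \<in> Iset T. j \<noteq> i \<and> v j > 0)"
    then have "v j = 0" if "j \<noteq> i" for j using v that unfolding posroot_def by (metis le_less)
    then have vu: "v = (\<lambda>j. v i * unit i j)" by (auto simp: unit_def)
    have "bil T v v = v i * (v i * 2)"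
      by (subst vu, subst (2) vu) (simp only: bil_scale_left bil_scale_right bil_unit_unit[OF i])
    then have "v i * v i = 1" using v by (simp add: posroot_def)
    then have "v i = 1" using v i by (auto simp: posroot_def zmult_eq_1_iff)
    then show False using vu ne by auto
  qed
  then obtain j where j: "j \<in> Iset T" "j \<noteq> i" "v j > 0" by blast
  then have "vrefl T i v j > 0" by (simp add: vrefl_def unit_def)
  then have "\<forall>l \<in> Iset T. 0 \<le> vrefl T i v l" using sign_coherent[OF q j(1)] by blast
  moreover have "\<forall>l. l \<notin> Iset T \<longrightarrow> vrefl T i v l = 0" using v i by (auto simp: posroot_def vrefl_def unit_def)
  ultimately show ?thesis using q by (simp add: posroot_def)
qed

section \<open>Reflections of affine weights and the order they generate\<close>

definition vpair :: "affine_type \<Rightarrow> (nat \<Rightarrow> int) \<Rightarrow> cweight \<Rightarrow> int" where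
  "vpair T v c = (\<Sum>j \<in> Iset T. v j * c j)"

definition vweight :: "affine_type \<Rightarrow> (nat \<Rightarrow> int) \<Rightarrow> cweight" where
  "vweight T v = (\<lambda>l. \<Sum>i \<in> Iset T. v i * csroot T i l)"

text \<open>Roots and coroots have the same coefficients, so \<open>v\<close> serves as both. Among
  the simple roots only \<alpha>_0 has a \<delta>-component, so the \<delta>-component of the root
  \<open>v\<close> is \<open>v 0\<close>.\<close>

definition arefl :: "affine_type \<Rightarrow> (nat \<Rightarrow> int) \<Rightarrow> aweight \<Rightarrow> aweight" where
  "arefl T v x = (\<lambda>l. fst x l - vpair T v (fst x) * vweight T v l, snd x - vpair T v (fst x) * v 0)"

lemma vpair_diff: "vpair T (\<lambda>j. u j - a * w j) c = vpair T u c - a * vpair T w c"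
  by (simp add: vpair_def algebra_simps sum_subtractf sum_distrib_left)

lemma vpair_diff2: "vpair T v (\<lambda>l. c l - a * d l) = vpair T v c - a * vpair T v d"
  by (simp add: vpair_def algebra_simps sum_subtractf sum_distrib_left)

lemma vweight_diff: "vweight T (\<lambda>j. u j - a * w j) l = vweight T u l - a * vweight T w l"
  by (simp add: vweight_def algebra_simps sum_subtractf sum_distrib_left)

lemma vpair_unit: "i \<in> Iset T \<Longrightarrow> vpair T (unit i) c = c i"
  by (simp add: vpair_def unit_def if_distrib[where f = "\<lambda>x. x * _"] cong: if_cong)

lemma vweight_unit: "i \<in> Iset T \<Longrightarrow> vweight T (unit i) = csroot T i"
  by (rule ext) (simp add: vweight_def unit_def if_distrib[where f = "\<lambda>x. x * _"] cong: if_cong)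

lemma vpair_csroot: "i \<in> Iset T \<Longrightarrow> vpair T v (csroot T i) = bil T (unit i) v"
  unfolding bil_unit vpair_def
  by (rule sum.cong) (simp_all add: csroot_def fund_comb_def cartan_sym[of T i])

lemma vweight_at: "i \<in> Iset T \<Longrightarrow> vweight T v i = bil T (unit i) v"
  unfolding bil_unit vweight_def
  by (rule sum.cong) (simp_all add: csroot_def fund_comb_def)

lemma dz_unit: "unit i 0 = dz i"
  by (simp add: dz_def unit_def)

lemma arefl_unit: "i \<in> Iset T \<Longrightarrow> arefl T (unit i) x = (\<lambda>l. fst x l - fst x i * csroot T i l, snd x - fst x i * dz i)"
  by (simp add: arefl_def vpair_unit vweight_unit dz_unit)

lemma vpair_vrefl:
  assumes i: "i \<in> Iset T"
  shows "vpair T (vrefl T i v) (fst (arefl T (unit i) x)) = vpair T v (fst x)"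
  unfolding arefl_unit[OF i] vrefl_def fst_conv vpair_diff vpair_diff2 vpair_unit[OF i] vpair_csroot[OF i]
  using csroot_self[OF i] bil_unit_unit[OF i] by (simp add: algebra_simps)

text \<open>Conjugation of reflections: the reflection in \<open>s\<^sub>i \<beta>\<close> is
  \<open>s\<^sub>i s\<^sub>\<beta> s\<^sub>i\<close>.\<close>

lemma arefl_vrefl:
  assumes i: "i \<in> Iset T"
  shows "arefl T (vrefl T i v) (arefl T (unit i) x) = arefl T (unit i) (arefl T v x)"
proof (rule prod_eqI)
  let ?p = "vpair T v (fst x)" and ?b = "bil T (unit i) v"
  have L: "arefl T (vrefl T i v) (arefl T (unit i) x) =
     (\<lambda>l. fst (arefl T (unit i) x) l - ?p * vweight T (vrefl T i v) l,
      snd (arefl T (unit i) x) - ?p * vrefl T i v 0)"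
    unfolding arefl_def[of T "vrefl T i v"] vpair_vrefl[OF i] ..
  have w: "vweight T (vrefl T i v) l = vweight T v l - ?b * csroot T i l" for l
    unfolding vrefl_def vweight_diff vweight_unit[OF i] ..
  have vi: "fst (arefl T v x) i = fst x i - ?p * ?b"
    unfolding arefl_def using vweight_at[OF i] by simp
  have d: "vrefl T i v 0 = v 0 - ?b * dz i" by (simp add: vrefl_def unit_def dz_def)
  have R: "arefl T (unit i) (arefl T v x) =
     (\<lambda>l. fst (arefl T v x) l - (fst x i - ?p * ?b) * csroot T i l, snd (arefl T v x) - (fst x i - ?p * ?b) * dz i)"
    unfolding arefl_unit[OF i, of "arefl T v x"] vi ..
  show "fst (arefl T (vrefl T i v) (arefl T (unit i) x)) = fst (arefl T (unit i) (arefl T v x))"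
    unfolding L R unfolding arefl_unit[OF i, of x] fst_conv w by (rule ext) (simp add: arefl_def algebra_simps)
  show "snd (arefl T (vrefl T i v) (arefl T (unit i) x)) = snd (arefl T (unit i) (arefl T v x))"
    unfolding L R unfolding arefl_unit[OF i, of x] snd_conv d by (simp add: arefl_def algebra_simps)
qed

inductive wstep :: "affine_type \<Rightarrow> aweight \<Rightarrow> aweight \<Rightarrow> bool" for T where
  "posroot T v \<Longrightarrow> 0 < vpair T v (fst x) \<Longrightarrow> wstep T x (arefl T v x)"

abbreviation reach :: "affine_type \<Rightarrow> aweight \<Rightarrow> aweight \<Rightarrow> bool" where
  "reach T \<equiv> (wstep T)\<^sup>*\<^sup>*"

abbreviation sr :: "affine_type \<Rightarrow> nat \<Rightarrow> aweight \<Rightarrow> aweight" where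
  "sr T i \<equiv> arefl T (unit i)"

lemma sr_at: "i \<in> Iset T \<Longrightarrow> fst (sr T i x) i = - fst x i"
  using csroot_self[of i T] by (simp add: arefl_unit)

lemma sr_sr: "i \<in> Iset T \<Longrightarrow> sr T i (sr T i x) = x"
  by (rule prod_eqI) (auto simp: arefl_unit csroot_self algebra_simps)

lemma sr_fix: "i \<in> Iset T \<Longrightarrow> fst x i = 0 \<Longrightarrow> sr T i x = x"
  by (simp add: arefl_unit)

lemma wstep_sr: "i \<in> Iset T \<Longrightarrow> 0 < fst x i \<Longrightarrow> wstep T x (sr T i x)"
  by (rule wstep.intros) (simp_all add: posroot_unit vpair_unit)

text \<open>Of the two weights \<open>x\<close> and \<open>s\<^sub>i x\<close>, the one that is
  higher in the order; \<open>wbot\<close> gives the lower one.\<close>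

definition wtop :: "affine_type \<Rightarrow> nat \<Rightarrow> aweight \<Rightarrow> aweight" where
  "wtop T i x = (if fst x i < 0 then sr T i x else x)"

definition wbot :: "affine_type \<Rightarrow> nat \<Rightarrow> aweight \<Rightarrow> aweight" where
  "wbot T i x = (if 0 < fst x i then sr T i x else x)"

lemma reach_bot:
  assumes i: "i \<in> Iset T"
  shows "reach T x (wbot T i x)" "reach T (sr T i x) (wbot T i x)"
proof -
  show "reach T x (wbot T i x)" using wstep_sr[OF i, of x] by (auto simp: wbot_def)
  show "reach T (sr T i x) (wbot T i x)"
    using wstep_sr[OF i, of "sr T i x"] sr_at[OF i, of x] sr_sr[OF i, of x] sr_fix[OF i, of x]
    by (cases "fst x i = 0") (auto simp: wbot_def)
qed

lemma reach_top:
  assumes i: "i \<in> Iset T"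
  shows "reach T (wtop T i x) x" "reach T (wtop T i x) (sr T i x)"
proof -
  show "reach T (wtop T i x) x"
    using wstep_sr[OF i, of "sr T i x"] sr_at[OF i, of x] sr_sr[OF i, of x] by (auto simp: wtop_def)
  show "reach T (wtop T i x) (sr T i x)"
    using wstep_sr[OF i, of x] sr_fix[OF i, of x] by (cases "fst x i = 0") (auto simp: wtop_def)
qed

text \<open>Except for the reflection in \<open>\<alpha>\<^sub>i\<close> itself, \<open>s\<^sub>i\<close> maps steps to steps; this gives the lifting
  property of the order.\<close>

lemma wstep_lift:
  assumes s: "wstep T x y" and i: "i \<in> Iset T"
  shows "(y = sr T i x \<and> 0 < fst x i) \<or> wstep T (sr T i x) (sr T i y)"
  using s
proof cases
  case (1 v)
  show ?thesis
  proof (cases "v = unit i")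
    case True then show ?thesis using 1 vpair_unit[OF i] by simp
  next
    case False
    have "wstep T (sr T i x) (arefl T (vrefl T i v) (sr T i x))"
      using posroot_vrefl[OF 1(2) i False] 1(3) by (intro wstep.intros) (simp_all add: vpair_vrefl[OF i])
    then show ?thesis using 1(1) by (simp add: arefl_vrefl[OF i])
  qed
qed

lemma wstep_bot:
  assumes s: "wstep T x y" and i: "i \<in> Iset T"
  shows "reach T (wbot T i x) (wbot T i y)"
proof -
  consider "y = sr T i x" "0 < fst x i" | "wstep T (sr T i x) (sr T i y)" using wstep_lift[OF s i] by blast
  then show ?thesis
  proof cases
    case 1 then show ?thesis using sr_at[OF i, of x] by (simp add: wbot_def)
  next
    case 2
    then show ?thesis
      using s reach_bot[OF i, of y] by (auto simp: wbot_def[of T i x] intro: converse_rtranclp_into_rtranclp)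
  qed
qed

lemma wstep_top:
  assumes s: "wstep T x y" and i: "i \<in> Iset T"
  shows "reach T (wtop T i x) (wtop T i y)"
proof -
  consider "y = sr T i x" "0 < fst x i" | "wstep T (sr T i x) (sr T i y)" using wstep_lift[OF s i] by blast
  then show ?thesis
  proof cases
    case 1 then show ?thesis using sr_at[OF i, of x] sr_sr[OF i, of x] by (simp add: wtop_def)
  next
    case 2
    then show ?thesis
      using s reach_top[OF i, of x] by (auto simp: wtop_def[of T i y] intro: rtranclp.rtrancl_into_rtrancl)
  qed
qed

text \<open>The form in which the lifting property is used: passing from a weight to the lower, or
  to the higher, of itself and its reflection under \<open>s\<^sub>i\<close> is monotone.\<close>

lemma reach_wbot: "reach T x y \<Longrightarrow> i \<in> Iset T \<Longrightarrow> reach T (wbot T i x) (wbot T i y)"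
  by (induction rule: rtranclp_induct) (auto dest: wstep_bot)

lemma reach_wtop: "reach T x y \<Longrightarrow> i \<in> Iset T \<Longrightarrow> reach T (wtop T i x) (wtop T i y)"
  by (induction rule: rtranclp_induct) (auto dest: wstep_top)

text \<open>The coefficient of \<delta> is chosen such that \<alpha>_0 has the same height 2 as the
  other simple roots. Every positive root then has positive height, so each step of the order
  strictly lowers it.\<close>

definition ahgt :: "affine_type \<Rightarrow> aweight \<Rightarrow> int" where
  "ahgt T x = hgt T (fst x) + 2 * nblk T * snd x"

lemma hgt_vweight: "hgt T (vweight T v) = (\<Sum>i \<in> Iset T. v i * hgt T (csroot T i))"
proof -
  have "hgt T (vweight T v) = (\<Sum>l \<in> Iset T. \<Sum>i \<in> Iset T. v i * (rho_list T ! l * csroot T i l))"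
    by (simp add: hgt_def vweight_def sum_distrib_left mult.left_commute)
  also have "\<dots> = (\<Sum>i \<in> Iset T. v i * hgt T (csroot T i))"
    by (subst sum.swap) (simp add: hgt_def sum_distrib_left)
  finally show ?thesis .
qed

lemma zero_Iset [simp]: "0 \<in> Iset T" by (simp add: Iset_iff)

lemma ahgt_vweight: "hgt T (vweight T v) + 2 * nblk T * v 0 = 2 * (\<Sum>i \<in> Iset T. v i)"
proof -
  have "hgt T (vweight T v) = (\<Sum>i \<in> Iset T. 2 * v i - (if i = 0 then 2 * nblk T * v 0 else 0))"
    unfolding hgt_vweight by (rule sum.cong) (auto simp: hgt_csroot algebra_simps)
  then show ?thesis by (simp add: sum_subtractf sum_distrib_left)
qed

lemma hgt_scale: "hgt T (\<lambda>l. a * c l) = a * hgt T c"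
  by (simp add: hgt_def sum_distrib_left mult.left_commute)

lemma ahgt_wstep: "wstep T x y \<Longrightarrow> ahgt T y < ahgt T x"
proof (induction rule: wstep.induct)
  case (1 v x)
  let ?p = "vpair T v (fst x)"
  have "fst (arefl T v x) = fst x - (\<lambda>l. ?p * vweight T v l)" by (auto simp: arefl_def)
  then have "hgt T (fst (arefl T v x)) = hgt T (fst x) - ?p * hgt T (vweight T v)"
    by (simp add: hgt_diff hgt_scale)
  then have e: "ahgt T (arefl T v x) = ahgt T x - ?p * (hgt T (vweight T v) + 2 * nblk T * v 0)"
    by (simp add: ahgt_def arefl_def algebra_simps)
  have nn: "\<forall>i \<in> Iset T. 0 \<le> v i" using 1 by (simp add: posroot_def)
  have "0 < (\<Sum>i \<in> Iset T. v i)"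
  proof (rule ccontr)
    assume "\<not> 0 < (\<Sum>i \<in> Iset T. v i)"
    moreover have "0 \<le> (\<Sum>i \<in> Iset T. v i)" using nn by (simp add: sum_nonneg)
    ultimately have "(\<Sum>i \<in> Iset T. v i) = 0" by simp
    then have "\<forall>i \<in> Iset T. v i = 0" using nn by (subst (asm) sum_nonneg_eq_0_iff) auto
    then have "bil T v v = 0" by (simp add: bil_def)
    then show False using 1 by (simp add: posroot_def)
  qed
  then have "0 < ?p * (2 * (\<Sum>i \<in> Iset T. v i))" using 1 by simp
  then show ?case unfolding e ahgt_vweight by linarith
qed

lemma ahgt_reach: "reach T x y \<Longrightarrow> ahgt T y \<le> ahgt T x"
  by (induction rule: rtranclp_induct) (auto dest: ahgt_wstep)

definition adel :: "int \<Rightarrow> aweight \<Rightarrow> aweight" where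
  "adel m x = (fst x, snd x + m)"

lemma adel_adel [simp]: "adel m (adel n x) = adel (m + n) x"
  by (simp add: adel_def)

lemma adel_0 [simp]: "adel 0 x = x"
  by (simp add: adel_def)

lemma reach_adel: "reach T x y \<Longrightarrow> reach T (adel m x) (adel m y)"
proof (induction rule: rtranclp_induct)
  case (step y z)
  have "wstep T (adel m y) (adel m z)"
    using step(2)
  proof cases
    case (1 v)
    have "adel m z = arefl T v (adel m y)" unfolding 1 by (simp add: adel_def arefl_def)
    then show ?thesis using 1 wstep.intros[of T v "adel m y"] by (simp add: adel_def)
  qed
  then show ?case using step by simp
qed simp

text \<open>The coefficients of \<delta>, which in simply laced type are also those of the canonical
  central element; \<open>vpair T (mark T)\<close> is the level.\<close>

fun marks :: "affine_type \<Rightarrow> int list" where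
  "marks E6 = [1,1,2,2,3,2,1]" | "marks E7 = [1,2,2,3,4,3,2,1]" | "marks E8 = [1,2,3,4,6,5,4,3,2]"

definition mark :: "affine_type \<Rightarrow> nat \<Rightarrow> int" where
  "mark T i = (if i \<in> Iset T then marks T ! i else 0)"

lemma mark_pos: "i \<in> Iset T \<Longrightarrow> 1 \<le> mark T i"
  by (cases T) (auto simp: mark_def Iset_E)

lemma mark_check: "list_all (\<lambda>T. length (marks T) = Suc (rnk T) \<and>
    list_all (\<lambda>i. sum_list (map2 (*) (marks T) (alph T ! i)) = 0) [0..<Suc (rnk T)]) [E6, E7, E8]"
  by code_simp

lemma sum_Iset_list:
  assumes "length xs = Suc (rnk T)" "length ys = Suc (rnk T)"
  shows "(\<Sum>l \<in> Iset T. xs ! l * ys ! l) = sum_list (map2 (*) xs (ys :: int list))"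
  using assms by (simp add: sum_list_sum_nth Iset_def atLeast0AtMost lessThan_Suc_atMost atLeast0LessThan)

lemma mark_csroot: "i \<in> Iset T \<Longrightarrow> vpair T (mark T) (csroot T i) = 0"
proof -
  assume i: "i \<in> Iset T"
  have "T \<in> set [E6, E7, E8]" by (cases T) auto
  then have c: "length (marks T) = Suc (rnk T)"
    "\<forall>i \<in> set [0..<Suc (rnk T)]. sum_list (map2 (*) (marks T) (alph T ! i)) = 0"
    using mark_check unfolding list_all_iff by blast+
  have "vpair T (mark T) (csroot T i) = (\<Sum>l \<in> Iset T. marks T ! l * alph T ! i ! l)"
    unfolding vpair_def by (rule sum.cong) (simp_all add: alph_nth[OF i] mark_def)
  also have "\<dots> = 0"
    unfolding sum_Iset_list[OF c(1) alph_nth(1)[OF i]] using c(2) i by (simp add: Iset_iff del: upt_Suc)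
  finally show ?thesis .
qed

lemma level_check_E6:
  "list_all (\<lambda>j. sum_list (map2 (*) (marks E6) (wlist E6 j)) = 0) [0..<27]"
  by code_simp

lemma level_check_E7:
  "list_all (\<lambda>j. sum_list (map2 (*) (marks E7) (wlist E7 j)) = 0) [0..<56]"
  by code_simp

lemma level_check_E8:
  "list_all (\<lambda>j. sum_list (map2 (*) (marks E8) (wlist E8 j)) = 0) [0..<249]"
  by code_simp

lemma level_zero:
  assumes "j < ncls T"
  shows "vpair T (mark T) (wfun T j) = 0"
proof -
  have l: "length (marks T) = Suc (rnk T)" by (cases T) auto
  have "vpair T (mark T) (wfun T j) = (\<Sum>l \<in> Iset T. marks T ! l * wlist T j ! l)"
    unfolding vpair_def by (rule sum.cong) (simp_all add: wfun_def mark_def)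
  also have "\<dots> = 0"
    unfolding sum_Iset_list[OF l chk_wtD(1)[OF assms]]
    using level_check_E6 level_check_E7 level_check_E8 assms by (cases T) (auto simp: list_all_iff simp del: marks.simps)
  finally show ?thesis .
qed

text \<open>If the pairing with \<open>h\<^sub>i\<close> is negative, the reflection in \<delta> -
  \<alpha>_i is used instead. At level zero it agrees with \<open>s\<^sub>i\<close> up to a multiple
  of \<delta>, and it lowers the weight.\<close>

lemma conn_sr:
  assumes i: "i \<in> Iset T" and lev: "vpair T (mark T) (fst x) = 0"
  shows "\<exists>m. reach T x (adel m (sr T i x))"
proof -
  consider "0 < fst x i" | "fst x i = 0" | "fst x i < 0" by linarith
  then show ?thesis
  proof cases
    case 1 then show ?thesis using wstep_sr[OF i 1] adel_0 by (metis r_into_rtranclp)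
  next
    case 2 then show ?thesis using sr_fix[OF i 2] adel_0 by (metis rtranclp.rtrancl_refl)
  next
    case 3
    define v where "v = (\<lambda>j. mark T j - 1 * unit i j)"
    have mz: "bil T (unit l) (mark T) = 0" if "l \<in> Iset T" for l
      using mark_csroot[OF that] vpair_csroot[OF that] by metis
    have mm: "bil T (mark T) w = 0" for w
    proof -
      have "bil T (mark T) w = (\<Sum>l \<in> Iset T. w l * bil T (unit l) (mark T))"
        unfolding bil_sym[of T "mark T"]
        by (simp add: bil_def[of T w] bil_unit sum_distrib_left algebra_simps)
      then show ?thesis using mz by simp
    qed
    have "bil T v v = 2"
      unfolding v_def bil_diff_left bil_diff_right mult_1_left
      using mm bil_sym[of T "unit i" "mark T"] bil_unit_unit[OF i] by simp
    moreover have "0 \<le> v l" if "l \<in> Iset T" for l using mark_pos[OF that] by (cases "l = i") (auto simp: v_def unit_def)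
    moreover have "v l = 0" if "l \<notin> Iset T" for l using that i by (auto simp: v_def unit_def mark_def)
    ultimately have pr: "posroot T v" by (simp add: posroot_def)
    have p: "vpair T v (fst x) = - fst x i" unfolding v_def vpair_diff using lev vpair_unit[OF i] by simp
    have "vweight T (mark T) l = 0" for l
    proof (cases "l \<in> Iset T")
      case True then show ?thesis using vweight_at[OF True] mz[OF True] by simp
    next
      case False then show ?thesis by (simp add: vweight_def csroot_out)
    qed
    then have w: "vweight T v l = - csroot T i l" for l
      unfolding v_def vweight_diff using vweight_unit[OF i] by simp
    have "wstep T x (arefl T v x)" using pr p 3 by (intro wstep.intros) simp_all
    moreover have "arefl T v x = adel (fst x i * (v 0 + dz i)) (sr T i x)"
    proof -
      have a: "arefl T v x = (\<lambda>l. fst x l - - fst x i * - csroot T i l, snd x - - fst x i * v 0)"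
        by (simp add: arefl_def p w)
      show ?thesis unfolding a arefl_unit[OF i] adel_def by (simp add: algebra_simps)
    qed
    ultimately show ?thesis by (metis r_into_rtranclp)
  qed
qed


text \<open>The elements of weight zero have no place in the order on weights. They are replaced by their
  upper neighbour when they are the first factor, and by their lower neighbour when they are the
  second one.\<close>

definition i1 :: "affine_type \<Rightarrow> nat \<Rightarrow> int \<Rightarrow> aweight" where
  "i1 T j m = (case kind T j of None \<Rightarrow> (wfun T j, m) | Some k \<Rightarrow> (csroot T k, m + dz k))"

definition i2 :: "affine_type \<Rightarrow> nat \<Rightarrow> int \<Rightarrow> aweight" where
  "i2 T j m = (case kind T j of None \<Rightarrow> (wfun T j, m) | Some k \<Rightarrow> (- csroot T k, m - dz k))"

lemma adel_i1: "adel d (i1 T j m) = i1 T j (m + d)"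
  and adel_i2: "adel d (i2 T j m) = i2 T j (m + d)"
  by (auto simp: i1_def i2_def adel_def split: option.splits)

lemma sr_csroot: "i \<in> Iset T \<Longrightarrow> sr T i (csroot T i, m) = (- csroot T i, m - 2 * dz i)"
  by (auto simp: arefl_unit csroot_self fun_eq_iff)

lemma sr_one: "i \<in> Iset T \<Longrightarrow> c i = 1 \<Longrightarrow> sr T i (c, m) = (c - csroot T i, m - dz i)"
  by (auto simp: arefl_unit fun_eq_iff)

text \<open>Between nonzero weights both substitutes are reflected by \<open>s\<^sub>i\<close>. On
  entering weight zero the substitute for the first factor stays and that for the second is
  reflected; on leaving it is the other way round.\<close>

lemma i12_F:
  assumes j: "j < ncls T" and i: "i \<in> Iset T" and F: "F T j i = Some k"
  shows "i1 T k (m - dz i) = i1 T j m \<or>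
      (i1 T k (m - dz i) = sr T i (i1 T j m) \<and> 0 < fst (i1 T j m) i \<and> fl T j i = 1)" (is ?A)
    and "i2 T k (m - dz i) = i2 T j m \<or>
      (i2 T k (m - dz i) = sr T i (i2 T j m) \<and> 0 < fst (i2 T j m) i \<and> el T j i = 0)" (is ?B)
proof -
  note s = str_F[OF j i F]
  have w: "wfun T k = wfun T j - csroot T i" by (rule wfun_F[OF j i F])
  consider (1) "kind T j = None" "kind T k = None" | (2) "kind T j = None" "kind T k = Some i"
    | (3) "kind T j = Some i" "kind T k = None" | (4) "kind T j = Some i" "kind T k = Some i"
    using kind_E_colour[of T k _ i] kind_F_colour[of T j _ i] s(2) F by (cases "kind T j"; cases "kind T k") auto
  then have "?A \<and> ?B"
  proof cases
    case 1
    have e: "el T j i = 0" "fl T k i = 0"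
      using chk_strD(4)[OF j i] chk_strD(4)[OF s(1) i] 1 s(3,4) fl_nonneg[of T k i] el_nonneg[of T j i] by auto
    then have "wfun T j i = 1" using chk_strD(1)[OF j i] s(3) by simp
    then show ?thesis using 1 e s(3) w sr_one[OF i, of "wfun T j" m] by (simp add: i1_def i2_def)
  next
    case 2
    have e: "el T j i = 0"
      using chk_strD(4)[OF j i] 2 s(3) fl_nonneg[of T k i] by auto
    have "wfun T j = csroot T i" using w kind_Some_wfun[OF s(1) 2(2)] by simp
    then show ?thesis using 2 e sr_csroot[OF i, of m] csroot_self[OF i] by (simp add: i1_def i2_def)
  next
    case 3
    have "fl T k i = 0" using chk_strD(4)[OF s(1) i] 3 s(4) el_nonneg[of T j i] by auto
    then have f: "fl T j i = 1" using s(3) by simp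
    have "wfun T k = - csroot T i" using w kind_Some_wfun[OF j 3(1)] by simp
    then show ?thesis using 3 f sr_csroot[OF i, of "m + dz i"] csroot_self[OF i] by (simp add: i1_def i2_def)
  next
    case 4
    then have "csroot T i = 0" using w kind_Some_wfun[OF j 4(1)] kind_Some_wfun[OF s(1) 4(2)] by simp
    then show ?thesis using csroot_nz[OF i] by simp
  qed
  then show ?A ?B by blast+
qed

lemma csroot_off: "i \<noteq> k \<Longrightarrow> csroot T k i \<le> 0"
  using cartan_off by (auto simp: csroot_def fund_comb_def)

text \<open>An element of weight zero is replaced by \<alpha>_k or -\<alpha>_k. The vanishing string
  length excludes \<open>i = k\<close>, and otherwise the sign is that of an off-diagonal Cartan
  entry.\<close>

lemma i12_sign:
  assumes j: "j < ncls T" and i: "i \<in> Iset T"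
  shows "el T j i = 0 \<Longrightarrow> 0 \<le> fst (i2 T j m) i" "fl T j i = 0 \<Longrightarrow> fst (i1 T j m) i \<le> 0"
proof -
  have own: "fl T j k \<noteq> 0" "el T j k \<noteq> 0" if "kind T j = Some k" for k
    using kind_F[OF j that] fl_pos el_pos by blast+
  show "0 \<le> fst (i2 T j m) i" if e: "el T j i = 0"
  proof (cases "kind T j")
    case None then show ?thesis using chk_strD(1)[OF j i] e fl_nonneg[of T j i] by (simp add: i2_def)
  next
    case (Some k)
    then have "i \<noteq> k" using own e by auto
    then show ?thesis using Some csroot_off[of i k T] by (simp add: i2_def)
  qed
  show "fst (i1 T j m) i \<le> 0" if e: "fl T j i = 0"
  proof (cases "kind T j")
    case None then show ?thesis using chk_strD(1)[OF j i] e el_nonneg[of T j i] by (simp add: i1_def)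
  next
    case (Some k)
    then have "i \<noteq> k" using own e by auto
    then show ?thesis using Some csroot_off[of i k T] by (simp add: i1_def)
  qed
qed

text \<open>Says that \<open>z\<^sup>m j\<close> lies below \<open>z\<^sup>n k\<close>: paths of
  reflections run from the higher weight to the lower one.\<close>

definition below :: "affine_type \<Rightarrow> nat \<Rightarrow> int \<Rightarrow> nat \<Rightarrow> int \<Rightarrow> bool" where
  "below T j m k n \<longleftrightarrow> reach T (i2 T k n) (i1 T j m)"

text \<open>If the weight of the first factor is reflected at all, then \<open>fl T j i = 1\<close>,
  so the second factor has \<open>el T k i = 0\<close> and its weight is already the higher one of
  its pair. Monotonicity of \<open>wtop\<close> then undoes the reflection.\<close>

lemma below_left:
  assumes j: "j < ncls T" and k: "k < ncls T" and i: "i \<in> Iset T" and F: "F T j i = Some j'"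
    and lt: "el T k i < fl T j i"
  shows "below T j' (m - dz i) k n \<longleftrightarrow> below T j m k n"
  using i12_F(1)[OF j i F, of m]
proof
  assume a: "i1 T j' (m - dz i) = sr T i (i1 T j m) \<and> 0 < fst (i1 T j m) i \<and> fl T j i = 1"
  then have "el T k i = 0" using lt el_nonneg[of T k i] by simp
  then have tk: "wtop T i (i2 T k n) = i2 T k n" using i12_sign(1)[OF k i, of n] by (simp add: wtop_def)
  have tj: "wtop T i (sr T i (i1 T j m)) = i1 T j m"
    using a sr_at[OF i, of "i1 T j m"] sr_sr[OF i] by (simp add: wtop_def)
  have "reach T (i2 T k n) (sr T i (i1 T j m)) \<longleftrightarrow> reach T (i2 T k n) (i1 T j m)"
    using reach_wtop[OF _ i, of "i2 T k n" "sr T i (i1 T j m)"] wstep_sr[OF i, of "i1 T j m"] a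
    by (auto simp: tk tj intro: rtranclp.rtrancl_into_rtrancl)
  then show ?thesis using a by (simp add: below_def)
qed (simp add: below_def)

text \<open>Dual to \<open>below_left\<close>: when the second weight is reflected, the first factor
  has \<open>fl T j i = 0\<close>, so its weight is the lower one of its pair.\<close>

lemma below_right:
  assumes j: "j < ncls T" and k: "k < ncls T" and i: "i \<in> Iset T" and F: "F T k i = Some k'"
    and le: "fl T j i \<le> el T k i"
  shows "below T j m k' (n - dz i) \<longleftrightarrow> below T j m k n"
  using i12_F(2)[OF k i F, of n]
proof
  assume a: "i2 T k' (n - dz i) = sr T i (i2 T k n) \<and> 0 < fst (i2 T k n) i \<and> el T k i = 0"
  then have "fl T j i = 0" using le fl_nonneg[of T j i] by simp
  then have bj: "wbot T i (i1 T j m) = i1 T j m" using i12_sign(2)[OF j i, of m] by (simp add: wbot_def)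
  have bk: "wbot T i (i2 T k n) = sr T i (i2 T k n)" using a by (simp add: wbot_def)
  have "reach T (sr T i (i2 T k n)) (i1 T j m) \<longleftrightarrow> reach T (i2 T k n) (i1 T j m)"
    using reach_wbot[OF _ i, of "i2 T k n" "i1 T j m"] wstep_sr[OF i, of "i2 T k n"] a
    by (auto simp: bj bk intro: converse_rtranclp_into_rtranclp)
  then show ?thesis using a by (simp add: below_def)
qed (simp add: below_def)

lemma below_shift: "below T j (m + d) k (n + d) \<longleftrightarrow> below T j m k n"
proof
  assume "below T j (m + d) k (n + d)"
  then show "below T j m k n"
    using reach_adel[of T "i2 T k (n + d)" "i1 T j (m + d)" "- d"] by (simp add: below_def adel_i1 adel_i2)
next
  assume "below T j m k n"
  then show "below T j (m + d) k (n + d)"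
    using reach_adel[of T "i2 T k n" "i1 T j m" d] by (simp add: below_def adel_i1 adel_i2)
qed

section \<open>The energy function as a maximal exponent\<close>

definition is_top :: "int set \<Rightarrow> int \<Rightarrow> bool" where
  "is_top S M \<longleftrightarrow> M \<in> S \<and> (\<forall>x \<in> S. x \<le> M)"

definition top_of :: "int set \<Rightarrow> int" where
  "top_of S = (THE M. is_top S M)"

lemma top_of_eq: "is_top S M \<Longrightarrow> top_of S = M"
  unfolding top_of_def by (rule the_equality) (auto simp: is_top_def intro: antisym)

lemma is_top_exists: "S \<noteq> {} \<Longrightarrow> (\<And>x. x \<in> S \<Longrightarrow> x \<le> K) \<Longrightarrow> \<exists>M. is_top S M"
proof -
  assume S: "S \<noteq> {}" "\<And>x. x \<in> S \<Longrightarrow> x \<le> K"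
  then obtain a where a: "a \<in> S" by blast
  have f: "finite (S \<inter> {a..K})" by simp
  have ne: "S \<inter> {a..K} \<noteq> {}" using a S(2)[OF a] by auto
  have "is_top S (Max (S \<inter> {a..K}))"
    unfolding is_top_def
  proof (intro conjI ballI)
    show "Max (S \<inter> {a..K}) \<in> S" using Max_in[OF f ne] by simp
    fix x assume x: "x \<in> S"
    show "x \<le> Max (S \<inter> {a..K})"
    proof (cases "a \<le> x")
      case True then show ?thesis using x S(2)[OF x] f by (intro Max_ge) auto
    next
      case False
      have "a \<le> Max (S \<inter> {a..K})" using a S(2)[OF a] f by (intro Max_ge) auto
      then show ?thesis using False by linarith
    qed
  qed
  then show ?thesis ..
qed

definition bset :: "affine_type \<Rightarrow> nat \<Rightarrow> nat \<Rightarrow> int set" where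
  "bset T j k = {m. below T j m k 0}"

lemma i1_F_reach:
  assumes j: "j < ncls T" and i: "i \<in> Iset T" and F: "F T j i = Some k"
  shows "reach T (i1 T j m) (i1 T k (m - dz i))"
  using i12_F(1)[OF assms, of m] wstep_sr[OF i, of "i1 T j m"] by auto

lemma level_i1: "j < ncls T \<Longrightarrow> vpair T (mark T) (fst (i1 T j m)) = 0"
  using level_zero[of j T] mark_csroot kind_lt[of T j] by (auto simp: i1_def split: option.splits)

lemma i1_E_reach:
  assumes j: "j < ncls T" and i: "i \<in> Iset T" and E: "E T j i = Some k"
  shows "\<exists>n. reach T (i1 T j m) (i1 T k n)"
proof -
  note s = str_E[OF j i E]
  from i12_F(1)[OF s(1) i s(2), of "m + dz i"] show ?thesis
  proof
    assume "i1 T j (m + dz i - dz i) = i1 T k (m + dz i)"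
    then have "i1 T j m = i1 T k (m + dz i)" by simp
    then show ?thesis by (metis rtranclp.rtrancl_refl)
  next
    assume "i1 T j (m + dz i - dz i) = sr T i (i1 T k (m + dz i)) \<and>
      0 < fst (i1 T k (m + dz i)) i \<and> fl T k i = 1"
    then have "i1 T k (m + dz i) = sr T i (i1 T j m)" using sr_sr[OF i] by simp
    moreover obtain d where "reach T (i1 T j m) (adel d (sr T i (i1 T j m)))"
      using conn_sr[OF i level_i1[OF j]] by blast
    ultimately show ?thesis by (metis adel_i1)
  qed
qed

lemma conn_trans:
  assumes "\<exists>n. reach T (i1 T j m) (i1 T k n)" "\<And>m. \<exists>n. reach T (i1 T k m) (i1 T l n)"
  shows "\<exists>n. reach T (i1 T j m) (i1 T l n)"
  using assms by (meson rtranclp_trans)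

lemma conn_top:
  assumes "j < ncls T" "kind T j \<noteq> Some 0"
  shows "(\<exists>n. reach T (i1 T j m) (i1 T (top_cls T) n)) \<and> (\<exists>n. reach T (i1 T (top_cls T) m) (i1 T j n))"
  using assms
proof (induction "hrank T j" arbitrary: j m rule: less_induct)
  case less
  show ?case
  proof (cases "j = top_cls T")
    case True then show ?thesis by blast
  next
    case False
    obtain i k where i: "i \<in> Iset T - {0}" "E T j i = Some k"
      using ex_E[OF less.prems(1,2) False] by fastforce
    have iI: "i \<in> Iset T" using i by simp
    note s = str_E[OF less.prems(1) iI i(2)]
    have "kind T k \<noteq> Some 0" using kind_F_colour[of T k 0 i] s(2) i(1) by auto
    note IH = less.hyps[OF hrank_E[OF less.prems(1) i] s(1) this]
    show ?thesis
      using conn_trans[OF i1_E_reach[OF less.prems(1) iI i(2)]] IH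
        conn_trans[of T "top_cls T" m k j] i1_F_reach[OF s(1) iI s(2)] by blast
  qed
qed

text \<open>Any two elements become comparable after a shift by a multiple of \<delta>. Level zero
  enters here through \<open>conn_sr\<close>, and the sets of exponents \<open>bset\<close> become
  non-empty.\<close>

lemma conn_i1:
  assumes j: "j < ncls T" and k: "k < ncls T"
  shows "\<exists>n. reach T (i1 T j m) (i1 T k n)"
proof -
  have to: "\<exists>n. reach T (i1 T j m) (i1 T (top_cls T) n)" if jn: "j < ncls T" for j m
  proof (cases "kind T j = Some 0")
    case False then show ?thesis using conn_top jn by blast
  next
    case True
    obtain l where l: "F T j 0 = Some l" "l < ncls T" "kind T l = None" using kind_F_root[OF jn True] by blast
    have "\<exists>n. reach T (i1 T j m) (i1 T l n)" using i1_F_reach[OF jn zero_Iset l(1)] by blast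
    moreover have "\<exists>n. reach T (i1 T l m') (i1 T (top_cls T) n)" for m' using conn_top[OF l(2)] l(3) by simp
    ultimately show ?thesis by (rule conn_trans)
  qed
  have fr: "\<exists>n. reach T (i1 T (top_cls T) m) (i1 T k n)" if kn: "k < ncls T" for k m
  proof (cases "kind T k = Some 0")
    case False then show ?thesis using conn_top kn by blast
  next
    case True
    obtain l where l: "E T k 0 = Some l" "l < ncls T" "kind T l = None" using kind_E_root[OF kn True] by blast
    note s = str_E[OF kn zero_Iset l(1)]
    have "\<exists>n. reach T (i1 T (top_cls T) m) (i1 T l n)" using conn_top[OF l(2)] l(3) by simp
    moreover have "\<exists>n. reach T (i1 T l m') (i1 T k n)" for m' using i1_F_reach[OF s(1) zero_Iset s(2)] by blast
    ultimately show ?thesis by (rule conn_trans)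
  qed
  show ?thesis using conn_trans[OF to[OF j] fr[OF k]] .
qed

text \<open>The set is non-empty by \<open>conn_i1\<close>. It is bounded because a large exponent
  would give the first factor a greater affine height than the second.\<close>

lemma bset_top:
  assumes j: "j < ncls T" and k: "k < ncls T"
  shows "\<exists>M. is_top (bset T j k) M"
proof (rule is_top_exists)
  \<comment> \<open>The substitute for a second factor of weight zero is the weight of its lower
    neighbour, so the connectedness proved for \<open>i1\<close> applies.\<close>
  have "\<exists>l n. l < ncls T \<and> i2 T k 0 = i1 T l n"
  proof (cases "kind T k")
    case None
    then have "i2 T k 0 = i1 T k 0" by (simp add: i1_def i2_def)
    then show ?thesis using k by blast
  next
    case (Some i)
    obtain l where "F T k i = Some l" "l < ncls T" "kind T l = None" "wfun T l = - csroot T i"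
      using kind_F_root[OF k Some] by blast
    then have "i2 T k 0 = i1 T l (- dz i)" using Some by (simp add: i1_def i2_def)
    then show ?thesis using \<open>l < ncls T\<close> by blast
  qed
  then show "bset T j k \<noteq> {}" using conn_i1 j unfolding bset_def below_def by fastforce
  fix m assume "m \<in> bset T j k"
  then have h: "ahgt T (i1 T j m) \<le> ahgt T (i2 T k 0)" using ahgt_reach by (simp add: bset_def below_def)
  let ?K = "\<bar>ahgt T (i2 T k 0) - ahgt T (i1 T j 0)\<bar>"
  have "i1 T j m = adel m (i1 T j 0)" by (simp add: adel_i1)
  then have "2 * nblk T * m \<le> ?K" using h by (simp add: ahgt_def adel_def distrib_left)
  then have "2 * (nblk T * m) \<le> ?K" by (simp add: mult.assoc)
  show "m \<le> ?K"
  proof (cases "0 \<le> m")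
    case True
    then have "1 * m \<le> nblk T * m" using nblk_ge[of T] by (intro mult_right_mono) auto
    then show ?thesis using \<open>2 * (nblk T * m) \<le> ?K\<close> True by linarith
  qed simp
qed

definition energy_tab :: "affine_type \<Rightarrow> nat \<Rightarrow> nat \<Rightarrow> int" where
  "energy_tab T j k = - top_of (bset T j k)"

lemma is_top_shift:
  assumes "is_top S M" "\<And>x. x + d \<in> S' \<longleftrightarrow> x \<in> S"
  shows "is_top S' (M + d)"
  unfolding is_top_def
proof (intro conjI ballI)
  show "M + d \<in> S'" using assms by (simp add: is_top_def)
  fix x assume "x \<in> S'"
  then have "x - d \<in> S" using assms(2)[of "x - d"] by simp
  then show "x \<le> M + d" using assms(1) by (force simp: is_top_def)
qed

lemma energy_tab_left:
  assumes j: "j < ncls T" and k: "k < ncls T" and i: "i \<in> Iset T" and F: "F T j i = Some j'"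
    and lt: "el T k i < fl T j i"
  shows "energy_tab T j' k = energy_tab T j k + dz i"
proof -
  obtain M where M: "is_top (bset T j k) M" using bset_top[OF j k] by blast
  have "is_top (bset T j' k) (M + - dz i)"
    by (rule is_top_shift[OF M]) (use below_left[OF assms] in \<open>simp add: bset_def\<close>)
  then show ?thesis using top_of_eq[OF M] top_of_eq by (simp add: energy_tab_def)
qed

lemma energy_tab_right:
  assumes j: "j < ncls T" and k: "k < ncls T" and i: "i \<in> Iset T" and F: "F T k i = Some k'"
    and le: "fl T j i \<le> el T k i"
  shows "energy_tab T j k' = energy_tab T j k - dz i"
proof -
  obtain M where M: "is_top (bset T j k) M" using bset_top[OF j k] by blast
  \<comment> \<open>Only the difference of the two exponents matters, so the change of the second
    one is moved to the first.\<close>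
  have "below T j (x + dz i) k' 0 \<longleftrightarrow> below T j x k 0" for x
    using below_right[OF assms, of x 0] below_shift[of T j x "dz i" k' "- dz i"] by simp
  then have "is_top (bset T j k') (M + dz i)"
    by (intro is_top_shift[OF M]) (simp add: bset_def)
  then show ?thesis using top_of_eq[OF M] top_of_eq by (simp add: energy_tab_def)
qed

lemma energy_tab_diag:
  assumes j: "j < ncls T" "kind T j = None"
  shows "energy_tab T j j = 0"
proof -
  have "is_top (bset T j j) 0"
    unfolding is_top_def
  proof (intro conjI ballI)
    show "0 \<in> bset T j j" using j by (simp add: bset_def below_def i1_def i2_def)
    fix m assume "m \<in> bset T j j"
    then have "ahgt T (wfun T j, m) \<le> ahgt T (wfun T j, 0)"
      using ahgt_reach j(2) by (fastforce simp: bset_def below_def i1_def i2_def)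
    then have "nblk T * m \<le> nblk T * 0" by (simp add: ahgt_def mult.commute)
    then show "m \<le> 0" using nblk_pos[of T] by (simp only: mult_le_cancel_left_pos)
  qed
  then show ?thesis using top_of_eq by (simp add: energy_tab_def)
qed

lemma tensor_ff_perfect:
  assumes j: "j < ncls T" and k: "k < ncls T" and i: "i \<in> Iset T"
  shows "ff (tensor D (perfect T) (perfect T)) i (pel T j, pel T k) =
     (if el T k i < fl T j i then map_option (\<lambda>l. (pel T l, pel T k)) (F T j i)
      else map_option (\<lambda>l. (pel T j, pel T l)) (F T k i))"
  using perfect_table(1)[OF k i] perfect_table(2)[OF j i] perfect_ff[OF j i] perfect_ff[OF k i]
  by (simp add: tensor_def option.map_comp o_def)

lemma F_neq: "j < ncls T \<Longrightarrow> i \<in> Iset T \<Longrightarrow> F T j i = Some k \<Longrightarrow> k \<noteq> j"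
  using str_F(3) by fastforce

text \<open>\<open>is_energy\<close> recognises the factor that has changed by comparing components.
  No arrow has equal ends, so the two cases cannot both apply.\<close>

theorem energy_exists: "is_energy T (\<lambda>b b'. energy_tab T (pidx T b) (pidx T b'))"
  unfolding is_energy_def
proof (intro conjI ballI allI impI)
  fix b b' i c c'
  assume b: "b \<in> elts (perfect T)" "b' \<in> elts (perfect T)" and i: "i \<in> Iset T"
    and t: "ff (tensor (classical_data T) (perfect T) (perfect T)) i (b, b') = Some (c, c')"
  obtain j k where jk: "j < ncls T" "b = pel T j" "k < ncls T" "b' = pel T k"
    using b by (auto simp: elts_perfect)
  have "\<exists>d. energy_tab T (pidx T c) (pidx T c') = energy_tab T j k + d \<and> (i \<noteq> 0 \<longrightarrow> d = 0) \<and>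
     (i = 0 \<and> c' = b' \<longrightarrow> d = 1) \<and> (i = 0 \<and> c = b \<longrightarrow> d = - 1)"
  proof (cases "el T k i < fl T j i")
    case True
    then obtain l where l: "F T j i = Some l" "c = pel T l" "c' = pel T k"
      using t tensor_ff_perfect[OF jk(1,3) i, of "classical_data T"] by (auto simp: jk)
    have ll: "l < ncls T" "l \<noteq> j" using F_lt F_neq l jk i by blast+
    then have "c \<noteq> b" using pel_inject l jk by blast
    then show ?thesis using energy_tab_left[OF jk(1,3) i l(1) True] l jk ll
      by (auto simp: pidx_pel dz_def)
  next
    case False
    then obtain l where l: "F T k i = Some l" "c = pel T j" "c' = pel T l"
      using t tensor_ff_perfect[OF jk(1,3) i, of "classical_data T"] by (auto simp: jk)
    have ll: "l < ncls T" "l \<noteq> k" using F_lt F_neq l jk i by blast+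
    then have "c' \<noteq> b'" using pel_inject l jk by blast
    then show ?thesis using energy_tab_right[OF jk(1,3) i l(1)] False l jk ll
      by (auto simp: pidx_pel dz_def)
  qed
  then show "i \<noteq> 0 \<Longrightarrow> energy_tab T (pidx T c) (pidx T c') = energy_tab T (pidx T b) (pidx T b')"
    "i = 0 \<and> ff (perfect T) 0 b = Some c \<and> c' = b' \<Longrightarrow>
       energy_tab T (pidx T c) (pidx T c') = energy_tab T (pidx T b) (pidx T b') + 1"
    "i = 0 \<and> c = b \<and> ff (perfect T) 0 b' = Some c' \<Longrightarrow>
       energy_tab T (pidx T c) (pidx T c') = energy_tab T (pidx T b) (pidx T b') - 1"
    using jk by (auto simp: pidx_pel)
next
  fix c assume c: "extremal T c"
  then obtain j where j: "j < ncls T" "c = pel T j" by (auto simp: extremal_def elts_perfect)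
  have "kind T j = None"
  proof (cases "T = E8")
    case True
    then have "wfun T j \<noteq> 0" using c perfect_table(3)[OF j(1)] unfolding extremal_def j(2) by metis
    then show ?thesis using kind_wfun[OF j(1)] by simp
  qed (rule kind_not_E8)
  then show "energy_tab T (pidx T c) (pidx T c) = 0" using energy_tab_diag j by (simp add: pidx_pel)
qed

lemma is_energy_energy: "is_energy T (energy T)"
  unfolding energy_def by (rule someI[of "is_energy T", OF energy_exists])

text \<open>From here on the energy function enters only through its recursion along the
  arrows.\<close>

definition en :: "affine_type \<Rightarrow> nat \<Rightarrow> nat \<Rightarrow> int" where
  "en T j k = energy T (pel T j) (pel T k)"

lemma en_left:
  assumes j: "j < ncls T" and k: "k < ncls T" and i: "i \<in> Iset T" and F: "F T j i = Some j'"
    and lt: "el T k i < fl T j i"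
  shows "en T j' k = en T j k + dz i"
proof -
  have t: "ff (tensor (classical_data T) (perfect T) (perfect T)) i (pel T j, pel T k) = Some (pel T j', pel T k)"
    using tensor_ff_perfect[OF j k i] F lt by simp
  have f: "ff (perfect T) i (pel T j) = Some (pel T j')" using perfect_ff[OF j i] F by simp
  show ?thesis
    using is_energy_energy[of T, unfolded is_energy_def, THEN conjunct1, rule_format, OF _ _ i t] f j k
    by (cases "i = 0") (auto simp: elts_perfect en_def dz_def)
qed

lemma en_right:
  assumes j: "j < ncls T" and k: "k < ncls T" and i: "i \<in> Iset T" and F: "F T k i = Some k'"
    and le: "fl T j i \<le> el T k i"
  shows "en T j k' = en T j k - dz i"
proof -
  have t: "ff (tensor (classical_data T) (perfect T) (perfect T)) i (pel T j, pel T k) = Some (pel T j, pel T k')"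
    using tensor_ff_perfect[OF j k i] F le by simp
  have f: "ff (perfect T) i (pel T k) = Some (pel T k')" using perfect_ff[OF k i] F by simp
  show ?thesis
    using is_energy_energy[of T, unfolded is_energy_def, THEN conjunct1, rule_format, OF _ _ i t] f j k
    by (cases "i = 0") (auto simp: elts_perfect en_def dz_def)
qed

section \<open>The ground state\<close>

fun gs_list :: "affine_type \<Rightarrow> nat list" where
  "gs_list E6 = [3, 13, 21]" | "gs_list E7 = [6, 39]" | "gs_list E8 = [17]"

text \<open>The colour \<open>i\<close> with \<open>\<phi>(b\<^sub>r) = \<Lambda>\<^sub>i\<close>.
  The ground state sequence has period 3, 2 and 1 in the three types, and
  \<open>\<epsilon>(b\<^sub>r)\<close> belongs to the next colour.\<close>

fun gc_list :: "affine_type \<Rightarrow> nat list" where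
  "gc_list E6 = [0, 6, 1]" | "gc_list E7 = [0, 7]" | "gc_list E8 = [0]"

fun gperiod :: "affine_type \<Rightarrow> nat" where
  "gperiod E6 = 3" | "gperiod E7 = 2" | "gperiod E8 = 1"

definition gidx :: "affine_type \<Rightarrow> nat \<Rightarrow> nat" where
  "gidx T r = gs_list T ! (r mod gperiod T)"

definition gcol :: "affine_type \<Rightarrow> nat \<Rightarrow> nat" where
  "gcol T r = gc_list T ! (r mod gperiod T)"

text \<open>Preceded by a raising step of colour \<open>gcol T (Suc r)\<close>, each path is a loop
  at \<open>b\<^sub>r\<close>, of total weight \<delta> in types E6 and E7 and 2\<delta> in type E8.
  That preceding step is the only one at which the tensor product rule would not choose the second
  factor, and the steps of colour 0 in the loop yield the strict inequality in
  \<open>ground_ok\<close>.\<close>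

fun up_path :: "affine_type \<Rightarrow> nat list list" where
  "up_path E6 = [[5,4,2,3,1,4,3,5,4,2,0],
     [3,4,2,0,5,4,2,3,4,5,6],
     [2,4,3,5,4,2,6,5,4,3,1]]"
| "up_path E7 = [[6,5,4,2,3,1,4,3,5,4,2,6,5,4,3,1,0],
     [1,3,4,2,5,4,3,1,6,5,4,2,3,4,5,6,7]]"
| "up_path E8 = [[8,7,6,5,4,2,3,1,4,3,5,4,2,6,5,4,3,1,7,6,5,4,2,3,4,5,6,7,8,8,7,6,5,4,2,3,1,4,3,5,4,2,6,5,4,3,1,7,6,5,4,2,3,4,5,6,7,8,0]]"

text \<open>Applying raising operators to the second factor only, while the first factor stays the same.\<close>

fun upw :: "affine_type \<Rightarrow> nat \<Rightarrow> nat \<Rightarrow> nat list \<Rightarrow> (nat \<times> int) option" where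
  "upw T b k [] = Some (k, 0)"
| "upw T b k (i # is) = (if i < Suc (rnk T) \<and> fl T b i < el T k i then (case E T k i of None \<Rightarrow> None
     | Some k' \<Rightarrow> map_option (\<lambda>(l, d). (l, d + dz i)) (upw T b k' is)) else None)"

definition ground_ok :: "affine_type \<Rightarrow> nat \<Rightarrow> bool" where
  "ground_ok T s = (gidx T s < ncls T \<and> gcol T s < Suc (rnk T) \<and>
     list_all (\<lambda>i. fl T (gidx T s) i = (if i = gcol T s then 1 else 0) \<and>
       el T (gidx T s) i = (if i = gcol T (Suc s) then 1 else 0)) [0..<Suc (rnk T)] \<and>
     (case E T (gidx T s) (gcol T (Suc s)) of None \<Rightarrow> False | Some k \<Rightarrow>
        (case upw T (gidx T (Suc s)) k (up_path T ! s) of None \<Rightarrow> False | Some (l, d) \<Rightarrow>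
           l = gidx T s \<and> 0 < d + dz (gcol T (Suc s)))))"

definition ground_uniq :: "affine_type \<Rightarrow> nat \<Rightarrow> bool" where
  "ground_uniq T j = list_all (\<lambda>s. if list_all (\<lambda>i. fl T j i = (if i = gcol T s then 1 else 0))
     [0..<Suc (rnk T)] then j = gidx T s else True) [0..<gperiod T]"

lemma ground_check: "list_all (\<lambda>T. list_all (ground_ok T) [0..<gperiod T]) [E6, E7, E8]"
  by code_simp

lemma ground_uniq_E6: "list_all (ground_uniq E6) [0..<27]"
  by code_simp

lemma ground_uniq_E7: "list_all (ground_uniq E7) [0..<56]"
  by code_simp

lemma ground_uniq_E8: "list_all (ground_uniq E8) [0..<249]"
  by code_simp

lemma gperiod_pos: "0 < gperiod T"
  by (cases T) auto

lemma g_mod: "gidx T (r mod gperiod T) = gidx T r" "gcol T (r mod gperiod T) = gcol T r"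
  "gidx T (Suc (r mod gperiod T)) = gidx T (Suc r)" "gcol T (Suc (r mod gperiod T)) = gcol T (Suc r)"
  by (simp_all add: gidx_def gcol_def mod_Suc_eq)

lemma ground_okD: "ground_ok T (r mod gperiod T)"
proof -
  have "T \<in> set [E6, E7, E8]" by (cases T) auto
  then have "\<forall>s \<in> set [0..<gperiod T]. ground_ok T s" using ground_check unfolding list_all_iff by blast
  then show ?thesis using gperiod_pos[of T] by simp
qed

lemma gidx_lt: "gidx T r < ncls T"
  using ground_okD[of T r] by (simp add: ground_ok_def g_mod)

lemma gcol_I: "gcol T r \<in> Iset T"
  using ground_okD[of T r] by (simp add: ground_ok_def g_mod Iset_iff)

lemma fl_gidx: "i \<in> Iset T \<Longrightarrow> fl T (gidx T r) i = (if i = gcol T r then 1 else 0)"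
  and el_gidx: "i \<in> Iset T \<Longrightarrow> el T (gidx T r) i = (if i = gcol T (Suc r) then 1 else 0)"
  using ground_okD[of T r] by (simp_all add: ground_ok_def g_mod Iset_iff list_all_iff del: upt_Suc)

text \<open>Part of perfectness, read off from the table: an element is determined by its \<phi> if
  this is a fundamental weight occurring in the ground state. It makes the ground state sequence
  unique.\<close>

lemma gidx_unique:
  assumes j: "j < ncls T" and f: "\<And>i. i \<in> Iset T \<Longrightarrow> fl T j i = (if i = gcol T r then 1 else 0)"
  shows "j = gidx T r"
proof -
  have u: "ground_uniq T j"
    using ground_uniq_E6 ground_uniq_E7 ground_uniq_E8 j by (cases T) (simp_all add: list_all_iff)
  have "r mod gperiod T \<in> set [0..<gperiod T]" using gperiod_pos[of T] by simp
  moreover have "list_all (\<lambda>i. fl T j i = (if i = gcol T (r mod gperiod T) then 1 else 0)) [0..<Suc (rnk T)]"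
    using f by (simp add: list_all_iff g_mod Iset_iff del: upt_Suc)
  ultimately have "j = gidx T (r mod gperiod T)" using u unfolding ground_uniq_def list_all_iff by (meson)
  then show ?thesis by (simp add: g_mod)
qed

lemma upw_sound:
  "upw T b k is = Some (l, d) \<Longrightarrow> b < ncls T \<Longrightarrow> k < ncls T \<Longrightarrow> en T b l = en T b k + d"
proof (induction "is" arbitrary: k d)
  case (Cons i "is")
  have c: "i \<in> Iset T" "fl T b i < el T k i" using Cons.prems(1) by (auto simp: Iset_iff split: if_splits)
  obtain k' e where k': "E T k i = Some k'" "upw T b k' is = Some (l, e)" "d = e + dz i"
    using Cons.prems(1) by (auto split: if_splits option.splits)
  note s = str_E[OF Cons.prems(3) c(1) k'(1)]
  have "en T b k = en T b k' - dz i"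
    using s c by (intro en_right[OF Cons.prems(2) s(1) c(1) s(2)]) linarith
  then show ?case using Cons.IH[OF k'(2) Cons.prems(2) s(1)] k'(3) by simp
qed simp

text \<open>Following the loop by the recursion compares the raised element with
  \<open>b\<^sub>r\<close> itself. This is what makes raising a tail factor of the ground state
  leave the Fock space.\<close>

lemma en_ground_raise:
  assumes "i \<in> Iset T" "E T (gidx T r) i = Some k"
  shows "en T (gidx T (Suc r)) k < en T (gidx T (Suc r)) (gidx T r) + dz i"
proof -
  have "el T (gidx T r) i \<noteq> 0" using assms el_pos by simp
  then have i: "i = gcol T (Suc r)" using el_gidx[OF assms(1), of r] by (auto split: if_splits)
  obtain d where d: "upw T (gidx T (Suc r)) k (up_path T ! (r mod gperiod T)) = Some (gidx T r, d)" "0 < d + dz i"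
    using ground_okD[of T r] assms(2) unfolding ground_ok_def g_mod i by (auto split: option.splits)
  have "k < ncls T" using E_lt assms(2) gidx_lt by blast
  from upw_sound[OF d(1) gidx_lt this] d(2) show ?thesis by linarith
qed

lemma gcol_0: "gcol T 0 = 0"
  by (cases T) (simp_all add: gcol_def)

lemma phi_weight_pel: "j < ncls T \<Longrightarrow> phi_weight T (perfect T) (pel T j) = (\<lambda>i. if i \<in> Iset T then fl T j i else 0)"
  and eps_weight_pel: "j < ncls T \<Longrightarrow> eps_weight T (perfect T) (pel T j) = (\<lambda>i. if i \<in> Iset T then el T j i else 0)"
  by (auto simp: phi_weight_def eps_weight_def fund_comb_def perfect_table)

lemma phi_weight_gidx: "phi_weight T (perfect T) (pel T (gidx T r)) = cfund (gcol T r)"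
  using gcol_I[of T r] by (auto simp: phi_weight_pel gidx_lt fl_gidx cfund_def)

lemma eps_weight_gidx: "eps_weight T (perfect T) (pel T (gidx T r)) = cfund (gcol T (Suc r))"
  using gcol_I[of T "Suc r"] by (auto simp: eps_weight_pel gidx_lt el_gidx cfund_def)

lemma phi_weight_unique:
  assumes b: "b \<in> elts (perfect T)" "phi_weight T (perfect T) b = cfund (gcol T r)"
  shows "b = pel T (gidx T r)"
proof -
  obtain j where j: "j < ncls T" "b = pel T j" using b(1) by (auto simp: elts_perfect)
  have "fl T j i = (if i = gcol T r then 1 else 0)" if "i \<in> Iset T" for i
    using fun_cong[OF b(2), of i] that phi_weight_pel[OF j(1)] j(2) by (simp add: cfund_def)
  then show ?thesis using gidx_unique[OF j(1)] j(2) by blast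
qed

lemma ground_elt_eq: "ground_elt T r = pel T (gidx T r)"
proof -
  have "ground_elt T = (\<lambda>r. pel T (gidx T r))"
    unfolding ground_elt_def
  proof (rule the_equality)
    show "(\<forall>r. pel T (gidx T r) \<in> elts (perfect T)) \<and> phi_weight T (perfect T) (pel T (gidx T 0)) = cfund 0 \<and>
      (\<forall>r. phi_weight T (perfect T) (pel T (gidx T (Suc r))) = eps_weight T (perfect T) (pel T (gidx T r)))"
      using gidx_lt by (auto simp: elts_perfect phi_weight_gidx eps_weight_gidx gcol_0)
    fix b assume b: "(\<forall>r. b r \<in> elts (perfect T)) \<and> phi_weight T (perfect T) (b 0) = cfund 0 \<and>
      (\<forall>r. phi_weight T (perfect T) (b (Suc r)) = eps_weight T (perfect T) (b r))"
    show "b = (\<lambda>r. pel T (gidx T r))"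
    proof
      fix r show "b r = pel T (gidx T r)"
      proof (induction r)
        case 0 then show ?case using b phi_weight_unique[of "b 0" T 0] by (simp add: gcol_0)
      next
        case (Suc r)
        then have "phi_weight T (perfect T) (b (Suc r)) = cfund (gcol T (Suc r))"
          using b by (simp add: eps_weight_gidx)
        then show ?case using b phi_weight_unique by blast
      qed
    qed
  qed
  then show ?thesis by simp
qed

primrec gexp :: "affine_type \<Rightarrow> nat \<Rightarrow> int" where
  "gexp T 0 = 0" | "gexp T (Suc r) = gexp T r + 1 - en T (gidx T (Suc r)) (gidx T r)"

lemma ground_exp_eq: "ground_exp T r = gexp T r"
proof -
  have "ground_exp T = gexp T"
    unfolding ground_exp_def
  proof (rule the_equality)
    show "gexp T 0 = 0 \<and> (\<forall>r. energy_aff (energy T) (gexp T (Suc r), ground_elt T (Suc r)) (gexp T r, ground_elt T r) = 1)"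
      by (simp add: energy_aff_def ground_elt_eq en_def)
    fix m assume m: "m 0 = 0 \<and> (\<forall>r. energy_aff (energy T) (m (Suc r), ground_elt T (Suc r)) (m r, ground_elt T r) = 1)"
    have step: "m (Suc r) = m r + 1 - en T (gidx T (Suc r)) (gidx T r)" for r
      using m[THEN conjunct2, rule_format, of r] by (simp add: energy_aff_def ground_elt_eq en_def)
    show "m = gexp T"
    proof
      fix r show "m r = gexp T r" using m step by (induction r) simp_all
    qed
  qed
  then show ?thesis by simp
qed


section \<open>The signature rule\<close>

text \<open>\<open>stk m p r\<close> lists, from left to right, the minus signs of the columns \<open>0, \<dots>, r - 1\<close> that have
  not cancelled among these columns.\<close>

primrec stk :: "(nat \<Rightarrow> nat) \<Rightarrow> (nat \<Rightarrow> nat) \<Rightarrow> nat \<Rightarrow> position list" where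
  "stk m p 0 = []"
| "stk m p (Suc r) = map (Pair r) [0..<m r] @ drop (p r) (stk m p r)"

primrec elen :: "(nat \<Rightarrow> nat) \<Rightarrow> (nat \<Rightarrow> nat) \<Rightarrow> nat \<Rightarrow> nat" where
  "elen m p 0 = 0"
| "elen m p (Suc r) = m r + (elen m p r - p r)"

text \<open>Explicit description of the cancellation: plus sign number \<open>t\<close> from the
  right in column \<open>r\<close>, counted from 0, cancels entry \<open>t\<close> of the list of
  minus signs surviving to its right. Its position in the column is
  \<open>m r + p r - 1 - t\<close>.\<close>

definition cm :: "(nat \<Rightarrow> nat) \<Rightarrow> (nat \<Rightarrow> nat) \<Rightarrow> position \<Rightarrow> position \<Rightarrow> bool" where
  "cm m p x y \<longleftrightarrow> (\<exists>r t. t < p r \<and> t < length (stk m p r) \<and> x = (r, m r + p r - 1 - t) \<and> y = stk m p r ! t)"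

lemma length_stk: "length (stk m p r) = elen m p r"
  by (induction r) auto

lemma stk_mem: "y \<in> set (stk m p r) \<Longrightarrow> fst y < r \<and> snd y < m (fst y)"
proof (induction r)
  case (Suc r)
  then consider "y \<in> Pair r ` {0..<m r}" | "y \<in> set (stk m p r)" using in_set_dropD by fastforce
  then show ?case using Suc.IH by cases auto
qed simp

lemma left_of_trans: "left_of x y \<Longrightarrow> left_of y z \<Longrightarrow> left_of x z"
  by (auto simp: left_of_def)

lemma left_of_irrefl: "\<not> left_of x x"
  by (simp add: left_of_def)

lemma left_of_total: "x \<noteq> y \<Longrightarrow> left_of x y \<or> left_of y x"
  by (cases x; cases y) (auto simp: left_of_def)

lemma stk_sorted: "sorted_wrt left_of (stk m p r)"
proof (induction r)
  case (Suc r)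
  have a: "sorted_wrt left_of (map (Pair r) [0..<m r])"
    by (auto simp: sorted_wrt_iff_nth_less left_of_def)
  have b: "sorted_wrt left_of (drop (p r) (stk m p r))" using Suc by (rule sorted_wrt_drop)
  have "left_of x y" if "x \<in> set (map (Pair r) [0..<m r])" "y \<in> set (drop (p r) (stk m p r))" for x y
    using that stk_mem[of y m p r] in_set_dropD by (fastforce simp: left_of_def)
  then show ?case using a b by (simp add: sorted_wrt_append)
qed simp

lemma stk_nth_left: "s < t \<Longrightarrow> t < length (stk m p r) \<Longrightarrow> left_of (stk m p r ! s) (stk m p r ! t)"
  using stk_sorted[of m p r] by (auto simp: sorted_wrt_iff_nth_less)

lemma stk_nth_index: "s < length (stk m p r) \<Longrightarrow> t < length (stk m p r) \<Longrightarrow>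
    left_of (stk m p r ! s) (stk m p r ! t) \<Longrightarrow> s < t"
  using stk_nth_left[of t s m p r] left_of_irrefl left_of_trans by (metis linorder_neqE_nat)

lemma stk_distinct: "s < length (stk m p r) \<Longrightarrow> t < length (stk m p r) \<Longrightarrow>
    stk m p r ! s = stk m p r ! t \<Longrightarrow> s = t"
  using stk_nth_left[of t s m p r] stk_nth_left[of s t m p r] left_of_irrefl by (metis linorder_neqE_nat)

lemma cmE:
  assumes "cm m p x y"
  obtains t where "t < p (fst x)" "t < length (stk m p (fst x))" "x = (fst x, m (fst x) + p (fst x) - 1 - t)"
    "y = stk m p (fst x) ! t" "snd x = m (fst x) + p (fst x) - 1 - t"
  using assms by (auto simp: cm_def)

lemma cm_basic:
  assumes "cm m p x y"
  shows "x \<in> positions m p" "y \<in> positions m p" "\<not> is_minus m x" "is_minus m y" "left_of x y" "fst y < fst x"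
proof -
  obtain t where t: "t < p (fst x)" "t < length (stk m p (fst x))" "y = stk m p (fst x) ! t"
    "snd x = m (fst x) + p (fst x) - 1 - t" using cmE[OF assms] by blast
  have y: "fst y < fst x" "snd y < m (fst y)" using stk_mem[of y m p "fst x"] t by auto
  show "x \<in> positions m p" "\<not> is_minus m x" using t by (cases x; auto simp: positions_def is_minus_def)+
  show "y \<in> positions m p" "is_minus m y" "left_of x y" "fst y < fst x"
    using y by (cases y; auto simp: positions_def is_minus_def left_of_def)+
qed

lemma cm_right_unique:
  assumes "cm m p x y" "cm m p x z"
  shows "y = z"
proof -
  obtain s where s: "s < p (fst x)" "y = stk m p (fst x) ! s" "snd x = m (fst x) + p (fst x) - 1 - s"
    using cmE[OF assms(1)] by blast
  obtain t where t: "t < p (fst x)" "z = stk m p (fst x) ! t" "snd x = m (fst x) + p (fst x) - 1 - t"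
    using cmE[OF assms(2)] by blast
  have "s = t" using s t by linarith
  then show ?thesis using s t by simp
qed

lemma stk_gone: "y \<notin> set (stk m p r) \<Longrightarrow> fst y < r \<Longrightarrow> r \<le> r' \<Longrightarrow> y \<notin> set (stk m p r')"
proof (induction r')
  case (Suc r')
  show ?case
  proof (cases "r = Suc r'")
    case False
    then have "y \<notin> set (stk m p r')" "fst y \<noteq> r'" using Suc by auto
    then show ?thesis using in_set_dropD by fastforce
  qed (use Suc in simp)
qed simp

text \<open>A matched minus sign is dropped from the list when the column of its partner is passed,
  and it never returns.\<close>

lemma cm_exclusive:
  assumes c: "cm m p x y" and y: "y \<in> set (stk m p r)"
  shows "r \<le> fst x"
proof (rule ccontr)
  assume r: "\<not> r \<le> fst x"
  obtain t where t: "t < p (fst x)" "t < length (stk m p (fst x))" "y = stk m p (fst x) ! t"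
    using cmE[OF c] by blast
  have "y \<notin> set (drop (p (fst x)) (stk m p (fst x)))"
  proof
    assume "y \<in> set (drop (p (fst x)) (stk m p (fst x)))"
    then obtain s where "s < length (drop (p (fst x)) (stk m p (fst x)))" "drop (p (fst x)) (stk m p (fst x)) ! s = y"
      unfolding in_set_conv_nth by blast
    then have "p (fst x) + s < length (stk m p (fst x))" "y = stk m p (fst x) ! (p (fst x) + s)" by auto
    then show False using stk_distinct[of t m p "fst x" "p (fst x) + s"] t by auto
  qed
  moreover have f: "fst y < fst x" by (rule cm_basic(6)[OF c])
  ultimately have "y \<notin> set (stk m p (Suc (fst x)))" by auto
  then have "y \<notin> set (stk m p r)" using stk_gone f r by (metis less_Suc_eq not_less_eq_eq)
  then show False using y by simp
qed

lemma cm_left_unique: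
  assumes "cm m p x y" "cm m p z y"
  shows "x = z"
proof -
  obtain s where s: "s < p (fst x)" "s < length (stk m p (fst x))" "x = (fst x, m (fst x) + p (fst x) - 1 - s)"
    "y = stk m p (fst x) ! s" using cmE[OF assms(1)] by blast
  obtain t where t: "t < p (fst z)" "t < length (stk m p (fst z))" "z = (fst z, m (fst z) + p (fst z) - 1 - t)"
    "y = stk m p (fst z) ! t" using cmE[OF assms(2)] by blast
  have "y \<in> set (stk m p (fst x))" using nth_mem[OF s(2)] unfolding s(4) .
  moreover have "y \<in> set (stk m p (fst z))" using nth_mem[OF t(2)] unfolding t(4) .
  ultimately have f: "fst x = fst z" using cm_exclusive assms by (metis le_antisym)
  then have st: "s = t" using stk_distinct[of s m p "fst x" t] s(2,4) t(2,4) by simp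
  show ?thesis by (rule prod_eqI[OF f]) (metis s(3) t(3) st f snd_conv)
qed

lemma minus_fate:
  assumes "j < m c" "c < r"
  shows "(c, j) \<in> set (stk m p r) \<or> (\<exists>x. cm m p x (c, j) \<and> fst x < r)"
  using assms(2)
proof (induction r)
  case (Suc r)
  show ?case
  proof (cases "c = r")
    case True then show ?thesis using assms(1) by auto
  next
    case False
    then have "(c, j) \<in> set (stk m p r) \<or> (\<exists>x. cm m p x (c, j) \<and> fst x < r)" using Suc by simp
    then show ?thesis
    proof
      assume "(c, j) \<in> set (stk m p r)"
      then obtain t where t: "t < length (stk m p r)" "(c, j) = stk m p r ! t" by (auto simp: in_set_conv_nth)
      show ?thesis
      proof (cases "t < p r")
        case True
        then have "cm m p (r, m r + p r - 1 - t) (c, j)" using t unfolding cm_def by blast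
        then show ?thesis by (metis fst_conv lessI)
      next
        case False
        then have "t - p r < length (drop (p r) (stk m p r))" "(c, j) = drop (p r) (stk m p r) ! (t - p r)"
          using t by auto
        then have "(c, j) \<in> set (drop (p r) (stk m p r))" by (metis nth_mem)
        then show ?thesis by simp
      qed
    next
      assume "\<exists>x. cm m p x (c, j) \<and> fst x < r"
      then show ?thesis using less_SucI by blast
    qed
  qed
qed simp

definition plus_index :: "(nat \<Rightarrow> nat) \<Rightarrow> (nat \<Rightarrow> nat) \<Rightarrow> position \<Rightarrow> nat" where
  "plus_index m p u = m (fst u) + p (fst u) - 1 - snd u"

lemma plus_match:
  assumes u: "u \<in> positions m p" "\<not> is_minus m u"
  shows "plus_index m p u < p (fst u)" "u = (fst u, m (fst u) + p (fst u) - 1 - plus_index m p u)"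
    "plus_index m p u < length (stk m p (fst u)) \<Longrightarrow> cm m p u (stk m p (fst u) ! plus_index m p u)"
    "length (stk m p (fst u)) \<le> plus_index m p u \<Longrightarrow> \<not> cm m p u v"
proof -
  have s: "m (fst u) \<le> snd u" "snd u < m (fst u) + p (fst u)"
    using u by (auto simp: positions_def is_minus_def)
  then show a: "plus_index m p u < p (fst u)" and b: "u = (fst u, m (fst u) + p (fst u) - 1 - plus_index m p u)"
    by (auto simp: plus_index_def prod_eq_iff)
  show "plus_index m p u < length (stk m p (fst u)) \<Longrightarrow> cm m p u (stk m p (fst u) ! plus_index m p u)"
    using a b unfolding cm_def by blast
  show "\<not> cm m p u v" if l: "length (stk m p (fst u)) \<le> plus_index m p u"
  proof
    assume "cm m p u v"
    then obtain t where "t < p (fst u)" "t < length (stk m p (fst u))" "snd u = m (fst u) + p (fst u) - 1 - t"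
      using cmE by blast
    then show False using l s unfolding plus_index_def by linarith
  qed
qed

text \<open>An unmatched plus sign has seen the whole list cancelled, so all minus signs surviving
  further on come from its own column or from columns to its left.\<close>

lemma unmatched_plus_left:
  assumes u: "u \<in> positions m p" "\<not> is_minus m u" "length (stk m p (fst u)) \<le> plus_index m p u"
    and r: "fst u < r" and y: "y \<in> set (stk m p r)"
  shows "left_of y u"
  using r y
proof (induction r)
  case (Suc r)
  have "length (stk m p (fst u)) \<le> p (fst u)" using u(3) plus_match(1)[OF u(1,2)] by linarith
  then have d: "drop (p (fst u)) (stk m p (fst u)) = []" by simp
  show ?case
  proof (cases "fst u = r")
    case True
    then have "y \<in> Pair r ` {0..<m r}" using Suc.prems(2) d by simp
    then show ?thesis using u(2) True by (auto simp: left_of_def is_minus_def)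
  next
    case False
    then have fu: "fst u < r" using Suc.prems(1) by simp
    from Suc.prems(2) consider "fst y = r" | "y \<in> set (stk m p r)" using in_set_dropD by fastforce
    then show ?thesis using Suc.IH[OF fu] fu by cases (auto simp: left_of_def)
  qed
qed simp

lemma cm_between:
  assumes "cm m p x y" "u \<in> positions m p" "left_of x u" "left_of u y"
  shows "\<exists>v. left_of x v \<and> left_of v y \<and> (cm m p u v \<or> cm m p v u)"
  using assms
proof (induction "fst x" arbitrary: x y u rule: less_induct)
  case less
  let ?r = "fst x"
  obtain t where t: "t < p ?r" "t < length (stk m p ?r)" "y = stk m p ?r ! t" "snd x = m ?r + p ?r - 1 - t"
    using cmE[OF less.prems(1)] by blast
  have yr: "y \<in> set (stk m p ?r)" using t by simp
  have ym: "is_minus m y" "y \<in> positions m p" using cm_basic[OF less.prems(1)] by blast+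
  show ?case
  proof (cases "fst u = ?r")
    case True
    then have su: "snd x < snd u" using less.prems(3) by (simp add: left_of_def)
    have up: "\<not> is_minus m u" using su t(1,4) True by (auto simp: is_minus_def)
    let ?s = "plus_index m p u"
    have s: "?s < t" "?s < length (stk m p (fst u))"
      using su t True less.prems(2) by (auto simp: plus_index_def positions_def)
    note c = plus_match(3)[OF less.prems(2) up s(2)]
    have "left_of (stk m p (fst u) ! ?s) y" using stk_nth_left[of ?s t m p ?r] s t True by simp
    moreover have "left_of x (stk m p (fst u) ! ?s)" using cm_basic(6)[OF c] True by (simp add: left_of_def)
    ultimately show ?thesis using c by blast
  next
    case False
    then have fu: "fst u < ?r" using less.prems(3) by (auto simp: left_of_def)
    show ?thesis
    proof (cases "is_minus m u")
      case True
      then have "(fst u, snd u) \<in> set (stk m p ?r) \<or> (\<exists>v. cm m p v (fst u, snd u) \<and> fst v < ?r)"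
        by (intro minus_fate[OF _ fu]) (simp add: is_minus_def)
      then consider "u \<in> set (stk m p ?r)" | v where "cm m p v u" "fst v < ?r" by auto
      then show ?thesis
      proof cases
        case 1
        then obtain s where s: "s < length (stk m p ?r)" "u = stk m p ?r ! s" by (auto simp: in_set_conv_nth)
        have st: "s < t" using stk_nth_index[of s m p ?r t] s t less.prems(4) by simp
        let ?v = "(?r, m ?r + p ?r - 1 - s)"
        have "s < p ?r" using st t(1) by simp
        then have "cm m p ?v u" using s(1) unfolding cm_def s(2) by blast
        moreover have "left_of x ?v" using st t(1,4) by (auto simp: left_of_def)
        moreover have "left_of ?v y" using stk_mem[OF yr] by (simp add: left_of_def)
        ultimately show ?thesis by blast
      next
        case 2
        have "left_of x v" using 2 by (simp add: left_of_def)
        moreover have "left_of v y" using left_of_trans[OF cm_basic(5)[OF 2(1)] less.prems(4)] .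
        ultimately show ?thesis using 2 by blast
      qed
    next
      case up: False
      let ?s = "plus_index m p u"
      show ?thesis
      proof (cases "?s < length (stk m p (fst u))")
        case False
        then have "left_of y u" using unmatched_plus_left[OF less.prems(2) up _ fu yr] by simp
        then show ?thesis using less.prems(4) left_of_trans left_of_irrefl by blast
      next
        case True
        define v where "v = stk m p (fst u) ! ?s"
        have c: "cm m p u v" using plus_match(3)[OF less.prems(2) up True] by (simp add: v_def)
        have xv: "left_of x v" using cm_basic(6)[OF c] fu by (simp add: left_of_def)
        have "left_of v y"
        proof (rule ccontr)
          assume n: "\<not> left_of v y"
          have "v \<noteq> y" using cm_exclusive[of m p u y ?r] c yr fu by auto
          then have yv: "left_of y v" using n left_of_total by blast
          \<comment> \<open>The pair \<open>u\<close>, \<open>v\<close> would enclose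
            \<open>y\<close>, so by induction the partner of \<open>y\<close> would lie to the right
            of \<open>u\<close>; but \<open>y\<close> survives up to the column of
            \<open>x\<close>.\<close>
          obtain w where w: "left_of u w" "cm m p y w \<or> cm m p w y"
            using less.hyps[OF fu c ym(2) less.prems(4) yv] by blast
          then have "cm m p w y" using cm_basic(3)[of m p y w] ym by blast
          then have "?r \<le> fst w" using cm_exclusive yr by blast
          then show False using w(1) fu by (auto simp: left_of_def)
        qed
        then show ?thesis using c xv by blast
      qed
    qed
  qed
qed

lemma unmatched_order:
  assumes x: "x \<in> positions m p" "\<not> is_minus m x" "\<And>v. \<not> cm m p x v"
    and y: "y \<in> positions m p" "is_minus m y" "\<And>v. \<not> cm m p v y" and xy: "left_of x y"
  shows False
proof -
  have f: "fst y < fst x"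
    using xy x(2) y(2) by (auto simp: left_of_def is_minus_def)
  have "(fst y, snd y) \<in> set (stk m p (Suc (fst x))) \<or> (\<exists>v. cm m p v (fst y, snd y) \<and> fst v < Suc (fst x))"
    by (rule minus_fate) (use y f in \<open>auto simp: is_minus_def\<close>)
  then have ys: "y \<in> set (stk m p (Suc (fst x)))" using y(3) by auto
  have l: "length (stk m p (fst x)) \<le> plus_index m p x" using plus_match(3)[OF x(1,2)] x(3) by (meson not_less)
  have "left_of y x" using unmatched_plus_left[OF x(1,2) l _ ys] by simp
  then show False using xy left_of_trans left_of_irrefl by blast
qed

lemma finite_between: "finite {u \<in> positions m p. left_of x u \<and> left_of u y}"
proof (rule finite_subset)
  show "{u \<in> positions m p. left_of x u \<and> left_of u y} \<subseteq> (SIGMA r : {..fst x}. {..<m r + p r})"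
    by (auto simp: positions_def left_of_def)
qed simp

text \<open>Induction on the number of enclosed signs: a pair inside encloses fewer of them, and the
  non-crossing property provides the premise of the inductive definition.\<close>

lemma cm_cancels: "cm m p x y \<Longrightarrow> cancels m p x y"
proof (induction "card {u \<in> positions m p. left_of x u \<and> left_of u y}" arbitrary: x y rule: less_induct)
  case less
  note b = cm_basic[OF less.prems]
  have "\<exists>v. left_of x v \<and> left_of v y \<and> (cancels m p u v \<or> cancels m p v u)"
    if u: "u \<in> positions m p" "left_of x u" "left_of u y" for u
  proof -
    obtain v where v: "left_of x v" "left_of v y" "cm m p u v \<or> cm m p v u"
      using cm_between[OF less.prems u] by blast
    have vp: "v \<in> positions m p" using v(3) cm_basic(1,2) by blast
    have small: "card {w \<in> positions m p. left_of a w \<and> left_of w b} < card {w \<in> positions m p. left_of x w \<and> left_of w y}"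
      if ab: "left_of x a" "left_of a y" "left_of b y" "a \<in> positions m p" for a b
    proof (rule psubset_card_mono[OF finite_between])
      have "{w \<in> positions m p. left_of a w \<and> left_of w b} \<subseteq> {w \<in> positions m p. left_of x w \<and> left_of w y}"
        using left_of_trans ab by blast
      moreover have "a \<in> {w \<in> positions m p. left_of x w \<and> left_of w y}" using ab by simp
      moreover have "a \<notin> {w \<in> positions m p. left_of a w \<and> left_of w b}" using left_of_irrefl by blast
      ultimately show "{w \<in> positions m p. left_of a w \<and> left_of w b} \<subset> {w \<in> positions m p. left_of x w \<and> left_of w y}"
        by blast
    qed
    from v(3) have "cancels m p u v \<or> cancels m p v u"
    proof
      assume c: "cm m p u v"
      show ?thesis using less.hyps[OF small[OF u(2,3) v(2) u(1)] c] by blast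
    next
      assume c: "cm m p v u"
      show ?thesis using less.hyps[OF small[OF v(1,2) u(3) vp] c] by blast
    qed
    then show ?thesis using v by blast
  qed
  then show ?case using b by (intro cancels.intros) blast+
qed

text \<open>If \<open>x\<close> or \<open>y\<close> had another partner, one of the pairs would
  enclose a sign whose partner, by uniqueness, is not enclosed, contrary to what holds between
  partners. If both were unmatched, \<open>y\<close> would have to survive the column of
  \<open>x\<close>, where the list is used up.\<close>

lemma cancels_cm: "cancels m p x y \<Longrightarrow> cm m p x y"
proof (induction rule: cancels.induct)
  case (1 x y)
  have btw: "\<exists>v. left_of x v \<and> left_of v y \<and> (cm m p u v \<or> cm m p v u)"
    if "u \<in> positions m p" "left_of x u" "left_of u y" for u
    using 1(6) that by blast
  show ?case
  proof (cases "\<exists>z. cm m p x z")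
    case True
    then obtain z where z: "cm m p x z" by blast
    note zb = cm_basic[OF z]
    show ?thesis
    proof (cases "z = y")
      case False
      then consider "left_of z y" | "left_of y z" using left_of_total by blast
      then show ?thesis
      proof cases
        case 1
        obtain v where v: "left_of x v" "cm m p z v \<or> cm m p v z" using btw[OF zb(2,5) 1] by blast
        then have "cm m p v z" using cm_basic(3) zb(4) by blast
        then have "v = x" using cm_left_unique z by blast
        then show ?thesis using v(1) left_of_irrefl by blast
      next
        case 2
        obtain v where v: "left_of x v" "left_of v z" "cm m p y v \<or> cm m p v y"
          using cm_between[OF z \<open>y \<in> positions m p\<close> \<open>left_of x y\<close> 2] by blast
        then have vy: "cm m p v y" using cm_basic(3) \<open>is_minus m y\<close> by blast
        note vb = cm_basic[OF vy]
        obtain w where w: "left_of w y" "cm m p v w \<or> cm m p w v" using btw[OF vb(1) v(1) vb(5)] by blast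
        then have "cm m p v w" using cm_basic(4) vb(3) by blast
        then have "w = y" using cm_right_unique vy by blast
        then show ?thesis using w(1) left_of_irrefl by blast
      qed
    qed (use z in simp)
  next
    case False
    show ?thesis
    proof (cases "\<exists>z. cm m p z y")
      case True
      then obtain z where z: "cm m p z y" by blast
      note zb = cm_basic[OF z]
      have "z \<noteq> x" using z False by blast
      then consider "left_of z x" | "left_of x z" using left_of_total by blast
      then show ?thesis
      proof cases
        case 1
        obtain v where "cm m p x v \<or> cm m p v x"
          using cm_between[OF z \<open>x \<in> positions m p\<close> 1 \<open>left_of x y\<close>] by blast
        then show ?thesis using False cm_basic(4) \<open>\<not> is_minus m x\<close> by blast
      next
        case 2
        obtain v where v: "left_of v y" "cm m p z v \<or> cm m p v z" using btw[OF zb(1) 2 zb(5)] by blast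
        then have "cm m p z v" using cm_basic(4) zb(3) by blast
        then have "v = y" using cm_right_unique z by blast
        then show ?thesis using v(1) left_of_irrefl by blast
      qed
    next
      case False
      then show ?thesis
        using unmatched_order[OF \<open>x \<in> positions m p\<close> \<open>\<not> is_minus m x\<close> _ \<open>y \<in> positions m p\<close> \<open>is_minus m y\<close> _ \<open>left_of x y\<close>]
          \<open>\<not> (\<exists>z. cm m p x z)\<close> by blast
    qed
  qed
qed

lemma cancels_iff: "cancels m p x y \<longleftrightarrow> cm m p x y"
  using cm_cancels cancels_cm by blast

text \<open>Plus signs cancel from the right, so the survivors of a column are its leftmost ones, as
  many as \<open>p r\<close> exceeds \<open>elen m p r\<close>.\<close>

lemma remaining_plus_eq:
  "remaining_plus m p = (SIGMA r : UNIV. {j. m r \<le> j \<and> j < m r + p r - elen m p r})"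
proof (intro set_eqI iffI)
  fix u assume "u \<in> remaining_plus m p"
  then have u: "u \<in> positions m p" "\<not> is_minus m u" "\<And>v. \<not> cm m p u v"
    by (auto simp: remaining_plus_def remaining_def cancels_iff)
  have "elen m p (fst u) \<le> plus_index m p u"
    using plus_match(3)[OF u(1,2)] u(3) by (metis length_stk not_less)
  then show "u \<in> (SIGMA r : UNIV. {j. m r \<le> j \<and> j < m r + p r - elen m p r})"
    using u(1,2) by (cases u) (auto simp: plus_index_def positions_def is_minus_def)
next
  fix u assume a: "u \<in> (SIGMA r : UNIV. {j. m r \<le> j \<and> j < m r + p r - elen m p r})"
  then have u: "u \<in> positions m p" "\<not> is_minus m u" by (auto simp: positions_def is_minus_def)
  have "length (stk m p (fst u)) \<le> plus_index m p u" using a by (auto simp: plus_index_def length_stk)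
  then have "\<not> cm m p u v" for v using plus_match(4)[OF u] by blast
  moreover have "\<not> cm m p v u" for v using cm_basic(4) u(2) by blast
  ultimately show "u \<in> remaining_plus m p" using u by (auto simp: remaining_plus_def remaining_def cancels_iff)
qed

text \<open>Holds in the ground state because there the \<phi> of each factor is the \<epsilon> of
  its right neighbour: from column \<open>k\<close> on, the minus signs of a column are cancelled by
  the plus signs of the next one.\<close>

definition tail_at :: "(nat \<Rightarrow> nat) \<Rightarrow> (nat \<Rightarrow> nat) \<Rightarrow> nat \<Rightarrow> bool" where
  "tail_at m p k \<longleftrightarrow> (\<forall>r \<ge> k. p (Suc r) = m r)"

lemma stk_tail: "tail_at m p k \<Longrightarrow> k \<le> r \<Longrightarrow> stk m p (Suc r) = map (Pair r) [0..<m r] @ drop (p k) (stk m p k)"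
proof (induction r)
  case (Suc r)
  show ?case
  proof (cases "k = Suc r")
    case False
    then have "stk m p (Suc r) = map (Pair r) [0..<m r] @ drop (p k) (stk m p k)" "p (Suc r) = m r"
      using Suc by (auto simp: tail_at_def)
    then show ?thesis by (subst stk.simps(2)) simp
  qed simp
qed simp

lemma elen_tail: "tail_at m p k \<Longrightarrow> k < r \<Longrightarrow> elen m p r = p r + (elen m p k - p k)"
proof -
  assume a: "tail_at m p k" "k < r"
  then obtain s where s: "r = Suc s" "k \<le> s" by (cases r) auto
  have "elen m p r = length (stk m p (Suc s))" by (simp only: length_stk s)
  also have "\<dots> = m s + (elen m p k - p k)" using stk_tail[OF a(1) s(2)] by (simp add: length_stk)
  finally show ?thesis using a s by (simp add: tail_at_def)
qed

lemma remaining_minus_eq: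
  assumes tl: "tail_at m p k"
  shows "remaining_minus m p = set (drop (p k) (stk m p k))"
proof (intro set_eqI iffI)
  fix y assume "y \<in> remaining_minus m p"
  then have y: "y \<in> positions m p" "is_minus m y" "\<And>v. \<not> cm m p v y"
    by (auto simp: remaining_minus_def remaining_def cancels_iff)
  define r where "r = Suc (max (fst y) k)"
  have "(fst y, snd y) \<in> set (stk m p (Suc r)) \<or> (\<exists>v. cm m p v (fst y, snd y) \<and> fst v < Suc r)"
    by (rule minus_fate) (use y in \<open>auto simp: is_minus_def r_def\<close>)
  then have "y \<in> set (stk m p (Suc r))" using y(3) by simp
  moreover have kr: "k \<le> r" and "fst y \<noteq> r" by (auto simp: r_def)
  ultimately show "y \<in> set (drop (p k) (stk m p k))" unfolding stk_tail[OF tl kr] by auto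
next
  fix y assume y: "y \<in> set (drop (p k) (stk m p k))"
  then have ys: "y \<in> set (stk m p k)" by (rule in_set_dropD)
  have ym: "y \<in> positions m p" "is_minus m y" using stk_mem[OF ys] by (cases y; auto simp: positions_def is_minus_def)+
  have "\<not> cm m p v y" for v
  proof
    assume c: "cm m p v y"
    have "y \<in> set (stk m p (Suc (k + fst v)))" unfolding stk_tail[OF tl le_add1] using y by simp
    from cm_exclusive[OF c this] show False by simp
  qed
  moreover have "\<not> cm m p y v" for v using cm_basic(3) ym(2) by blast
  ultimately show "y \<in> remaining_minus m p" using ym by (auto simp: remaining_minus_def remaining_def cancels_iff)
qed

text \<open>The factor chosen by the iterated tensor product rule: the leftmost one whose \<phi>
  exceeds the \<epsilon> of the product of the factors to its right. For \<open>is_e\<close> the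
  inequality is weak.\<close>

definition is_f :: "(nat \<Rightarrow> nat) \<Rightarrow> (nat \<Rightarrow> nat) \<Rightarrow> nat \<Rightarrow> bool" where
  "is_f m p r \<longleftrightarrow> elen m p r < p r \<and> (\<forall>t > r. p t \<le> elen m p t)"

definition is_e :: "(nat \<Rightarrow> nat) \<Rightarrow> (nat \<Rightarrow> nat) \<Rightarrow> nat \<Rightarrow> bool" where
  "is_e m p r \<longleftrightarrow> elen m p r \<le> p r \<and> (\<forall>t > r. p t < elen m p t)"

lemma plus_fst: "r \<in> fst ` remaining_plus m p \<longleftrightarrow> elen m p r < p r"
proof
  assume "elen m p r < p r"
  then have "(r, m r) \<in> remaining_plus m p" by (simp add: remaining_plus_eq)
  then show "r \<in> fst ` remaining_plus m p" by force
qed (auto simp: remaining_plus_eq)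

lemma plus_fst_bound: "tail_at m p k \<Longrightarrow> r \<in> fst ` remaining_plus m p \<Longrightarrow> r \<le> k"
  using elen_tail[of m p k r] plus_fst[of r m p] by (cases "k < r") auto

lemma plus_Max:
  assumes tl: "tail_at m p k"
  shows "remaining_plus m p \<noteq> {} \<Longrightarrow> is_f m p (Max (fst ` remaining_plus m p))"
    "is_f m p r \<Longrightarrow> remaining_plus m p \<noteq> {} \<and> Max (fst ` remaining_plus m p) = r"
proof -
  let ?S = "fst ` remaining_plus m p"
  have f: "finite ?S" using plus_fst_bound[OF tl] by (meson finite_nat_set_iff_bounded_le)
  show "is_f m p (Max ?S)" if "remaining_plus m p \<noteq> {}"
    using Max_in[OF f] Max_ge[OF f] that unfolding is_f_def plus_fst[symmetric] by (metis image_is_empty not_le plus_fst)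
  assume r: "is_f m p r"
  have m: "r \<in> ?S" using r by (simp add: is_f_def plus_fst)
  moreover have "t \<le> r" if "t \<in> ?S" for t using r that by (metis is_f_def not_le plus_fst)
  ultimately show "remaining_plus m p \<noteq> {} \<and> Max ?S = r" using Max_eqI[OF f] by blast
qed

lemma plus_card:
  assumes tl: "tail_at m p k"
  shows "card (remaining_plus m p) = (\<Sum>r \<le> k. p r - elen m p r)"
proof -
  have "remaining_plus m p = (SIGMA r : {..k}. {j. m r \<le> j \<and> j < m r + p r - elen m p r})"
    using plus_fst_bound[OF tl] unfolding remaining_plus_eq by force
  also have "\<dots> = (SIGMA r : {..k}. {m r..<m r + p r - elen m p r})" by auto
  finally show ?thesis by (simp add: diff_diff_eq)
qed

text \<open>The rightmost surviving minus sign stands in the last column that used up the list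
  before refilling it. In the columns passed afterwards there are more survivors than plus signs, so
  it is never reached.\<close>

lemma last_stk:
  "p r < elen m p r \<Longrightarrow> fst (last (stk m p r)) < r \<and>
     elen m p (fst (last (stk m p r))) \<le> p (fst (last (stk m p r))) \<and>
     (\<forall>t. fst (last (stk m p r)) < t \<and> t < r \<longrightarrow> p t < elen m p t)"
  if "0 < elen m p r" for r
  using that
proof (induction r)
  case (Suc r)
  show ?case
  proof (cases "elen m p r \<le> p r")
    case True
    then have "drop (p r) (stk m p r) = []" by (simp add: length_stk)
    moreover have "0 < m r" using Suc.prems True by simp
    ultimately have "last (stk m p (Suc r)) \<in> set (map (Pair r) [0..<m r])"
      by (metis append_Nil2 last_in_set length_map length_upt list.size(3) minus_nat.diff_0 not_less_iff_gr_or_eq stk.simps(2))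
    then have "fst (last (stk m p (Suc r))) = r" by auto
    then show ?thesis using True by auto
  next
    case False
    then have "drop (p r) (stk m p r) \<noteq> []" by (simp add: length_stk)
    then have "last (stk m p (Suc r)) = last (stk m p r)" by (simp add: last_drop)
    moreover have "fst (last (stk m p r)) < r \<and> elen m p (fst (last (stk m p r))) \<le> p (fst (last (stk m p r))) \<and>
       (\<forall>t. fst (last (stk m p r)) < t \<and> t < r \<longrightarrow> p t < elen m p t)"
      using Suc.IH False by simp
    ultimately show ?thesis using False by (auto simp: less_Suc_eq)
  qed
qed simp

lemma minus_Min:
  assumes tl: "tail_at m p k"
  shows "remaining_minus m p \<noteq> {} \<Longrightarrow> is_e m p (Min (fst ` remaining_minus m p))"
    "is_e m p r \<Longrightarrow> remaining_minus m p \<noteq> {} \<and> Min (fst ` remaining_minus m p) = r"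
proof -
  have e: "remaining_minus m p \<noteq> {} \<longleftrightarrow> p k < elen m p k"
    by (auto simp: remaining_minus_eq[OF tl] length_stk)
  have main: "is_e m p (Min (fst ` remaining_minus m p))" if ne: "remaining_minus m p \<noteq> {}"
  proof -
    have pk: "p k < elen m p k" using ne e by simp
    let ?l = "last (stk m p k)"
    have d: "drop (p k) (stk m p k) \<noteq> []" using pk by (simp add: length_stk)
    have lastd: "?l = last (drop (p k) (stk m p k))" using pk by (simp add: last_drop length_stk)
    have sd: "sorted_wrt left_of (drop (p k) (stk m p k))" by (rule sorted_wrt_drop[OF stk_sorted])
    have "fst ?l \<le> fst y" if "y \<in> set (drop (p k) (stk m p k))" for y
    proof -
      let ?D = "drop (p k) (stk m p k)"
      obtain s where s: "s < length ?D" "y = ?D ! s" using \<open>y \<in> set ?D\<close> by (auto simp: in_set_conv_nth)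
      have l: "?l = ?D ! (length ?D - 1)" unfolding lastd by (rule last_conv_nth[OF d])
      show ?thesis
      proof (cases "s = length ?D - 1")
        case False
        then have "s < length ?D - 1" "length ?D - 1 < length ?D" using s d by (auto simp: length_greater_0_conv[symmetric] simp del: length_greater_0_conv)
        then have "left_of y ?l" using sd unfolding l s(2) sorted_wrt_iff_nth_less by blast
        then show ?thesis by (auto simp: left_of_def)
      qed (use l s in simp)
    qed
    moreover have "?l \<in> set (drop (p k) (stk m p k))" unfolding lastd by (rule last_in_set[OF d])
    ultimately have mn: "Min (fst ` remaining_minus m p) = fst ?l"
      unfolding remaining_minus_eq[OF tl] by (intro Min_eqI) auto
    have "0 < elen m p k" using pk by simp
    note ls = last_stk[OF this pk]
    have "p t < elen m p t" if "fst ?l < t" for t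
    proof -
      consider "t < k" | "t = k" | "k < t" by linarith
      then show ?thesis using ls that pk elen_tail[OF tl, of t] by cases auto
    qed
    then show ?thesis using ls mn by (simp add: is_e_def)
  qed
  then show "remaining_minus m p \<noteq> {} \<Longrightarrow> is_e m p (Min (fst ` remaining_minus m p))" .
  assume r: "is_e m p r"
  have "r < Suc (max k r)" by simp
  then have "p (Suc (max k r)) < elen m p (Suc (max k r))" using r unfolding is_e_def by blast
  moreover have "elen m p (Suc (max k r)) = p (Suc (max k r)) + (elen m p k - p k)"
    by (rule elen_tail[OF tl]) simp
  ultimately have "p k < elen m p k" by linarith
  then have ne: "remaining_minus m p \<noteq> {}" using e by simp
  have "is_e m p s \<Longrightarrow> s = r" for s using r by (metis is_e_def linorder_neqE_nat not_le)
  then show "remaining_minus m p \<noteq> {} \<and> Min (fst ` remaining_minus m p) = r" using main[OF ne] ne by blast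
qed

lemma minus_card:
  assumes tl: "tail_at m p k"
  shows "card (remaining_minus m p) = elen m p k - p k"
proof -
  have "distinct (stk m p k)" using stk_distinct by (auto simp: distinct_conv_nth)
  then show ?thesis unfolding remaining_minus_eq[OF tl] by (simp add: distinct_card distinct_drop length_stk)
qed


section \<open>The Fock space crystal\<close>

definition sj :: "affine_type \<Rightarrow> (nat \<Rightarrow> int \<times> perfect_elt) \<Rightarrow> nat \<Rightarrow> nat" where
  "sj T s r = pidx T (snd (s r))"

definition sm :: "affine_type \<Rightarrow> nat \<Rightarrow> (nat \<Rightarrow> int \<times> perfect_elt) \<Rightarrow> nat \<Rightarrow> nat" where
  "sm T i s r = nat (el T (sj T s r) i)"

definition sp :: "affine_type \<Rightarrow> nat \<Rightarrow> (nat \<Rightarrow> int \<times> perfect_elt) \<Rightarrow> nat \<Rightarrow> nat" where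
  "sp T i s r = nat (fl T (sj T s r) i)"

definition valid :: "affine_type \<Rightarrow> (nat \<Rightarrow> int \<times> perfect_elt) \<Rightarrow> bool" where
  "valid T s \<longleftrightarrow> (\<forall>r. s r \<in> elts (affinization (perfect T)))"

text \<open>Lowers the factor \<open>r\<close> whether or not the tensor product rule selects it;
  without an arrow the value of \<open>the\<close> is arbitrary.\<close>

definition fu :: "affine_type \<Rightarrow> nat \<Rightarrow> (nat \<Rightarrow> int \<times> perfect_elt) \<Rightarrow> nat \<Rightarrow> nat \<Rightarrow> int \<times> perfect_elt" where
  "fu T i s r = s(r := (fst (s r) - dz i, pel T (the (F T (sj T s r) i))))"

definition eu :: "affine_type \<Rightarrow> nat \<Rightarrow> (nat \<Rightarrow> int \<times> perfect_elt) \<Rightarrow> nat \<Rightarrow> nat \<Rightarrow> int \<times> perfect_elt" where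
  "eu T i s r = s(r := (fst (s r) + dz i, pel T (the (E T (sj T s r) i))))"

lemma validD:
  assumes "valid T s"
  shows "sj T s r < ncls T" "s r = (fst (s r), pel T (sj T s r))"
proof -
  obtain j where j: "j < ncls T" "snd (s r) = pel T j"
    using assms by (auto simp: valid_def affinization_def elts_perfect mem_Times_iff dest!: spec[of _ r])
  then have "sj T s r = j" by (simp add: sj_def pidx_pel)
  then show "sj T s r < ncls T" "s r = (fst (s r), pel T (sj T s r))" using j by (simp_all add: prod_eq_iff)
qed

lemma sm_sp: "int (sm T i s r) = el T (sj T s r) i" "int (sp T i s r) = fl T (sj T s r) i"
  using el_nonneg fl_nonneg by (simp_all add: sm_def sp_def)

lemma aff_ops:
  assumes s: "valid T s" and i: "i \<in> Iset T"
  shows "eps (affinization (perfect T)) i (s r) = Fin (int (sm T i s r))"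
    "phi (affinization (perfect T)) i (s r) = Fin (int (sp T i s r))"
    "ff (affinization (perfect T)) i (s r) = (if sp T i s r = 0 then None else Some (fu T i s r r))"
    "ee (affinization (perfect T)) i (s r) = (if sm T i s r = 0 then None else Some (eu T i s r r))"
    "wt (affinization (perfect T)) (s r) = (wfun T (sj T s r), fst (s r))"
proof -
  note v = validD[OF s, of r]
  note t = perfect_table[OF v(1)] perfect_ff[OF v(1) i] perfect_ee[OF v(1) i]
  show "eps (affinization (perfect T)) i (s r) = Fin (int (sm T i s r))"
    "phi (affinization (perfect T)) i (s r) = Fin (int (sp T i s r))"
    "wt (affinization (perfect T)) (s r) = (wfun T (sj T s r), fst (s r))"
    using t i by (subst v(2), simp add: affinization_def sm_sp)+
  have fp: "sp T i s r = 0 \<longleftrightarrow> F T (sj T s r) i = None"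
    using sm_sp(2)[of T i s r] fl_pos[of T "sj T s r" i] by linarith
  have ep: "sm T i s r = 0 \<longleftrightarrow> E T (sj T s r) i = None"
    using sm_sp(1)[of T i s r] el_pos[of T "sj T s r" i] by linarith
  show "ff (affinization (perfect T)) i (s r) = (if sp T i s r = 0 then None else Some (fu T i s r r))"
    unfolding fp by (subst v(2), cases "F T (sj T s r) i") (auto simp: affinization_def t fu_def dz_def)
  show "ee (affinization (perfect T)) i (s r) = (if sm T i s r = 0 then None else Some (eu T i s r r))"
    unfolding ep by (subst v(2), cases "E T (sj T s r) i") (auto simp: affinization_def t eu_def dz_def)
qed

lemma lower_part_Suc: "lower_part s (Suc n) = s n # lower_part s n"
  by (simp add: lower_part_def)

lemma length_lower_part [simp]: "length (lower_part s n) = n"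
  by (simp add: lower_part_def)

lemma lower_part_cong: "(\<And>r. r < n \<Longrightarrow> s r = s' r) \<Longrightarrow> lower_part s n = lower_part s' n"
  by (simp add: lower_part_def)

lemma lower_part_upd: "n \<le> r \<Longrightarrow> lower_part (s(r := x)) n = lower_part s n"
  by (rule lower_part_cong) auto

lemma replace_lower_part: "(\<And>r. n \<le> r \<Longrightarrow> s' r = s r) \<Longrightarrow> replace_lower s (lower_part s' n) = s'"
  by (rule ext) (auto simp: replace_lower_def lower_part_def)

abbreviation tpow :: "affine_type \<Rightarrow> nat \<Rightarrow> ((int \<times> perfect_elt) list, aweight) crystal" where
  "tpow T n \<equiv> tensor_power (affine_data T) (affinization (perfect T)) n"

text \<open>The \<phi> of the product of the first factors, that is, the number of plus signs
  surviving among these columns; the counterpart of \<open>elen\<close>.\<close>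

fun plen :: "(nat \<Rightarrow> nat) \<Rightarrow> (nat \<Rightarrow> nat) \<Rightarrow> nat \<Rightarrow> nat" where
  "plen m p 0 = 0" | "plen m p (Suc r) = plen m p r + (p r - elen m p r)"

lemma tpow_step:
  "eps (tpow T (Suc n)) i (x # xs) = max (eps (affinization (perfect T)) i x)
     (eps (tpow T n) i xs - Fin (fst (wt (affinization (perfect T)) x) i))"
  "phi (tpow T (Suc n)) i (x # xs) = max (phi (tpow T n) i xs)
     (phi (affinization (perfect T)) i x + Fin (fst (wt (tpow T n) xs) i))"
  "wt (tpow T (Suc n)) (x # xs) = wt (affinization (perfect T)) x + wt (tpow T n) xs"
  "ff (tpow T (Suc n)) i (x # xs) = (if phi (affinization (perfect T)) i x > eps (tpow T n) i xs
     then map_option (\<lambda>y. y # xs) (ff (affinization (perfect T)) i x)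
     else map_option (\<lambda>ys. x # ys) (ff (tpow T n) i xs))"
  "ee (tpow T (Suc n)) i (x # xs) = (if phi (affinization (perfect T)) i x \<ge> eps (tpow T n) i xs
     then map_option (\<lambda>y. y # xs) (ee (affinization (perfect T)) i x)
     else map_option (\<lambda>ys. x # ys) (ee (tpow T n) i xs))"
  by (simp_all add: tensor_def Let_def affine_data_def option.map_comp o_def)

lemma tpow_eps_phi:
  assumes s: "valid T s" and i: "i \<in> Iset T"
  shows "eps (tpow T n) i (lower_part s n) = Fin (int (elen (sm T i s) (sp T i s) n)) \<and>
    phi (tpow T n) i (lower_part s n) = Fin (int (plen (sm T i s) (sp T i s) n)) \<and>
    fst (wt (tpow T n) (lower_part s n)) i =
      int (plen (sm T i s) (sp T i s) n) - int (elen (sm T i s) (sp T i s) n)"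
proof (induction n)
  case 0 then show ?case by (simp add: lower_part_def zero_extended_def)
next
  case (Suc n)
  have w: "wfun T (sj T s n) i = int (sp T i s n) - int (sm T i s n)"
    using chk_strD(1)[OF validD(1)[OF s] i] by (simp add: sm_sp)
  show ?case
    unfolding lower_part_Suc tpow_step aff_ops[OF s i] using Suc w
    by (auto simp: max_def)
qed

lemma fin_less: "Fin (int a) > Fin (int b) \<longleftrightarrow> b < a" "Fin (int a) \<ge> Fin (int b) \<longleftrightarrow> b \<le> a"
  by auto

lemma tpow_ff:
  assumes s: "valid T s" and i: "i \<in> Iset T"
  defines "m \<equiv> sm T i s" and "p \<equiv> sp T i s"
  shows "((\<forall>r < n. p r \<le> elen m p r) \<longrightarrow> ff (tpow T n) i (lower_part s n) = None) \<and>
    (\<forall>r < n. elen m p r < p r \<and> (\<forall>t. r < t \<and> t < n \<longrightarrow> p t \<le> elen m p t) \<longrightarrow>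
       ff (tpow T n) i (lower_part s n) = Some (lower_part (fu T i s r) n))"
proof (induction n)
  case (Suc n)
  have e: "eps (tpow T n) i (lower_part s n) = Fin (int (elen m p n))"
    using tpow_eps_phi[OF s i] by (simp add: m_def p_def)
  have st: "ff (tpow T (Suc n)) i (lower_part s (Suc n)) =
     (if elen m p n < p n then Some (fu T i s n n # lower_part s n)
      else map_option (\<lambda>ys. s n # ys) (ff (tpow T n) i (lower_part s n)))"
    unfolding lower_part_Suc tpow_step(4) e aff_ops(2,3)[OF s i] p_def[symmetric] fin_less by auto
  show ?case
  proof (intro conjI impI allI)
    assume "\<forall>r < Suc n. p r \<le> elen m p r"
    then show "ff (tpow T (Suc n)) i (lower_part s (Suc n)) = None" using Suc st by (simp add: not_less)
  next
    fix r assume r: "r < Suc n" and a: "elen m p r < p r \<and> (\<forall>t. r < t \<and> t < Suc n \<longrightarrow> p t \<le> elen m p t)"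
    show "ff (tpow T (Suc n)) i (lower_part s (Suc n)) = Some (lower_part (fu T i s r) (Suc n))"
    proof (cases "r = n")
      case True
      have "lower_part (fu T i s n) n = lower_part s n" unfolding fu_def by (rule lower_part_upd) simp
      then show ?thesis using a st True by (simp add: lower_part_Suc)
    next
      case False
      then have rn: "r < n" using r by simp
      then have "\<not> elen m p n < p n" using a by (simp add: not_less)
      moreover have "ff (tpow T n) i (lower_part s n) = Some (lower_part (fu T i s r) n)" using Suc rn a by simp
      moreover have "fu T i s r n = s n" using rn by (simp add: fu_def)
      ultimately show ?thesis using st by (simp add: lower_part_Suc)
    qed
  qed
qed (simp add: lower_part_def)

lemma tpow_ee:
  assumes s: "valid T s" and i: "i \<in> Iset T"
  defines "m \<equiv> sm T i s" and "p \<equiv> sp T i s"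
  shows "\<forall>r < n. elen m p r \<le> p r \<and> (\<forall>t. r < t \<and> t < n \<longrightarrow> p t < elen m p t) \<longrightarrow>
       ee (tpow T n) i (lower_part s n) = (if m r = 0 then None else Some (lower_part (eu T i s r) n))"
proof (induction n)
  case (Suc n)
  have e: "eps (tpow T n) i (lower_part s n) = Fin (int (elen m p n))"
    using tpow_eps_phi[OF s i] by (simp add: m_def p_def)
  have st: "ee (tpow T (Suc n)) i (lower_part s (Suc n)) =
     (if elen m p n \<le> p n then (if m n = 0 then None else Some (eu T i s n n # lower_part s n))
      else map_option (\<lambda>ys. s n # ys) (ee (tpow T n) i (lower_part s n)))"
    unfolding lower_part_Suc tpow_step(5) e aff_ops(2,4)[OF s i] p_def[symmetric] m_def[symmetric] fin_less by auto
  show ?case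
  proof (intro impI allI)
    fix r assume r: "r < Suc n" and a: "elen m p r \<le> p r \<and> (\<forall>t. r < t \<and> t < Suc n \<longrightarrow> p t < elen m p t)"
    show "ee (tpow T (Suc n)) i (lower_part s (Suc n)) = (if m r = 0 then None else Some (lower_part (eu T i s r) (Suc n)))"
    proof (cases "r = n")
      case True
      have "lower_part (eu T i s n) n = lower_part s n" unfolding eu_def by (rule lower_part_upd) simp
      then show ?thesis using a st True by (simp add: lower_part_Suc)
    next
      case False
      then have rn: "r < n" using r by simp
      then have "\<not> elen m p n \<le> p n" using a by (simp add: not_le)
      moreover have "ee (tpow T n) i (lower_part s n) = (if m r = 0 then None else Some (lower_part (eu T i s r) n))"
        using Suc rn a by simp
      moreover have "eu T i s r n = s n" using rn by (simp add: eu_def)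
      ultimately show ?thesis using st by (simp add: lower_part_Suc)
    qed
  qed
qed simp

section \<open>The operators on the Fock space crystal\<close>

definition ground_from :: "affine_type \<Rightarrow> (nat \<Rightarrow> int \<times> perfect_elt) \<Rightarrow> nat \<Rightarrow> bool" where
  "ground_from T s k \<longleftrightarrow> (\<forall>r \<ge> k. s r = ground_seq T r)"

definition eaff :: "affine_type \<Rightarrow> (nat \<Rightarrow> int \<times> perfect_elt) \<Rightarrow> nat \<Rightarrow> int" where
  "eaff T s r = en T (sj T s (Suc r)) (sj T s r) + fst (s (Suc r)) - fst (s r)"

lemma energy_aff_eaff: "valid T s \<Longrightarrow> energy_aff (energy T) (s (Suc r)) (s r) = eaff T s r"
  using validD(2)[of T s r] validD(2)[of T s "Suc r"] by (metis eaff_def en_def energy_aff_def snd_conv)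

lemma fock_set_iff: "s \<in> fock_set T \<longleftrightarrow> valid T s \<and> (\<forall>r. 0 < eaff T s r) \<and> (\<exists>k. ground_from T s k)"
proof -
  have "s \<in> fock_set T \<longleftrightarrow> valid T s \<and> (\<forall>r. energy_aff (energy T) (s (Suc r)) (s r) > 0) \<and> (\<exists>k. ground_from T s k)"
    by (simp add: fock_set_def valid_def ground_from_def)
  then show ?thesis using energy_aff_eaff by auto
qed

lemma ground_seq_eq: "ground_seq T r = (gexp T r, pel T (gidx T r))"
  by (simp add: ground_seq_def ground_exp_eq ground_elt_eq)

lemma sj_ground: "s r = ground_seq T r \<Longrightarrow> sj T s r = gidx T r"
  by (simp add: sj_def ground_seq_eq pidx_pel gidx_lt)

lemma ground_tail: "ground_from T s k \<Longrightarrow> i \<in> Iset T \<Longrightarrow> tail_at (sm T i s) (sp T i s) k"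
  by (simp add: tail_at_def ground_from_def sm_def sp_def sj_ground fl_gidx el_gidx)

lemma valid_fu:
  assumes s: "valid T s" and i: "i \<in> Iset T" and p: "0 < sp T i s r"
  shows "valid T (fu T i s r)" "F T (sj T s r) i = Some (sj T (fu T i s r) r)"
    "t \<noteq> r \<Longrightarrow> sj T (fu T i s r) t = sj T s t"
proof -
  have "F T (sj T s r) i \<noteq> None" using p fl_pos sm_sp(2)[of T i s r] by fastforce
  then obtain k where k: "F T (sj T s r) i = Some k" by blast
  then have kl: "k < ncls T" using F_lt validD(1)[OF s] by blast
  show "valid T (fu T i s r)"
    using s kl k by (auto simp: valid_def fu_def affinization_def elts_perfect)
  show "F T (sj T s r) i = Some (sj T (fu T i s r) r)" using k kl by (simp add: sj_def fu_def pidx_pel)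
qed (simp add: sj_def fu_def)

lemma valid_eu:
  assumes s: "valid T s" and i: "i \<in> Iset T" and p: "0 < sm T i s r"
  shows "valid T (eu T i s r)" "E T (sj T s r) i = Some (sj T (eu T i s r) r)"
    "t \<noteq> r \<Longrightarrow> sj T (eu T i s r) t = sj T s t"
proof -
  have "E T (sj T s r) i \<noteq> None" using p el_pos sm_sp(1)[of T i s r] by fastforce
  then obtain k where k: "E T (sj T s r) i = Some k" by blast
  then have kl: "k < ncls T" using E_lt validD(1)[OF s] by blast
  show "valid T (eu T i s r)"
    using s kl k by (auto simp: valid_def eu_def affinization_def elts_perfect)
  show "E T (sj T s r) i = Some (sj T (eu T i s r) r)" using k kl by (simp add: sj_def eu_def pidx_pel)
qed (simp add: sj_def eu_def)

lemma fu_eu: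
  assumes s: "valid T s" and i: "i \<in> Iset T"
  shows "0 < sp T i s r \<Longrightarrow> eu T i (fu T i s r) r = s" "0 < sm T i s r \<Longrightarrow> fu T i (eu T i s r) r = s"
proof -
  assume "0 < sp T i s r"
  note v = valid_fu[OF s i this]
  have "E T (sj T (fu T i s r) r) i = Some (sj T s r)" using str_F(2)[OF validD(1)[OF s] i v(2)] .
  moreover have "s r = (fst (fu T i s r r) + dz i, pel T (sj T s r))"
    using validD(2)[OF s, of r] by (simp add: fu_def)
  ultimately have "eu T i (fu T i s r) r = (fu T i s r)(r := s r)"
    unfolding eu_def[of T i "fu T i s r"] by (metis option.sel)
  then show "eu T i (fu T i s r) r = s" by (simp add: fu_def)
next
  assume "0 < sm T i s r"
  note v = valid_eu[OF s i this]
  have "F T (sj T (eu T i s r) r) i = Some (sj T s r)" using str_E(2)[OF validD(1)[OF s] i v(2)] .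
  moreover have "s r = (fst (eu T i s r r) - dz i, pel T (sj T s r))"
    using validD(2)[OF s, of r] by (simp add: eu_def)
  ultimately have "fu T i (eu T i s r) r = (eu T i s r)(r := s r)"
    unfolding fu_def[of T i "eu T i s r"] by (metis option.sel)
  then show "fu T i (eu T i s r) r = s" by (simp add: eu_def)
qed

lemma fu_sm_sp:
  assumes s: "valid T s" and i: "i \<in> Iset T" and p: "0 < sp T i s r"
  shows "sm T i (fu T i s r) = (sm T i s)(r := sm T i s r + 1)" "sp T i (fu T i s r) = (sp T i s)(r := sp T i s r - 1)"
proof -
  note v = valid_fu[OF s i p]
  note st = str_F[OF validD(1)[OF s] i v(2)]
  have "int (sm T i (fu T i s r) r) = int (sm T i s r) + 1" "int (sp T i s r) = int (sp T i (fu T i s r) r) + 1"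
    using st by (simp_all add: sm_sp)
  then have "sm T i (fu T i s r) r = sm T i s r + 1" "sp T i (fu T i s r) r = sp T i s r - 1" by linarith+
  then show "sm T i (fu T i s r) = (sm T i s)(r := sm T i s r + 1)" "sp T i (fu T i s r) = (sp T i s)(r := sp T i s r - 1)"
    using v(3) by (auto simp: fun_eq_iff sm_def sp_def)
qed

text \<open>One plus sign of column \<open>r\<close> becomes a minus sign. To the left of
  \<open>r\<close> no column has more plus signs than there were survivors, so the additional minus
  sign is never cancelled.\<close>

lemma elen_fu:
  assumes f: "is_f m p r"
  shows "elen (m(r := m r + 1)) (p(r := p r - 1)) t = elen m p t + (if r < t then 1 else 0)"
proof (induction t)
  case (Suc t)
  consider "t < r" | "t = r" | "r < t" by linarith
  then show ?case
  proof cases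
    case 2 then show ?thesis using Suc f by (simp add: is_f_def)
  next
    case 3
    then have "p t \<le> elen m p t" using f by (simp add: is_f_def)
    then show ?thesis using 3 Suc by simp
  qed (use Suc in simp)
qed simp

lemma elen_eu:
  assumes e: "is_e m p r" and m: "0 < m r"
  shows "elen (m(r := m r - 1)) (p(r := p r + 1)) t = elen m p t - (if r < t then 1 else 0)"
proof (induction t)
  case (Suc t)
  consider "t < r" | "t = r" | "r < t" by linarith
  then show ?case
  proof cases
    case 2 then show ?thesis using Suc e m by (simp add: is_e_def)
  next
    case 3
    then have "p t < elen m p t" using e by (simp add: is_e_def)
    then show ?thesis using 3 Suc by simp
  qed (use Suc in simp)
qed simp

lemma is_e_minus: "is_e m p r \<Longrightarrow> 0 < m r"
proof -
  assume e: "is_e m p r"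
  then have "p (Suc r) < elen m p (Suc r)" unfolding is_e_def by blast
  then show ?thesis using e by (simp add: is_e_def)
qed

lemma is_f_plus: "is_f m p r \<Longrightarrow> 0 < p r"
  by (auto simp: is_f_def)

lemma is_f_unique: "is_f m p r \<Longrightarrow> is_f m p t \<Longrightarrow> r = t"
  by (metis is_f_def linorder_neqE_nat not_le)

lemma is_e_unique: "is_e m p r \<Longrightarrow> is_e m p t \<Longrightarrow> r = t"
  by (metis is_e_def linorder_neqE_nat not_le)

lemma is_e_fu: "is_f m p r \<Longrightarrow> is_e (m(r := m r + 1)) (p(r := p r - 1)) r"
  unfolding is_e_def elen_fu by (auto simp: is_f_def less_Suc_eq_le)

lemma is_f_eu: "is_e m p r \<Longrightarrow> is_f (m(r := m r - 1)) (p(r := p r + 1)) r"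
proof -
  assume e: "is_e m p r"
  have "p t \<le> elen m p t - 1" if "r < t" for t
    using e that unfolding is_e_def by (metis Suc_pred' diff_Suc_1 less_Suc_eq_le less_nat_zero_code neq0_conv)
  then show ?thesis
    using e unfolding is_f_def elen_eu[OF e is_e_minus[OF e]] by (simp add: is_e_def)
qed

lemma elen_ge: "m r \<le> elen m p (Suc r)"
  by simp

text \<open>In the pair \<open>(r + 1, r)\<close> the tensor product rule for two factors chooses
  the right one, and in \<open>(r, r - 1)\<close> the left one. In both cases the change of the
  energy cancels the change of the exponent.\<close>

lemma eaff_fu:
  assumes s: "valid T s" and i: "i \<in> Iset T" and f: "is_f (sm T i s) (sp T i s) r"
  shows "eaff T (fu T i s r) t = eaff T s t"
proof -
  have p: "0 < sp T i s r" by (rule is_f_plus[OF f])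
  note v = valid_fu[OF s i p] and j = validD(1)[OF s]
  consider "t \<noteq> r" "Suc t \<noteq> r" | "t = r" | "Suc t = r" by blast
  then show ?thesis
  proof cases
    case 1 then show ?thesis using v(3) by (simp add: eaff_def fu_def)
  next
    case 2
    have "sp T i s (Suc r) \<le> elen (sm T i s) (sp T i s) (Suc r)" using f unfolding is_f_def by blast
    then have "sp T i s (Suc r) \<le> sm T i s r" using f by (simp add: is_f_def)
    then have le: "fl T (sj T s (Suc r)) i \<le> el T (sj T s r) i" using sm_sp by (metis of_nat_le_iff)
    show ?thesis
      using en_right[OF j j i v(2) le] v(3)[of "Suc r"] 2 by (simp add: eaff_def fu_def)
  next
    case 3
    have "sm T i s t \<le> elen (sm T i s) (sp T i s) r" using elen_ge[of "sm T i s" t] 3 by metis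
    then have "sm T i s t < sp T i s r" using f by (simp add: is_f_def)
    then have lt: "el T (sj T s t) i < fl T (sj T s r) i" using sm_sp by (metis of_nat_less_iff)
    show ?thesis
      using en_left[OF j j i v(2) lt] v(3)[of t] 3 by (auto simp: eaff_def fu_def)
  qed
qed

lemma fock_fu:
  assumes s: "s \<in> fock_set T" and i: "i \<in> Iset T" and f: "is_f (sm T i s) (sp T i s) r"
  shows "fu T i s r \<in> fock_set T"
proof -
  have v: "valid T s" and e: "\<forall>t. 0 < eaff T s t" using s fock_set_iff by blast+
  obtain k where k: "ground_from T s k" using s fock_set_iff by blast
  have "ground_from T (fu T i s r) (max k (Suc r))" using k by (auto simp: ground_from_def fu_def)
  then show ?thesis
    unfolding fock_set_iff using valid_fu(1)[OF v i is_f_plus[OF f]] eaff_fu[OF v i f] e by auto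
qed

lemma eu_sm_sp:
  assumes s: "valid T s" and i: "i \<in> Iset T" and m: "0 < sm T i s r"
  shows "sm T i (eu T i s r) = (sm T i s)(r := sm T i s r - 1)" "sp T i (eu T i s r) = (sp T i s)(r := sp T i s r + 1)"
proof -
  note v = valid_eu[OF s i m]
  note st = str_E[OF validD(1)[OF s] i v(2)]
  have "int (sm T i s r) = int (sm T i (eu T i s r) r) + 1" "int (sp T i (eu T i s r) r) = int (sp T i s r) + 1"
    using st by (simp_all add: sm_sp)
  then have "sm T i (eu T i s r) r = sm T i s r - 1" "sp T i (eu T i s r) r = sp T i s r + 1" by linarith+
  then show "sm T i (eu T i s r) = (sm T i s)(r := sm T i s r - 1)" "sp T i (eu T i s r) = (sp T i s)(r := sp T i s r + 1)"
    using v(3) by (auto simp: fun_eq_iff sm_def sp_def)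
qed

lemma fock_eu:
  assumes s: "s \<in> fock_set T" and i: "i \<in> Iset T" and e: "is_e (sm T i s) (sp T i s) r"
  shows "eu T i s r \<in> fock_set T" "is_f (sm T i (eu T i s r)) (sp T i (eu T i s r)) r"
proof -
  have v: "valid T s" using s fock_set_iff by blast
  note m = is_e_minus[OF e]
  show f: "is_f (sm T i (eu T i s r)) (sp T i (eu T i s r)) r"
    unfolding eu_sm_sp[OF v i m] by (rule is_f_eu[OF e])
  note v' = valid_eu(1)[OF v i m]
  have "eaff T (eu T i s r) t = eaff T s t" for t
    using eaff_fu[OF v' i f, of t] fu_eu(2)[OF v i m] by simp
  moreover obtain k where k: "ground_from T s k" using s fock_set_iff by blast
  have "ground_from T (eu T i s r) (max k (Suc r))" using k by (auto simp: ground_from_def eu_def)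
  ultimately show "eu T i s r \<in> fock_set T" using s v' unfolding fock_set_iff by auto
qed

lemma stab_ground: "s \<in> fock_set T \<Longrightarrow> ground_from T s (stab T s)"
proof -
  assume "s \<in> fock_set T"
  then have "\<exists>k. \<forall>r \<ge> k. s r = ground_seq T r" by (simp add: fock_set_def)
  then show ?thesis unfolding ground_from_def stab_def by (rule LeastI_ex)
qed

lemma fock_ff_eq:
  assumes s: "s \<in> fock_set T" and i: "i \<in> Iset T"
  shows "is_f (sm T i s) (sp T i s) r \<Longrightarrow> fock_ff T i s = Some (fu T i s r)"
    "(\<And>r. \<not> is_f (sm T i s) (sp T i s) r) \<Longrightarrow> fock_ff T i s = None"
proof -
  have v: "valid T s" using s fock_set_iff by blast
  let ?m = "sm T i s" and ?p = "sp T i s" and ?k = "stab T s"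
  have tl: "tail_at ?m ?p ?k" by (rule ground_tail[OF stab_ground[OF s] i])
  show "fock_ff T i s = Some (fu T i s r)" if f: "is_f ?m ?p r"
  proof -
    have r: "r < Suc ?k" using plus_fst_bound[OF tl, of r] f by (simp add: is_f_def plus_fst)
    have "ff (tpow T (Suc ?k)) i (lower_part s (Suc ?k)) = Some (lower_part (fu T i s r) (Suc ?k))"
      using tpow_ff[OF v i, of "Suc ?k"] r f unfolding is_f_def by blast
    moreover have "replace_lower s (lower_part (fu T i s r) (Suc ?k)) = fu T i s r"
      using r by (intro replace_lower_part) (simp add: fu_def)
    ultimately show ?thesis by (simp add: fock_ff_def Let_def del: tensor_power.simps)
  qed
  show "fock_ff T i s = None" if n: "\<And>r. \<not> is_f ?m ?p r"
  proof -
    have "remaining_plus ?m ?p = {}" using plus_Max(1)[OF tl] n by blast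
    then have "\<forall>r. ?p r \<le> elen ?m ?p r" using plus_fst[of _ ?m ?p] by (metis empty_iff image_empty not_le)
    then have "ff (tpow T (Suc ?k)) i (lower_part s (Suc ?k)) = None" using tpow_ff[OF v i, of "Suc ?k"] by blast
    then show ?thesis by (simp add: fock_ff_def Let_def del: tensor_power.simps)
  qed
qed

text \<open>The affine energy of the factors \<open>k + 1\<close> and \<open>k\<close> is 1 in the
  ground state, and raising the factor \<open>k\<close> makes it at most 0. This is why
  \<open>fock_ee\<close> gives \<open>None\<close> when the tensor product rule selects the ground
  state factor.\<close>

lemma raise_ground_not_fock:
  assumes s: "valid T s" and k: "ground_from T s k" and i: "i \<in> Iset T" and m: "0 < sm T i s k"
  shows "eu T i s k \<notin> fock_set T"
proof
  assume a: "eu T i s k \<in> fock_set T"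
  note v = valid_eu[OF s i m]
  have g: "s k = ground_seq T k" "s (Suc k) = ground_seq T (Suc k)" using k by (auto simp: ground_from_def)
  have j: "sj T s k = gidx T k" "sj T s (Suc k) = gidx T (Suc k)" using g sj_ground by auto
  have "eaff T (eu T i s k) k = en T (gidx T (Suc k)) (sj T (eu T i s k) k) + gexp T (Suc k) - (gexp T k + dz i)"
    using v(3)[of "Suc k"] j g by (simp add: eaff_def) (simp add: eu_def ground_seq_eq)
  moreover have "en T (gidx T (Suc k)) (sj T (eu T i s k) k) < en T (gidx T (Suc k)) (gidx T k) + dz i"
    using en_ground_raise[OF i] v(2) j by metis
  ultimately have "eaff T (eu T i s k) k \<le> 0" by simp
  then show False using a fock_set_iff by (metis not_le)
qed

lemma fock_ee_eq:
  assumes s: "s \<in> fock_set T" and i: "i \<in> Iset T"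
  shows "is_e (sm T i s) (sp T i s) r \<Longrightarrow> fock_ee T i s = Some (eu T i s r)"
    "(\<And>r. \<not> is_e (sm T i s) (sp T i s) r) \<Longrightarrow> fock_ee T i s = None"
proof -
  have v: "valid T s" using s fock_set_iff by blast
  let ?m = "sm T i s" and ?p = "sp T i s" and ?k = "stab T s"
  have gr: "ground_from T s ?k" by (rule stab_ground[OF s])
  have tl: "tail_at ?m ?p ?k" by (rule ground_tail[OF gr i])
  show "fock_ee T i s = Some (eu T i s r)" if e: "is_e ?m ?p r"
  proof -
    have pk: "?p (Suc (max ?k r)) < elen ?m ?p (Suc (max ?k r))"
      using e unfolding is_e_def by (meson le_imp_less_Suc max.cobounded2)
    have "elen ?m ?p (Suc (max ?k r)) = ?p (Suc (max ?k r)) + (elen ?m ?p ?k - ?p ?k)"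
      by (rule elen_tail[OF tl]) simp
    then have pk: "?p ?k < elen ?m ?p ?k" using pk by linarith
    \<comment> \<open>In the stable part the excess of \<open>elen\<close> over \<open>p\<close> is
      constant and positive, so the selected factor lies below it.\<close>
    have r: "r < ?k"
    proof (rule ccontr)
      assume "\<not> r < ?k"
      then consider "r = ?k" | "?k < r" by linarith
      then show False using e pk elen_tail[OF tl, of r] by cases (auto simp: is_e_def)
    qed
    then have rs: "r < Suc ?k" by simp
    have "ee (tpow T (Suc ?k)) i (lower_part s (Suc ?k)) = Some (lower_part (eu T i s r) (Suc ?k))"
      using tpow_ee[OF v i, of "Suc ?k"] rs e is_e_minus[OF e] unfolding is_e_def by fastforce
    moreover have "replace_lower s (lower_part (eu T i s r) (Suc ?k)) = eu T i s r"
      using rs by (intro replace_lower_part) (simp add: eu_def)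
    ultimately show ?thesis
      using fock_eu(1)[OF s i e] by (simp add: fock_ee_def Let_def del: tensor_power.simps)
  qed
  show "fock_ee T i s = None" if n: "\<And>r. \<not> is_e ?m ?p r"
  proof -
    have "remaining_minus ?m ?p = {}" using minus_Min(1)[OF tl] n by blast
    then have pk: "elen ?m ?p ?k \<le> ?p ?k" by (simp add: remaining_minus_eq[OF tl] length_stk)
    have "ee (tpow T (Suc ?k)) i (lower_part s (Suc ?k)) =
        (if ?m ?k = 0 then None else Some (lower_part (eu T i s ?k) (Suc ?k)))"
      using tpow_ee[OF v i, of "Suc ?k"] pk by simp
    moreover have "replace_lower s (lower_part (eu T i s ?k) (Suc ?k)) = eu T i s ?k"
      by (intro replace_lower_part) (simp add: eu_def)
    moreover have "0 < ?m ?k \<Longrightarrow> eu T i s ?k \<notin> fock_set T" by (rule raise_ground_not_fock[OF v gr i])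
    ultimately show ?thesis by (simp add: fock_ee_def Let_def del: tensor_power.simps)
  qed
qed

lemma plen_sum: "plen m p n = (\<Sum>r < n. p r - elen m p r)"
  by (induction n) simp_all

text \<open>The definition uses the least \<open>k\<close> from which the sequence is in the ground
  state. Here any such \<open>k\<close> is allowed, because both numbers count surviving signs; a
  sequence and its image under an operator can then be compared at a common
  \<open>k\<close>.\<close>

lemma fock_eps_phi:
  assumes s: "s \<in> fock_set T" and i: "i \<in> Iset T" and k: "ground_from T s k"
  shows "eps (fock_crystal T) i s = Fin (int (elen (sm T i s) (sp T i s) k - sp T i s k))"
    "phi (fock_crystal T) i s = Fin (int (plen (sm T i s) (sp T i s) (Suc k)))"
proof -
  have v: "valid T s" using s fock_set_iff by blast
  let ?m = "sm T i s" and ?p = "sp T i s" and ?l = "stab T s"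
  have gr: "ground_from T s ?l" by (rule stab_ground[OF s])
  have tl: "tail_at ?m ?p ?l" "tail_at ?m ?p k" using ground_tail[OF gr i] ground_tail[OF k i] by auto
  have "s ?l = ground_seq T ?l" using gr by (simp add: ground_from_def)
  then have "ground_elt T ?l = pel T (sj T s ?l)" by (simp add: ground_elt_eq sj_ground)
  then have ph: "phi (perfect T) i (ground_elt T ?l) = Fin (int (?p ?l))"
    using perfect_table(2)[OF validD(1)[OF v] i] by (simp add: sm_sp)
  have c: "elen ?m ?p ?l - ?p ?l = elen ?m ?p k - ?p k" "plen ?m ?p (Suc ?l) = plen ?m ?p (Suc k)"
    using minus_card[OF tl(1)] minus_card[OF tl(2)] plus_card[OF tl(1)] plus_card[OF tl(2)]
    by (simp_all only: plen_sum lessThan_Suc_atMost)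
  note t = tpow_eps_phi[OF v i, of ?l]
  have "eps (fock_crystal T) i s = Fin (int (elen ?m ?p ?l - ?p ?l))"
    using t by (simp add: fock_crystal_def Let_def ph zero_extended_def max_def)
  then show "eps (fock_crystal T) i s = Fin (int (elen ?m ?p k - ?p k))" using c by simp
  have "phi (fock_crystal T) i s = Fin (int (plen ?m ?p (Suc ?l)))"
    using t by (simp add: fock_crystal_def Let_def ph zero_extended_def max_def)
  then show "phi (fock_crystal T) i s = Fin (int (plen ?m ?p (Suc k)))" using c by simp
qed

definition wdiff :: "affine_type \<Rightarrow> (nat \<Rightarrow> int \<times> perfect_elt) \<Rightarrow> nat \<Rightarrow> aweight" where
  "wdiff T s r = wt (affinization (perfect T)) (s r) - wt (affinization (perfect T)) (ground_seq T r)"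

lemma fock_wt:
  assumes k: "ground_from T s k"
  shows "wt (fock_crystal T) s = fund 0 + (\<Sum>r < k. wdiff T s r)"
proof -
  have "(\<Sum>r \<in> {r. s r \<noteq> ground_seq T r}. wdiff T s r) = (\<Sum>r < k. wdiff T s r)"
    by (rule sum.mono_neutral_left) (use k in \<open>auto simp: ground_from_def wdiff_def not_less[symmetric]\<close>)
  then show ?thesis by (simp add: fock_crystal_def wdiff_def)
qed

lemma fst_sum_at: "fst (\<Sum>r \<in> A. f r) l = (\<Sum>r \<in> A. fst (f r :: aweight) l)"
  by (induction A rule: infinite_finite_induct) simp_all

lemma valid_ground: "valid T (ground_seq T)"
  using gidx_lt by (auto simp: valid_def ground_seq_eq affinization_def elts_perfect)

lemma wdiff_eq:
  assumes s: "valid T s"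
  shows "wdiff T s r = (wfun T (sj T s r) - wfun T (gidx T r), fst (s r) - gexp T r)"
proof -
  have "wt (affinization (perfect T)) (s r) = (wfun T (sj T s r), fst (s r))" by (rule aff_ops(5)[OF s zero_Iset])
  moreover have "wt (affinization (perfect T)) (ground_seq T r) = (wfun T (gidx T r), gexp T r)"
    using aff_ops(5)[OF valid_ground zero_Iset, of T r] sj_ground[of "ground_seq T" r T] by (simp add: ground_seq_eq)
  ultimately show ?thesis by (simp add: wdiff_def)
qed

lemma plen_elen: "int (plen m p n) - int (elen m p n) = (\<Sum>r < n. int (p r) - int (m r))"
  by (induction n) (auto)

lemma fock_pairing:
  assumes s: "s \<in> fock_set T" and i: "i \<in> Iset T"
  shows "phi (fock_crystal T) i s = eps (fock_crystal T) i s + Fin (fst (wt (fock_crystal T) s) i)"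
proof -
  have v: "valid T s" using s fock_set_iff by blast
  obtain k where k: "ground_from T s k" using s fock_set_iff by blast
  let ?m = "sm T i s" and ?p = "sp T i s"
  have pm: "wfun T (sj T s r) i = int (?p r) - int (?m r)" for r
    using chk_strD(1)[OF validD(1)[OF v] i] by (simp add: sm_sp)
  have gw: "wfun T (gidx T r) i = fl T (gidx T r) i - fl T (gidx T (Suc r)) i" for r
    using chk_strD(1)[OF gidx_lt i] by (simp add: el_gidx fl_gidx i)
  \<comment> \<open>The \<epsilon> of a ground state element is the \<phi> of the next one, so the
    weights of the ground state telescope.\<close>
  have gsum: "(\<Sum>r < k. wfun T (gidx T r) i) = fl T (gidx T 0) i - fl T (gidx T k) i"
    unfolding gw by (induction k) simp_all
  have pk: "int (?p k) = fl T (gidx T k) i" using k by (simp add: sm_sp sj_ground ground_from_def)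
  have "fst (wt (fock_crystal T) s) i = (if i = 0 then 1 else 0) + (\<Sum>r < k. wfun T (sj T s r) i - wfun T (gidx T r) i)"
    unfolding fock_wt[OF k] by (simp add: fst_sum_at wdiff_eq[OF v] fund_def cfund_def)
  also have "\<dots> = (\<Sum>r < k. int (?p r) - int (?m r)) + int (?p k)"
    using gsum fl_gidx[OF i, of 0] by (simp add: sum_subtractf pm pk gcol_0)
  also have "\<dots> = int (plen ?m ?p (Suc k)) - int (elen ?m ?p k - ?p k)"
    using plen_elen[of ?m ?p k] by auto
  finally show ?thesis using fock_eps_phi[OF s i k] by simp
qed

lemma fock_ff_step:
  assumes s: "s \<in> fock_set T" and i: "i \<in> Iset T" and f: "is_f (sm T i s) (sp T i s) r"
  shows "wt (fock_crystal T) (fu T i s r) = wt (fock_crystal T) s - sroot T i"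
    "eps (fock_crystal T) i (fu T i s r) = eps (fock_crystal T) i s + 1"
    "phi (fock_crystal T) i (fu T i s r) = phi (fock_crystal T) i s - 1"
proof -
  have v: "valid T s" using s fock_set_iff by blast
  have p: "0 < sp T i s r" by (rule is_f_plus[OF f])
  note vf = valid_fu[OF v i p] and ff = fock_fu[OF s i f]
  obtain k0 where k0: "ground_from T s k0" using s fock_set_iff by blast
  define k where "k = max k0 (Suc r)"
  have k: "ground_from T s k" and k': "ground_from T (fu T i s r) k" and rk: "r < k"
    using k0 by (auto simp: k_def ground_from_def fu_def)
  have "wdiff T (fu T i s r) t = wdiff T s t - (if t = r then sroot T i else 0)" for t
  proof -
    have "fst (fu T i s r t) = fst (s t) - (if t = r then dz i else 0)" by (simp add: fu_def)
    moreover have "wfun T (sj T (fu T i s r) t) = wfun T (sj T s t) - (if t = r then csroot T i else 0)"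
      using vf(3) wfun_F[OF validD(1)[OF v] i vf(2)] by simp
    ultimately show ?thesis
      unfolding wdiff_eq[OF v] wdiff_eq[OF vf(1)] by (simp add: sroot_def dz_def prod_eq_iff)
  qed
  then have "(\<Sum>t < k. wdiff T (fu T i s r) t) = (\<Sum>t < k. wdiff T s t) - sroot T i"
    using rk by (simp add: sum_subtractf)
  then show w: "wt (fock_crystal T) (fu T i s r) = wt (fock_crystal T) s - sroot T i"
    unfolding fock_wt[OF k] fock_wt[OF k'] by simp
  have "sp T i s k \<le> elen (sm T i s) (sp T i s) k" using f rk by (simp add: is_f_def)
  then show e: "eps (fock_crystal T) i (fu T i s r) = eps (fock_crystal T) i s + 1"
    unfolding fock_eps_phi(1)[OF s i k] fock_eps_phi(1)[OF ff i k'] fu_sm_sp[OF v i p] elen_fu[OF f]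
    using rk by (simp add: one_extended_def Suc_diff_le)
  have "fst (sroot T i) i = 2" using csroot_self[OF i] by (simp add: sroot_def)
  then show "phi (fock_crystal T) i (fu T i s r) = phi (fock_crystal T) i s - 1"
    using fock_eps_phi[OF s i k]
    unfolding fock_pairing[OF ff i] fock_pairing[OF s i] w e by (simp add: one_extended_def)
qed

theorem fock_is_crystal: "is_crystal (affine_data T) (fock_crystal T)"
  unfolding is_crystal_def
proof (intro ballI conjI)
  fix s assume "s \<in> elts (fock_crystal T)"
  then have s: "s \<in> fock_set T" by (simp add: fock_crystal_def)
  have v: "valid T s" using s fock_set_iff by blast
  obtain k where k: "ground_from T s k" using s fock_set_iff by blast
  show "wt (fock_crystal T) s \<in> lattice (affine_data T)"
    unfolding fock_wt[OF k]
    by (auto simp: affine_data_def fst_sum_at wdiff_eq[OF v] wfun_out fund_def cfund_def)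
  fix i assume "i \<in> index (affine_data T)"
  then have i: "i \<in> Iset T" by (simp add: affine_data_def)
  let ?m = "sm T i s" and ?p = "sp T i s"
  have ops: "ee (fock_crystal T) = fock_ee T" "ff (fock_crystal T) = fock_ff T" "elts (fock_crystal T) = fock_set T"
    "simple_root (affine_data T) = sroot T" "pairing (affine_data T) i w = fst w i" for w
    by (simp_all add: fock_crystal_def affine_data_def)
  have ee_iff: "fock_ee T i x = Some y \<longleftrightarrow> (\<exists>r. is_e (sm T i x) (sp T i x) r \<and> y = eu T i x r)"
    if "x \<in> fock_set T" for x y
    using fock_ee_eq[OF that i] is_e_unique by (metis option.distinct(1) option.inject)
  have ff_iff: "fock_ff T i x = Some y \<longleftrightarrow> (\<exists>r. is_f (sm T i x) (sp T i x) r \<and> y = fu T i x r)"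
    if "x \<in> fock_set T" for x y
    using fock_ff_eq[OF that i] is_f_unique by (metis option.distinct(1) option.inject)
  have inv: "fock_ff T i x = Some y \<longleftrightarrow> fock_ee T i y = Some x" if x: "x \<in> fock_set T" and y: "y \<in> fock_set T" for x y
  proof
    have vx: "valid T x" and vy: "valid T y" using x y fock_set_iff by blast+
    show "fock_ee T i y = Some x" if a: "fock_ff T i x = Some y"
    proof -
      obtain r where r: "is_f (sm T i x) (sp T i x) r" "y = fu T i x r" using a ff_iff[OF x] by blast
      note p = is_f_plus[OF r(1)]
      have "is_e (sm T i y) (sp T i y) r" unfolding r(2) fu_sm_sp[OF vx i p] by (rule is_e_fu[OF r(1)])
      moreover have "eu T i y r = x" unfolding r(2) by (rule fu_eu(1)[OF vx i p])
      ultimately show ?thesis using ee_iff[OF y] by blast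
    qed
    show "fock_ff T i x = Some y" if a: "fock_ee T i y = Some x"
    proof -
      obtain r where r: "is_e (sm T i y) (sp T i y) r" "x = eu T i y r" using a ee_iff[OF y] by blast
      have "is_f (sm T i x) (sp T i x) r" using fock_eu(2)[OF y i r(1)] r(2) by simp
      moreover have "fu T i x r = y" unfolding r(2) by (rule fu_eu(2)[OF vy i is_e_minus[OF r(1)]])
      ultimately show ?thesis using ff_iff[OF x] by blast
    qed
  qed
  note ep = fock_eps_phi[OF s i k]
  show "eps (fock_crystal T) i s \<noteq> Pinf" "phi (fock_crystal T) i s \<noteq> Pinf" using ep by simp_all
  show "phi (fock_crystal T) i s = eps (fock_crystal T) i s + Fin (pairing (affine_data T) i (wt (fock_crystal T) s))"
    unfolding ops by (rule fock_pairing[OF s i])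
  show "\<forall>s'. ff (fock_crystal T) i s = Some s' \<longrightarrow> s' \<in> elts (fock_crystal T) \<and>
      wt (fock_crystal T) s' = wt (fock_crystal T) s - simple_root (affine_data T) i \<and>
      eps (fock_crystal T) i s' = eps (fock_crystal T) i s + 1 \<and> phi (fock_crystal T) i s' = phi (fock_crystal T) i s - 1"
    unfolding ops
  proof (intro allI impI)
    fix s' assume "fock_ff T i s = Some s'"
    then obtain r where r: "is_f ?m ?p r" and s': "s' = fu T i s r" using ff_iff[OF s] by blast
    show "s' \<in> fock_set T \<and> wt (fock_crystal T) s' = wt (fock_crystal T) s - sroot T i \<and>
      eps (fock_crystal T) i s' = eps (fock_crystal T) i s + 1 \<and> phi (fock_crystal T) i s' = phi (fock_crystal T) i s - 1"
      unfolding s' by (intro conjI fock_fu[OF s i r] fock_ff_step[OF s i r])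
  qed
  show "\<forall>s'. ee (fock_crystal T) i s = Some s' \<longrightarrow> s' \<in> elts (fock_crystal T) \<and>
      wt (fock_crystal T) s' = wt (fock_crystal T) s + simple_root (affine_data T) i \<and>
      eps (fock_crystal T) i s' = eps (fock_crystal T) i s - 1 \<and> phi (fock_crystal T) i s' = phi (fock_crystal T) i s + 1"
    unfolding ops
  proof (intro allI impI)
    fix s' assume e: "fock_ee T i s = Some s'"
    then obtain r where r: "is_e ?m ?p r" "s' = eu T i s r" using ee_iff[OF s] by blast
    have s': "s' \<in> fock_set T" and f: "is_f (sm T i s') (sp T i s') r" using fock_eu[OF s i r(1)] r(2) by simp_all
    \<comment> \<open>The statements about raising are those about lowering from \<open>s'\<close>,
      read backwards.\<close>
    have fs: "fu T i s' r = s" unfolding r(2) by (rule fu_eu(2)[OF v i is_e_minus[OF r(1)]])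
    obtain k' where k': "ground_from T s' k'" using s' fock_set_iff by blast
    note st = fock_ff_step[OF s' i f, unfolded fs] and ep' = fock_eps_phi[OF s' i k']
    have "wt (fock_crystal T) s' = wt (fock_crystal T) s + sroot T i" using st(1) by (simp add: algebra_simps)
    then show "s' \<in> fock_set T \<and> wt (fock_crystal T) s' = wt (fock_crystal T) s + sroot T i \<and>
      eps (fock_crystal T) i s' = eps (fock_crystal T) i s - 1 \<and> phi (fock_crystal T) i s' = phi (fock_crystal T) i s + 1"
      using s' st(2,3) unfolding ep' by (simp add: one_extended_def)
  qed
  show "(ff (fock_crystal T) i s = Some s') = (ee (fock_crystal T) i s' = Some s)"
    if "s' \<in> elts (fock_crystal T)" for s'
    using inv[OF s] that unfolding ops by blast
  show "phi (fock_crystal T) i s = Minf \<longrightarrow> ee (fock_crystal T) i s = None \<and> ff (fock_crystal T) i s = None"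
    using ep by simp
qed

lemma ground_seq_fock: "ground_seq T \<in> fock_set T"
proof -
  have "ground_from T (ground_seq T) 0" by (simp add: ground_from_def)
  moreover have "0 < eaff T (ground_seq T) r" for r
    by (simp add: eaff_def sj_ground ground_seq_eq)
  ultimately show ?thesis using valid_ground fock_set_iff by blast
qed


section \<open>Connectivity\<close>

lemma F_00: "\<exists>k. F T 0 0 = Some k \<and> kind T 0 \<noteq> Some 0 \<and> kind T k \<noteq> Some 0"
proof -
  have "F E6 0 0 = Some 4 \<and> kind E6 0 = None \<and> kind E6 4 = None \<and>
      F E7 0 0 = Some 8 \<and> kind E7 0 = None \<and> kind E7 8 = None \<and>
      F E8 0 0 = Some 34 \<and> kind E8 0 = None \<and> kind E8 34 = None"
    by code_simp
  then show ?thesis by (cases T) simp_all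
qed

text \<open>Arrows of nonzero colour join every column except the one of kind 0 to the top column
  without changing the shift, and the 0-arrow leaving entry 0 changes it by one; so all pairs
  \<open>(j, q)\<close> are connected. The step is an equivalence because arrows are followed in
  both directions.\<close>

lemma column_induct:
  fixes Q :: "nat \<Rightarrow> int \<Rightarrow> bool"
  assumes step: "\<And>i j k q. i \<in> Iset T \<Longrightarrow> j < ncls T \<Longrightarrow> F T j i = Some k \<Longrightarrow> Q j q \<longleftrightarrow> Q k (q + dz i)"
    and base: "Q j\<^sub>0 q\<^sub>0" "j\<^sub>0 < ncls T" and j: "j < ncls T"
  shows "Q j q"
proof -
  define u where "u = top_cls T"
  have top: "Q j q \<longleftrightarrow> Q u q" if "j < ncls T" "kind T j \<noteq> Some 0" for j q
    using that
  proof (induction "hrank T j" arbitrary: j rule: less_induct)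
    case less
    show ?case
    proof (cases "j = u")
      case False
      then obtain i where i: "i \<in> Iset T - {0}" "E T j i \<noteq> None" using ex_E less.prems u_def by blast
      then obtain k where k: "E T j i = Some k" by blast
      have i': "i \<in> Iset T" "dz i = 0" using i by (auto simp: dz_def)
      note st = str_E[OF less.prems(1) i'(1) k]
      have "kind T k \<noteq> Some 0" using kind_F_colour[of T k 0 i] st(2) i by auto
      then have "Q k q \<longleftrightarrow> Q u q" using less.hyps[OF hrank_E[OF less.prems(1) i(1) k] st(1)] by blast
      moreover have "Q k q \<longleftrightarrow> Q j q" using step[OF i'(1) st(1,2)] i'(2) by simp
      ultimately show ?thesis by blast
    qed simp
  qed
  have ex_top: "\<exists>d. \<forall>q. Q j q \<longleftrightarrow> Q u (q + d)" if j: "j < ncls T" for j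
  proof (cases "kind T j = Some 0")
    case True
    obtain k where k: "F T j 0 = Some k" "k < ncls T" "kind T k = None" using kind_F_root[OF j True] by blast
    have "Q j q \<longleftrightarrow> Q u (q + 1)" for q
      using step[OF zero_Iset j k(1)] top[OF k(2)] k(3) by (simp add: dz_def)
    then show ?thesis by blast
  next
    case False
    then have "Q j q \<longleftrightarrow> Q u (q + 0)" for q using top[OF j] by simp
    then show ?thesis by blast
  qed
  have up: "Q u q \<longleftrightarrow> Q u (q + 1)" for q
  proof -
    obtain k where k: "F T 0 0 = Some k" "kind T 0 \<noteq> Some 0" "kind T k \<noteq> Some 0"
      using F_00 by blast
    have j: "0 < ncls T" by (cases T) simp_all
    show ?thesis using step[OF zero_Iset j k(1)] top[OF j k(2)] top[OF F_lt[OF k(1) j] k(3)] by (simp add: dz_def)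
  qed
  obtain d\<^sub>0 where d\<^sub>0: "\<forall>q. Q j\<^sub>0 q \<longleftrightarrow> Q u (q + d\<^sub>0)" using ex_top[OF base(2)] by blast
  obtain d where d: "\<forall>q. Q j q \<longleftrightarrow> Q u (q + d)" using ex_top[OF j] by blast
  have q0: "Q u (q\<^sub>0 + d\<^sub>0)" using d\<^sub>0 base(1) by blast
  have "Q u q" for q
  proof (induction q rule: int_induct[where k = "q\<^sub>0 + d\<^sub>0"])
    case base then show ?case by (rule q0)
  next
    case (step1 i) then show ?case using up by blast
  next
    case (step2 i) then show ?case using up[of "i - 1"] by simp
  qed
  then show ?thesis using d by blast
qed

text \<open>An isomorphism preserves weights, which identifies the elements of nonzero weight. An
  element of weight zero is identified by its upper neighbour.\<close>

lemma psi_pel: "j < ncls T \<Longrightarrow> psi T (pel T j) = cls T j"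
proof -
  assume j: "j < ncls T"
  have iso: "bij_betw (psi T) (elts (perfect T)) (elts (column_crystal T))"
    "\<And>a. a \<in> elts (perfect T) \<Longrightarrow> wt (column_crystal T) (psi T a) = wt (perfect T) a"
    "\<And>a i. a \<in> elts (perfect T) \<Longrightarrow> i \<in> Iset T \<Longrightarrow>
       ee (column_crystal T) i (psi T a) = map_option (psi T) (ee (perfect T) i a)"
    using psi_iso[of T] unfolding crystal_iso_def classical_data_def by simp_all
  have im: "\<exists>k. k < ncls T \<and> psi T (pel T j) = cls T k \<and> wfun T k = wfun T j" if j: "j < ncls T" for j
  proof -
    have e: "pel T j \<in> elts (perfect T)" using j by (simp add: elts_perfect)
    then have "psi T (pel T j) \<in> cls T ` {..<ncls T}" using bij_betwE[OF iso(1)] elts_columns[of T] by blast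
    then obtain k where k: "k < ncls T" "psi T (pel T j) = cls T k" by blast
    then have "wfun T k = wfun T j"
      using iso(2)[OF e] column_table(3)[OF k(1)] perfect_table(3)[OF j] by simp
    then show ?thesis using k by blast
  qed
  have real: "psi T (pel T j) = cls T j" if j: "j < ncls T" and n: "kind T j = None" for j
  proof -
    obtain k where k: "k < ncls T" "psi T (pel T j) = cls T k" "wfun T k = wfun T j" using im[OF j] by blast
    then have "kind T k = None" using kind_wfun[OF j] kind_wfun[OF k(1)] n by simp
    then show ?thesis using wfun_inject[OF k(1) j _ n k(3)] k(2) by simp
  qed
  show ?thesis
  proof (cases "kind T j")
    case None then show ?thesis using real[OF j] by blast
  next
    case (Some i)
    have i: "i \<in> Iset T" using kind_lt Some by blast
    obtain k where k: "E T j i = Some k" "k < ncls T" "kind T k = None" using kind_E_root[OF j Some] by blast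
    obtain l where l: "l < ncls T" "psi T (pel T j) = cls T l" using im[OF j] by blast
    have "pel T j \<in> elts (perfect T)" using j by (simp add: elts_perfect)
    from iso(3)[OF this i] have "map_option (cls T) (E T l i) = Some (cls T k)"
      by (simp add: l column_ops[OF l(1) i] perfect_ee[OF j i] k real[OF k(2,3)])
    then obtain m where m: "E T l i = Some m" "cls T m = cls T k" by blast
    then have "m = k" using cls_inject E_lt[OF m(1) l(1)] k(2) by blast
    then have "F T k i = Some l" using m(1) F_E[OF k(2) l(1) i] by simp
    moreover have "F T k i = Some j" using k F_E[OF k(2) j i] by simp
    ultimately show ?thesis using l by simp
  qed
qed

lemma column_energy_cls: "j < ncls T \<Longrightarrow> k < ncls T \<Longrightarrow> column_energy T (cls T j) (cls T k) = en T j k"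
proof -
  have "inv_into (elts (perfect T)) (psi T) (cls T j) = pel T j" if "j < ncls T" for j
  proof -
    have "inj_on (psi T) (elts (perfect T))"
      using psi_iso[of T] unfolding crystal_iso_def by (blast dest: bij_betw_imp_inj_on)
    moreover have "pel T j \<in> elts (perfect T)" using that by (simp add: elts_perfect)
    ultimately show ?thesis using inv_into_f_f psi_pel[OF that] by metis
  qed
  then show "j < ncls T \<Longrightarrow> k < ncls T \<Longrightarrow> column_energy T (cls T j) (cls T k) = en T j k"
    by (simp add: column_energy_def en_def)
qed


section \<open>Columns of the wall pattern\<close>

definition pdist :: "affine_type \<Rightarrow> nat \<Rightarrow> int" where
  "pdist T r = (case T of E6 \<Rightarrow> 8 * int r | E7 \<Rightarrow> if even r then 0 else 4 | E8 \<Rightarrow> 0)"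

definition pflip :: "affine_type \<Rightarrow> nat \<Rightarrow> bool" where
  "pflip T r \<longleftrightarrow> T = E7 \<and> odd r"

definition unplace :: "affine_type \<Rightarrow> nat \<Rightarrow> block \<Rightarrow> block" where
  "unplace T r b = (fst b - pdist T r, rotq T (pflip T r) ` snd b)"

lemma place_eq: "place T r b = (fst b + pdist T r, rotq T (pflip T r) ` snd b)"
  by (cases T) (auto simp: place_def pdist_def pflip_def move_rotq)

lemma block_cells: "b \<in> blocks T \<Longrightarrow> snd b \<subseteq> cells T"
  using cube_blocks_cells unfolding blocks_def by blast

lemma rotq_cells_rev: "rotq T \<rho> x \<in> cells T \<Longrightarrow> x \<in> cells T"
  by (cases x) (auto simp: rotq_def cells_def rot_cell_def split: if_splits)

text \<open>The hypothesis keeps the cells inside the pattern: \<open>rot_cell\<close> uses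
  truncated subtraction, so arbitrary cells could not be recovered after a rotation.\<close>

lemma unplace_place: "place T r b \<in> blocks T \<Longrightarrow> unplace T r (place T r b) = b"
proof -
  assume "place T r b \<in> blocks T"
  then have "rotq T (pflip T r) ` snd b \<subseteq> cells T" using block_cells by (force simp: place_eq)
  then have s: "snd b \<subseteq> cells T" using rotq_cells_rev by blast
  then have "rotq T (pflip T r) ` rotq T (pflip T r) ` snd b = rotq T False ` snd b" by simp
  then show ?thesis by (simp add: unplace_def place_eq rotq_def prod_eq_iff)
qed

lemma place_unplace: "b \<in> blocks T \<Longrightarrow> place T r (unplace T r b) = b"
proof -
  assume "b \<in> blocks T"
  then have "rotq T (pflip T r) ` rotq T (pflip T r) ` snd b = rotq T False ` snd b"
    by (simp add: block_cells)
  then show ?thesis by (simp add: unplace_def place_eq rotq_def prod_eq_iff)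
qed

lemma place_iff: "c \<in> blocks T \<Longrightarrow> place T r b = c \<longleftrightarrow> b = unplace T r c"
  using unplace_place place_unplace by metis

definition wcol :: "affine_type \<Rightarrow> nat \<Rightarrow> nat \<Rightarrow> int \<Rightarrow> block set" where
  "wcol T r j q = place T r -` colset T j q"

lemma colset_blocks: "colset T j q \<subseteq> blocks T"
  by (auto simp: colset_def blocks_eq)

lemma place_wcol: "place T r ` wcol T r j q = colset T j q"
proof
  show "colset T j q \<subseteq> place T r ` wcol T r j q"
  proof
    fix c assume c: "c \<in> colset T j q"
    then have "place T r (unplace T r c) = c" using colset_blocks place_unplace by blast
    then show "c \<in> place T r ` wcol T r j q" unfolding wcol_def using c by (metis image_eqI vimageI)
  qed
qed (auto simp: wcol_def)

lemma wall_columns_eq: "wall_columns T r = {wcol T r j q | j q. j < ncls T}"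
proof
  show "{wcol T r j q | j q. j < ncls T} \<subseteq> wall_columns T r"
    using place_wcol unfolding wall_columns_def columns_eq by blast
  show "wall_columns T r \<subseteq> {wcol T r j q | j q. j < ncls T}"
  proof
    fix Y assume "Y \<in> wall_columns T r"
    then obtain j q where j: "j < ncls T" and Y: "place T r ` Y = colset T j q"
      unfolding wall_columns_def columns_eq by blast
    have "wcol T r j q \<subseteq> Y"
    proof
      fix b assume "b \<in> wcol T r j q"
      then have b: "place T r b \<in> place T r ` Y" using Y by (simp add: wcol_def)
      then obtain b' where b': "b' \<in> Y" "place T r b = place T r b'" by blast
      have "place T r b \<in> blocks T" using b Y colset_blocks by blast
      then have "b = b'" using unplace_place b'(2) by metis
      then show "b \<in> Y" using b'(1) by simp
    qed
    moreover have "Y \<subseteq> wcol T r j q" using Y by (auto simp: wcol_def)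
    ultimately show "Y \<in> {wcol T r j q | j q. j < ncls T}" using j by blast
  qed
qed

lemma wcol_inject: "j < ncls T \<Longrightarrow> k < ncls T \<Longrightarrow> wcol T r j q = wcol T r k p \<longleftrightarrow> j = k \<and> q = p"
  using place_wcol colset_inject by metis

lemma wall_class_wcol: "j < ncls T \<Longrightarrow> wall_class T r (wcol T r j q) = cls T j"
  by (simp add: wall_class_def place_wcol column_class_colset)

lemma wall_ops_wcol:
  assumes "j < ncls T" "i \<in> Iset T"
  shows "wall_ff T r i (wcol T r j q) = map_option (\<lambda>k. wcol T r k (q + dz i)) (F T j i)"
    "wall_ee T r i (wcol T r j q) = map_option (\<lambda>k. wcol T r k (q - dz i)) (E T j i)"
  unfolding wall_ff_def wall_ee_def place_wcol column_ff_colset[OF assms] column_ee_colset[OF assms]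
  by (simp_all add: option.map_comp o_def wcol_def)

text \<open>Each arrow of the graph adds a single block of its own colour; this is what relates the
  graph to the count of blocks in the weight of a wall.\<close>

lemma wcol_F:
  assumes "j < ncls T" "F T j i = Some k"
  shows "\<exists>b. b \<notin> wcol T r j q \<and> wall_colour T r b = i \<and> wcol T r k (q + dz i) = insert b (wcol T r j q)"
proof -
  have "fst_out T i j = Some k" using assms(2) by (auto simp: F_def split: option.splits if_splits)
  then obtain n where n: "(i, n, k) \<in> set (outs T j)" using fst_out_SomeD(2) assms(1) by blast
  note o = outs_edge_shift[OF n assms(1), of q, folded dz_def]
  define c where "c = blk T (n + nblk T * q)"
  have c: "c \<in> blocks T" by (simp add: c_def blocks_eq)
  have "colset T k (q + dz i) = insert c (colset T j q)" unfolding colset_def c_def o(3)[symmetric] by simp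
  then have "wcol T r k (q + dz i) = insert (unplace T r c) (wcol T r j q)"
    unfolding wcol_def by (intro set_eqI) (simp only: vimage_eq insert_iff place_iff[OF c])
  moreover have "c \<notin> colset T j q" using o(1) unfolding colset_def c_def by simp
  then have "unplace T r c \<notin> wcol T r j q" by (simp add: wcol_def place_unplace[OF c])
  moreover have "wall_colour T r (unplace T r c) = i"
    using o(2) by (simp add: wall_colour_def place_unplace[OF c]) (simp add: c_def colour_blk)
  ultimately show ?thesis by blast
qed


section \<open>The ground state wall\<close>

definition wcells :: "affine_type \<Rightarrow> bool \<Rightarrow> int \<Rightarrow> cell list" where
  "wcells T \<rho> n = map (rotq T (\<rho> \<noteq> flips T (n div nblk T))) (base_cells T (nat (n mod nblk T)))"

lemma set_wcells: "set (wcells T \<rho> n) = rotq T \<rho> ` snd (blk T n)"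
  unfolding wcells_def snd_blk by (simp add: base_cells_sub)

text \<open>The cubes with positive index of a column of the ground state wall, in the coordinates of the
  pattern, where cube \<open>c\<close> of the pattern is cube 0 of the wall.\<close>

definition gtop :: "affine_type \<Rightarrow> int \<Rightarrow> bool \<Rightarrow> int \<Rightarrow> bool" where
  "gtop T c \<rho> n = (let k = zcube T n - c; S = set (wcells T \<rho> n) in case T of
     E6 \<Rightarrow> k = 1 \<and> card S = 3 \<or> k = 2 \<and> S = set [(2, True), (2, False)] \<or> k = 3 \<and> card S = 1
   | E7 \<Rightarrow> k = 1 \<and> card S \<noteq> 1 \<or> k = 2 \<and> S = set [(2, True), (2, False), (3, True), (3, False)] \<or>
       k = 3 \<and> set [(3, True), (3, False)] \<subseteq> S \<or> k = 4 \<and> S = set [(3, True), (3, False)] \<or> k = 5 \<and> card S = 1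
   | E8 \<Rightarrow> k = 1 \<and> zcol T n \<in> {7,5,2} \<or> k = 2 \<and> zcol T n \<in> {6,4} \<or> k = 3 \<and> zcol T n \<in> {5,3} \<or>
       k = 4 \<and> zcol T n \<in> {4,1} \<or> k = 5 \<and> zcol T n \<in> {2,3} \<or>
       k = 6 \<and> S = set [(4, True), (4, False), (5, True), (5, False), (6, True), (6, False)] \<or>
       k = 7 \<and> zcol T n = 5 \<or> k = 8 \<and> zcol T n = 6 \<or> k = 9 \<and> zcol T n = 7 \<or>
       k = 10 \<and> zcol T n = 8 \<or> k = 11 \<and> zcol T n = 0)"

definition gmem :: "affine_type \<Rightarrow> int \<Rightarrow> bool \<Rightarrow> int \<Rightarrow> bool" where
  "gmem T c \<rho> n \<longleftrightarrow> zcube T n \<le> c \<or> gtop T c \<rho> n"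

lemma times_UNIV_cells:
  "{2::nat} \<times> (UNIV::bool set) = set [(2, True), (2, False)]"
  "{3::nat} \<times> (UNIV::bool set) = set [(3, True), (3, False)]"
  "{2::nat, 3} \<times> (UNIV::bool set) = set [(2, True), (2, False), (3, True), (3, False)]"
  "{4::nat..6} \<times> (UNIV::bool set) = set [(4, True), (4, False), (5, True), (5, False), (6, True), (6, False)]"
  by (auto simp: UNIV_bool)

lemma unplace_ground_iff: "unplace T r (blk T n) \<in> ground_wall T r \<longleftrightarrow> gmem T (pdist T r) (pflip T r) n"
proof -
  define b where "b = unplace T r (blk T n)"
  have p: "place T r b = blk T n" by (simp add: b_def place_unplace blocks_eq)
  have w: "b \<in> wall_cube T r k \<longleftrightarrow> zcube T n - pdist T r = k" for k
  proof -
    have "b \<in> wall_cube T r k \<longleftrightarrow> fst b = k" by (simp add: wall_cube_def p blocks_eq)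
    then show ?thesis by (simp add: b_def unplace_def)
  qed
  have s: "snd b = set (wcells T (pflip T r) n)" by (simp add: b_def unplace_def set_wcells)
  have c: "wall_colour T r b = zcol T n" by (simp add: wall_colour_def p colour_blk)
  have "b \<in> ground_top T r \<longleftrightarrow> gtop T (pdist T r) (pflip T r) n"
    using w s c by (cases T) (simp_all only: ground_top_def gtop_def Let_def affine_type.case Un_iff mem_Collect_eq
        times_UNIV_cells disj_assoc)
  moreover have "b \<in> (\<Union>k \<in> {..0}. wall_cube T r k) \<longleftrightarrow> zcube T n \<le> pdist T r"
    by (simp add: w)
  ultimately show ?thesis by (simp add: ground_wall_def gmem_def b_def)
qed

text \<open>Number \<open>l\<close> is the first block above cube \<open>c\<close>, and all blocks
  beyond \<open>h\<close> lie in cube \<open>c + 12\<close> or higher, while the top part of the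
  ground state reaches at most cube \<open>c + 11\<close>. Comparing the two sets on
  \<open>{l..h}\<close> therefore suffices.\<close>

definition gchk :: "affine_type \<Rightarrow> int \<Rightarrow> bool \<Rightarrow> nat \<Rightarrow> int \<Rightarrow> int \<Rightarrow> int \<Rightarrow> bool" where
  "gchk T c \<rho> j q l h = (case rep T j of (a, xs) \<Rightarrow>
     zcube T (l - 1) = c \<and> zcube T l = c + 1 \<and> c + 12 \<le> zcube T (h + 1) \<and>
     l \<le> a + nblk T * q \<and> a + nblk T * q \<le> h + 1 \<and> list_all (\<lambda>x. x + nblk T * q \<le> h) xs \<and>
     list_all (\<lambda>n. gtop T c \<rho> n \<longleftrightarrow> mem (n - nblk T * q) (a, xs)) [l..h])"

lemma gtop_zcube: "gtop T c \<rho> n \<Longrightarrow> zcube T n \<le> c + 11"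
  by (cases T) (auto simp: gtop_def Let_def)

lemma gchk_mem:
  assumes "gchk T c \<rho> j q l h"
  shows "gmem T c \<rho> n \<longleftrightarrow> n \<in> zcol_set T j q"
proof -
  obtain a xs where r: "rep T j = (a, xs)" by (cases "rep T j")
  have g: "zcube T (l - 1) = c" "zcube T l = c + 1" "c + 12 \<le> zcube T (h + 1)"
    "l \<le> a + nblk T * q" "a + nblk T * q \<le> h + 1" "\<forall>x \<in> set xs. x + nblk T * q \<le> h"
    "\<forall>n \<in> {l..h}. gtop T c \<rho> n \<longleftrightarrow> mem (n - nblk T * q) (a, xs)"
    using assms unfolding gchk_def r prod.case list_all_iff set_upto by blast+
  have z: "n \<in> zcol_set T j q \<longleftrightarrow> mem (n - nblk T * q) (a, xs)"
    unfolding zcol_set_def shift_iff r cset_def by simp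
  also have m: "\<dots> \<longleftrightarrow> n - nblk T * q < a \<or> n - nblk T * q \<in> set xs"
    using cset_eq[of a xs] unfolding cset_def by blast
  finally have e: "n \<in> zcol_set T j q \<longleftrightarrow> n - nblk T * q < a \<or> n - nblk T * q \<in> set xs" .
  consider "n < l" | "l \<le> n" "n \<le> h" | "h < n" by linarith
  then show ?thesis
  proof cases
    case 1
    then have "zcube T n \<le> c" using zcube_mono[of n "l - 1" T] g(1) by simp
    moreover have "n - nblk T * q < a" using 1 g(4) by linarith
    ultimately show ?thesis using e by (simp add: gmem_def)
  next
    case 2
    then have "\<not> zcube T n \<le> c" using zcube_mono[of l n T] g(2) by simp
    then have "gmem T c \<rho> n \<longleftrightarrow> gtop T c \<rho> n" by (simp add: gmem_def)
    also have "\<dots> \<longleftrightarrow> mem (n - nblk T * q) (a, xs)" using g(7) 2 by simp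
    finally show ?thesis using z by blast
  next
    case 3
    then have "c + 12 \<le> zcube T n" using zcube_mono[of "h + 1" n T] g(3) by simp
    then have "\<not> gmem T c \<rho> n" using gtop_zcube[of T c \<rho> n] unfolding gmem_def by linarith
    moreover have "\<not> n - nblk T * q < a" using 3 g(5) by linarith
    moreover have "n - nblk T * q \<notin> set xs" using 3 g(6) by force
    ultimately show ?thesis using e by blast
  qed
qed

text \<open>The columns of the ground state wall up to periodicity: three in type E6, where column
  \<open>r\<close> is displaced by \<open>8 * r\<close> cubes, two in type E7 according to the
  parity of \<open>r\<close>, and one in type E8.\<close>

lemma ground_checks:
  shows "gchk E6 0 False 3 (-1) 0 25" "gchk E6 8 False 13 1 16 41" "gchk E6 16 False 21 3 32 57"
    "gchk E7 0 False 6 (-1) 0 27" "gchk E7 4 True 39 1 9 36" "gchk E8 0 False 17 0 0 35"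
  by code_simp+

text \<open>Three columns to the left the pattern of type E6 is displaced by 24 cubes, that is 48
  blocks or four half-periods; an even number of half-periods causes no rotation.\<close>

lemma gmem_period: "gmem E6 (c + 24 * a) \<rho> (n + 48 * a) \<longleftrightarrow> gmem E6 c \<rho> n"
proof -
  have e: "n + 48 * a = n + nblk E6 * (4 * a)" by simp
  have "zcube E6 (n + 48 * a) = zcube E6 n + 24 * a" unfolding e zcube_period by simp
  moreover have "(n + 48 * a) div 12 = n div 12 + 4 * a" "(n + 48 * a) mod 12 = n mod 12"
    using div_mult_self1[of "12::int" n "4 * a"] mod_mult_self1[of n "4 * a" 12] by simp_all
  then have "wcells E6 \<rho> (n + 48 * a) = wcells E6 \<rho> n" by (simp add: wcells_def flips_def)
  ultimately show ?thesis by (simp add: gmem_def gtop_def Let_def)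
qed

text \<open>The number of periods by which the ground state column is shifted against its entry in
  the table.\<close>

definition qground :: "affine_type \<Rightarrow> nat \<Rightarrow> int" where
  "qground T r = (case T of E6 \<Rightarrow> 4 * int (r div 3) + [-1, 1, 3] ! (r mod 3)
     | E7 \<Rightarrow> if even r then -1 else 1 | E8 \<Rightarrow> 0)"

lemma zcol_set_shift: "n + nblk T * d \<in> zcol_set T j (q + d) \<longleftrightarrow> n \<in> zcol_set T j q"
  by (simp add: zcol_set_def algebra_simps)

lemma ground_mem: "gmem T (pdist T r) (pflip T r) n \<longleftrightarrow> n \<in> zcol_set T (gidx T r) (qground T r)"
proof (cases T)
  case E6
  define a b where "a = r div 3" and "b = r mod 3"
  have r: "r = 3 * a + b" by (simp add: a_def b_def)
  define m where "m = n - 48 * int a"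
  have n: "n = m + 48 * int a" by (simp add: m_def)
  have "b < 3" by (simp add: b_def)
  then consider "b = 0" | "b = 1" | "b = 2" by linarith
  then have g: "gmem E6 (8 * int b) False m \<longleftrightarrow> m \<in> zcol_set E6 ([3, 13, 21] ! b) ([-1, 1, 3] ! b)"
    using ground_checks(1-3)[THEN gchk_mem, of m]
    by cases (simp_all add: numeral_2_eq_2)
  have "pdist E6 r = 8 * int b + 24 * int a" by (simp add: pdist_def r)
  then have "gmem E6 (pdist E6 r) False n \<longleftrightarrow> gmem E6 (8 * int b) False m"
    unfolding n using gmem_period by metis
  moreover have "qground E6 r = [-1, 1, 3] ! b + 4 * int a" by (simp add: qground_def a_def b_def)
  then have "n \<in> zcol_set E6 ([3, 13, 21] ! b) (qground E6 r) \<longleftrightarrow>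
      m \<in> zcol_set E6 ([3, 13, 21] ! b) ([-1, 1, 3] ! b)"
    using zcol_set_shift[of m E6 "4 * int a" "[3, 13, 21] ! b" "[-1, 1, 3] ! b"] by (simp add: n)
  moreover have "gidx E6 r = [3, 13, 21] ! b" by (simp add: gidx_def b_def)
  ultimately show ?thesis using g E6 by (simp add: pflip_def)
next
  case E7
  show ?thesis
  proof (cases "even r")
    case True
    then have "gidx E7 r = 6" by (simp add: gidx_def even_iff_mod_2_eq_zero)
    then show ?thesis
      using ground_checks gchk_mem[of E7 0 False 6 "-1" 0 27 n] True E7
      by (simp add: pdist_def pflip_def qground_def)
  next
    case False
    then have "gidx E7 r = 39" by (simp add: gidx_def odd_iff_mod_2_eq_one)
    then show ?thesis
      using ground_checks gchk_mem[of E7 4 True 39 1 9 36 n] False E7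
      by (simp add: pdist_def pflip_def qground_def)
  qed
next
  case E8
  have "gidx E8 r = 17" by (simp add: gidx_def)
  then show ?thesis
    using ground_checks gchk_mem[of E8 0 False 17 0 0 35 n] E8
    by (simp add: pdist_def pflip_def qground_def)
qed

lemma ground_wall_eq: "ground_wall T r = wcol T r (gidx T r) (qground T r)"
proof -
  have "place T r b \<in> blocks T" if "b \<in> ground_wall T r" for b
    using that by (cases T) (auto simp: ground_wall_def ground_top_def wall_cube_def)
  moreover have "place T r b \<in> blocks T" if "b \<in> wcol T r (gidx T r) (qground T r)" for b
    using that colset_blocks unfolding wcol_def by blast
  moreover have "b \<in> ground_wall T r \<longleftrightarrow> b \<in> wcol T r (gidx T r) (qground T r)" if p: "place T r b \<in> blocks T" for b
  proof -
    obtain n where n: "place T r b = blk T n" using p blocks_eq by blast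
    have b: "b = unplace T r (blk T n)" using unplace_place[OF p] n by simp
    have "b \<in> wcol T r (gidx T r) (qground T r) \<longleftrightarrow> n \<in> zcol_set T (gidx T r) (qground T r)"
      by (simp add: wcol_def n colset_def)
    moreover have "b \<in> ground_wall T r \<longleftrightarrow> gmem T (pdist T r) (pflip T r) n"
      unfolding b by (rule unplace_ground_iff)
    ultimately show ?thesis using ground_mem by simp
  qed
  ultimately show ?thesis by blast
qed


section \<open>Identification of columns with elements of the affinization\<close>

text \<open>Multiplication by \<open>z\<close> shifts a column down by \<open>nblk T\<close> blocks.\<close>

definition qorigin :: "affine_type \<Rightarrow> nat \<Rightarrow> int" where
  "qorigin T r = gexp T r + qground T r"

lemma aff_cls_ops:
  assumes "j < ncls T" "i \<in> Iset T"
  shows "ff (affinization (column_crystal T)) i (m, cls T j) = map_option (\<lambda>k. (m - dz i, cls T k)) (F T j i)"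
    "ee (affinization (column_crystal T)) i (m, cls T j) = map_option (\<lambda>k. (m + dz i, cls T k)) (E T j i)"
  using column_ops[OF assms] by (simp_all add: affinization_def option.map_comp o_def dz_def)

definition ident0 :: "affine_type \<Rightarrow> nat \<Rightarrow> block set \<Rightarrow> int \<times> block set set" where
  "ident0 T r Y = (THE x. \<exists>j q. j < ncls T \<and> Y = wcol T r j q \<and> x = (qorigin T r - q, cls T j))"

lemma ident0_wcol: "j < ncls T \<Longrightarrow> ident0 T r (wcol T r j q) = (qorigin T r - q, cls T j)"
proof -
  assume j: "j < ncls T"
  show ?thesis
    unfolding ident0_def
  proof (rule the_equality)
    show "\<exists>j' q'. j' < ncls T \<and> wcol T r j q = wcol T r j' q' \<and>
        (qorigin T r - q, cls T j) = (qorigin T r - q', cls T j')" using j by blast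
    fix x assume "\<exists>j' q'. j' < ncls T \<and> wcol T r j q = wcol T r j' q' \<and> x = (qorigin T r - q', cls T j')"
    then obtain j' q' where "j' < ncls T" "wcol T r j q = wcol T r j' q'" "x = (qorigin T r - q', cls T j')" by blast
    then show "x = (qorigin T r - q, cls T j)" using wcol_inject[OF j] by simp
  qed
qed

lemma ident0_is_ident: "is_ident T r (ident0 T r)"
  unfolding is_ident_def
proof (intro conjI ballI)
  show "bij_betw (ident0 T r) (wall_columns T r) (elts (affinization (column_crystal T)))"
    unfolding bij_betw_def
  proof
    show "inj_on (ident0 T r) (wall_columns T r)"
    proof (rule inj_onI)
      fix Y Z assume a: "Y \<in> wall_columns T r" "Z \<in> wall_columns T r" and e: "ident0 T r Y = ident0 T r Z"
      obtain j q where j: "j < ncls T" "Y = wcol T r j q" using a(1) wall_columns_eq by blast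
      obtain k p where k: "k < ncls T" "Z = wcol T r k p" using a(2) wall_columns_eq by blast
      show "Y = Z" using e cls_inject[OF j(1) k(1)] unfolding j(2) k(2) ident0_wcol[OF j(1)] ident0_wcol[OF k(1)] by simp
    qed
    have "(m, cls T j) \<in> ident0 T r ` wall_columns T r" if j: "j < ncls T" for m j
    proof -
      have "ident0 T r (wcol T r j (qorigin T r - m)) = (m, cls T j)" using ident0_wcol[OF j] by simp
      moreover have "wcol T r j (qorigin T r - m) \<in> wall_columns T r" using j wall_columns_eq by blast
      ultimately show ?thesis by (metis image_eqI)
    qed
    then have "UNIV \<times> cls T ` {..<ncls T} \<subseteq> ident0 T r ` wall_columns T r" by blast
    moreover have "ident0 T r Y \<in> UNIV \<times> cls T ` {..<ncls T}" if Y: "Y \<in> wall_columns T r" for Y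
    proof -
      obtain j q where j: "j < ncls T" "Y = wcol T r j q" using Y wall_columns_eq by blast
      then show ?thesis using ident0_wcol[OF j(1), of r q] by simp
    qed
    then have "ident0 T r ` wall_columns T r \<subseteq> UNIV \<times> cls T ` {..<ncls T}" by blast
    ultimately show "ident0 T r ` wall_columns T r = elts (affinization (column_crystal T))"
      unfolding affinization_def elts_columns by simp
  qed
  show "ident0 T r (ground_wall T r) = (ground_exp T r, psi T (ground_elt T r))"
    by (simp add: ground_wall_eq ident0_wcol gidx_lt ground_exp_eq ground_elt_eq psi_pel qorigin_def)
  fix Y i assume Y: "Y \<in> wall_columns T r" and i: "i \<in> Iset T"
  obtain j q where j: "j < ncls T" "Y = wcol T r j q" using Y wall_columns_eq by blast
  show "ee (affinization (column_crystal T)) i (ident0 T r Y) = map_option (ident0 T r) (wall_ee T r i Y)"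
    unfolding j(2) ident0_wcol[OF j(1)] aff_cls_ops[OF j(1) i] wall_ops_wcol[OF j(1) i]
    by (cases "E T j i") (simp_all add: ident0_wcol E_lt[OF _ j(1)])
  show "ff (affinization (column_crystal T)) i (ident0 T r Y) = map_option (ident0 T r) (wall_ff T r i Y)"
    unfolding j(2) ident0_wcol[OF j(1)] aff_cls_ops[OF j(1) i] wall_ops_wcol[OF j(1) i]
    by (cases "F T j i") (simp_all add: ident0_wcol F_lt[OF _ j(1)])
qed

lemma ident_wcol:
  assumes j: "j < ncls T"
  shows "ident T r (wcol T r j q) = (qorigin T r - q, cls T j)"
proof -
  have id: "is_ident T r (ident T r)" unfolding ident_def using ident0_is_ident by (rule someI[of "is_ident T r"])
  have wc: "wcol T r j q \<in> wall_columns T r" if "j < ncls T" for j q using that wall_columns_eq by blast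
  have st: "ee (affinization (column_crystal T)) i (ident T r (wcol T r j q)) = map_option (ident T r) (wall_ee T r i (wcol T r j q))"
    "ff (affinization (column_crystal T)) i (ident T r (wcol T r j q)) = map_option (ident T r) (wall_ff T r i (wcol T r j q))"
    if "j < ncls T" "i \<in> Iset T" for i j q
    using id wc[OF that(1)] that(2) unfolding is_ident_def by blast+
  show ?thesis
  proof (rule column_induct[where Q = "\<lambda>j q. ident T r (wcol T r j q) = (qorigin T r - q, cls T j)", OF _ _ gidx_lt j])
    show "ident T r (wcol T r (gidx T r) (qground T r)) = (qorigin T r - qground T r, cls T (gidx T r))"
      using id unfolding is_ident_def ground_wall_eq
      by (simp add: ground_exp_eq ground_elt_eq psi_pel gidx_lt qorigin_def)
    fix i j k q assume i: "i \<in> Iset T" and j: "j < ncls T" and k: "F T j i = Some k"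
    have kl: "k < ncls T" by (rule F_lt[OF k j])
    have kj: "E T k i = Some j" using k F_E[OF j kl i] by simp
    show "ident T r (wcol T r j q) = (qorigin T r - q, cls T j) \<longleftrightarrow>
        ident T r (wcol T r k (q + dz i)) = (qorigin T r - (q + dz i), cls T k)"
    proof
      assume a: "ident T r (wcol T r j q) = (qorigin T r - q, cls T j)"
      show "ident T r (wcol T r k (q + dz i)) = (qorigin T r - (q + dz i), cls T k)"
        using st(2)[OF j i, of q] unfolding a aff_cls_ops[OF j i] wall_ops_wcol[OF j i] k
        by (simp add: diff_diff_eq)
    next
      assume a: "ident T r (wcol T r k (q + dz i)) = (qorigin T r - (q + dz i), cls T k)"
      show "ident T r (wcol T r j q) = (qorigin T r - q, cls T j)"
        using st(1)[OF kl i, of "q + dz i"] unfolding a aff_cls_ops[OF kl i] wall_ops_wcol[OF kl i] kj by simp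
    qed
  qed
qed


section \<open>The crystal of Young walls\<close>

definition cdiff :: "(block \<Rightarrow> nat) \<Rightarrow> block set \<Rightarrow> block set \<Rightarrow> nat \<Rightarrow> int" where
  "cdiff c A G i = int (card {b \<in> A - G. c b = i}) - int (card {b \<in> G - A. c b = i})"

lemma cdiff_insert:
  assumes b: "b \<notin> A" and fin: "finite (A - G)" "finite (G - A)"
  shows "cdiff c (insert b A) G i = cdiff c A G i + (if c b = i then 1 else 0)"
proof -
  have f: "finite {x \<in> A - G. c x = i}" "finite {x \<in> G - insert b A. c x = i}"
    using fin by (auto intro: finite_subset[OF _ fin(1)] finite_subset[OF _ fin(2)])
  consider "c b \<noteq> i" | "c b = i" "b \<in> G" | "c b = i" "b \<notin> G" by blast
  then show ?thesis
  proof cases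
    case 1
    then have "{x \<in> insert b A - G. c x = i} = {x \<in> A - G. c x = i}"
      "{x \<in> G - insert b A. c x = i} = {x \<in> G - A. c x = i}" by auto
    then show ?thesis using 1 by (simp add: cdiff_def)
  next
    case 2
    then have e: "{x \<in> insert b A - G. c x = i} = {x \<in> A - G. c x = i}"
      "{x \<in> G - A. c x = i} = insert b {x \<in> G - insert b A. c x = i}" using b by auto
    have "b \<notin> {x \<in> G - insert b A. c x = i}" by blast
    then show ?thesis unfolding cdiff_def e using 2 f(2) by simp
  next
    case 3
    then have e: "{x \<in> insert b A - G. c x = i} = insert b {x \<in> A - G. c x = i}"
      "{x \<in> G - insert b A. c x = i} = {x \<in> G - A. c x = i}" using b by auto
    have "b \<notin> {x \<in> A - G. c x = i}" using b by blast
    then show ?thesis unfolding cdiff_def e using 3 f(1) by simp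
  qed
qed

lemma finite_diff_insert:
  "finite (insert b A - G) \<and> finite (G - insert b A) \<longleftrightarrow> finite (A - G) \<and> finite (G - A)"
proof -
  have "G - insert b A = (G - A) - {b}" by blast
  then show ?thesis by (simp add: insert_Diff_if)
qed

definition root_comb :: "affine_type \<Rightarrow> (nat \<Rightarrow> int) \<Rightarrow> aweight" where
  "root_comb T d = (\<Sum>i \<in> Iset T. scale_weight (d i) (sroot T i))"

lemma scale_weight_add: "scale_weight (a + b) w = scale_weight a w + scale_weight b w"
  by (simp add: scale_weight_def prod_eq_iff fun_eq_iff distrib_right)

lemma scale_weight_simps [simp]: "scale_weight 0 w = 0" "scale_weight 1 w = w"
  by (simp_all add: scale_weight_def prod_eq_iff fun_eq_iff)

lemma root_comb_add: "root_comb T (\<lambda>i. d i + e i) = root_comb T d + root_comb T e"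
  by (simp add: root_comb_def scale_weight_add sum.distrib)

lemma root_comb_sum: "root_comb T (\<lambda>i. \<Sum>r < (n::nat). d r i) = (\<Sum>r < n. root_comb T (d r))"
  by (induction n) (simp_all add: root_comb_add, simp add: root_comb_def)

lemma root_comb_single: "i \<in> Iset T \<Longrightarrow> root_comb T (\<lambda>l. if i = l then 1 else 0) = sroot T i"
proof -
  assume i: "i \<in> Iset T"
  have "root_comb T (\<lambda>l. if i = l then 1 else 0) = (\<Sum>l \<in> Iset T. if i = l then sroot T l else 0)"
    unfolding root_comb_def by (rule sum.cong) simp_all
  then show ?thesis using i by (simp add: finite_Iset)
qed

text \<open>Both sides change by \<alpha>_i along an arrow of colour \<open>i\<close>, so
  \<open>column_induct\<close> carries the formula from the ground state column to all columns.
  Finiteness is part of the invariant, because the cardinality of an infinite set is 0.\<close>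

lemma column_weight:
  assumes "j < ncls T"
  shows "finite (wcol T r j q - ground_wall T r) \<and> finite (ground_wall T r - wcol T r j q) \<and>
    root_comb T (cdiff (wall_colour T r) (wcol T r j q) (ground_wall T r)) = (wfun T (gidx T r) - wfun T j, q - qground T r)"
proof (rule column_induct[OF _ _ gidx_lt assms, where Q = "\<lambda>j q. finite (wcol T r j q - ground_wall T r) \<and>
    finite (ground_wall T r - wcol T r j q) \<and> root_comb T (cdiff (wall_colour T r) (wcol T r j q) (ground_wall T r)) =
    (wfun T (gidx T r) - wfun T j, q - qground T r)"])
  show "finite (wcol T r (gidx T r) (qground T r) - ground_wall T r) \<and>
      finite (ground_wall T r - wcol T r (gidx T r) (qground T r)) \<and>
      root_comb T (cdiff (wall_colour T r) (wcol T r (gidx T r) (qground T r)) (ground_wall T r)) =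
      (wfun T (gidx T r) - wfun T (gidx T r), qground T r - qground T r)"
    by (simp add: ground_wall_eq cdiff_def root_comb_def flip: zero_prod_def)
next
  fix i j k q assume i: "i \<in> Iset T" and j: "j < ncls T" and k: "F T j i = Some k"
  let ?G = "ground_wall T r" and ?c = "wall_colour T r"
  let ?A = "wcol T r j q" and ?B = "wcol T r k (q + dz i)"
  obtain b where b: "b \<notin> ?A" "?c b = i" "?B = insert b ?A" using wcol_F[OF j k] by blast
  have fin: "finite (?B - ?G) \<and> finite (?G - ?B) \<longleftrightarrow> finite (?A - ?G) \<and> finite (?G - ?A)"
    unfolding b(3) by (rule finite_diff_insert)
  show "finite (?A - ?G) \<and> finite (?G - ?A) \<and>
      root_comb T (cdiff ?c ?A ?G) = (wfun T (gidx T r) - wfun T j, q - qground T r) \<longleftrightarrow>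
      finite (?B - ?G) \<and> finite (?G - ?B) \<and>
      root_comb T (cdiff ?c ?B ?G) = (wfun T (gidx T r) - wfun T k, q + dz i - qground T r)"
  proof (cases "finite (?A - ?G) \<and> finite (?G - ?A)")
    case True
    have "cdiff ?c ?B ?G l = cdiff ?c ?A ?G l + (if i = l then 1 else 0)" for l
      unfolding b(3) using cdiff_insert[OF b(1), of ?G ?c l] True b(2) by blast
    then have "cdiff ?c ?B ?G = (\<lambda>l. cdiff ?c ?A ?G l + (if i = l then 1 else 0))" by blast
    then have "root_comb T (cdiff ?c ?B ?G) = root_comb T (cdiff ?c ?A ?G) + (csroot T i, dz i)"
      using root_comb_single[OF i] by (simp only: root_comb_add) (simp add: sroot_def dz_def)
    moreover have "(wfun T (gidx T r) - wfun T k, q + dz i - qground T r) =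
        (wfun T (gidx T r) - wfun T j, q - qground T r) + (csroot T i, dz i)"
      using wfun_F[OF j i k] by simp
    ultimately have "root_comb T (cdiff ?c ?B ?G) = (wfun T (gidx T r) - wfun T k, q + dz i - qground T r) \<longleftrightarrow>
        root_comb T (cdiff ?c ?A ?G) = (wfun T (gidx T r) - wfun T j, q - qground T r)"
      by (simp only: add_right_cancel)
    then show ?thesis using True fin by blast
  next
    case False
    then show ?thesis using fin by blast
  qed
qed

text \<open>Goes from sequences to walls, opposite to the isomorphism of the theorem, since in this
  direction every column has an explicit formula. The sign is reversed because a higher exponent
  means fewer blocks.\<close>

definition wmap :: "affine_type \<Rightarrow> (nat \<Rightarrow> int \<times> perfect_elt) \<Rightarrow> wall" where
  "wmap T s r = wcol T r (sj T s r) (qorigin T r - fst (s r))"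

lemma ident_wmap: "valid T s \<Longrightarrow> ident T r (wmap T s r) = (fst (s r), cls T (sj T s r))"
  by (simp add: wmap_def ident_wcol validD(1))

lemma wmap_ground: "wmap T (ground_seq T) = ground_wall T"
proof
  fix r
  have "sj T (ground_seq T) r = gidx T r" by (rule sj_ground) simp
  then show "wmap T (ground_seq T) r = ground_wall T r"
    by (simp add: wmap_def ground_wall_eq ground_seq_eq qorigin_def)
qed

lemma wmap_eq_iff:
  assumes "valid T s" "valid T t"
  shows "wmap T s r = wmap T t r \<longleftrightarrow> s r = t r"
proof
  assume "wmap T s r = wmap T t r"
  then have "sj T s r = sj T t r" "fst (s r) = fst (t r)"
    using wcol_inject[OF validD(1)[OF assms(1)] validD(1)[OF assms(2)]] unfolding wmap_def by simp_all
  then show "s r = t r" using validD(2)[OF assms(1), of r] validD(2)[OF assms(2), of r] by metis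
qed (simp add: wmap_def sj_def)

lemma wmap_surj:
  assumes "\<And>r. W r \<in> wall_columns T r"
  shows "\<exists>s. valid T s \<and> wmap T s = W"
proof -
  have "\<exists>jq. fst jq < ncls T \<and> W r = wcol T r (fst jq) (snd jq)" for r
    using assms[of r] unfolding wall_columns_eq by fastforce
  then obtain jq where jq: "\<And>r. fst (jq r) < ncls T" "\<And>r. W r = wcol T r (fst (jq r)) (snd (jq r))" by metis
  define s where "s r = (qorigin T r - snd (jq r), pel T (fst (jq r)))" for r
  have "valid T s" using jq(1) by (auto simp: valid_def s_def affinization_def elts_perfect)
  moreover have "sj T s r = fst (jq r)" for r using jq(1) by (simp add: sj_def s_def pidx_pel)
  then have "wmap T s = W" by (simp add: fun_eq_iff wmap_def jq(2) s_def)
  ultimately show ?thesis by blast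
qed

lemma wmap_columns: "valid T s \<Longrightarrow> wmap T s r \<in> wall_columns T r"
  using validD(1) unfolding wmap_def wall_columns_eq by blast

lemma wmap_finite:
  assumes "valid T s"
  shows "finite (wmap T s r - ground_wall T r)" "finite (ground_wall T r - wmap T s r)"
  using column_weight[OF validD(1)[OF assms]] unfolding wmap_def by blast+

text \<open>A single column always differs from the ground state column in finitely many blocks, so
  the finiteness condition only concerns the number of columns that differ.\<close>

lemma young_wall_wmap:
  assumes s: "valid T s"
  shows "young_wall T (wmap T s) \<longleftrightarrow> (\<exists>k. ground_from T s k)"
proof -
  let ?d = "\<lambda>r. (wmap T s r - ground_wall T r) \<union> (ground_wall T r - wmap T s r)"
  have S: "{(r, b). b \<in> ?d r} = Sigma UNIV ?d" by blast
  have e: "?d r = {} \<longleftrightarrow> s r = ground_seq T r" for r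
  proof -
    have "?d r = {} \<longleftrightarrow> wmap T s r = wmap T (ground_seq T) r" unfolding wmap_ground by blast
    then show ?thesis using wmap_eq_iff[OF s valid_ground] by simp
  qed
  have "finite (Sigma UNIV ?d) \<longleftrightarrow> (\<exists>k. ground_from T s k)"
  proof
    assume "finite (Sigma UNIV ?d)"
    then have "finite (fst ` Sigma UNIV ?d)" by (rule finite_imageI)
    moreover have "fst ` Sigma UNIV ?d = {r. ?d r \<noteq> {}}" by force
    ultimately have "finite {r. s r \<noteq> ground_seq T r}" unfolding e[symmetric] by simp
    then obtain k where k: "\<forall>r \<in> {r. s r \<noteq> ground_seq T r}. r < k" using finite_nat_set_iff_bounded by blast
    have "s r = ground_seq T r" if r: "k \<le> r" for r
    proof (rule ccontr)
      assume "s r \<noteq> ground_seq T r"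
      then have "r < k" using k by blast
      then show False using r by simp
    qed
    then have "ground_from T s k" unfolding ground_from_def by blast
    then show "\<exists>k. ground_from T s k" by blast
  next
    assume "\<exists>k. ground_from T s k"
    then obtain k where k: "\<And>r. k \<le> r \<Longrightarrow> s r = ground_seq T r" unfolding ground_from_def by blast
    have "Sigma UNIV ?d \<subseteq> Sigma {..<k} ?d"
    proof
      fix x assume "x \<in> Sigma UNIV ?d"
      then obtain r b where x: "x = (r, b)" and b: "b \<in> ?d r" by (elim SigmaE)
      have "r < k"
      proof (rule ccontr)
        assume "\<not> r < k"
        then have "s r = ground_seq T r" using k[of r] by simp
        then show False using e[of r] b by blast
      qed
      then show "x \<in> Sigma {..<k} ?d" unfolding x using b by (intro SigmaI) (simp_all only: lessThan_iff)
    qed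
    moreover have "finite (Sigma {..<k} ?d)" using wmap_finite[OF s] by (intro finite_SigmaI finite_UnI finite_lessThan)
    ultimately show "finite (Sigma UNIV ?d)" by (rule finite_subset)
  qed
  then show ?thesis unfolding young_wall_def S using wmap_columns[OF s] by blast
qed

lemma reduced_iff:
  assumes s: "valid T s"
  shows "wmap T s \<in> reduced_wall_set T \<longleftrightarrow> s \<in> fock_set T"
proof -
  have "energy_aff (column_energy T) (ident T (Suc r) (wmap T s (Suc r))) (ident T r (wmap T s r)) = eaff T s r" for r
    by (simp add: ident_wmap[OF s] energy_aff_def eaff_def column_energy_cls validD(1)[OF s])
  then show ?thesis
    unfolding reduced_wall_set_def fock_set_iff using young_wall_wmap[OF s] s by (simp add: conj_commute)
qed

lemma bij_wmap: "bij_betw (wmap T) (fock_set T) (reduced_wall_set T)"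
  unfolding bij_betw_def
proof
  have v: "valid T s" if "s \<in> fock_set T" for s using that fock_set_iff by blast
  show "inj_on (wmap T) (fock_set T)"
  proof (rule inj_onI)
    fix s t assume a: "s \<in> fock_set T" "t \<in> fock_set T" "wmap T s = wmap T t"
    show "s = t"
      by (rule ext) (simp add: wmap_eq_iff[OF v[OF a(1)] v[OF a(2)], symmetric] a(3))
  qed
  show "wmap T ` fock_set T = reduced_wall_set T"
  proof
    show "wmap T ` fock_set T \<subseteq> reduced_wall_set T" using v reduced_iff by blast
    show "reduced_wall_set T \<subseteq> wmap T ` fock_set T"
    proof
      fix W assume W: "W \<in> reduced_wall_set T"
      then have "\<And>r. W r \<in> wall_columns T r" by (simp add: reduced_wall_set_def young_wall_def)
      then obtain s where s: "valid T s" "wmap T s = W" using wmap_surj by blast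
      then show "W \<in> wmap T ` fock_set T" using reduced_iff[OF s(1)] W by blast
    qed
  qed
qed

lemma wall_signs:
  assumes "valid T s" "i \<in> Iset T"
  shows "wall_minus T i (wmap T s) = sm T i s" "wall_plus T i (wmap T s) = sp T i s"
  using validD(1)[OF assms(1)] assms(2)
  by (simp_all add: fun_eq_iff wall_minus_def wall_plus_def wmap_def wall_class_wcol column_table sm_def sp_def)

lemma wmap_fu:
  assumes "valid T s" "i \<in> Iset T" "0 < sp T i s r"
  shows "map_option (\<lambda>Z. (wmap T s)(r := Z)) (wall_ff T r i (wmap T s r)) = Some (wmap T (fu T i s r))"
proof -
  note v = valid_fu[OF assms]
  have "(wmap T s)(r := wcol T r (sj T (fu T i s r) r) (qorigin T r - fst (s r) + dz i)) = wmap T (fu T i s r)"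
  proof
    fix t show "((wmap T s)(r := wcol T r (sj T (fu T i s r) r) (qorigin T r - fst (s r) + dz i))) t = wmap T (fu T i s r) t"
    proof (cases "t = r")
      case True
      have "qorigin T r - fst (s r) + dz i = qorigin T r - fst (fu T i s r r)" by (simp add: fu_def)
      then show ?thesis unfolding wmap_def True by (simp only: fun_upd_same)
    next
      case False
      then have "fu T i s r t = s t" by (simp add: fu_def)
      then show ?thesis using False v(3)[OF False] unfolding wmap_def by simp
    qed
  qed
  then show ?thesis
    using wall_ops_wcol(1)[OF validD(1)[OF assms(1)] assms(2), of r r "qorigin T r - fst (s r)"] v(2)
    by (simp add: wmap_def[of T s r])
qed

lemma wmap_eu:
  assumes "valid T s" "i \<in> Iset T" "0 < sm T i s r"
  shows "map_option (\<lambda>Z. (wmap T s)(r := Z)) (wall_ee T r i (wmap T s r)) = Some (wmap T (eu T i s r))"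
proof -
  note v = valid_eu[OF assms]
  have "(wmap T s)(r := wcol T r (sj T (eu T i s r) r) (qorigin T r - fst (s r) - dz i)) = wmap T (eu T i s r)"
  proof
    fix t show "((wmap T s)(r := wcol T r (sj T (eu T i s r) r) (qorigin T r - fst (s r) - dz i))) t = wmap T (eu T i s r) t"
    proof (cases "t = r")
      case True
      have "qorigin T r - fst (s r) - dz i = qorigin T r - fst (eu T i s r r)" by (simp add: eu_def)
      then show ?thesis unfolding wmap_def True by (simp only: fun_upd_same)
    next
      case False
      then have "eu T i s r t = s t" by (simp add: eu_def)
      then show ?thesis using False v(3)[OF False] unfolding wmap_def by simp
    qed
  qed
  then show ?thesis
    using wall_ops_wcol(2)[OF validD(1)[OF assms(1)] assms(2), of r r "qorigin T r - fst (s r)"] v(2)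
    by (simp add: wmap_def[of T s r])
qed

lemma wall_ops:
  assumes s: "s \<in> fock_set T" and i: "i \<in> Iset T"
  shows "wall_crystal_ff T i (wmap T s) = map_option (wmap T) (fock_ff T i s)"
    "wall_crystal_ee T i (wmap T s) = map_option (wmap T) (fock_ee T i s)"
proof -
  have v: "valid T s" using s fock_set_iff by blast
  have tl: "tail_at (sm T i s) (sp T i s) (stab T s)" by (rule ground_tail[OF stab_ground[OF s] i])
  note signs = wall_signs[OF v i]
  show "wall_crystal_ff T i (wmap T s) = map_option (wmap T) (fock_ff T i s)"
  proof (cases "\<exists>r. is_f (sm T i s) (sp T i s) r")
    case True
    then obtain r where r: "is_f (sm T i s) (sp T i s) r" by blast
    have m: "remaining_plus (sm T i s) (sp T i s) \<noteq> {}" "Max (fst ` remaining_plus (sm T i s) (sp T i s)) = r"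
      using plus_Max(2)[OF tl r] by blast+
    show ?thesis
      unfolding wall_crystal_ff_def sign_plus_def signs Let_def m(2) fock_ff_eq(1)[OF s i r]
      using m(1) wmap_fu[OF v i is_f_plus[OF r]] by simp
  next
    case False
    then have "remaining_plus (sm T i s) (sp T i s) = {}" using plus_Max(1)[OF tl] by blast
    then show ?thesis
      unfolding wall_crystal_ff_def sign_plus_def signs using fock_ff_eq(2)[OF s i] False by simp
  qed
  show "wall_crystal_ee T i (wmap T s) = map_option (wmap T) (fock_ee T i s)"
  proof (cases "\<exists>r. is_e (sm T i s) (sp T i s) r")
    case True
    then obtain r where r: "is_e (sm T i s) (sp T i s) r" by blast
    have m: "remaining_minus (sm T i s) (sp T i s) \<noteq> {}" "Min (fst ` remaining_minus (sm T i s) (sp T i s)) = r"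
      using minus_Min(2)[OF tl r] by blast+
    show ?thesis
      unfolding wall_crystal_ee_def sign_minus_def signs Let_def m(2) fock_ee_eq(1)[OF s i r]
      using m(1) wmap_eu[OF v i is_e_minus[OF r]] by simp
  next
    case False
    then have "remaining_minus (sm T i s) (sp T i s) = {}" using minus_Min(1)[OF tl] by blast
    then show ?thesis
      unfolding wall_crystal_ee_def sign_minus_def signs using fock_ee_eq(2)[OF s i] False by simp
  qed
qed

lemma block_diff_sum:
  assumes fin: "\<And>r. finite (W r - ground_wall T r)" "\<And>r. finite (ground_wall T r - W r)"
    and k: "\<And>r. k \<le> r \<Longrightarrow> W r = ground_wall T r"
  shows "block_diff T W i = (\<Sum>r < k. cdiff (wall_colour T r) (W r) (ground_wall T r) i)"
proof -
  have card_eq: "card {(r, b). b \<in> X r \<and> wall_colour T r b = i} = (\<Sum>r < k. card {b \<in> X r. wall_colour T r b = i})"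
    if X: "\<And>r. finite (X r)" "\<And>r. k \<le> r \<Longrightarrow> X r = {}" for X
  proof -
    have "{(r, b). b \<in> X r \<and> wall_colour T r b = i} = Sigma {..<k} (\<lambda>r. {b \<in> X r. wall_colour T r b = i})"
    proof (rule set_eqI)
      fix x :: "nat \<times> block"
      obtain r b where x: "x = (r, b)" by (cases x)
      have "r < k" if "b \<in> X r" using X(2)[of r] that by (cases "r < k") simp_all
      then show "x \<in> {(r, b). b \<in> X r \<and> wall_colour T r b = i} \<longleftrightarrow>
          x \<in> Sigma {..<k} (\<lambda>r. {b \<in> X r. wall_colour T r b = i})"
        unfolding x by blast
    qed
    moreover have "card (Sigma {..<k} (\<lambda>r. {b \<in> X r. wall_colour T r b = i})) =
        (\<Sum>r < k. card {b \<in> X r. wall_colour T r b = i})"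
      using X(1) by (intro card_SigmaI ballI finite_lessThan finite_Collect_conjI disjI1) simp_all
    ultimately show ?thesis by simp
  qed
  have "card {(r, b). b \<in> W r - ground_wall T r \<and> wall_colour T r b = i} =
      (\<Sum>r < k. card {b \<in> W r - ground_wall T r. wall_colour T r b = i})"
    by (rule card_eq[OF fin(1)]) (simp add: k)
  moreover have "card {(r, b). b \<in> ground_wall T r - W r \<and> wall_colour T r b = i} =
      (\<Sum>r < k. card {b \<in> ground_wall T r - W r. wall_colour T r b = i})"
    by (rule card_eq[OF fin(2)]) (simp add: k)
  ultimately show ?thesis unfolding block_diff_def cdiff_def by (simp add: sum_subtractf)
qed

lemma wall_wt:
  assumes s: "s \<in> fock_set T"
  shows "wt (wall_crystal T) (wmap T s) = wt (fock_crystal T) s"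
proof -
  have v: "valid T s" using s fock_set_iff by blast
  obtain k where k: "ground_from T s k" using s fock_set_iff by blast
  have g: "wmap T s r = ground_wall T r" if "k \<le> r" for r
    using k that wmap_eq_iff[OF v valid_ground] unfolding ground_from_def wmap_ground[symmetric] by blast
  have "wt (wall_crystal T) (wmap T s) = fund 0 - root_comb T (block_diff T (wmap T s))"
    by (simp add: wall_crystal_def root_comb_def)
  also have "block_diff T (wmap T s) = (\<lambda>i. \<Sum>r < k. cdiff (wall_colour T r) (wmap T s r) (ground_wall T r) i)"
    by (rule ext) (rule block_diff_sum[OF wmap_finite[OF v] g])
  also have "root_comb T \<dots> = (\<Sum>r < k. root_comb T (cdiff (wall_colour T r) (wmap T s r) (ground_wall T r)))"
    by (rule root_comb_sum)
  also have "\<dots> = (\<Sum>r < k. - wdiff T s r)"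
  proof (rule sum.cong)
    fix r
    show "root_comb T (cdiff (wall_colour T r) (wmap T s r) (ground_wall T r)) = - wdiff T s r"
      using column_weight[OF validD(1)[OF v], of r r "qorigin T r - fst (s r)"]
      unfolding wdiff_eq[OF v] wmap_def by (simp add: qorigin_def)
  qed simp
  also have "fund 0 - \<dots> = wt (fock_crystal T) s" unfolding fock_wt[OF k] by (simp add: sum_negf)
  finally show ?thesis .
qed

lemma wall_eps_phi:
  assumes s: "s \<in> fock_set T" and i: "i \<in> Iset T"
  shows "eps (wall_crystal T) i (wmap T s) = eps (fock_crystal T) i s"
    "phi (wall_crystal T) i (wmap T s) = phi (fock_crystal T) i s"
proof -
  have v: "valid T s" using s fock_set_iff by blast
  obtain k where k: "ground_from T s k" using s fock_set_iff by blast
  note tl = ground_tail[OF k i] and signs = wall_signs[OF v i]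
  show "eps (wall_crystal T) i (wmap T s) = eps (fock_crystal T) i s"
    unfolding fock_eps_phi[OF s i k] by (simp add: wall_crystal_def sign_minus_def signs minus_card[OF tl])
  show "phi (wall_crystal T) i (wmap T s) = phi (fock_crystal T) i s"
    unfolding fock_eps_phi[OF s i k]
    by (simp only: wall_crystal_def crystal.simps sign_plus_def signs plus_card[OF tl] plen_sum lessThan_Suc_atMost)
qed

lemma wmap_iso: "crystal_iso (affine_data T) (fock_crystal T) (wall_crystal T) (wmap T)"
proof -
  have p: "elts (fock_crystal T) = fock_set T" "elts (wall_crystal T) = reduced_wall_set T"
    "ee (fock_crystal T) = fock_ee T" "ee (wall_crystal T) = wall_crystal_ee T"
    "ff (fock_crystal T) = fock_ff T" "ff (wall_crystal T) = wall_crystal_ff T" "index (affine_data T) = Iset T"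
    by (simp_all add: fock_crystal_def wall_crystal_def affine_data_def)
  show ?thesis
    unfolding crystal_iso_def p by (intro conjI ballI bij_wmap wall_wt wall_eps_phi wall_ops)
qed


section \<open>Transport of crystals\<close>

lemma is_crystal_closed:
  assumes "is_crystal D A" "a \<in> elts A" "i \<in> index D"
  shows "ee A i a = Some a' \<Longrightarrow> a' \<in> elts A" "ff A i a = Some a' \<Longrightarrow> a' \<in> elts A"
  using assms unfolding is_crystal_def by blast+

text \<open>The axioms for the wall crystal are not verified on walls; they are inherited from the
  Fock space crystal in this way.\<close>

lemma is_crystal_iso:
  assumes A: "is_crystal D A" and iso: "crystal_iso D A B f"
  shows "is_crystal D B"
  unfolding is_crystal_def
proof
  fix b assume "b \<in> elts B"
  then obtain a where a: "a \<in> elts A" "b = f a" using iso unfolding crystal_iso_def bij_betw_def by blast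
  have inj: "f x = f y \<longleftrightarrow> x = y" if "x \<in> elts A" "y \<in> elts A" for x y
    using iso that unfolding crystal_iso_def bij_betw_def inj_on_def by blast
  have f: "f x \<in> elts B" if "x \<in> elts A" for x
    using iso that unfolding crystal_iso_def bij_betw_def by blast
  have eq: "wt B (f x) = wt A x" if "x \<in> elts A" for x
    using iso that unfolding crystal_iso_def by blast
  have eqi: "eps B i (f x) = eps A i x" "phi B i (f x) = phi A i x"
    "ee B i (f x) = map_option f (ee A i x)" "ff B i (f x) = map_option f (ff A i x)"
    if "x \<in> elts A" "i \<in> index D" for x i
    using iso that unfolding crystal_iso_def by blast+
  have cr: "wt A a \<in> lattice D"
    using A a(1) unfolding is_crystal_def by blast
  show "wt B b \<in> lattice D \<and> (\<forall>i \<in> index D.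
     eps B i b \<noteq> Pinf \<and> phi B i b \<noteq> Pinf \<and>
     phi B i b = eps B i b + Fin (pairing D i (wt B b)) \<and>
     (\<forall>b'. ee B i b = Some b' \<longrightarrow> b' \<in> elts B \<and> wt B b' = wt B b + simple_root D i \<and>
        eps B i b' = eps B i b - 1 \<and> phi B i b' = phi B i b + 1) \<and>
     (\<forall>b'. ff B i b = Some b' \<longrightarrow> b' \<in> elts B \<and> wt B b' = wt B b - simple_root D i \<and>
        eps B i b' = eps B i b + 1 \<and> phi B i b' = phi B i b - 1) \<and>
     (\<forall>b' \<in> elts B. ff B i b = Some b' \<longleftrightarrow> ee B i b' = Some b) \<and>
     (phi B i b = Minf \<longrightarrow> ee B i b = None \<and> ff B i b = None))"
  proof (intro conjI ballI)
    show "wt B b \<in> lattice D" using cr eq a by simp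
    fix i assume i: "i \<in> index D"
    note ei = eqi[OF a(1) i]
    have c: "eps A i a \<noteq> Pinf" "phi A i a \<noteq> Pinf" "phi A i a = eps A i a + Fin (pairing D i (wt A a))"
      "phi A i a = Minf \<Longrightarrow> ee A i a = None \<and> ff A i a = None"
      "\<And>a'. ee A i a = Some a' \<Longrightarrow> wt A a' = wt A a + simple_root D i \<and>
        eps A i a' = eps A i a - 1 \<and> phi A i a' = phi A i a + 1"
      "\<And>a'. ff A i a = Some a' \<Longrightarrow> wt A a' = wt A a - simple_root D i \<and>
        eps A i a' = eps A i a + 1 \<and> phi A i a' = phi A i a - 1"
      "\<And>a'. a' \<in> elts A \<Longrightarrow> ff A i a = Some a' \<longleftrightarrow> ee A i a' = Some a"
      using A a(1) i unfolding is_crystal_def by blast+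
    show "eps B i b \<noteq> Pinf" "phi B i b \<noteq> Pinf" "phi B i b = eps B i b + Fin (pairing D i (wt B b))"
      unfolding a(2) ei eq[OF a(1)] by (fact c(1) c(2) c(3))+
    show "phi B i b = Minf \<longrightarrow> ee B i b = None \<and> ff B i b = None"
      unfolding a(2) ei using c(4) by simp
    show "\<forall>b'. ee B i b = Some b' \<longrightarrow> b' \<in> elts B \<and> wt B b' = wt B b + simple_root D i \<and>
        eps B i b' = eps B i b - 1 \<and> phi B i b' = phi B i b + 1"
    proof (intro allI impI)
      fix b' assume "ee B i b = Some b'"
      then obtain a' where a': "ee A i a = Some a'" "b' = f a'" unfolding a(2) ei by blast
      have m: "a' \<in> elts A" by (rule is_crystal_closed(1)[OF A a(1) i a'(1)])
      show "b' \<in> elts B \<and> wt B b' = wt B b + simple_root D i \<and> eps B i b' = eps B i b - 1 \<and> phi B i b' = phi B i b + 1"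
        unfolding a'(2) a(2) ei eqi[OF m i] eq[OF m] eq[OF a(1)] using f[OF m] c(5)[OF a'(1)] by blast
    qed
    show "\<forall>b'. ff B i b = Some b' \<longrightarrow> b' \<in> elts B \<and> wt B b' = wt B b - simple_root D i \<and>
        eps B i b' = eps B i b + 1 \<and> phi B i b' = phi B i b - 1"
    proof (intro allI impI)
      fix b' assume "ff B i b = Some b'"
      then obtain a' where a': "ff A i a = Some a'" "b' = f a'" unfolding a(2) ei by blast
      have m: "a' \<in> elts A" by (rule is_crystal_closed(2)[OF A a(1) i a'(1)])
      show "b' \<in> elts B \<and> wt B b' = wt B b - simple_root D i \<and> eps B i b' = eps B i b + 1 \<and> phi B i b' = phi B i b - 1"
        unfolding a'(2) a(2) ei eqi[OF m i] eq[OF m] eq[OF a(1)] using f[OF m] c(6)[OF a'(1)] by blast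
    qed
    fix b' assume "b' \<in> elts B"
    then obtain a' where a': "a' \<in> elts A" "b' = f a'" using iso unfolding crystal_iso_def bij_betw_def by blast
    have "map_option f (ff A i a) = Some (f a') \<longleftrightarrow> ff A i a = Some a'"
      using is_crystal_closed(2)[OF A a(1) i] inj a'(1) by (cases "ff A i a") auto
    moreover have "map_option f (ee A i a') = Some (f a) \<longleftrightarrow> ee A i a' = Some a"
      using is_crystal_closed(1)[OF A a'(1) i] inj a(1) by (cases "ee A i a'") auto
    ultimately show "ff B i b = Some b' \<longleftrightarrow> ee B i b' = Some b"
      unfolding a(2) a'(2) ei eqi[OF a'(1) i] using c(7)[OF a'(1)] by blast
  qed
qed

lemma crystal_iso_inv_into:
  assumes A: "is_crystal D A" and iso: "crystal_iso D A B f"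
  shows "crystal_iso D B A (inv_into (elts A) f)"
  unfolding crystal_iso_def
proof (intro conjI ballI)
  let ?g = "inv_into (elts A) f"
  have bij: "bij_betw f (elts A) (elts B)" using iso unfolding crystal_iso_def by blast
  then show "bij_betw ?g (elts B) (elts A)" by (rule bij_betw_inv_into)
  fix b assume "b \<in> elts B"
  then obtain a where a: "a \<in> elts A" "b = f a" using bij unfolding bij_betw_def by blast
  have gf: "?g (f x) = x" if "x \<in> elts A" for x using bij that by (rule bij_betw_inv_into_left)
  have gb: "?g b = a" using gf a by simp
  have "wt B (f a) = wt A a" using iso a(1) unfolding crystal_iso_def by blast
  then show "wt A (?g b) = wt B b" unfolding gb unfolding a(2) by (rule sym)
  fix i assume i: "i \<in> index D"
  have e: "eps B i b = eps A i a" "phi B i b = phi A i a"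
    "ee B i b = map_option f (ee A i a)" "ff B i b = map_option f (ff A i a)"
    using iso a(1) i unfolding crystal_iso_def a(2) by blast+
  show "eps A i (?g b) = eps B i b" "phi A i (?g b) = phi B i b" unfolding gb e by (rule refl)+
  show "ee A i (?g b) = map_option ?g (ee B i b)"
    unfolding gb e using is_crystal_closed(1)[OF A a(1) i] gf by (cases "ee A i a") auto
  show "ff A i (?g b) = map_option ?g (ff B i b)"
    unfolding gb e using is_crystal_closed(2)[OF A a(1) i] gf by (cases "ff A i a") auto
qed

theorem theorem5p3:
  fixes T :: affine_type
  shows "is_crystal (affine_data T) (wall_crystal T) \<and>
    is_crystal (affine_data T) (fock_crystal T) \<and>
    ground_wall T \<in> elts (wall_crystal T) \<and>
    ground_seq T \<in> elts (fock_crystal T) \<and>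
    (\<exists>\<Phi>. crystal_iso (affine_data T) (wall_crystal T) (fock_crystal T) \<Phi> \<and>
      \<Phi> (ground_wall T) = ground_seq T)"
proof (intro conjI exI)
  show "is_crystal (affine_data T) (wall_crystal T)" by (rule is_crystal_iso[OF fock_is_crystal wmap_iso])
  show "is_crystal (affine_data T) (fock_crystal T)" by (rule fock_is_crystal)
  show g: "ground_seq T \<in> elts (fock_crystal T)" using ground_seq_fock by (simp add: fock_crystal_def)
  have b: "bij_betw (wmap T) (elts (fock_crystal T)) (elts (wall_crystal T))"
    using wmap_iso unfolding crystal_iso_def by blast
  show "ground_wall T \<in> elts (wall_crystal T)" using bij_betwE[OF b] g wmap_ground by metis
  show "crystal_iso (affine_data T) (wall_crystal T) (fock_crystal T) (inv_into (elts (fock_crystal T)) (wmap T))"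
    by (rule crystal_iso_inv_into[OF fock_is_crystal wmap_iso])
  show "inv_into (elts (fock_crystal T)) (wmap T) (ground_wall T) = ground_seq T"
    using bij_betw_inv_into_left[OF b g] wmap_ground by metis
qed

end
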